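(* Let $s\in\mathbb{N}$ and let $f\in C^\infty([0,1]^s)$ with $\mu=\int_{[0,1]^s}f(\boldsymbol x)\,\mathrm{d}\boldsymbol x$. Suppose that there exist constants $K,\alpha>0$ and a finite collection $\mathcal{J}=\{J_1,\dots,J_L\}$ of subsets of $\{1,\dots,s\}$ such that for every $\boldsymbol k\in\mathbb{N}_0^s$, $$\|f^{|\boldsymbol\kappa|}\|_1\le K\alpha^{\|\boldsymbol\kappa\|_0}\max_{J\in\mathcal J}\prod_{j\in J}(|\kappa_j|)!,$$ and suppose moreover that there exist $c>0$ and $\beta>0$ with $$\liminf_{N\to\infty}\frac{|Q_{N,c,\beta,\mathcal J}(f)|}{|Q_N|}>0,\qquad Q_{N,c,\beta,\mathcal J}(f)=\Big\{\boldsymbol k\in Q_N:\ |\hat f(\boldsymbol k)|\ge c\,2^{-\|\boldsymbol\kappa\|_1}\beta^{\|\boldsymbol\kappa\|_0}\max_{J\in\mathcal J}\prod_{j\in J}(|\kappa_j|)!\Big\}.$$ Then, under the complete random design, $$\limsup_{m\to\infty}\sqrt m\,\Big|\Pr(\hat\mu_{m,\infty}<\mu)+\tfrac12\Pr(\hat\mu_{m,\infty}=\mu)-\tfrac12\Big|<\infty .$$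
   Context: Binary digits: for $k\in\mathbb N_0$ write $k=\sum_{\ell\ge1}a_\ell2^{\ell-1}$ with $a_\ell\in\{0,1\}$, put $\vec k=(a_1,a_2,\dots)$ and $\kappa=\{\ell\in\mathbb N:a_\ell=1\}$. For $x\in[0,1)$ write $x=\sum_{\ell\ge1}x_\ell2^{-\ell}$ (using the expansion not ending in infinitely many 1's) and $\vec x=(x_1,x_2,\dots)$. For $\boldsymbol k=(k_1,\dots,k_s)\in\mathbb N_0^s$ with digit sets $\boldsymbol\kappa=(\kappa_1,\dots,\kappa_s)$ let $\|\boldsymbol\kappa\|_1=\sum_{j}\sum_{\ell\in\kappa_j}\ell$ and $\|\boldsymbol\kappa\|_0=\sum_j|\kappa_j|$; $\mathbb N_*^s=\mathbb N_0^s\setminus\{\boldsymbol0\}$ and $Q_N=\{\boldsymbol k\in\mathbb N_*^s:\|\boldsymbol\kappa\|_1\le N\}$. Walsh coefficients: $\hat f(\boldsymbol k)=\int_{[0,1]^s}f(\boldsymbol x)(-1)^{\sum_j\vec k_j^{\mathsf T}\vec x_j}\,\mathrm d\boldsymbol x$. $f^{|\boldsymbol\kappa|}=\partial^{\|\boldsymbol\kappa\|_0}f/\partial x_1^{|\kappa_1|}\cdots\partial x_s^{|\kappa_s|}$ and $\|\cdot\|_1$ is the $L^1([0,1]^s)$ norm; an empty product equals $1$. Randomized digital net: for $m\in\mathbb N$ and $i\in\{0,\dots,2^m-1\}$ let $\vec i\in\{0,1\}^m$ be its binary digit vector ($i=\sum_{\ell=1}^m i_\ell2^{\ell-1}$).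 Random matrices $C_j\in\{0,1\}^{\infty\times m}$ (rows indexed by $\ell\in\mathbb N$), $j=1,\dots,s$, and digital shifts $\vec D_j\in\{0,1\}^\infty$ with i.i.d. uniform $\{0,1\}$ entries independent of the $C_j$, define points $\boldsymbol x_i=(x_{i1},\dots,x_{is})$ by $\vec x_{ij}=C_j\vec i+\vec D_j\bmod 2$, and $\hat\mu_{m,\infty}=2^{-m}\sum_{i=0}^{2^m-1}f(\boldsymbol x_i)$. Under the complete random design all entries of all $C_j$ are i.i.d. uniform on $\{0,1\}$. *)

theory Defs
  imports "HOL-Analysis.Analysis" "HOL-Probability.Probability"
begin

definition kappa :: "nat \<Rightarrow> nat set" where
  "kappa k = {l. 1 \<le> l \<and> bit k (l - 1)}"

definition kappa_norm1 :: "('n::finite \<Rightarrow> nat) \<Rightarrow> nat" where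
  "kappa_norm1 k = (\<Sum>j\<in>UNIV. \<Sum>l\<in>kappa (k j). l)"

definition kappa_norm0 :: "('n::finite \<Rightarrow> nat) \<Rightarrow> nat" where
  "kappa_norm0 k = (\<Sum>j\<in>UNIV. card (kappa (k j)))"

text \<open>l-th binary digit (l >= 1) of x in [0,1), expansion not ending in infinitely many 1's.\<close>
definition xdigit :: "real \<Rightarrow> nat \<Rightarrow> nat" where
  "xdigit x l = nat (\<lfloor>2 ^ l * x\<rfloor> mod 2)"

definition walsh :: "nat \<Rightarrow> real \<Rightarrow> real" where
  "walsh k x = (-1) ^ (\<Sum>l\<in>kappa k. xdigit x l)"

definition unit_cube :: "(real ^ 'n::finite) set" where
  "unit_cube = cbox 0 One"

definition walsh_coeff :: "(real ^ 'n::finite \<Rightarrow> real) \<Rightarrow> ('n \<Rightarrow> nat) \<Rightarrow> real" where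
  "walsh_coeff f k = (LINT x:unit_cube|lborel. f x * (\<Prod>j\<in>UNIV. walsh (k j) (x $ j)))"

definition Q_set :: "nat \<Rightarrow> ('n::finite \<Rightarrow> nat) set" where
  "Q_set N = {k. k \<noteq> (\<lambda>_. 0) \<and> kappa_norm1 k \<le> N}"

definition max_fact :: "'n::finite set set \<Rightarrow> ('n \<Rightarrow> nat) \<Rightarrow> real" where
  "max_fact JJ k = Max ((\<lambda>J. \<Prod>j\<in>J. fact (card (kappa (k j)))) ` JJ)"

definition Q_large :: "(real ^ 'n::finite \<Rightarrow> real) \<Rightarrow> nat \<Rightarrow> real \<Rightarrow> real \<Rightarrow> 'n set set
    \<Rightarrow> ('n \<Rightarrow> nat) set" where
  "Q_large f N c \<beta> JJ = {k \<in> Q_set N.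
     \<bar>walsh_coeff f k\<bar> \<ge> c * 2 powr (- real (kappa_norm1 k)) * \<beta> ^ kappa_norm0 k * max_fact JJ k}"

definition upd :: "real ^ 'n \<Rightarrow> 'n \<Rightarrow> real \<Rightarrow> real ^ 'n" where
  "upd x j t = (\<chi> i. if i = j then t else x $ i)"

definition partial :: "'n \<Rightarrow> (real ^ 'n \<Rightarrow> real) \<Rightarrow> real ^ 'n \<Rightarrow> real" where
  "partial j g x = vector_derivative (\<lambda>t. g (upd x j t)) (at (x $ j) within {0..1})"

fun iter_partial :: "'n list \<Rightarrow> (real ^ 'n \<Rightarrow> real) \<Rightarrow> real ^ 'n \<Rightarrow> real" where
  "iter_partial [] g = g"
| "iter_partial (j # js) g = partial j (iter_partial js g)"

definition smooth_on_cube :: "(real ^ 'n::finite \<Rightarrow> real) \<Rightarrow> bool" where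
  "smooth_on_cube f \<longleftrightarrow> (\<forall>js.
     continuous_on unit_cube (iter_partial js f) \<and>
     (\<forall>j. \<forall>x\<in>unit_cube.
        ((\<lambda>t. iter_partial js f (upd x j t)) has_vector_derivative partial j (iter_partial js f) x)
          (at (x $ j) within {0..1})))"

text \<open>f^{|kappa|}: n j-fold derivative in coordinate j (order irrelevant for smooth f).\<close>
definition mixed_deriv :: "(real ^ 'n::finite \<Rightarrow> real) \<Rightarrow> ('n \<Rightarrow> nat) \<Rightarrow> real ^ 'n \<Rightarrow> real" where
  "mixed_deriv f n = iter_partial (SOME js. \<forall>j. count_list js j = n j) f"

definition L1_norm_cube :: "(real ^ 'n::finite \<Rightarrow> real) \<Rightarrow> real" where
  "L1_norm_cube g = (LINT x:unit_cube|lborel. \<bar>g x\<bar>)"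

text \<open>Random bits: Inl (j,l,r) is the entry (l,r) of C_j, Inr (j,l) is the l-th digit of D_j;
  all i.i.d. uniform on {0,1}. (Columns r > m are simply unused.)\<close>
type_synonym 'n rbits = "('n \<times> nat \<times> nat) + ('n \<times> nat) \<Rightarrow> bool"

definition design :: "'n rbits measure" where
  "design = PiM UNIV (\<lambda>_. measure_pmf (bernoulli_pmf (1/2)))"

text \<open>l-th digit (l >= 1) of coordinate j of point i: (C_j vec i + vec D_j)_l mod 2.\<close>
definition net_digit :: "'n rbits \<Rightarrow> nat \<Rightarrow> nat \<Rightarrow> 'n \<Rightarrow> nat \<Rightarrow> nat" where
  "net_digit \<omega> m i j l =
     (card {r \<in> {1..m}. \<omega> (Inl (j, l, r)) \<and> bit i (r - 1)} + (if \<omega> (Inr (j, l)) then 1 else 0)) mod 2"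

definition net_point :: "'n::finite rbits \<Rightarrow> nat \<Rightarrow> nat \<Rightarrow> real ^ 'n" where
  "net_point \<omega> m i = (\<chi> j. \<Sum>l. real (net_digit \<omega> m i j (Suc l)) / 2 ^ Suc l)"

definition mu_hat :: "(real ^ 'n::finite \<Rightarrow> real) \<Rightarrow> nat \<Rightarrow> 'n rbits \<Rightarrow> real" where
  "mu_hat f m \<omega> = (\<Sum>i<2 ^ m. f (net_point \<omega> m i)) / 2 ^ m"

end

theory Submission
  imports Defs "HOL-Real_Asymp.Real_Asymp" "HOL-Library.Nat_Bijection"
begin

text \<open>
  Identify \<open>k\<close> with the finite set \<open>A\<close> of its digit positions \<open>(j, l)\<close>; the XOR of two indices becomes
  the symmetric difference. The error of the net is \<open>\<Sum> fhat A * shift_sign A\<close> over the nonempty \<open>A\<close> in the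
  dual of the random net, a random linear subspace over the field with two elements. Choose \<open>N\<close> such that
  about \<open>\<epsilon> m\<close> sets of weight at most \<open>N\<close> fall into the dual. With high probability they are linearly
  independent: a minimal dependent family of size \<open>r\<close> has probability \<open>2 ^ (- m (r - 1))\<close>, and the number of
  such families is exponentially small relative to \<open>q ^ (r - 1) / r!\<close>, where \<open>q\<close> is the number of sets of
  weight at most \<open>N\<close>, because the symmetric difference of typical sets is too heavy. Their signs are then
  independent, so the truncated error is symmetric, and by the Littlewood-Offord inequality it exceeds
  the smallest of \<open>\<delta> m\<close> large coefficients with probability \<open>1 - O(1 / sqrt m)\<close>. The remaining coefficients are
  negligible: sets of weight slightly above \<open>N\<close> have fibres of concentrated cardinality, so that their
  factorials are comparable to those of the large coefficients, and heavier sets decay geometrically.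
  The counting estimates come from exponential tilting.
\<close>

section \<open>The Littlewood-Offord inequality\<close>

text \<open>Scales: \<open>card (Qs N)\<close> is at most \<open>exp (C * sqrt N)\<close>, so about
  \<epsilon> m sets in the dual force \<open>sqrt N\<close> to be at least of order m, and all gains
  and losses are measured against \<open>exp (C * sqrt N)\<close>. Powers of \<alpha> and \<beta>
  with order \<open>sqrt N\<close> factors are losses of just this size; they are paid for by
  cutting off at N + B sqrt N instead of N, which multiplies the number of sets by a constant only.
  The obstacle is the factorials, whose logarithm is of order \<open>sqrt N * ln N\<close>: a shift
  of the cut-off by that order would multiply the count by a power of N and spoil the bound for
  independence. Concentration of every fibre within \<open>sqrt N / ln N\<close> removes the
  logarithm from their ratios. Sets without this property are so few up to weight N + D sqrt N ln N
  that the dual misses them with probability 1 - O(1/m); beyond that weight a worst-case bound on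
  the factorials suffices. The bound for dependence is exp(\<epsilon> m - c sqrt N), so \<epsilon>
  has to be small; any fixed \<epsilon> still leaves order m large coefficients, whence the rate
  1/sqrt m.\<close>

lemma LYM_inequality:
  fixes S :: "'a set"
  assumes "finite S" "F \<subseteq> Pow S" "\<And>A B. A \<in> F \<Longrightarrow> B \<in> F \<Longrightarrow> \<not> A \<subset> B"
  shows "(\<Sum>A\<in>F. 1 / real (card S choose card A)) \<le> 1"
  using assms
proof (induction "card S" arbitrary: S F)
  case 0
  then have "S = {}" by simp
  then have "F \<subseteq> {{}}" using 0 by auto
  then have "F = {} \<or> F = {{}}" by auto
  then show ?case using \<open>S = {}\<close> by auto
next
  case (Suc n)
  have finF: "finite F" using Suc.prems by (meson finite_Pow_iff finite_subset)
  have cS: "card S = Suc n" using Suc.hyps by simp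
  show ?case
  proof (cases "S \<in> F")
    case True
    then have "F = {S}" using Suc.prems by blast
    then show ?thesis by simp
  next
    case False
    \<comment> \<open>The weight of \<open>A\<close> is the average over the points \<open>x\<close>
      of \<open>S\<close> of its weights inside \<open>S - {x}\<close>, where a point
      \<open>x\<close> of \<open>A\<close> contributes 0. The identity fails for
      \<open>A = S\<close>, hence the case split.\<close>
    have 1: "1 / real (Suc n choose card A) = (\<Sum>x\<in>S. if x \<in> A then 0 else 1 / real (n choose card A) / real (Suc n))"
      if "A \<in> F" for A
    proof -
      have AS: "A \<subset> S" using that False Suc.prems by auto
      have cA: "card A \<le> n" using psubset_card_mono[OF Suc.prems(1) AS] cS by simp
      have "(\<Sum>x\<in>S. if x \<in> A then 0 else 1 / real (n choose card A) / real (Suc n))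
         = (\<Sum>x\<in>S - A. 1 / real (n choose card A) / real (Suc n))"
        using Suc.prems(1) by (intro sum.mono_neutral_cong_right) auto
      also have "\<dots> = real (Suc n - card A) / real (n choose card A) / real (Suc n)"
      proof -
        have "card (S - A) = Suc n - card A"
          using card_Diff_subset[of A S] AS Suc.prems(1) cS finite_subset by auto
        then show ?thesis by simp
      qed
      also have "\<dots> = 1 / real (Suc n choose card A)"
      proof -
        have "(Suc n - card A) * (Suc n choose card A) = Suc n * (n choose card A)"
          using binomial_absorb_comp[of "Suc n" "card A"] by simp
        then have "real (Suc n - card A) * real (Suc n choose card A) = real (Suc n) * real (n choose card A)"
          by (metis of_nat_mult)
        moreover have "real (n choose card A) > 0" "real (Suc n choose card A) > 0" using cA by auto
        ultimately show ?thesis by (simp add: field_simps del: of_nat_Suc)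
      qed
      finally show ?thesis by simp
    qed
    have "(\<Sum>A\<in>F. 1 / real (card S choose card A))
        = (\<Sum>A\<in>F. \<Sum>x\<in>S. if x \<in> A then 0 else 1 / real (n choose card A) / real (Suc n))"
      unfolding cS by (intro sum.cong 1 refl)
    also have "\<dots> = (\<Sum>x\<in>S. \<Sum>A\<in>F. if x \<in> A then 0 else 1 / real (n choose card A) / real (Suc n))"
      by (rule sum.swap)
    also have "\<dots> \<le> (\<Sum>x\<in>S. 1 / real (Suc n))"
    proof (intro sum_mono)
      fix x assume x: "x \<in> S"
      have c: "card (S - {x}) = n" using x cS Suc.prems(1) by simp
      have "(\<Sum>A\<in>{A\<in>F. x \<notin> A}. 1 / real (card (S - {x}) choose card A)) \<le> 1"
        using Suc.prems c by (intro Suc.hyps(1)) auto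
      then have "(\<Sum>A\<in>{A\<in>F. x \<notin> A}. 1 / real (n choose card A)) / real (Suc n) \<le> 1 / real (Suc n)"
        unfolding c by (intro divide_right_mono) auto
      moreover have "(\<Sum>A\<in>F. if x \<in> A then 0 else 1 / real (n choose card A) / real (Suc n))
         = (\<Sum>A\<in>{A\<in>F. x \<notin> A}. 1 / real (n choose card A) / real (Suc n))"
        using finF by (intro sum.mono_neutral_cong_right) auto
      ultimately show "(\<Sum>A\<in>F. if x \<in> A then 0 else 1 / real (n choose card A) / real (Suc n)) \<le> 1 / real (Suc n)"
        by (simp add: sum_divide_distrib)
    qed
    also have "\<dots> = 1" using cS by simp
    finally show ?thesis .
  qed
qed

lemma Sperner:
  assumes "finite S" "F \<subseteq> Pow S" "\<And>A B. A \<in> F \<Longrightarrow> B \<in> F \<Longrightarrow> \<not> A \<subset> B"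
  shows "card F \<le> card S choose (card S div 2)"
proof -
  have finF: "finite F" using assms by (meson finite_Pow_iff finite_subset)
  have pos: "real (card S choose (card S div 2)) > 0" by simp
  have "real (card F) / real (card S choose (card S div 2)) = (\<Sum>A\<in>F. 1 / real (card S choose (card S div 2)))"
    by simp
  also have "\<dots> \<le> (\<Sum>A\<in>F. 1 / real (card S choose card A))"
  proof (intro sum_mono divide_left_mono)
    fix A assume "A \<in> F"
    then have "card A \<le> card S" using assms by (auto intro: card_mono)
    then show "0 < real (card S choose (card S div 2)) * real (card S choose card A)" by simp
    show "real (card S choose card A) \<le> real (card S choose (card S div 2))"
      using binomial_maximum by simp
  qed simp
  also have "\<dots> \<le> 1" by (rule LYM_inequality) (use assms in auto)
  finally show ?thesis using pos by (simp add: divide_le_eq)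
qed

text \<open>The square of the bound \<open>4 ^ k / sqrt (2 * k + 1)\<close>, a form whose induction
  step reduces to \<open>(2 * k + 1) * (2 * k + 3) \<le> (2 * k + 2)^2\<close>.\<close>

lemma central_binomial_sq: "real (2 * k choose k) ^ 2 * (2 * real k + 1) \<le> 16 ^ k"
proof (induction k)
  case (Suc k)
  have "Suc k * (2 * Suc k choose Suc k) = 2 * ((2 * k + 1) * (2 * k choose k))"
  proof -
    have a: "Suc k * (2 * Suc k choose Suc k) = (2 * Suc k) * (Suc (2 * k) choose k)"
      using Suc_times_binomial_eq[of "Suc (2*k)" k] by simp
    have b: "(2 * k + 1) * (2 * k choose k) = (k + 1) * (Suc (2 * k) choose k)"
      using binomial_absorb_comp[of "Suc (2*k)" k] by (simp add: Suc_diff_le)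
    from a b show ?thesis by simp
  qed
  then have e: "real (Suc k) * real (2 * Suc k choose Suc k) = 2 * (2 * real k + 1) * real (2 * k choose k)"
    by (metis (no_types, lifting) of_nat_mult of_nat_add of_nat_numeral of_nat_1 mult.assoc)
  have "real (Suc k) ^ 2 * (real (2 * Suc k choose Suc k) ^ 2 * (2 * real (Suc k) + 1))
     = (real (Suc k) * real (2 * Suc k choose Suc k)) ^ 2 * (2 * real k + 3)"
    by (simp add: power_mult_distrib del: of_nat_Suc) simp
  also have "\<dots> = 4 * (2 * real k + 1) * (2 * real k + 3) * (real (2 * k choose k) ^ 2 * (2 * real k + 1))"
    unfolding e by (simp add: power2_eq_square algebra_simps)
  also have "\<dots> \<le> 4 * (2 * real k + 1) * (2 * real k + 3) * 16 ^ k"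
    using Suc by (intro mult_left_mono) auto
  also have "\<dots> \<le> (16 * real (Suc k) ^ 2) * 16 ^ k"
    by (intro mult_right_mono) (auto simp: power2_eq_square algebra_simps)
  finally have "real (Suc k) ^ 2 * (real (2 * Suc k choose Suc k) ^ 2 * (2 * real (Suc k) + 1))
      \<le> real (Suc k) ^ 2 * 16 ^ Suc k" by (simp add: mult_ac)
  then show ?case by (rule mult_left_le_imp_le) simp
qed simp

lemma middle_binomial_le:
  assumes "n > 0"
  shows "real (n choose (n div 2)) \<le> 2 ^ n / sqrt n"
proof -
  have ev: "real (2 * k choose k) * sqrt (2 * real k + 1) \<le> 2 ^ (2 * k)" for k
  proof (rule power2_le_imp_le)
    show "(real (2 * k choose k) * sqrt (2 * real k + 1))\<^sup>2 \<le> (2 ^ (2 * k))\<^sup>2"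
      using central_binomial_sq[of k]
      by (simp add: power_mult_distrib power_mult[symmetric] mult.commute[of _ 2])
         (simp add: power_mult)
  qed simp
  have "real (n choose (n div 2)) * sqrt n \<le> 2 ^ n"
  proof (cases "even n")
    case True
    then obtain k where k: "n = 2 * k" by (elim evenE)
    have "real (n choose (n div 2)) * sqrt n \<le> real (2 * k choose k) * sqrt (2 * real k + 1)"
      unfolding k by (intro mult_mono) auto
    also note ev[of k]
    finally show ?thesis by (simp only: k)
  next
    case False
    then obtain k where k: "n = 2 * k + 1" by (elim oddE)
    \<comment> \<open>By symmetry and Pascal's rule, the middle coefficient of an odd row is half
      the central coefficient of the next row.\<close>
    have "Suc (2 * k) - k = Suc k" by simp
    then have "Suc (2 * k) choose k = Suc (2 * k) choose Suc k"
      using binomial_symmetric[of k "Suc (2 * k)"] by simp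
    moreover have "2 * Suc k choose Suc k = (Suc (2 * k) choose k) + (Suc (2 * k) choose Suc k)"
      by simp
    ultimately have "2 * (Suc (2 * k) choose k) = 2 * Suc k choose Suc k" by simp
    then have "2 * real (Suc (2 * k) choose k) = real (2 * Suc k choose Suc k)"
      by (metis of_nat_mult of_nat_numeral)
    then have "real (n choose (n div 2)) * sqrt n = real (2 * Suc k choose Suc k) * sqrt n / 2"
      by (simp add: k)
    also have "\<dots> \<le> real (2 * Suc k choose Suc k) * sqrt (2 * real (Suc k) + 1) / 2"
      by (intro mult_mono divide_right_mono) (auto simp: k)
    also have "\<dots> \<le> 2 ^ (2 * Suc k) / 2" by (intro divide_right_mono ev) auto
    finally show ?thesis by (simp add: k)
  qed
  then show ?thesis using assms by (simp add: field_simps)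
qed

text \<open>\<open>U\<close> is the set of indices carrying a minus sign; sign patterns encoded as
  sets make Sperner's theorem applicable.\<close>

definition signed_sum :: "('a \<Rightarrow> real) \<Rightarrow> 'a set \<Rightarrow> 'a set \<Rightarrow> real" where
  "signed_sum a R U = (\<Sum>i\<in>R. (if i \<in> U then - a i else a i))"

text \<open>Erdos' argument: exchanging the signs at the negative entries makes the sum decreasing
  in \<open>U\<close>, and each additional element lowers it by at least \<open>2 * \<tau>\<close>,
  the length of the open target interval. So the patterns form an antichain. \<open>b\<close> will
  be the contribution of the remaining indices.\<close>

lemma Littlewood_Offord_antichain:
  assumes fin: "finite R" and \<tau>: "\<tau> > 0" and big: "\<And>i. i \<in> R \<Longrightarrow> \<bar>a i\<bar> \<ge> \<tau>"
  shows "card {U \<in> Pow R. \<bar>b + signed_sum a R U\<bar> < \<tau>} \<le> card R choose (card R div 2)"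
proof -
  let ?F = "{U \<in> Pow R. \<bar>b + signed_sum a R U\<bar> < \<tau>}"
  define P where "P = {i\<in>R. a i < 0}"
  define g where "g U = (U - P) \<union> (P - U)" for U
  have inj: "inj g" unfolding g_def inj_def by blast
  have ss: "signed_sum a R U = signed_sum (\<lambda>i. \<bar>a i\<bar>) R (g U)" for U
    unfolding signed_sum_def by (intro sum.cong) (auto simp: g_def P_def)
  have "card (g ` ?F) \<le> card R choose (card R div 2)"
  proof (rule Sperner[OF fin])
    show "g ` ?F \<subseteq> Pow R" by (auto simp: g_def P_def)
    fix A B assume A: "A \<in> g ` ?F" and B: "B \<in> g ` ?F"
    show "\<not> A \<subset> B"
    proof
      assume AB: "A \<subset> B"
      then obtain x where x: "x \<in> B" "x \<notin> A" by auto
      have BR: "B \<subseteq> R" using B by (auto simp: g_def P_def)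
      have bA: "\<bar>b + signed_sum (\<lambda>i. \<bar>a i\<bar>) R A\<bar> < \<tau>" using A ss by auto
      have bB: "\<bar>b + signed_sum (\<lambda>i. \<bar>a i\<bar>) R B\<bar> < \<tau>" using B ss by auto
      have "signed_sum (\<lambda>i. \<bar>a i\<bar>) R A - signed_sum (\<lambda>i. \<bar>a i\<bar>) R B
          = (\<Sum>i\<in>R. if i \<in> B - A then 2 * \<bar>a i\<bar> else 0)"
        unfolding signed_sum_def sum_subtractf[symmetric] using AB by (intro sum.cong) auto
      also have "\<dots> \<ge> (if x \<in> B - A then 2 * \<bar>a x\<bar> else 0)"
        using x BR fin by (intro member_le_sum) auto
      finally have "signed_sum (\<lambda>i. \<bar>a i\<bar>) R A - signed_sum (\<lambda>i. \<bar>a i\<bar>) R B \<ge> 2 * \<tau>"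
        using x big[of x] BR by auto
      with bA bB show False by linarith
    qed
  qed
  moreover have "card (g ` ?F) = card ?F" by (intro card_image inj_on_subset[OF inj]) auto
  ultimately show ?thesis by simp
qed

text \<open>The signs outside \<open>R\<close> are fixed first, so that only the entries in
  \<open>R\<close> have to be large and the rate is governed by \<open>card R\<close>.\<close>

lemma Littlewood_Offord:
  assumes fin: "finite A" and R: "R \<subseteq> A" "R \<noteq> {}" and \<tau>: "\<tau> > 0" and big: "\<And>i. i \<in> R \<Longrightarrow> \<bar>a i\<bar> \<ge> \<tau>"
  shows "real (card {U \<in> Pow A. \<bar>signed_sum a A U\<bar> < \<tau>}) \<le> 2 ^ card A / sqrt (card R)"
proof -
  have finR: "finite R" and finAR: "finite (A - R)" using fin R finite_subset by auto
  have cR: "card R > 0" using R finR by (simp add: card_gt_0_iff)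
  let ?F = "{U \<in> Pow A. \<bar>signed_sum a A U\<bar> < \<tau>}"
  let ?G = "SIGMA W:Pow (A - R). {U \<in> Pow R. \<bar>signed_sum a (A - R) W + signed_sum a R U\<bar> < \<tau>}"
  have split: "signed_sum a A U = signed_sum a (A - R) (U \<inter> (A - R)) + signed_sum a R (U \<inter> R)" for U
  proof -
    have "signed_sum a A U = signed_sum a (A - R) U + signed_sum a R U"
      unfolding signed_sum_def using fin R by (simp add: sum.subset_diff)
    moreover have "signed_sum a (A - R) U = signed_sum a (A - R) (U \<inter> (A - R))"
      "signed_sum a R U = signed_sum a R (U \<inter> R)"
      unfolding signed_sum_def by (intro sum.cong; auto)+
    ultimately show ?thesis by simp
  qed
  have "card ?F \<le> card ?G"
  proof (rule card_inj_on_le)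
    show "inj_on (\<lambda>U. (U \<inter> (A - R), U \<inter> R)) ?F" using R by (auto simp: inj_on_def)
    show "(\<lambda>U. (U \<inter> (A - R), U \<inter> R)) ` ?F \<subseteq> ?G" using split by auto
    show "finite ?G" using finR finAR by (intro finite_SigmaI) auto
  qed
  also have "card ?G = (\<Sum>W\<in>Pow (A - R). card {U \<in> Pow R. \<bar>signed_sum a (A - R) W + signed_sum a R U\<bar> < \<tau>})"
    using finR finAR by (intro card_SigmaI) auto
  also have "\<dots> \<le> (\<Sum>W\<in>Pow (A - R). card R choose (card R div 2))"
    by (intro sum_mono Littlewood_Offord_antichain finR \<tau> big)
  also have "\<dots> = 2 ^ card (A - R) * (card R choose (card R div 2))"
    using finAR by (simp add: card_Pow)
  finally have "real (card ?F) \<le> 2 ^ card (A - R) * real (card R choose (card R div 2))"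
    by (simp flip: of_nat_le_iff[where 'a=real])
  also have "\<dots> \<le> 2 ^ card (A - R) * (2 ^ card R / sqrt (card R))"
    using middle_binomial_le[OF cR] by (intro mult_left_mono) auto
  also have "\<dots> = 2 ^ card A / sqrt (card R)"
  proof -
    have "card A = card (A - R) + card R" using fin R by (metis card_Diff_subset card_mono finR le_add_diff_inverse2)
    then show ?thesis by (simp add: power_add)
  qed
  finally show ?thesis .
qed

lemma signed_sum_complement: "signed_sum a A (A - U) = - signed_sum a A U"
  unfolding signed_sum_def sum_negf[symmetric] by (intro sum.cong) auto

section \<open>Counting digit sets by exponential tilting\<close>

definition wt :: "('n \<times> nat) set \<Rightarrow> nat" where
  "wt A = (\<Sum>a\<in>A. snd a)"

definition grid :: "nat \<Rightarrow> ('n::finite \<times> nat) set" where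
  "grid L = UNIV \<times> {1..L}"

definition Qs :: "nat \<Rightarrow> ('n::finite \<times> nat) set set" where
  "Qs N = {A. finite A \<and> A \<subseteq> UNIV \<times> {1..} \<and> wt A \<le> N}"

definition fibre_card :: "'n \<Rightarrow> ('n \<times> nat) set \<Rightarrow> nat" where
  "fibre_card j A = card {l. (j, l) \<in> A}"

lemma finite_grid [simp]: "finite (grid L)"
  by (simp add: grid_def)

lemma sum_grid: "(\<Sum>a\<in>(grid L :: ('n::finite \<times> nat) set). g (snd a)) = real CARD('n) * (\<Sum>l=1..L. g l)"
proof -
  have "(\<Sum>a\<in>(UNIV :: 'n set) \<times> {1..L}. g (snd a)) = (\<Sum>j\<in>(UNIV::'n set). \<Sum>l=1..L. g l)"
    by (simp only: sum.cartesian_product case_prod_unfold)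
  then show ?thesis by (simp add: grid_def)
qed

text \<open>A set of weight at most \<open>N\<close> has no level above \<open>N\<close>, so grids
  of any height \<open>L \<ge> N\<close> serve. The tilt below uses height \<open>4 * N\<close>,
  which leaves room for its mean weight to reach \<open>N\<close>.\<close>

lemma Qs_eq: "N \<le> L \<Longrightarrow> Qs N = {A \<in> Pow (grid L :: ('n::finite \<times> nat) set). wt A \<le> N}"
proof (intro set_eqI iffI)
  fix A :: "('n \<times> nat) set" assume "N \<le> L" and A: "A \<in> Qs N"
  have "snd a \<le> N" if "a \<in> A" for a
    using A that member_le_sum[of a A snd] by (auto simp: Qs_def wt_def)
  with A \<open>N \<le> L\<close> show "A \<in> {A \<in> Pow (grid L). wt A \<le> N}"
    by (force simp: Qs_def grid_def)
next
  fix A :: "('n \<times> nat) set" assume "A \<in> {A \<in> Pow (grid L). wt A \<le> N}"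
  then show "A \<in> Qs N" using finite_subset[of A "grid L"] by (auto simp: Qs_def grid_def)
qed

lemma finite_Qs [simp]: "finite (Qs N)"
  by (subst Qs_eq[OF order_refl]) auto

lemma Qs_mono: "M \<le> N \<Longrightarrow> Qs M \<subseteq> Qs N"
  by (auto simp: Qs_def)

lemma empty_in_Qs [simp]: "{} \<in> Qs N"
  by (simp add: Qs_def wt_def)

lemma card_Qs_pos [simp]: "card (Qs N) > 0"
  by (metis card_gt_0_iff empty_in_Qs empty_iff finite_Qs)

section \<open>Generating functions over the subsets of a finite set\<close>

lemma sum_Pow_insert:
  fixes g :: "'a set \<Rightarrow> real"
  assumes "finite G" "a \<notin> G"
  shows "(\<Sum>A\<in>Pow (insert a G). g A) = (\<Sum>A\<in>Pow G. g A) + (\<Sum>A\<in>Pow G. g (insert a A))"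
proof -
  have "inj_on (insert a) (Pow G)" using assms by (auto simp: inj_on_def)
  then have "(\<Sum>A\<in>insert a ` Pow G. g A) = (\<Sum>A\<in>Pow G. g (insert a A))"
    by (subst sum.reindex) auto
  moreover have "Pow G \<inter> insert a ` Pow G = {}" using assms by auto
  ultimately show ?thesis unfolding Pow_insert using assms
    by (subst sum.union_disjoint) auto
qed

lemma sum_Pow_prod:
  fixes y :: "'a \<Rightarrow> real"
  assumes "finite G"
  shows "(\<Sum>A\<in>Pow G. \<Prod>a\<in>A. y a) = (\<Prod>a\<in>G. 1 + y a)"
  using assms
proof (induction G)
  case (insert a G)
  have "(\<Sum>A\<in>Pow G. \<Prod>a\<in>insert a A. y a) = (\<Sum>A\<in>Pow G. y a * (\<Prod>a\<in>A. y a))"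
    using insert by (intro sum.cong) (auto simp: finite_subset intro!: prod.insert)
  then show ?case using insert
    by (simp add: sum_Pow_insert sum_distrib_left[symmetric] algebra_simps)
qed simp

lemma sum_Pow_exp:
  assumes "finite G"
  shows "(\<Sum>A\<in>Pow G. exp (\<Sum>a\<in>A. \<psi> a)) = (\<Prod>a\<in>G. 1 + exp (\<psi> a :: real))"
proof -
  have "(\<Sum>A\<in>Pow G. exp (\<Sum>a\<in>A. \<psi> a)) = (\<Sum>A\<in>Pow G. \<Prod>a\<in>A. exp (\<psi> a))"
    using assms finite_subset by (intro sum.cong refl exp_sum) auto
  then show ?thesis using sum_Pow_prod[OF assms] by simp
qed

text \<open>Unnormalised mean and variance of a sum of independent variables: \<open>a\<close> is
  present with odds \<open>z a\<close>, that is, with probability \<open>z a / (1 + z a)\<close>,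
  and then contributes \<open>w a\<close>.\<close>

lemma sum_Pow_variance:
  fixes z w :: "'a \<Rightarrow> real"
  assumes "finite G" "\<And>a. z a \<ge> 0"
  shows "(\<Sum>A\<in>Pow G. (\<Prod>a\<in>A. z a) * ((\<Sum>a\<in>A. w a) - (\<Sum>a\<in>G. w a * z a / (1 + z a)))) = 0 \<and>
    (\<Sum>A\<in>Pow G. (\<Prod>a\<in>A. z a) * ((\<Sum>a\<in>A. w a) - (\<Sum>a\<in>G. w a * z a / (1 + z a)))\<^sup>2)
      = (\<Prod>a\<in>G. 1 + z a) * (\<Sum>a\<in>G. (w a)\<^sup>2 * z a / (1 + z a)\<^sup>2)"
  using assms(1)
proof (induction G)
  case (insert b G)
  define M where "M = (\<Sum>a\<in>G. w a * z a / (1 + z a))"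
  define d where "d A = (\<Sum>a\<in>A. w a) - M" for A
  define P where "P A = (\<Prod>a\<in>A. z a)" for A
  define p where "p = z b / (1 + z b)"
  have zb: "1 + z b > 0" using assms(2)[of b] by simp
  \<comment> \<open>\<open>p\<close> is the occupation probability of the new element; the identity
    \<open>z b * (1 - p) = p\<close> cancels the terms linear in \<open>w b\<close>.\<close>
  have zp: "z b * (1 - p) = p" "p * (1 + z b) = z b" using zb by (simp_all add: p_def field_simps)
  have M': "(\<Sum>a\<in>insert b G. w a * z a / (1 + z a)) = M + w b * p"
    using insert by (simp add: M_def p_def)
  have d1: "(\<Sum>a\<in>A. w a) - (M + w b * p) = d A - w b * p" for A by (simp add: d_def)
  have ins: "(\<Prod>a\<in>insert b A. z a) = z b * P A" "(\<Sum>a\<in>insert b A. w a) - (M + w b * p) = d A + w b * (1 - p)"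
    if "A \<subseteq> G" for A
  proof -
    have "finite A" "b \<notin> A" using that insert.hyps finite_subset[of A G] by auto
    then show "(\<Prod>a\<in>insert b A. z a) = z b * P A" "(\<Sum>a\<in>insert b A. w a) - (M + w b * p) = d A + w b * (1 - p)"
      by (auto simp: P_def d_def algebra_simps)
  qed
  have E1: "(\<Sum>A\<in>Pow G. P A * d A) = 0" using insert.IH by (simp add: P_def d_def M_def)
  have E0: "(\<Sum>A\<in>Pow G. P A) = (\<Prod>a\<in>G. 1 + z a)" unfolding P_def by (rule sum_Pow_prod) fact
  have E2: "(\<Sum>A\<in>Pow G. P A * (d A)\<^sup>2) = (\<Prod>a\<in>G. 1 + z a) * (\<Sum>a\<in>G. (w a)\<^sup>2 * z a / (1 + z a)\<^sup>2)"
    using insert.IH by (simp add: P_def d_def M_def)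
  have "(\<Sum>A\<in>Pow (insert b G). (\<Prod>a\<in>A. z a) * ((\<Sum>a\<in>A. w a) - (M + w b * p)))
    = (\<Sum>A\<in>Pow G. P A * (d A - w b * p)) + (\<Sum>A\<in>Pow G. z b * P A * (d A + w b * (1 - p)))"
    unfolding sum_Pow_insert[OF insert.hyps(1,2)]
    by (intro arg_cong2[where f="(+)"] sum.cong refl) (simp add: d1 P_def, simp only: ins Pow_iff)
  also have "\<dots> = (\<Sum>A\<in>Pow G. (1 + z b) * (P A * d A) + P A * w b * (z b * (1 - p) - p))"
    unfolding sum.distrib[symmetric] by (intro sum.cong) (auto simp: algebra_simps)
  also have "\<dots> = 0" unfolding zp using E1 by (simp add: sum_distrib_left[symmetric])
  finally have r1: "(\<Sum>A\<in>Pow (insert b G). (\<Prod>a\<in>A. z a) * ((\<Sum>a\<in>A. w a) - (M + w b * p))) = 0" .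
  have pw: "P A * (d A - w b * p)\<^sup>2 + z b * P A * (d A + w b * (1 - p))\<^sup>2
      = (1 + z b) * (P A * (d A)\<^sup>2) + (w b)\<^sup>2 * p * P A" for A
  proof -
    have "P A * (d A - w b * p)\<^sup>2 + z b * P A * (d A + w b * (1 - p))\<^sup>2
      = (1 + z b) * (P A * (d A)\<^sup>2) + 2 * P A * d A * w b * (z b * (1 - p) - p)
        + (w b)\<^sup>2 * P A * (p * p + (z b * (1 - p)) * (1 - p))"
      by (simp add: power2_eq_square algebra_simps)
    also have "\<dots> = (1 + z b) * (P A * (d A)\<^sup>2) + (w b)\<^sup>2 * p * P A"
      unfolding zp(1) by (simp add: algebra_simps)
    finally show ?thesis .
  qed
  have "(\<Sum>A\<in>Pow (insert b G). (\<Prod>a\<in>A. z a) * ((\<Sum>a\<in>A. w a) - (M + w b * p))\<^sup>2)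
    = (\<Sum>A\<in>Pow G. P A * (d A - w b * p)\<^sup>2) + (\<Sum>A\<in>Pow G. z b * P A * (d A + w b * (1 - p))\<^sup>2)"
    unfolding sum_Pow_insert[OF insert.hyps(1,2)]
    by (intro arg_cong2[where f="(+)"] sum.cong refl) (simp add: d1 P_def, simp only: ins Pow_iff)
  also have "\<dots> = (\<Sum>A\<in>Pow G. (1 + z b) * (P A * (d A)\<^sup>2) + (w b)\<^sup>2 * p * P A)"
    unfolding sum.distrib[symmetric] pw ..
  also have "\<dots> = (1 + z b) * (\<Sum>A\<in>Pow G. P A * (d A)\<^sup>2) + (w b)\<^sup>2 * p * (\<Sum>A\<in>Pow G. P A)"
    by (simp add: sum.distrib sum_distrib_left)
  also have "\<dots> = (\<Prod>a\<in>insert b G. 1 + z a) * (\<Sum>a\<in>insert b G. (w a)\<^sup>2 * z a / (1 + z a)\<^sup>2)"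
  proof -
    have "p = (1 + z b) * (z b / (1 + z b)\<^sup>2)" using zb by (simp add: p_def power2_eq_square)
    then have "(w b)\<^sup>2 * p = (1 + z b) * ((w b)\<^sup>2 * z b / (1 + z b)\<^sup>2)" by simp
    then show ?thesis unfolding E0 E2 using insert.hyps by (simp add: algebra_simps)
  qed
  finally show ?case unfolding M' using r1 by simp
qed simp

section \<open>Exponential sums and quadratic bounds for the exponential\<close>

lemma sum_exp_neg_le:
  assumes "\<theta> > (0::real)"
  shows "(\<Sum>l=1..L. exp (- \<theta> * real l)) \<le> 1 / \<theta>"
proof -
  have "(\<Sum>l=1..L. exp (- \<theta> * real l)) \<le> (1 - exp (- \<theta> * real L)) / \<theta>"
  proof (induction L)
    case (Suc L)
    have "\<theta> \<le> exp \<theta> - 1" using exp_ge_add_one_self[of \<theta>] by linarith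
    then have "\<theta> * exp (- \<theta> * real (Suc L)) \<le> (exp \<theta> - 1) * exp (- \<theta> * real (Suc L))"
      by (intro mult_right_mono) auto
    also have "\<dots> = exp (- \<theta> * real L) - exp (- \<theta> * real (Suc L))"
      by (simp add: left_diff_distrib exp_add[symmetric] algebra_simps)
    finally have "exp (- \<theta> * real (Suc L)) \<le> (exp (- \<theta> * real L) - exp (- \<theta> * real (Suc L))) / \<theta>"
      using assms by (simp add: field_simps)
    then show ?case using Suc by (simp add: diff_divide_distrib)
  qed simp
  also have "\<dots> \<le> 1 / \<theta>" using assms by (intro divide_right_mono) auto
  finally show ?thesis .
qed

text \<open>Half of the exponential absorbs the factor \<open>real l\<close>; the next lemma does
  the same with its square.\<close>

lemma sum_l_exp_neg_le:
  assumes "\<theta> > (0::real)"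
  shows "(\<Sum>l=1..L. real l * exp (- \<theta> * real l)) \<le> 4 / \<theta>\<^sup>2"
proof -
  have "(\<Sum>l=1..L. real l * exp (- \<theta> * real l)) \<le> (\<Sum>l=1..L. 2 / \<theta> * exp (- (\<theta> / 2) * real l))"
  proof (intro sum_mono)
    fix l
    have "\<theta> / 2 * real l \<le> exp (\<theta> / 2 * real l)" using exp_ge_add_one_self[of "\<theta> / 2 * real l"] by linarith
    then have "\<theta> / 2 * real l * exp (- \<theta> * real l) \<le> exp (\<theta> / 2 * real l) * exp (- \<theta> * real l)"
      by (intro mult_right_mono) auto
    also have "\<dots> = exp (- (\<theta> / 2) * real l)" by (simp add: exp_add[symmetric])
    finally show "real l * exp (- \<theta> * real l) \<le> 2 / \<theta> * exp (- (\<theta> / 2) * real l)"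
      using assms by (simp add: field_simps)
  qed
  also have "\<dots> \<le> 2 / \<theta> * (1 / (\<theta> / 2))"
    unfolding sum_distrib_left[symmetric] using assms by (intro mult_left_mono sum_exp_neg_le) auto
  also have "\<dots> = 4 / \<theta>\<^sup>2" by (simp add: power2_eq_square)
  finally show ?thesis .
qed

lemma sum_sq_exp_neg_le:
  assumes "\<theta> > (0::real)"
  shows "(\<Sum>l=1..L. (real l)\<^sup>2 * exp (- \<theta> * real l)) \<le> 16 / \<theta> ^ 3"
proof -
  have "(\<Sum>l=1..L. (real l)\<^sup>2 * exp (- \<theta> * real l)) \<le> (\<Sum>l=1..L. 8 / \<theta>\<^sup>2 * exp (- (\<theta> / 2) * real l))"
  proof (intro sum_mono)
    fix l
    define y where "y = \<theta> / 2 * real l"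
    have "y \<ge> 0" using assms by (simp add: y_def)
    then have "y\<^sup>2 \<le> 2 * exp y" using exp_lower_Taylor_quadratic[of y] by simp
    then have "y\<^sup>2 * exp (- \<theta> * real l) \<le> 2 * exp y * exp (- \<theta> * real l)"
      by (intro mult_right_mono) auto
    also have "\<dots> = 2 * exp (- (\<theta> / 2) * real l)" by (simp add: exp_add[symmetric] y_def)
    finally show "(real l)\<^sup>2 * exp (- \<theta> * real l) \<le> 8 / \<theta>\<^sup>2 * exp (- (\<theta> / 2) * real l)"
      using assms by (simp add: field_simps y_def power2_eq_square)
  qed
  also have "\<dots> \<le> 8 / \<theta>\<^sup>2 * (1 / (\<theta> / 2))"
    unfolding sum_distrib_left[symmetric] using assms by (intro mult_left_mono sum_exp_neg_le) auto
  also have "\<dots> = 16 / \<theta> ^ 3" by (simp add: power2_eq_square power3_eq_cube)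
  finally show ?thesis .
qed

lemma exp_neg_le_quadratic: "y \<ge> (0::real) \<Longrightarrow> exp (- y) \<le> 1 - y + y\<^sup>2"
proof -
  assume y: "y \<ge> 0"
  have q: "1 - y + y\<^sup>2 > 0"
  proof -
    have "1 - y + y\<^sup>2 = (1 - y / 2)\<^sup>2 + 3 / 4 * y\<^sup>2" by (simp add: power2_eq_square algebra_simps)
    moreover have "\<dots> > 0" by (cases "y = 0") (auto intro: add_nonneg_pos)
    ultimately show ?thesis by simp
  qed
  \<comment> \<open>The product of \<open>1 - y + y^2\<close> with the Taylor polynomial
    \<open>1 + y + y^2 / 2\<close> of \<open>exp y\<close> has no negative coefficient.\<close>
  have "1 \<le> 1 + y\<^sup>2 / 2 + y ^ 3 / 2 + y ^ 4 / 2" using y by simp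
  also have "\<dots> = (1 - y + y\<^sup>2) * (1 + y + y\<^sup>2 / 2)"
    by (simp add: power2_eq_square power3_eq_cube power4_eq_xxxx field_simps)
  also have "\<dots> \<le> (1 - y + y\<^sup>2) * exp y"
    using q exp_lower_Taylor_quadratic[OF y] by (intro mult_left_mono) auto
  finally show ?thesis by (simp add: exp_minus field_simps)
qed

lemma exp_le_quadratic: "\<bar>y\<bar> \<le> (1::real) \<Longrightarrow> exp y \<le> 1 + y + y\<^sup>2"
  using exp_bound[of y] exp_neg_le_quadratic[of "-y"] by (cases "y \<ge> 0") auto

text \<open>Under the weights \<open>exp (- \<theta> * wt A)\<close> the cells of \<open>grid L\<close> are occupied independently, the cell
  \<open>(j, l)\<close> with probability \<open>occ \<theta> l\<close>; \<open>pfun\<close> is the normalising constant.\<close>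

definition occ :: "real \<Rightarrow> nat \<Rightarrow> real" where
  "occ \<theta> l = 1 / (1 + exp (\<theta> * real l))"

definition pfun :: "'n::finite itself \<Rightarrow> nat \<Rightarrow> real \<Rightarrow> real" where
  "pfun _ L \<theta> = (\<Prod>a\<in>(grid L :: ('n \<times> nat) set). 1 + exp (- \<theta> * real (snd a)))"

lemma occ_alt: "occ \<theta> l = exp (- \<theta> * real l) / (1 + exp (- \<theta> * real l))"
proof -
  have "1 + exp (\<theta> * real l) > 0" "1 + exp (- (\<theta> * real l)) > 0" by (simp_all add: add_pos_pos)
  then show ?thesis by (simp add: occ_def exp_minus field_simps)
qed

lemma occ_pos: "occ \<theta> l > 0"
  by (simp add: occ_def add_pos_pos)

lemma occ_le_exp: "occ \<theta> l \<le> exp (- \<theta> * real l)"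
  unfolding occ_alt by (simp add: divide_le_eq add_pos_pos algebra_simps)

lemma occ_lt_1: "occ \<theta> l < 1"
  unfolding occ_def by (simp add: divide_less_eq add_pos_pos)

lemma pfun_pos: "pfun TYPE('n::finite) L \<theta> > 0"
  unfolding pfun_def by (intro prod_pos) (simp add: add_pos_pos)

lemma wt_exp: "exp (- \<theta> * real (wt A)) = exp (\<Sum>a\<in>A. - \<theta> * real (snd a))"
  by (simp add: wt_def sum_distrib_left)

lemma pfun_eq: "(\<Sum>A\<in>Pow (grid L :: ('n::finite \<times> nat) set). exp (- \<theta> * real (wt A))) = pfun TYPE('n) L \<theta>"
  unfolding pfun_def wt_exp by (rule sum_Pow_exp) simp

text \<open>The bound is uniform in the height \<open>L\<close>, as the tail estimate sums over
  grids of arbitrary height.\<close>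

lemma pfun_le:
  assumes "\<theta> > 0"
  shows "pfun TYPE('n::finite) L \<theta> \<le> exp (real CARD('n) / \<theta>)"
proof -
  have "pfun TYPE('n) L \<theta> \<le> (\<Prod>a\<in>(grid L :: ('n \<times> nat) set). exp (exp (- \<theta> * real (snd a))))"
    unfolding pfun_def by (intro prod_mono) (auto simp: exp_ge_add_one_self add_nonneg_nonneg)
  also have "\<dots> = exp (real CARD('n) * (\<Sum>l=1..L. exp (- \<theta> * real l)))"
    using sum_grid[of "\<lambda>l. exp (- \<theta> * real l)" L, where 'n='n]
    by (simp add: exp_sum[symmetric])
  also have "\<dots> \<le> exp (real CARD('n) * (1 / \<theta>))"
    using sum_exp_neg_le[OF assms, of L] by (intro iffD2[OF exp_le_cancel_iff] mult_left_mono) auto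
  finally show ?thesis by simp
qed

text \<open>Rankin's trick: \<open>exp (\<theta> * (N - wt A)) \<ge> 1\<close> for every set in
  \<open>Qs N\<close>. The choice \<open>\<theta> = 1 / sqrt N\<close> balances
  \<open>\<theta> * N\<close> against \<open>CARD('n) / \<theta>\<close>.\<close>

lemma card_Qs_le:
  assumes "N > 0"
  shows "real (card (Qs N :: ('n::finite \<times> nat) set set)) \<le> exp ((1 + real CARD('n)) * sqrt N)"
proof -
  define \<theta> where "\<theta> = 1 / sqrt N"
  have \<theta>: "\<theta> > 0" using assms by (simp add: \<theta>_def)
  have "real (card (Qs N :: ('n \<times> nat) set set)) = (\<Sum>A\<in>(Qs N :: ('n \<times> nat) set set). 1)" by simp
  also have "\<dots> \<le> (\<Sum>A\<in>(Qs N :: ('n \<times> nat) set set). exp (\<theta> * real N) * exp (- \<theta> * real (wt A)))"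
    using \<theta> by (intro sum_mono) (auto simp: exp_add[symmetric] Qs_def)
  also have "\<dots> \<le> (\<Sum>A\<in>Pow (grid N :: ('n \<times> nat) set). exp (\<theta> * real N) * exp (- \<theta> * real (wt A)))"
    by (intro sum_mono2) (auto simp: Qs_eq[of N N])
  also have "\<dots> = exp (\<theta> * real N) * pfun TYPE('n) N \<theta>"
    by (simp only: sum_distrib_left[symmetric] pfun_eq)
  also have "\<dots> \<le> exp (\<theta> * real N) * exp (real CARD('n) / \<theta>)"
    using pfun_le[OF \<theta>] by (intro mult_left_mono) auto
  also have "\<dots> = exp ((1 + real CARD('n)) * sqrt N)"
    using assms by (simp add: exp_add[symmetric] \<theta>_def real_div_sqrt algebra_simps)
  finally show ?thesis .
qed

text \<open>Exponential moment of one fibre under the tilted measure: cells outside fibre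
  \<open>j\<close> keep their factor, and a cell inside it gains
  \<open>1 + p * (exp \<eta> - 1) \<le> exp ((\<eta> + \<eta>^2) * p)\<close> with \<open>p\<close>
  its occupation probability. Both signs of \<open>\<eta>\<close> are covered, for the two
  tails.\<close>

lemma fibre_chernoff:
  assumes "\<bar>\<eta>\<bar> \<le> 1"
  shows "(\<Sum>A\<in>Pow (grid L :: ('n::finite \<times> nat) set). exp (- \<theta> * real (wt A) + \<eta> * real (fibre_card j A)))
    \<le> pfun TYPE('n) L \<theta> * exp ((\<eta> + \<eta>\<^sup>2) * (\<Sum>l=1..L. occ \<theta> l))"
proof -
  let ?G = "grid L :: ('n \<times> nat) set"
  define \<psi> where "\<psi> a = - \<theta> * real (snd a) + (if fst a = j then \<eta> else 0)" for a :: "'n \<times> nat"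
  have e: "exp (- \<theta> * real (wt A) + \<eta> * real (fibre_card j A)) = exp (\<Sum>a\<in>A. \<psi> a)" if "A \<in> Pow ?G" for A
  proof -
    have fA: "finite A" using that finite_subset[of A ?G] by auto
    have "(\<Sum>a\<in>A. if fst a = j then \<eta> else 0) = (\<Sum>a\<in>{a\<in>A. fst a = j}. \<eta>)"
      using fA by (intro sum.mono_neutral_cong_right) auto
    also have "\<dots> = \<eta> * real (card {a\<in>A. fst a = j})" by simp
    also have "{a\<in>A. fst a = j} = Pair j ` {l. (j, l) \<in> A}" by force
    also have "card \<dots> = fibre_card j A" unfolding fibre_card_def by (intro card_image) (auto simp: inj_on_def)
    finally show ?thesis by (simp add: \<psi>_def sum.distrib sum_subtractf wt_def sum_negf sum_distrib_left)
  qed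
  have "(\<Sum>A\<in>Pow ?G. exp (- \<theta> * real (wt A) + \<eta> * real (fibre_card j A))) = (\<Prod>a\<in>?G. 1 + exp (\<psi> a))"
    using e sum_Pow_exp[of ?G \<psi>] by simp
  also have "\<dots> \<le> (\<Prod>a\<in>?G. (1 + exp (- \<theta> * real (snd a))) * exp (if fst a = j then (\<eta> + \<eta>\<^sup>2) * occ \<theta> (snd a) else 0))"
  proof (intro prod_mono conjI)
    fix a :: "'n \<times> nat"
    show "0 \<le> 1 + exp (\<psi> a)" by (simp add: add_nonneg_nonneg)
    define z where "z = exp (- \<theta> * real (snd a))"
    have z: "z > 0" by (simp add: z_def)
    show "1 + exp (\<psi> a) \<le> (1 + exp (- \<theta> * real (snd a))) * exp (if fst a = j then (\<eta> + \<eta>\<^sup>2) * occ \<theta> (snd a) else 0)"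
    proof (cases "fst a = j")
      case True
      have "1 + exp (\<psi> a) = 1 + z * exp \<eta>" using True by (simp add: \<psi>_def z_def exp_add[symmetric])
      also have "\<dots> \<le> 1 + z * (1 + \<eta> + \<eta>\<^sup>2)" using exp_le_quadratic[OF assms] z by simp
      also have "\<dots> = (1 + z) * (1 + (\<eta> + \<eta>\<^sup>2) * (z / (1 + z)))" using z by (simp add: field_simps)
      also have "\<dots> \<le> (1 + z) * exp ((\<eta> + \<eta>\<^sup>2) * (z / (1 + z)))"
        using z by (intro mult_left_mono exp_ge_add_one_self) auto
      finally show ?thesis using True by (simp add: z_def occ_alt)
    qed (simp add: \<psi>_def)
  qed
  also have "\<dots> = pfun TYPE('n) L \<theta> * exp (\<Sum>a\<in>?G. if fst a = j then (\<eta> + \<eta>\<^sup>2) * occ \<theta> (snd a) else 0)"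
    by (simp add: pfun_def prod.distrib exp_sum)
  also have "(\<Sum>a\<in>?G. if fst a = j then (\<eta> + \<eta>\<^sup>2) * occ \<theta> (snd a) else 0) = (\<Sum>a\<in>Pair j ` {1..L}. (\<eta> + \<eta>\<^sup>2) * occ \<theta> (snd a))"
    by (intro sum.mono_neutral_cong_right) (auto simp: grid_def)
  also have "\<dots> = (\<eta> + \<eta>\<^sup>2) * (\<Sum>l=1..L. occ \<theta> l)"
    by (subst sum.reindex) (auto simp: inj_on_def sum_distrib_left)
  finally show ?thesis .
qed

text \<open>Rankin's trick combined with Chernoff's bound. The tilt \<open>\<theta>\<close> and the
  height \<open>L\<close> are not tied to \<open>N\<close>, so that a tilt adapted to one weight
  bound can be applied to a slightly larger one.\<close>

lemma card_fibre_low: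
  assumes "0 \<le> \<eta>" "\<eta> \<le> 1" "0 \<le> \<theta>" "N \<le> L"
  shows "real (card {A \<in> Qs N. real (fibre_card (j::'n::finite) A) \<le> (\<Sum>l=1..L. occ \<theta> l) - t})
    \<le> exp (\<theta> * real N) * pfun TYPE('n) L \<theta> * exp (- \<eta> * t + \<eta>\<^sup>2 * (\<Sum>l=1..L. occ \<theta> l))"
proof -
  define v where "v = (\<Sum>l=1..L. occ \<theta> l)"
  let ?S = "{A \<in> Qs N. real (fibre_card j A) \<le> v - t}"
  have "real (card ?S) = (\<Sum>A\<in>?S. 1)" by simp
  also have "\<dots> \<le> (\<Sum>A\<in>?S. exp (\<theta> * real N + \<eta> * (v - t)) * exp (- \<theta> * real (wt A) + (- \<eta>) * real (fibre_card j A)))"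
  proof (intro sum_mono)
    fix A assume A: "A \<in> ?S"
    have "\<theta> * real (wt A) \<le> \<theta> * real N" using A assms by (intro mult_left_mono) (auto simp: Qs_def)
    moreover have "\<eta> * real (fibre_card j A) \<le> \<eta> * (v - t)" using A assms by (intro mult_left_mono) auto
    ultimately show "1 \<le> exp (\<theta> * real N + \<eta> * (v - t)) * exp (- \<theta> * real (wt A) + (- \<eta>) * real (fibre_card j A))"
      by (simp add: exp_add[symmetric])
  qed
  also have "\<dots> \<le> (\<Sum>A\<in>Pow (grid L). exp (\<theta> * real N + \<eta> * (v - t)) * exp (- \<theta> * real (wt A) + (- \<eta>) * real (fibre_card j A)))"
    using assms by (intro sum_mono2) (auto simp: Qs_eq[of N L])
  also have "\<dots> \<le> exp (\<theta> * real N + \<eta> * (v - t)) * (pfun TYPE('n) L \<theta> * exp ((- \<eta> + (- \<eta>)\<^sup>2) * v))"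
    unfolding sum_distrib_left[symmetric] v_def using assms by (intro mult_left_mono fibre_chernoff) auto
  also have "\<dots> = exp (\<theta> * real N) * pfun TYPE('n) L \<theta> * exp (- \<eta> * t + \<eta>\<^sup>2 * v)"
  proof -
    have "\<theta> * real N + \<eta> * (v - t) + (- \<eta> + (- \<eta>)\<^sup>2) * v = \<theta> * real N + (- \<eta> * t + \<eta>\<^sup>2 * v)"
      by (simp add: algebra_simps power2_eq_square)
    then have "exp (\<theta> * real N + \<eta> * (v - t)) * exp ((- \<eta> + (- \<eta>)\<^sup>2) * v) = exp (\<theta> * real N) * exp (- \<eta> * t + \<eta>\<^sup>2 * v)"
      by (simp only: exp_add[symmetric])
    then show ?thesis by (simp only: mult_ac)
  qed
  finally show ?thesis by (simp add: v_def)
qed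

lemma card_fibre_high:
  assumes "0 \<le> \<eta>" "\<eta> \<le> 1" "0 \<le> \<theta>" "N \<le> L"
  shows "real (card {A \<in> Qs N. real (fibre_card (j::'n::finite) A) \<ge> (\<Sum>l=1..L. occ \<theta> l) + t})
    \<le> exp (\<theta> * real N) * pfun TYPE('n) L \<theta> * exp (- \<eta> * t + \<eta>\<^sup>2 * (\<Sum>l=1..L. occ \<theta> l))"
proof -
  define v where "v = (\<Sum>l=1..L. occ \<theta> l)"
  let ?S = "{A \<in> Qs N. real (fibre_card j A) \<ge> v + t}"
  have "real (card ?S) = (\<Sum>A\<in>?S. 1)" by simp
  also have "\<dots> \<le> (\<Sum>A\<in>?S. exp (\<theta> * real N - \<eta> * (v + t)) * exp (- \<theta> * real (wt A) + \<eta> * real (fibre_card j A)))"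
  proof (intro sum_mono)
    fix A assume A: "A \<in> ?S"
    have "\<theta> * real (wt A) \<le> \<theta> * real N" using A assms by (intro mult_left_mono) (auto simp: Qs_def)
    moreover have "\<eta> * real (fibre_card j A) \<ge> \<eta> * (v + t)" using A assms by (intro mult_left_mono) auto
    ultimately show "1 \<le> exp (\<theta> * real N - \<eta> * (v + t)) * exp (- \<theta> * real (wt A) + \<eta> * real (fibre_card j A))"
      by (simp add: exp_add[symmetric])
  qed
  also have "\<dots> \<le> (\<Sum>A\<in>Pow (grid L). exp (\<theta> * real N - \<eta> * (v + t)) * exp (- \<theta> * real (wt A) + \<eta> * real (fibre_card j A)))"
    using assms by (intro sum_mono2) (auto simp: Qs_eq[of N L])
  also have "\<dots> \<le> exp (\<theta> * real N - \<eta> * (v + t)) * (pfun TYPE('n) L \<theta> * exp ((\<eta> + \<eta>\<^sup>2) * v))"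
    unfolding sum_distrib_left[symmetric] v_def using assms by (intro mult_left_mono fibre_chernoff) auto
  also have "\<dots> = exp (\<theta> * real N) * pfun TYPE('n) L \<theta> * exp (- \<eta> * t + \<eta>\<^sup>2 * v)"
  proof -
    have "\<theta> * real N - \<eta> * (v + t) + (\<eta> + \<eta>\<^sup>2) * v = \<theta> * real N + (- \<eta> * t + \<eta>\<^sup>2 * v)"
      by (simp add: algebra_simps power2_eq_square)
    then have "exp (\<theta> * real N - \<eta> * (v + t)) * exp ((\<eta> + \<eta>\<^sup>2) * v) = exp (\<theta> * real N) * exp (- \<eta> * t + \<eta>\<^sup>2 * v)"
      by (simp only: exp_add[symmetric])
    then show ?thesis by (simp only: mult_ac)
  qed
  finally show ?thesis by (simp add: v_def)
qed

text \<open>Intermediate value theorem for the mean weight as a function of \<open>\<theta>\<close>;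
  the window confines the tilt to order \<open>1 / sqrt N\<close>.\<close>

lemma tilted_mean_exists:
  fixes a :: real
  assumes N: "N \<ge> 3" and a: "0 \<le> a" "a \<le> real N / 2"
  shows "\<exists>\<theta>. 1 / (6 * sqrt N) \<le> \<theta> \<and> \<theta> \<le> 3 * real CARD('n::finite) / sqrt N \<and>
    (\<Sum>b\<in>(grid (4 * N) :: ('n \<times> nat) set). real (snd b) * occ \<theta> (snd b)) = real N - a"
proof -
  define s where "s = real CARD('n)"
  have s: "s \<ge> 1" by (simp add: s_def Suc_leI)
  define f where "f \<theta> = s * (\<Sum>l=1..4*N. real l * occ \<theta> l)" for \<theta>
  have sqN: "sqrt N > 0" "sqrt N * sqrt N = N" using N by auto
  have sq1: "sqrt N \<ge> 3 / 2" using N by (intro real_le_rsqrt) (auto simp: power2_eq_square)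
  \<comment> \<open>The mean weight is at most \<open>4 * s / \<theta>^2\<close>, which lies below
    \<open>N / 2\<close> at \<open>\<theta> = 3 * s / sqrt N\<close>.\<close>
  have hi: "f (3 * s / sqrt N) \<le> real N - a"
  proof -
    define \<theta> where "\<theta> = 3 * s / sqrt N"
    have \<theta>: "\<theta> > 0" using sqN s by (simp add: \<theta>_def)
    have "f \<theta> \<le> s * (\<Sum>l=1..4*N. real l * exp (- \<theta> * real l))"
      unfolding f_def using s by (intro mult_left_mono sum_mono occ_le_exp) auto
    also have "\<dots> \<le> s * (4 / \<theta>\<^sup>2)" using s \<theta> by (intro mult_left_mono sum_l_exp_neg_le) auto
    also have "\<dots> = 4 * real N / (9 * s)" using sqN s by (simp add: \<theta>_def power2_eq_square field_simps)
    also have "\<dots> \<le> 4 * real N / 9" using s by (intro divide_left_mono) auto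
    also have "\<dots> \<le> real N - a" using a by simp
    finally show ?thesis by (simp add: \<theta>_def)
  qed
  have lo: "real N - a \<le> f (1 / (6 * sqrt N))"
  proof -
    define \<theta> where "\<theta> = 1 / (6 * sqrt N)"
    \<comment> \<open>The levels up to \<open>1 / \<theta>\<close> are occupied with probability at
      least 1/4. They alone contribute about \<open>K^2 / 8\<close>, which exceeds \<open>N\<close>,
      and they lie in the grid since \<open>6 * sqrt N \<le> 4 * N\<close>.\<close>
    define K where "K = nat \<lfloor>6 * sqrt N\<rfloor>"
    have K: "real K \<le> 6 * sqrt N" "real K + 1 \<ge> 6 * sqrt N" using sqN by (auto simp: K_def of_nat_nat)
    have sq2: "3 / 2 * sqrt N \<le> sqrt N * sqrt N" using sq1 by (intro mult_right_mono) auto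
    then have "6 * sqrt N \<le> 4 * (sqrt N * sqrt N)" by linarith
    then have K4: "K \<le> 4 * N" using K(1) sqN by linarith
    have occ4: "occ \<theta> l \<ge> 1 / 4" if "l \<in> {1..K}" for l
    proof -
      have "\<theta> * real l \<le> \<theta> * real K" using that sqN by (intro mult_left_mono) (auto simp: \<theta>_def)
      also have "\<dots> \<le> 1" using K(1) sqN by (simp add: \<theta>_def field_simps)
      finally have "exp (\<theta> * real l) \<le> 3" using exp_le by (meson exp_le_cancel_iff order_trans)
      then show ?thesis unfolding occ_def by (intro divide_left_mono) (auto simp: add_pos_pos)
    qed
    have sumK: "(\<Sum>l=1..K. real l) = real K * (real K + 1) / 2"
      by (induction K) (auto simp: field_simps)
    have "(6 * sqrt N - 1) * (6 * sqrt N) = 36 * (sqrt N * sqrt N) - 6 * sqrt N" by (simp add: algebra_simps)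
    then have "real N \<le> (6 * sqrt N - 1) * (6 * sqrt N) / 8" using sq2 sqN by linarith
    also have "\<dots> \<le> real K * (real K + 1) / 8"
      using K sq1 by (intro divide_right_mono mult_mono) auto
    also have "\<dots> = (\<Sum>l=1..K. real l * (1 / 4))" unfolding sum_distrib_right[symmetric] sumK by simp
    also have "\<dots> \<le> (\<Sum>l=1..K. real l * occ \<theta> l)" by (intro sum_mono mult_left_mono occ4) auto
    also have "\<dots> \<le> (\<Sum>l=1..4*N. real l * occ \<theta> l)"
      using K4 by (intro sum_mono2) (auto intro: mult_nonneg_nonneg less_imp_le[OF occ_pos])
    also have "\<dots> \<le> f \<theta>"
    proof -
      have "0 \<le> (\<Sum>l=1..4*N. real l * occ \<theta> l)"
        by (intro sum_nonneg mult_nonneg_nonneg less_imp_le[OF occ_pos]) auto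
      then show ?thesis unfolding f_def using mult_right_mono[OF s] by fastforce
    qed
    finally show ?thesis using a by (simp add: \<theta>_def)
  qed
  have "1 / (6 * sqrt N) \<le> 3 * s / sqrt N" using sqN s by (simp add: field_simps)
  then have "\<exists>\<theta>. 1 / (6 * sqrt N) \<le> \<theta> \<and> \<theta> \<le> 3 * s / sqrt N \<and> f \<theta> = real N - a"
  proof (intro IVT2'[of f, OF hi lo])
    show "continuous_on {1 / (6 * sqrt N)..3 * s / sqrt N} f"
    proof -
      have "1 + exp (x::real) \<noteq> 0" for x using exp_gt_zero[of x] by linarith
      then show ?thesis unfolding f_def occ_def by (intro continuous_intros) auto
    qed
  qed
  moreover have "f \<theta> = (\<Sum>b\<in>(grid (4 * N) :: ('n \<times> nat) set). real (snd b) * occ \<theta> (snd b))" for \<theta>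
    unfolding f_def s_def by (rule sum_grid[symmetric])
  ultimately show ?thesis by (simp add: s_def)
qed

text \<open>A converse to Rankin's bound up to \<open>exp (C * N powr (1/4))\<close>. The weight of
  a tilted set has standard deviation of order at most \<open>N powr (3/4)\<close>; with its mean
  placed \<open>a\<close> below \<open>N\<close>, for \<open>a\<close> of that order, at least half
  of the mass lies on weights between \<open>N - 2 * a\<close> and \<open>N\<close>, where the
  tilting factor varies by at most \<open>exp (2 * a * \<theta>)\<close>. The last conclusion, a
  mean weight of nearly \<open>N\<close>, is what later makes symmetric differences
  overweight.\<close>

lemma tilt_exists:
  "\<exists>C>0. \<forall>\<^sub>F N in sequentially. \<exists>\<theta>. 1 / (6 * sqrt N) \<le> \<theta> \<and> \<theta> \<le> 3 * real CARD('n::finite) / sqrt N \<and>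
     exp (\<theta> * real N) * pfun TYPE('n) (4 * N) \<theta> \<le> real (card (Qs N :: ('n \<times> nat) set set)) * exp (C * real N powr (1/4)) \<and>
     real N - C * real N powr (3/4) \<le> (\<Sum>b\<in>(grid (4 * N) :: ('n \<times> nat) set). real (snd b) * occ \<theta> (snd b))"
proof -
  define s where "s = real CARD('n)"
  have s: "s \<ge> 1" by (simp add: s_def Suc_leI)
  \<comment> \<open>The variance is at most \<open>16 * s / \<theta>^3\<close>, hence at most
    \<open>3456 * s * N powr (3/2)\<close> with \<open>3456 = 16 * 6^3\<close>; \<open>c\<close>
    makes this equal to \<open>a^2 / 2\<close>, as Chebyshev's inequality requires.\<close>
  define c where "c = sqrt (6912 * s)"
  have c: "c \<ge> 0" "c\<^sup>2 = 6912 * s" using s by (auto simp: c_def)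
  define C where "C = 1 + 6 * s * c + c"
  have C: "C > 0" using s c by (simp add: C_def add_pos_nonneg)
  have ev: "\<forall>\<^sub>F N in sequentially. c * real N powr (3/4) \<le> real N / 2" by real_asymp
  have "\<forall>\<^sub>F N in sequentially. \<exists>\<theta>. 1 / (6 * sqrt N) \<le> \<theta> \<and> \<theta> \<le> 3 * real CARD('n::finite) / sqrt N \<and>
     exp (\<theta> * real N) * pfun TYPE('n) (4 * N) \<theta> \<le> real (card (Qs N :: ('n \<times> nat) set set)) * exp (C * real N powr (1/4)) \<and>
     real N - C * real N powr (3/4) \<le> (\<Sum>b\<in>(grid (4 * N) :: ('n \<times> nat) set). real (snd b) * occ \<theta> (snd b))"
    using ev eventually_ge_at_top[of 3]
  proof eventually_elim
    case (elim N)
    define a where "a = c * real N powr (3/4)"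
    have a: "0 < a" "a \<le> real N / 2" using c s elim by (auto simp: a_def c_def)
    obtain \<theta> where \<theta>: "1 / (6 * sqrt N) \<le> \<theta>" "\<theta> \<le> 3 * s / sqrt N"
      "(\<Sum>b\<in>(grid (4 * N) :: ('n \<times> nat) set). real (snd b) * occ \<theta> (snd b)) = real N - a"
      using tilted_mean_exists[OF elim(2) less_imp_le[OF a(1)] a(2), where 'n='n] by (auto simp: s_def)
    have \<theta>0: "\<theta> > 0" using \<theta>(1) elim(2) by (auto intro: less_le_trans[rotated])
    define G where "G = (grid (4 * N) :: ('n \<times> nat) set)"
    define F where "F = pfun TYPE('n) (4 * N) \<theta>"
    have F: "F > 0" by (simp add: F_def pfun_pos)
    define M where "M = real N - a"
    have fG: "finite G" by (simp add: G_def)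
    have Mz: "(\<Sum>b\<in>G. real (snd b) * exp (- \<theta> * real (snd b)) / (1 + exp (- \<theta> * real (snd b)))) = M"
      using \<theta>(3) by (simp add: M_def G_def occ_alt)
    have wz: "(\<Prod>a\<in>A. exp (- \<theta> * real (snd a))) = exp (- \<theta> * real (wt A))" if "A \<in> Pow G" for A
      unfolding wt_exp using that fG by (intro exp_sum[symmetric]) (auto intro: finite_subset)
    have "(\<Sum>A\<in>Pow G. exp (- \<theta> * real (wt A)) * (real (wt A) - M)\<^sup>2)
        = (\<Sum>A\<in>Pow G. (\<Prod>a\<in>A. exp (- \<theta> * real (snd a))) * ((\<Sum>a\<in>A. real (snd a)) - M)\<^sup>2)"
      by (intro sum.cong refl) (simp only: wz, simp add: wt_def)
    also have "\<dots> = F * (\<Sum>b\<in>G. (real (snd b))\<^sup>2 * exp (- \<theta> * real (snd b)) / (1 + exp (- \<theta> * real (snd b)))\<^sup>2)"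
      using sum_Pow_variance[OF fG, of "\<lambda>b. exp (- \<theta> * real (snd b))" "\<lambda>b. real (snd b)"]
      unfolding Mz by (simp add: F_def pfun_def G_def)
    also have "\<dots> \<le> F * (\<Sum>b\<in>G. (real (snd b))\<^sup>2 * exp (- \<theta> * real (snd b)))"
    proof (intro mult_left_mono sum_mono)
      fix b
      have "(real (snd b))\<^sup>2 * exp (- \<theta> * real (snd b)) / (1 + exp (- \<theta> * real (snd b)))\<^sup>2
          \<le> (real (snd b))\<^sup>2 * exp (- \<theta> * real (snd b)) / 1"
        by (intro divide_left_mono one_le_power mult_pos_pos zero_less_power add_pos_pos) auto
      then show "(real (snd b))\<^sup>2 * exp (- \<theta> * real (snd b)) / (1 + exp (- \<theta> * real (snd b)))\<^sup>2
          \<le> (real (snd b))\<^sup>2 * exp (- \<theta> * real (snd b))" by simp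
    qed (use F in auto)
    also have "\<dots> = F * (s * (\<Sum>l=1..4*N. (real l)\<^sup>2 * exp (- \<theta> * real l)))"
      unfolding G_def s_def by (subst sum_grid[of "\<lambda>l. (real l)\<^sup>2 * exp (- \<theta> * real l)"]) simp
    also have "\<dots> \<le> F * (s * (16 / \<theta> ^ 3))"
      using F s \<theta>0 by (intro mult_left_mono sum_sq_exp_neg_le) auto
    also have "\<dots> \<le> F * (a\<^sup>2 / 2)"
    proof (intro mult_left_mono)
      have "16 / \<theta> ^ 3 \<le> 16 / (1 / (6 * sqrt N)) ^ 3"
        using \<theta>(1) \<theta>0 elim by (intro divide_left_mono power_mono mult_pos_pos) auto
      also have "\<dots> = 3456 * sqrt N ^ 3" by (simp add: power_divide power_mult_distrib)
      also have "sqrt N ^ 3 = (real N powr (3/4))\<^sup>2"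
        using elim by (simp add: powr_half_sqrt[symmetric] powr_powr[symmetric] powr_realpow[symmetric] powr_powr)
      finally have "s * (16 / \<theta> ^ 3) \<le> s * (3456 * (real N powr (3/4))\<^sup>2)" using s by (intro mult_left_mono) auto
      also have "\<dots> = a\<^sup>2 / 2" using c by (simp add: a_def power_mult_distrib)
      finally show "s * (16 / \<theta> ^ 3) \<le> a\<^sup>2 / 2" .
    qed (use F in auto)
    finally have var: "(\<Sum>A\<in>Pow G. exp (- \<theta> * real (wt A)) * (real (wt A) - M)\<^sup>2) \<le> F * (a\<^sup>2 / 2)" .
    define Near where "Near = {A\<in>Pow G. \<bar>real (wt A) - M\<bar> < a}"
    have far: "(\<Sum>A\<in>Pow G - Near. exp (- \<theta> * real (wt A))) \<le> F / 2"
    proof -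
      have "a\<^sup>2 * (\<Sum>A\<in>Pow G - Near. exp (- \<theta> * real (wt A))) \<le> (\<Sum>A\<in>Pow G - Near. exp (- \<theta> * real (wt A)) * (real (wt A) - M)\<^sup>2)"
        unfolding sum_distrib_left
      proof (intro sum_mono)
        fix A assume "A \<in> Pow G - Near"
        then have "a\<^sup>2 \<le> (real (wt A) - M)\<^sup>2" using a by (auto simp: Near_def abs_le_square_iff[symmetric])
        then show "a\<^sup>2 * exp (- \<theta> * real (wt A)) \<le> exp (- \<theta> * real (wt A)) * (real (wt A) - M)\<^sup>2"
          by (simp add: mult.commute)
      qed
      also have "\<dots> \<le> (\<Sum>A\<in>Pow G. exp (- \<theta> * real (wt A)) * (real (wt A) - M)\<^sup>2)"
        using fG by (intro sum_mono2) auto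
      also note var
      finally show ?thesis using a by (simp add: field_simps)
    qed
    have "F = (\<Sum>A\<in>Pow G. exp (- \<theta> * real (wt A)))" unfolding F_def G_def by (rule pfun_eq[symmetric])
    also have "\<dots> = (\<Sum>A\<in>Pow G - Near. exp (- \<theta> * real (wt A))) + (\<Sum>A\<in>Near. exp (- \<theta> * real (wt A)))"
      using fG by (intro sum.subset_diff) (auto simp: Near_def)
    finally have "F / 2 \<le> (\<Sum>A\<in>Near. exp (- \<theta> * real (wt A)))" using far by simp
    also have "\<dots> \<le> (\<Sum>A\<in>Near. exp (- \<theta> * real N + 2 * a * \<theta>))"
    proof (intro sum_mono)
      fix A assume "A \<in> Near"
      then have "real N - 2 * a \<le> real (wt A)" by (auto simp: Near_def M_def)
      then have "\<theta> * (real N - 2 * a) \<le> \<theta> * real (wt A)" using \<theta>0 by simp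
      then show "exp (- \<theta> * real (wt A)) \<le> exp (- \<theta> * real N + 2 * a * \<theta>)" by (simp add: algebra_simps)
    qed
    also have "\<dots> = real (card Near) * exp (- \<theta> * real N + 2 * a * \<theta>)" by simp
    also have "\<dots> \<le> real (card (Qs N :: ('n \<times> nat) set set)) * exp (- \<theta> * real N + 2 * a * \<theta>)"
    proof (intro mult_right_mono of_nat_mono card_mono)
      show "Near \<subseteq> Qs N" unfolding Near_def G_def by (subst Qs_eq[of N "4*N"]) (auto simp: M_def)
    qed auto
    finally have "F / 2 \<le> real (card (Qs N :: ('n \<times> nat) set set)) * exp (- \<theta> * real N + 2 * a * \<theta>)" .
    then have "exp (\<theta> * real N) * F \<le> exp (\<theta> * real N) * (2 * (real (card (Qs N :: ('n \<times> nat) set set)) * exp (- \<theta> * real N + 2 * a * \<theta>)))"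
      by (intro mult_left_mono) auto
    also have "\<dots> = 2 * real (card (Qs N :: ('n \<times> nat) set set)) * exp (2 * a * \<theta>)"
    proof -
      have "exp (\<theta> * real N) * exp (- \<theta> * real N + 2 * a * \<theta>) = exp (2 * a * \<theta>)"
        unfolding exp_add[symmetric] by simp
      then show ?thesis by (metis mult.assoc mult.commute)
    qed
    also have "\<dots> \<le> exp 1 * real (card (Qs N :: ('n \<times> nat) set set)) * exp (2 * a * \<theta>)"
      using exp_ge_add_one_self[of 1] by (intro mult_right_mono) auto
    also have "\<dots> = real (card (Qs N :: ('n \<times> nat) set set)) * exp (1 + 2 * a * \<theta>)"
      by (simp add: exp_add)
    also have "\<dots> \<le> real (card (Qs N :: ('n \<times> nat) set set)) * exp (C * real N powr (1/4))"
    proof (intro mult_left_mono iffD2[OF exp_le_cancel_iff])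
      have "2 * a * \<theta> \<le> 2 * a * (3 * s / sqrt N)" using a \<theta>(2) by (intro mult_left_mono) auto
      also have "\<dots> = 6 * s * c * (real N powr (3/4) / real N powr (1/2))"
        using elim by (simp add: a_def powr_half_sqrt)
      also have "real N powr (3/4) / real N powr (1/2) = real N powr (1/4)"
        by (simp add: powr_diff[symmetric])
      finally have "2 * a * \<theta> \<le> 6 * s * c * real N powr (1/4)" .
      moreover have "1 \<le> real N powr (1/4)" using elim by (intro ge_one_powr_ge_zero) auto
      moreover have "0 \<le> c * real N powr (1/4)" using c by simp
      ultimately show "1 + 2 * a * \<theta> \<le> C * real N powr (1/4)" unfolding C_def
        by (simp add: algebra_simps)
    qed auto
    finally have 1: "exp (\<theta> * real N) * F \<le> real (card (Qs N :: ('n \<times> nat) set set)) * exp (C * real N powr (1/4))" .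
    have "c * real N powr (3/4) \<le> C * real N powr (3/4)" using s c by (intro mult_right_mono) (auto simp: C_def)
    then have "real N - C * real N powr (3/4) \<le> real N - a" by (simp add: a_def)
    with 1 \<theta> show ?case by (intro exI[of _ \<theta>]) (auto simp: F_def s_def)
  qed
  with C show ?thesis by blast
qed

text \<open>The sum is the expected cardinality of one fibre. For the lower bound the levels up to
  \<open>1 / \<theta>\<close> suffice, each occupied with probability at least 1/4.\<close>

lemma occ_sum_bounds:
  assumes N: "N \<ge> 10" and \<theta>: "1 / (6 * sqrt N) \<le> \<theta>" "\<theta> \<le> b / sqrt N" "b > 0" "2 * b \<le> sqrt N"
  shows "(\<Sum>l=1..4*N. occ \<theta> l) \<le> 6 * sqrt N" "(\<Sum>l=1..4*N. occ \<theta> l) \<ge> sqrt N / (8 * b)"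
proof -
  have sqN: "sqrt N > 0" "sqrt N * sqrt N = N" using N by auto
  have sq3: "sqrt N \<ge> 3" using N by (intro real_le_rsqrt) auto
  have \<theta>0: "\<theta> > 0" using \<theta>(1) sqN by (auto intro: less_le_trans[rotated])
  have i\<theta>: "1 / \<theta> \<le> 6 * sqrt N" using \<theta>(1) \<theta>0 sqN by (simp add: field_simps)
  have "(\<Sum>l=1..4*N. occ \<theta> l) \<le> (\<Sum>l=1..4*N. exp (- \<theta> * real l))" by (intro sum_mono occ_le_exp)
  also have "\<dots> \<le> 1 / \<theta>" by (rule sum_exp_neg_le) fact
  finally show "(\<Sum>l=1..4*N. occ \<theta> l) \<le> 6 * sqrt N" using i\<theta> by simp
  define K where "K = nat \<lfloor>1 / \<theta>\<rfloor>"
  have K: "real K \<le> 1 / \<theta>" "real K + 1 \<ge> 1 / \<theta>" using \<theta>0 by (auto simp: K_def of_nat_nat)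
  have "3 * sqrt N \<le> sqrt N * sqrt N" using sq3 by (intro mult_right_mono) auto
  then have "6 * sqrt N \<le> 4 * (sqrt N * sqrt N)" using sqN by linarith
  then have K4: "K \<le> 4 * N" using K(1) sqN i\<theta> by linarith
  have occ4: "occ \<theta> l \<ge> 1 / 4" if "l \<in> {1..K}" for l
  proof -
    have "\<theta> * real l \<le> \<theta> * real K" using that \<theta>0 by (intro mult_left_mono) auto
    also have "\<dots> \<le> 1" using K(1) \<theta>0 by (simp add: field_simps)
    finally have "exp (\<theta> * real l) \<le> 3" using exp_le by (meson exp_le_cancel_iff order_trans)
    then show ?thesis unfolding occ_def by (intro divide_left_mono) (auto simp: add_pos_pos)
  qed
  have ge: "sqrt N / b \<le> 1 / \<theta>" using \<theta> \<theta>0 sqN by (simp add: field_simps)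
  have "2 \<le> sqrt N / b" using \<theta> by (simp add: field_simps)
  then have "sqrt N / (8 * b) \<le> real K * (1 / 4)" using K ge by simp
  also have "\<dots> = (\<Sum>l=1..K. 1 / 4)" by simp
  also have "\<dots> \<le> (\<Sum>l=1..K. occ \<theta> l)" by (intro sum_mono occ4)
  also have "\<dots> \<le> (\<Sum>l=1..4*N. occ \<theta> l)"
    using K4 by (intro sum_mono2) (auto intro: less_imp_le[OF occ_pos])
  finally show "(\<Sum>l=1..4*N. occ \<theta> l) \<ge> sqrt N / (8 * b)" .
qed

text \<open>The unique third set that together with \<open>A\<close> and \<open>B\<close> has
  symmetric difference \<open>u\<close>.\<close>

definition xor3 :: "'a set \<Rightarrow> 'a set \<Rightarrow> 'a set \<Rightarrow> 'a set" where
  "xor3 A B u = {a. (a \<in> A) \<noteq> ((a \<in> B) \<noteq> (a \<in> u))}"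

text \<open>For \<open>a \<in> u\<close> the exact factor is smaller than the one stated, by \<open>(1 - y a) * (1 - z a)\<^sup>2\<close>.\<close>

lemma sum_Pow_xor3_le:
  fixes y z :: "'a \<Rightarrow> real"
  assumes "finite G" "\<And>a. z a \<ge> 0" "\<And>a. 0 \<le> y a" "\<And>a. y a \<le> 1"
  shows "(\<Sum>A\<in>Pow G. \<Sum>B\<in>Pow G. (\<Prod>a\<in>A. z a) * (\<Prod>a\<in>B. z a) * (\<Prod>a\<in>xor3 A B u \<inter> G. y a))
    \<le> (\<Prod>a\<in>G. (1 + z a)\<^sup>2 - 2 * z a * (1 - y a))"
  using assms(1)
proof (induction G)
  case (insert b G)
  define T where "T A B = (\<Prod>a\<in>A. z a) * (\<Prod>a\<in>B. z a) * (\<Prod>a\<in>xor3 A B u \<inter> G. y a)" for A B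
  define T' where "T' A B = (\<Prod>a\<in>A. z a) * (\<Prod>a\<in>B. z a) * (\<Prod>a\<in>xor3 A B u \<inter> insert b G. y a)" for A B
  define c0 where "c0 = (if b \<in> u then y b else 1)"
  define c1 where "c1 = (if b \<in> u then 1 else y b)"
  have T': "T' A B = c0 * T A B" "T' (insert b A) B = z b * c1 * T A B"
     "T' A (insert b B) = z b * c1 * T A B" "T' (insert b A) (insert b B) = (z b)\<^sup>2 * c0 * T A B"
     if AB: "A \<subseteq> G" "B \<subseteq> G" for A B
  proof -
    have fin: "finite A" "finite B" and b: "b \<notin> A" "b \<notin> B" using AB insert.hyps finite_subset by auto
    have x: "(\<Prod>a\<in>X \<inter> insert b G. y a) = (if b \<in> X then y b else 1) * (\<Prod>a\<in>X \<inter> G. y a)" for X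
      using insert.hyps by (auto simp: Int_insert_right)
    have G: "xor3 (insert b A) B u \<inter> G = xor3 A B u \<inter> G" "xor3 A (insert b B) u \<inter> G = xor3 A B u \<inter> G"
      "xor3 (insert b A) (insert b B) u \<inter> G = xor3 A B u \<inter> G"
      using insert.hyps by (auto simp: xor3_def)
    have m: "b \<in> xor3 A B u \<longleftrightarrow> b \<in> u" "b \<in> xor3 (insert b A) B u \<longleftrightarrow> b \<notin> u"
       "b \<in> xor3 A (insert b B) u \<longleftrightarrow> b \<notin> u" "b \<in> xor3 (insert b A) (insert b B) u \<longleftrightarrow> b \<in> u"
      using b by (auto simp: xor3_def)
    show "T' A B = c0 * T A B" "T' (insert b A) B = z b * c1 * T A B"
     "T' A (insert b B) = z b * c1 * T A B" "T' (insert b A) (insert b B) = (z b)\<^sup>2 * c0 * T A B"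
      unfolding T'_def T_def x G m c0_def c1_def using fin b by (simp_all add: power2_eq_square)
  qed
  have T0: "T A B \<ge> 0" for A B unfolding T_def using assms by (intro mult_nonneg_nonneg prod_nonneg) auto
  have "(\<Sum>A\<in>Pow (insert b G). \<Sum>B\<in>Pow (insert b G). T' A B)
     = (\<Sum>A\<in>Pow G. \<Sum>B\<in>Pow G. T' A B + T' A (insert b B) + (T' (insert b A) B + T' (insert b A) (insert b B)))"
    by (simp only: sum_Pow_insert[OF insert.hyps(1,2)] sum.distrib)
  also have "\<dots> = (\<Sum>A\<in>Pow G. \<Sum>B\<in>Pow G. (c0 + 2 * z b * c1 + (z b)\<^sup>2 * c0) * T A B)"
    by (intro sum.cong refl) (simp add: T' algebra_simps)
  also have "\<dots> = (c0 + 2 * z b * c1 + (z b)\<^sup>2 * c0) * (\<Sum>A\<in>Pow G. \<Sum>B\<in>Pow G. T A B)"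
    by (simp add: sum_distrib_left)
  also have "\<dots> \<le> ((1 + z b)\<^sup>2 - 2 * z b * (1 - y b)) * (\<Sum>A\<in>Pow G. \<Sum>B\<in>Pow G. T A B)"
  proof (intro mult_right_mono)
    have "(1 - y b) * (1 - z b)\<^sup>2 \<ge> 0" using assms by simp
    then show "c0 + 2 * z b * c1 + (z b)\<^sup>2 * c0 \<le> (1 + z b)\<^sup>2 - 2 * z b * (1 - y b)"
      by (auto simp: c0_def c1_def power2_eq_square algebra_simps)
  qed (auto intro!: sum_nonneg T0)
  also have "\<dots> \<le> ((1 + z b)\<^sup>2 - 2 * z b * (1 - y b)) * (\<Prod>a\<in>G. (1 + z a)\<^sup>2 - 2 * z a * (1 - y a))"
  proof (intro mult_left_mono)
    show "(\<Sum>A\<in>Pow G. \<Sum>B\<in>Pow G. T A B) \<le> (\<Prod>a\<in>G. (1 + z a)\<^sup>2 - 2 * z a * (1 - y a))"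
      using insert.IH by (simp add: T_def)
    have "(1 + z b)\<^sup>2 - 2 * z b * (1 - y b) = 1 + z b * z b + 2 * (z b * y b)" by (simp add: power2_eq_square algebra_simps)
    then show "0 \<le> (1 + z b)\<^sup>2 - 2 * z b * (1 - y b)" using assms by simp
  qed
  finally show ?case using insert.hyps by (simp add: T'_def)
qed (simp add: xor3_def)

text \<open>Rankin's trick for pairs: \<open>\<theta>\<close> penalises the weights of
  \<open>A\<close> and \<open>B\<close>, \<open>\<eta>\<close> that of the third set. To first order
  in \<open>\<eta>\<close> the last factor is \<open>exp (- \<eta> * W)\<close> with
  \<open>W\<close> the mean weight of the symmetric difference of two tilted sets, so there is a
  gain as soon as \<open>W\<close> exceeds \<open>N\<close>.\<close>

lemma card_xor3_le:
  assumes "0 \<le> \<eta>" "0 \<le> \<theta>" "N \<le> L"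
  shows "real (card {(A, B). A \<in> Qs N \<and> B \<in> Qs N \<and> xor3 A B u \<in> (Qs N :: ('n::finite \<times> nat) set set)})
    \<le> exp (\<eta> * real N) * (exp (\<theta> * real N) * pfun TYPE('n) L \<theta>)\<^sup>2 *
       exp (- (\<Sum>a\<in>(grid L :: ('n \<times> nat) set). 2 * occ \<theta> (snd a) * (1 - occ \<theta> (snd a)) * (1 - exp (- \<eta> * real (snd a)))))"
proof -
  define G where "G = (grid L :: ('n \<times> nat) set)"
  have fG: "finite G" by (simp add: G_def)
  define z where "z a = exp (- \<theta> * real (snd a))" for a :: "'n \<times> nat"
  define y where "y a = exp (- \<eta> * real (snd a))" for a :: "'n \<times> nat"
  define S where "S = {(A, B). A \<in> Qs N \<and> B \<in> Qs N \<and> xor3 A B u \<in> (Qs N :: ('n \<times> nat) set set)}"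
  have SP: "S \<subseteq> Pow G \<times> Pow G" unfolding S_def G_def Qs_eq[OF assms(3)] by auto
  have zy: "z a > 0" "0 \<le> y a" "y a \<le> 1" for a using assms by (auto simp: z_def y_def)
  have zw: "(\<Prod>a\<in>A. z a) = exp (- \<theta> * real (wt A))" if "A \<subseteq> G" for A
    unfolding wt_exp z_def using that fG by (intro exp_sum[symmetric]) (auto intro: finite_subset)
  have yw: "(\<Prod>a\<in>A. y a) = exp (- \<eta> * real (wt A))" if "A \<subseteq> G" for A
    unfolding wt_exp y_def using that fG by (intro exp_sum[symmetric]) (auto intro: finite_subset)
  define T where "T A B = (\<Prod>a\<in>A. z a) * (\<Prod>a\<in>B. z a) * (\<Prod>a\<in>xor3 A B u \<inter> G. y a)" for A B
  have T0: "T A B \<ge> 0" for A B unfolding T_def using zy by (intro mult_nonneg_nonneg prod_nonneg) (auto intro: less_imp_le)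
  define E where "E = exp (\<eta> * real N) * (exp (\<theta> * real N))\<^sup>2"
  have "real (card S) = (\<Sum>(A, B)\<in>S. 1)" by simp
  also have "\<dots> \<le> (\<Sum>(A, B)\<in>S. E * T A B)"
  proof (intro sum_mono, clarify)
    fix A B assume AB: "(A, B) \<in> S"
    have sub: "A \<subseteq> G" "B \<subseteq> G" "xor3 A B u \<subseteq> G"
      using AB unfolding S_def G_def Qs_eq[OF assms(3)] by auto
    then have i: "xor3 A B u \<inter> G = xor3 A B u" by auto
    have w: "real (wt A) \<le> real N" "real (wt B) \<le> real N" "real (wt (xor3 A B u)) \<le> real N"
      using AB by (auto simp: S_def Qs_def)
    have "1 \<le> exp (\<theta> * (real N - real (wt A)) + \<theta> * (real N - real (wt B)) + \<eta> * (real N - real (wt (xor3 A B u))))"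
      using w assms by (intro one_le_exp_iff[THEN iffD2] add_nonneg_nonneg mult_nonneg_nonneg) auto
    also have "\<dots> = E * T A B"
      unfolding E_def T_def i zw[OF sub(1)] zw[OF sub(2)] yw[OF sub(3)]
      by (simp add: exp_add[symmetric] power2_eq_square algebra_simps)
    finally show "1 \<le> E * T A B" .
  qed
  also have "\<dots> \<le> (\<Sum>(A, B)\<in>Pow G \<times> Pow G. E * T A B)"
    using SP fG by (intro sum_mono2) (auto simp: E_def T0)
  also have "\<dots> = E * (\<Sum>A\<in>Pow G. \<Sum>B\<in>Pow G. T A B)"
    by (simp add: sum.cartesian_product[symmetric] sum_distrib_left)
  also have "\<dots> \<le> E * (\<Prod>a\<in>G. (1 + z a)\<^sup>2 - 2 * z a * (1 - y a))"
    unfolding T_def using zy by (intro mult_left_mono sum_Pow_xor3_le fG) (auto simp: E_def intro: less_imp_le)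
  also have "\<dots> \<le> E * (\<Prod>a\<in>G. (1 + z a)\<^sup>2 * exp (- (2 * occ \<theta> (snd a) * (1 - occ \<theta> (snd a)) * (1 - y a))))"
  proof (intro mult_left_mono prod_mono conjI)
    fix a :: "'n \<times> nat"
    define p where "p = occ \<theta> (snd a)"
    have p: "p = z a / (1 + z a)" by (simp add: p_def z_def occ_alt)
    have z1: "1 + z a > 0" using zy(1)[of a] by simp
    have "(1 + z a)\<^sup>2 - 2 * z a * (1 - y a) = 1 + z a * z a + 2 * (z a * y a)" by (simp add: power2_eq_square algebra_simps)
    then show "0 \<le> (1 + z a)\<^sup>2 - 2 * z a * (1 - y a)" using zy[of a] by simp
    have "1 - p = 1 / (1 + z a)" using z1 by (simp add: p field_simps)
    then have e: "(1 + z a)\<^sup>2 * (2 * p * (1 - p)) = 2 * z a" using z1 by (simp add: p power2_eq_square)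
    have "(1 + z a)\<^sup>2 - 2 * z a * (1 - y a) = (1 + z a)\<^sup>2 * (1 + - (2 * p * (1 - p) * (1 - y a)))"
      unfolding e[symmetric] by (simp add: algebra_simps)
    also have "\<dots> \<le> (1 + z a)\<^sup>2 * exp (- (2 * p * (1 - p) * (1 - y a)))"
      by (intro mult_left_mono exp_ge_add_one_self) auto
    finally show "(1 + z a)\<^sup>2 - 2 * z a * (1 - y a) \<le> (1 + z a)\<^sup>2 * exp (- (2 * occ \<theta> (snd a) * (1 - occ \<theta> (snd a)) * (1 - y a)))"
      by (simp add: p_def)
  qed (auto simp: E_def)
  also have "(\<Prod>a\<in>G. (1 + z a)\<^sup>2 * exp (- (2 * occ \<theta> (snd a) * (1 - occ \<theta> (snd a)) * (1 - y a))))
     = (pfun TYPE('n) L \<theta>)\<^sup>2 * exp (- (\<Sum>a\<in>G. 2 * occ \<theta> (snd a) * (1 - occ \<theta> (snd a)) * (1 - y a)))"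
    by (simp add: prod.distrib prod_power_distrib pfun_def G_def z_def exp_sum sum_negf[symmetric])
  finally show ?thesis by (simp add: S_def E_def G_def y_def power_mult_distrib mult_ac)
qed

text \<open>With \<open>p = occ \<theta> l\<close> the summand is
  \<open>l * (2 * p * (1 - p) - p)\<close>, the excess of the mean weight of a symmetric difference
  over that of a single set. The levels between \<open>1 / \<theta>\<close> and
  \<open>2 / \<theta>\<close>, where \<open>1/9 \<le> p \<le> 1/3\<close>, already give order
  \<open>N\<close>.\<close>

lemma occ_excess_sum:
  assumes N: "N \<ge> 10" and \<theta>: "1 / (6 * sqrt N) \<le> \<theta>" "\<theta> \<le> b / sqrt N" "b > 0" "2 * b \<le> sqrt N"
  shows "(\<Sum>l=1..4*N. real l * (occ \<theta> l * (1 - 2 * occ \<theta> l))) \<ge> real N / (54 * b\<^sup>2)"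
proof -
  have sqN: "sqrt N > 0" "sqrt N * sqrt N = N" using N by auto
  have sq3: "sqrt N \<ge> 3" using N by (intro real_le_rsqrt) auto
  have \<theta>0: "\<theta> > 0" using \<theta>(1) sqN by (auto intro: less_le_trans[rotated])
  have i\<theta>: "1 / \<theta> \<le> 6 * sqrt N" using \<theta>(1) \<theta>0 sqN by (simp add: field_simps)
  have ge: "sqrt N / b \<le> 1 / \<theta>" using \<theta> \<theta>0 sqN by (simp add: field_simps)
  have "2 \<le> sqrt N / b" using \<theta> by (simp add: field_simps)
  with ge have ge2: "2 \<le> 1 / \<theta>" by simp
  define K where "K = nat \<lceil>1 / \<theta>\<rceil>"
  define K' where "K' = nat \<lfloor>2 / \<theta>\<rfloor>"
  have K: "real K \<ge> 1 / \<theta>" "real K \<le> 1 / \<theta> + 1" using \<theta>0 by (auto simp: K_def of_nat_nat)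
  have K': "real K' \<le> 2 / \<theta>" "real K' + 1 \<ge> 2 / \<theta>" using \<theta>0 by (auto simp: K'_def of_nat_nat)
  have "3 * sqrt N \<le> sqrt N * sqrt N" using sq3 by (intro mult_right_mono) auto
  then have K4: "K' \<le> 4 * N" using K'(1) sqN i\<theta> by linarith
  have K1: "K \<ge> 1" using K ge2 by linarith
  have cnt: "real (card {K..K'}) \<ge> 1 / (2 * \<theta>)"
  proof -
    have "real K' + 1 - real K \<ge> 1 / \<theta> - 1" using K K' by (simp add: field_simps)
    moreover have "1 / \<theta> - 1 \<ge> 1 / (2 * \<theta>)" using ge2 \<theta>0 by (simp add: field_simps)
    ultimately have "real K' + 1 - real K \<ge> 1 / (2 * \<theta>)" by simp
    then show ?thesis by simp
  qed
  have each: "real l * (occ \<theta> l * (1 - 2 * occ \<theta> l)) \<ge> 1 / (27 * \<theta>)" if "l \<in> {K..K'}" for l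
  proof -
    have l: "1 / \<theta> \<le> real l" "real l \<le> 2 / \<theta>" using that K K' by auto
    then have tl: "1 \<le> \<theta> * real l" "\<theta> * real l \<le> 2" using \<theta>0 by (auto simp: field_simps)
    have "exp (\<theta> * real l) \<ge> 2" using tl(1) exp_ge_add_one_self[of "\<theta> * real l"] by linarith
    then have o1: "occ \<theta> l \<le> 1 / 3" unfolding occ_def by (intro divide_left_mono) (auto simp: add_pos_pos)
    have "exp (\<theta> * real l) \<le> exp (1 + 1)" using tl by simp
    also have "\<dots> = exp 1 * exp (1::real)" by (simp only: exp_add)
    also have "\<dots> \<le> 14 / 5 * (14 / 5)" using e_less_272 by (intro mult_mono) auto
    finally have "exp (\<theta> * real l) \<le> 8" by linarith
    then have o2: "occ \<theta> l \<ge> 1 / 9" unfolding occ_def by (intro divide_left_mono) (auto simp: add_pos_pos)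
    have "1 / (27 * \<theta>) = (1 / \<theta>) * (1 / 9 * (1 / 3))" by simp
    also have "\<dots> \<le> real l * (occ \<theta> l * (1 - 2 * occ \<theta> l))"
      using l o1 o2 \<theta>0 by (intro mult_mono mult_nonneg_nonneg) auto
    finally show ?thesis .
  qed
  have nn: "0 \<le> real l * (occ \<theta> l * (1 - 2 * occ \<theta> l))" for l
  proof -
    have "exp (\<theta> * real l) \<ge> 1" using \<theta>0 by simp
    then have "occ \<theta> l \<le> 1 / 2" unfolding occ_def by (intro divide_left_mono) (auto simp: add_pos_pos)
    then show ?thesis using occ_pos[of \<theta> l] by (intro mult_nonneg_nonneg) auto
  qed
  have "sqrt N / b * (sqrt N / b) \<le> 1 / \<theta> * (1 / \<theta>)" using ge sqN \<theta> \<theta>0 by (intro mult_mono) auto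
  then have "real N / (54 * b\<^sup>2) \<le> 1 / (2 * \<theta>) * (1 / (27 * \<theta>))"
    using sqN by (simp add: power2_eq_square)
  also have "\<dots> \<le> real (card {K..K'}) * (1 / (27 * \<theta>))" using cnt \<theta>0 by (intro mult_right_mono) auto
  also have "\<dots> = (\<Sum>l\<in>{K..K'}. 1 / (27 * \<theta>))" by simp
  also have "\<dots> \<le> (\<Sum>l\<in>{K..K'}. real l * (occ \<theta> l * (1 - 2 * occ \<theta> l)))" by (intro sum_mono each)
  also have "\<dots> \<le> (\<Sum>l=1..4*N. real l * (occ \<theta> l * (1 - 2 * occ \<theta> l)))"
    using K4 K1 by (intro sum_mono2 nn) auto
  finally show ?thesis .
qed

text \<open>The symmetric difference of two independent tilted sets occupies a cell with probability
  \<open>2 p (1 - p) > p\<close>, so its expected weight exceeds \<open>N\<close> by a constant factor; adding a fixed set \<open>u\<close> can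
  only increase the occupation probabilities.\<close>

lemma xor3_rare:
  "\<exists>c>0. \<forall>\<^sub>F N in sequentially. \<forall>u.
    real (card {(A, B). A \<in> Qs N \<and> B \<in> Qs N \<and> xor3 A B u \<in> (Qs N :: ('n::finite \<times> nat) set set)})
    \<le> (real (card (Qs N :: ('n \<times> nat) set set)))\<^sup>2 * exp (- c * sqrt N)"
proof -
  define s where "s = real CARD('n)"
  have s: "s \<ge> 1" by (simp add: s_def Suc_leI)
  obtain C where C: "C > 0" and tilt: "\<forall>\<^sub>F N in sequentially. \<exists>\<theta>. 1 / (6 * sqrt N) \<le> \<theta> \<and> \<theta> \<le> 3 * s / sqrt N \<and>
     exp (\<theta> * real N) * pfun TYPE('n) (4 * N) \<theta> \<le> real (card (Qs N :: ('n \<times> nat) set set)) * exp (C * real N powr (1/4)) \<and>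
     real N - C * real N powr (3/4) \<le> (\<Sum>b\<in>(grid (4 * N) :: ('n \<times> nat) set). real (snd b) * occ \<theta> (snd b))"
    using tilt_exists[where 'n='n] unfolding s_def by blast
  \<comment> \<open>\<open>c0\<close> is the relative excess from \<open>occ_excess_sum\<close> with
    \<open>b = 3 * s\<close>, summed over the \<open>s\<close> coordinates:
    \<open>s / (54 * 9 * s^2)\<close>. With \<open>\<eta> = \<epsilon> / sqrt N\<close> the gain is
    \<open>\<epsilon> * c0 * sqrt N\<close>; \<open>\<epsilon>\<close> makes the second-order loss
    half of it, and \<open>c\<close> keeps a quarter, the rest absorbing the terms of order
    \<open>N powr (1/4)\<close>.\<close>
  define c0 where "c0 = 1 / (486 * s)"
  define \<epsilon> where "\<epsilon> = c0 / (2 * 6912 * s)"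
  define c where "c = \<epsilon> * c0 / 4"
  have pos: "c0 > 0" "\<epsilon> > 0" "c > 0" using s by (auto simp: c0_def \<epsilon>_def c_def)
  have ev1: "\<forall>\<^sub>F N in sequentially. 2 * (3 * s) \<le> sqrt (real N)" by real_asymp
  have ev2: "\<forall>\<^sub>F N in sequentially. 2 * C * real N powr (1/4) + \<epsilon> * C * real N powr (1/4) \<le> c * sqrt (real N)"
    using pos by real_asymp
  have "\<forall>\<^sub>F N in sequentially. \<forall>u.
    real (card {(A, B). A \<in> Qs N \<and> B \<in> Qs N \<and> xor3 A B u \<in> (Qs N :: ('n::finite \<times> nat) set set)})
    \<le> (real (card (Qs N :: ('n \<times> nat) set set)))\<^sup>2 * exp (- c * sqrt N)"
    using tilt ev1 ev2 eventually_ge_at_top[of 10]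
  proof eventually_elim
    case (elim N)
    then obtain \<theta> where \<theta>: "1 / (6 * sqrt N) \<le> \<theta>" "\<theta> \<le> 3 * s / sqrt N"
     "exp (\<theta> * real N) * pfun TYPE('n) (4 * N) \<theta> \<le> real (card (Qs N :: ('n \<times> nat) set set)) * exp (C * real N powr (1/4))"
     "real N - C * real N powr (3/4) \<le> (\<Sum>b\<in>(grid (4 * N) :: ('n \<times> nat) set). real (snd b) * occ \<theta> (snd b))" by blast
    have sqN: "sqrt N > 0" "sqrt N * sqrt N = N" using elim(4) by auto
    have \<theta>0: "\<theta> > 0" using \<theta>(1) sqN by (auto intro: less_le_trans[rotated])
    define \<eta> where "\<eta> = \<epsilon> / sqrt N"
    have \<eta>: "\<eta> > 0" using pos sqN by (simp add: \<eta>_def)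
    let ?G = "grid (4 * N) :: ('n \<times> nat) set"
    define X where "X = (\<Sum>a\<in>?G. 2 * occ \<theta> (snd a) * (1 - occ \<theta> (snd a)) * (1 - exp (- \<eta> * real (snd a))))"
    have excess: "real N / (54 * (3 * s)\<^sup>2) \<le> (\<Sum>l=1..4*N. real l * (occ \<theta> l * (1 - 2 * occ \<theta> l)))"
      using elim \<theta> s by (intro occ_excess_sum) auto
    have sq: "(\<Sum>l=1..4*N. (real l)\<^sup>2 * exp (- \<theta> * real l)) \<le> 3456 * (real N * sqrt N)"
    proof -
      have "(\<Sum>l=1..4*N. (real l)\<^sup>2 * exp (- \<theta> * real l)) \<le> 16 / \<theta> ^ 3" by (rule sum_sq_exp_neg_le) fact
      also have "16 / \<theta> ^ 3 \<le> 16 / (1 / (6 * sqrt N)) ^ 3"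
        using \<theta>(1) \<theta>0 sqN by (intro divide_left_mono power_mono mult_pos_pos) auto
      also have "\<dots> = 3456 * (real N * sqrt N)"
        using sqN by (simp add: power_divide power_mult_distrib power3_eq_cube)
      finally show ?thesis .
    qed
    have "\<eta> * (real N + c0 * real N - C * real N powr (3/4)) - \<eta>\<^sup>2 * (6912 * s * (real N * sqrt N)) \<le> X"
    proof -
      have "\<eta> * (real N + c0 * real N - C * real N powr (3/4))
         \<le> \<eta> * ((\<Sum>b\<in>?G. real (snd b) * occ \<theta> (snd b)) + s * (\<Sum>l=1..4*N. real l * (occ \<theta> l * (1 - 2 * occ \<theta> l))))"
      proof (intro mult_left_mono)
        have "c0 * real N = s * (real N / (54 * (3 * s)\<^sup>2))" using s by (simp add: c0_def power2_eq_square)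
        also have "\<dots> \<le> s * (\<Sum>l=1..4*N. real l * (occ \<theta> l * (1 - 2 * occ \<theta> l)))"
          using excess s by (intro mult_left_mono) auto
        finally show "real N + c0 * real N - C * real N powr (3/4) \<le> (\<Sum>b\<in>?G. real (snd b) * occ \<theta> (snd b)) + s * (\<Sum>l=1..4*N. real l * (occ \<theta> l * (1 - 2 * occ \<theta> l)))"
          using \<theta>(4) by linarith
      qed (use \<eta> in auto)
      also have "\<dots> = \<eta> * (\<Sum>b\<in>?G. real (snd b) * (2 * occ \<theta> (snd b) * (1 - occ \<theta> (snd b))))"
        unfolding s_def sum_grid[of "\<lambda>l. real l * (occ \<theta> l * (1 - 2 * occ \<theta> l))", symmetric] sum.distrib[symmetric]
        by (intro arg_cong[where f="(*) \<eta>"] sum.cong) (auto simp: algebra_simps)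
      finally have A: "\<eta> * (real N + c0 * real N - C * real N powr (3/4)) \<le> \<eta> * (\<Sum>b\<in>?G. real (snd b) * (2 * occ \<theta> (snd b) * (1 - occ \<theta> (snd b))))" .
      have "\<eta>\<^sup>2 * (6912 * s * (real N * sqrt N)) \<ge> \<eta>\<^sup>2 * (2 * (s * (\<Sum>l=1..4*N. (real l)\<^sup>2 * exp (- \<theta> * real l))))"
        using sq s by (intro mult_left_mono) (auto simp: mult_ac)
      also have "\<eta>\<^sup>2 * (2 * (s * (\<Sum>l=1..4*N. (real l)\<^sup>2 * exp (- \<theta> * real l)))) = (\<Sum>b\<in>?G. \<eta>\<^sup>2 * (2 * ((real (snd b))\<^sup>2 * exp (- \<theta> * real (snd b)))))"
        unfolding s_def sum_grid[of "\<lambda>l. (real l)\<^sup>2 * exp (- \<theta> * real l)", symmetric] by (simp add: sum_distrib_left)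
      finally have B: "(\<Sum>b\<in>?G. \<eta>\<^sup>2 * (2 * ((real (snd b))\<^sup>2 * exp (- \<theta> * real (snd b))))) \<le> \<eta>\<^sup>2 * (6912 * s * (real N * sqrt N))" .
      have "(\<Sum>b\<in>?G. \<eta> * (real (snd b) * (2 * occ \<theta> (snd b) * (1 - occ \<theta> (snd b)))) - \<eta>\<^sup>2 * (2 * ((real (snd b))\<^sup>2 * exp (- \<theta> * real (snd b))))) \<le> X"
        unfolding X_def
      proof (intro sum_mono)
        fix b :: "'n \<times> nat"
        define p where "p = 2 * occ \<theta> (snd b) * (1 - occ \<theta> (snd b))"
        define y where "y = \<eta> * real (snd b)"
        have y: "y \<ge> 0" using \<eta> by (simp add: y_def)
        have p0: "p \<ge> 0" using occ_pos[of \<theta> "snd b"] occ_lt_1[of \<theta> "snd b"] by (simp add: p_def)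
        have "p \<le> 2 * occ \<theta> (snd b) * 1"
          unfolding p_def using occ_pos[of \<theta> "snd b"] by (intro mult_left_mono) auto
        then have p1: "p \<le> 2 * exp (- \<theta> * real (snd b))" using occ_le_exp[of \<theta> "snd b"] by linarith
        have "y * p - y\<^sup>2 * (2 * exp (- \<theta> * real (snd b))) \<le> y * p - y\<^sup>2 * p"
          using p1 by (simp add: mult_left_mono)
        also have "\<dots> = p * (y - y\<^sup>2)" by (simp add: algebra_simps)
        also have "\<dots> \<le> p * (1 - exp (- y))" using exp_neg_le_quadratic[OF y] p0 by (intro mult_left_mono) auto
        finally show "\<eta> * (real (snd b) * (2 * occ \<theta> (snd b) * (1 - occ \<theta> (snd b)))) - \<eta>\<^sup>2 * (2 * ((real (snd b))\<^sup>2 * exp (- \<theta> * real (snd b))))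
          \<le> 2 * occ \<theta> (snd b) * (1 - occ \<theta> (snd b)) * (1 - exp (- \<eta> * real (snd b)))"
          unfolding y_def p_def[symmetric] by (simp add: power_mult_distrib mult_ac)
      qed
      then show ?thesis using A B by (simp add: sum_subtractf sum_distrib_left)
    qed
    then have "\<eta> * real N - X \<le> - (\<eta> * c0 * real N) + \<eta> * C * real N powr (3/4) + \<eta>\<^sup>2 * (6912 * s * (real N * sqrt N))"
      by (simp add: algebra_simps)
    also have "\<eta>\<^sup>2 * (6912 * s * (real N * sqrt N)) = (\<epsilon> * c0 / 2) * sqrt N"
    proof -
      have "\<eta>\<^sup>2 * real N = \<epsilon>\<^sup>2" using sqN by (simp add: \<eta>_def power2_eq_square)
      moreover have "\<epsilon> * (6912 * s) = c0 / 2" using s by (simp add: \<epsilon>_def)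
      ultimately have "\<eta>\<^sup>2 * real N * (6912 * s) = \<epsilon> * c0 / 2" by (simp add: power2_eq_square)
      then show ?thesis by (simp add: mult_ac)
    qed
    also have "\<eta> * c0 * real N = \<epsilon> * c0 * sqrt N" using sqN by (simp add: \<eta>_def field_simps)
    also have "\<eta> * C * real N powr (3/4) = \<epsilon> * C * real N powr (1/4)"
    proof -
      have "real N powr (3/4) = real N powr (1/4) * sqrt N"
        using elim(4) by (simp add: powr_half_sqrt[symmetric] powr_add[symmetric])
      then show ?thesis using sqN by (simp add: \<eta>_def)
    qed
    finally have ex: "\<eta> * real N - X + 2 * (C * real N powr (1/4)) \<le> - c * sqrt N"
      using elim(3) by (simp add: c_def algebra_simps)
    show ?case
    proof
      fix u :: "('n \<times> nat) set"
      have "real (card {(A, B). A \<in> Qs N \<and> B \<in> Qs N \<and> xor3 A B u \<in> (Qs N :: ('n::finite \<times> nat) set set)})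
         \<le> exp (\<eta> * real N) * (exp (\<theta> * real N) * pfun TYPE('n) (4 * N) \<theta>)\<^sup>2 * exp (- X)"
        unfolding X_def using \<eta> \<theta>0 by (intro card_xor3_le) auto
      also have "\<dots> \<le> exp (\<eta> * real N) * (real (card (Qs N :: ('n \<times> nat) set set)) * exp (C * real N powr (1/4)))\<^sup>2 * exp (- X)"
        using \<theta>(3) pfun_pos[of "4*N" \<theta>, where 'n='n] by (intro mult_right_mono mult_left_mono power_mono) (auto intro!: mult_nonneg_nonneg simp: less_imp_le)
      also have "\<dots> = (real (card (Qs N :: ('n \<times> nat) set set)))\<^sup>2 * exp (\<eta> * real N - X + 2 * (C * real N powr (1/4)))"
        by (simp add: power_mult_distrib exp_add exp_diff exp_minus power2_eq_square field_simps)
          (simp add: exp_add[symmetric])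
      also have "\<dots> \<le> (real (card (Qs N :: ('n \<times> nat) set set)))\<^sup>2 * exp (- c * sqrt N)"
        using ex by (intro mult_left_mono) auto
      finally show "real (card {(A, B). A \<in> Qs N \<and> B \<in> Qs N \<and> xor3 A B u \<in> (Qs N :: ('n::finite \<times> nat) set set)})
        \<le> (real (card (Qs N :: ('n \<times> nat) set set)))\<^sup>2 * exp (- c * sqrt N)" .
    qed
  qed
  with pos show ?thesis by blast
qed

section \<open>Typical sizes of digit sets and growth of the counting function\<close>

lemma fibre_card_le: "finite A \<Longrightarrow> fibre_card j A \<le> card A"
proof -
  assume "finite A"
  have "fibre_card j A = card (Pair j ` {l. (j, l) \<in> A})"
    unfolding fibre_card_def by (intro card_image[symmetric]) (auto simp: inj_on_def)
  also have "\<dots> \<le> card A" using \<open>finite A\<close> by (intro card_mono) auto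
  finally show ?thesis .
qed

lemma few_elements_rare:
  "\<forall>\<^sub>F N in sequentially. real (card {A \<in> (Qs N :: ('n::finite \<times> nat) set set). real (card A) \<le> sqrt N / (48 * real CARD('n))})
     \<le> real (card (Qs N :: ('n \<times> nat) set set)) / sqrt N"
proof -
  define s where "s = real CARD('n)"
  have s: "s \<ge> 1" by (simp add: s_def Suc_leI)
  obtain C where C: "C > 0" and tilt: "\<forall>\<^sub>F N in sequentially. \<exists>\<theta>. 1 / (6 * sqrt N) \<le> \<theta> \<and> \<theta> \<le> 3 * s / sqrt N \<and>
     exp (\<theta> * real N) * pfun TYPE('n) (4 * N) \<theta> \<le> real (card (Qs N :: ('n \<times> nat) set set)) * exp (C * real N powr (1/4)) \<and>
     real N - C * real N powr (3/4) \<le> (\<Sum>b\<in>(grid (4 * N) :: ('n \<times> nat) set). real (snd b) * occ \<theta> (snd b))"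
    using tilt_exists[where 'n='n] unfolding s_def by blast
  \<comment> \<open>With \<open>\<eta> = 1 / (600 * s)\<close> the Chernoff loss
    \<open>\<eta>^2 * v\<close> is at most \<open>c * sqrt N\<close>, while the gain
    \<open>\<eta> * t\<close> exceeds twice that; \<open>t\<close> is half of the lower bound for
    the mean \<open>v\<close>.\<close>
  define c where "c = 1 / (60000 * s\<^sup>2)"
  have c: "c > 0" using s by (simp add: c_def)
  have ev1: "\<forall>\<^sub>F N in sequentially. 2 * (3 * s) \<le> sqrt (real N)" by real_asymp
  have ev2: "\<forall>\<^sub>F N in sequentially. exp (C * real N powr (1/4) - c * sqrt (real N)) \<le> 1 / sqrt (real N)"
    using c by real_asymp
  show ?thesis
    using tilt ev1 ev2 eventually_ge_at_top[of 10]
  proof eventually_elim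
    case (elim N)
    then obtain \<theta> where \<theta>: "1 / (6 * sqrt N) \<le> \<theta>" "\<theta> \<le> 3 * s / sqrt N"
     "exp (\<theta> * real N) * pfun TYPE('n) (4 * N) \<theta> \<le> real (card (Qs N :: ('n \<times> nat) set set)) * exp (C * real N powr (1/4))" by blast
    have sqN: "sqrt N > 0" "sqrt N * sqrt N = N" using elim(4) by auto
    have \<theta>0: "\<theta> > 0" using \<theta>(1) sqN by (auto intro: less_le_trans[rotated])
    define v where "v = (\<Sum>l=1..4*N. occ \<theta> l)"
    have v: "v \<le> 6 * sqrt N" "v \<ge> sqrt N / (8 * (3 * s))"
      unfolding v_def using elim(2,4) \<theta>(1,2) s occ_sum_bounds[of N \<theta> "3 * s"] by auto
    define t where "t = sqrt N / (48 * s)"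
    define \<eta> where "\<eta> = 1 / (600 * s)"
    have \<eta>: "0 \<le> \<eta>" "\<eta> \<le> 1" using s by (auto simp: \<eta>_def field_simps)
    \<comment> \<open>An arbitrary coordinate: a small set has a small fibre over each of
      them.\<close>
    let ?j = "undefined :: 'n"
    have "real (card {A \<in> (Qs N :: ('n::finite \<times> nat) set set). real (card A) \<le> sqrt N / (48 * s)})
       \<le> real (card {A \<in> Qs N. real (fibre_card ?j A) \<le> v - t})"
    proof (intro of_nat_mono card_mono subsetI)
      fix A assume A: "A \<in> {A \<in> (Qs N :: ('n::finite \<times> nat) set set). real (card A) \<le> sqrt N / (48 * s)}"
      have "real (fibre_card ?j A) \<le> real (card A)" using A fibre_card_le by (auto simp: Qs_def)
      also have "\<dots> \<le> sqrt N / (48 * s)" using A by simp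
      also have "\<dots> \<le> v - t" using v(2) s by (simp add: t_def field_simps)
      finally show "A \<in> {A \<in> Qs N. real (fibre_card ?j A) \<le> v - t}" using A by simp
    qed auto
    also have "\<dots> \<le> exp (\<theta> * real N) * pfun TYPE('n) (4 * N) \<theta> * exp (- \<eta> * t + \<eta>\<^sup>2 * v)"
      unfolding v_def using \<eta> \<theta>0 by (intro card_fibre_low) auto
    also have "\<dots> \<le> real (card (Qs N :: ('n \<times> nat) set set)) * exp (C * real N powr (1/4)) * exp (- c * sqrt N)"
    proof (rule mult_mono[OF \<theta>(3)])
      have "\<eta>\<^sup>2 * v \<le> \<eta>\<^sup>2 * (6 * sqrt N)" using v by (intro mult_left_mono) auto
      also have "\<dots> = c * sqrt N" using s by (simp add: \<eta>_def c_def power2_eq_square)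
      finally have "\<eta>\<^sup>2 * v \<le> c * sqrt N" .
      moreover have "\<eta> * t = 1 / (28800 * s\<^sup>2) * sqrt N" by (simp add: \<eta>_def t_def power2_eq_square)
      moreover have "1 / (28800 * s\<^sup>2) \<ge> 2 * c" using s by (simp add: c_def field_simps)
      then have "1 / (28800 * s\<^sup>2) * sqrt N \<ge> 2 * c * sqrt N" by (intro mult_right_mono) auto
      ultimately show "exp (- \<eta> * t + \<eta>\<^sup>2 * v) \<le> exp (- c * sqrt N)" by simp
    qed auto
    also have "\<dots> = real (card (Qs N :: ('n \<times> nat) set set)) * exp (C * real N powr (1/4) - c * sqrt N)"
      by (simp add: exp_diff exp_minus field_simps)
    also have "\<dots> \<le> real (card (Qs N :: ('n \<times> nat) set set)) * (1 / sqrt N)"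
      using elim(3) by (intro mult_left_mono) auto
    finally show ?case by (simp add: s_def)
  qed
qed

text \<open>Removing one element from a set of weight \<open>n + 1\<close> leaves a lighter set from which the removed
  level \<open>l\<close> can be read off as the missing weight; as most sets have about \<open>sqrt n\<close> elements, those of
  weight exactly \<open>n + 1\<close> form only a fraction of order \<open>1 / sqrt n\<close>.\<close>

lemma card_Qs_Suc_le:
  "\<exists>C>0. \<forall>\<^sub>F n in sequentially. real (card (Qs (Suc n) :: ('n::finite \<times> nat) set set)) \<le> real (card (Qs n :: ('n \<times> nat) set set)) * exp (C / sqrt (Suc n))"
proof -
  define s where "s = real CARD('n)"
  have s: "s \<ge> 1" by (simp add: s_def Suc_leI)
  define C where "C = 48 * s\<^sup>2 + 2"
  have "C > 0" by (simp add: C_def add_nonneg_pos)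
  have rare: "\<forall>\<^sub>F n in sequentially. real (card {A \<in> (Qs (Suc n) :: ('n::finite \<times> nat) set set). real (card A) \<le> sqrt (Suc n) / (48 * s)})
     \<le> real (card (Qs (Suc n) :: ('n \<times> nat) set set)) / sqrt (Suc n)"
    using few_elements_rare[where 'n='n] unfolding s_def by (rule eventually_sequentially_Suc[THEN iffD2])
  have "\<forall>\<^sub>F n in sequentially. real (card (Qs (Suc n) :: ('n::finite \<times> nat) set set)) \<le> real (card (Qs n :: ('n \<times> nat) set set)) * exp (C / sqrt (Suc n))"
    using rare eventually_ge_at_top[of 15]
  proof eventually_elim
    case (elim n)
    let ?Q' = "Qs (Suc n) :: ('n \<times> nat) set set" and ?Q = "Qs n :: ('n \<times> nat) set set"
    define y where "y = 1 / sqrt (Suc n)"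
    have "sqrt (Suc n) \<ge> 4" using elim by (intro real_le_rsqrt) auto
    then have y: "0 < y" "y \<le> 1 / 4" by (auto simp: y_def field_simps)
    define x where "x = sqrt (Suc n) / (48 * s)"
    have x: "x > 0" using s by (simp add: x_def)
    define D where "D = {A \<in> ?Q'. wt A = Suc n}"
    define D1 where "D1 = {A \<in> D. real (card A) > x}"
    define D2 where "D2 = {A \<in> ?Q'. real (card A) \<le> x}"
    have fin: "finite D" "finite D1" "finite D2" by (auto simp: D_def D1_def D2_def)
    have inj: "card (SIGMA A:D. A) \<le> card ((UNIV :: 'n set) \<times> ?Q)"
    proof (rule card_inj_on_le)
      have wt_rem: "wt A = snd a + wt (A - {a})" if "A \<in> D" "a \<in> A" for A a
        using that by (auto simp: wt_def D_def Qs_def sum.remove)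
      show "inj_on (\<lambda>(A, a). (fst a, A - {a})) (SIGMA A:D. A)"
      proof (intro inj_onI, clarsimp)
        fix A j l B i k
        assume h: "A \<in> D" "(j, l) \<in> A" "B \<in> D" "(j, k) \<in> B" "A - {(j, l)} = B - {(j, k)}"
        have "wt A = wt B" using h by (auto simp: D_def)
        with wt_rem[OF h(1,2)] wt_rem[OF h(3,4)] h(5) have "l = k" by simp
        with h show "A = B \<and> l = k" by blast
      qed
      show "(\<lambda>(A, a). (fst a, A - {a})) ` (SIGMA A:D. A) \<subseteq> UNIV \<times> ?Q"
      proof clarsimp
        fix A j l assume h: "A \<in> D" "(j, l) \<in> A"
        then have "l \<ge> 1" by (auto simp: D_def Qs_def)
        with wt_rem[OF h] h show "A - {(j, l)} \<in> ?Q" by (auto simp: D_def Qs_def)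
      qed
    qed simp
    \<comment> \<open>Double counting of the pairs of a set in \<open>D\<close> and one of its
      elements: each set in \<open>D1\<close> has more than \<open>x\<close> of them, and the
      injection bounds their number by \<open>s * card ?Q\<close>.\<close>
    have "x * real (card D1) = (\<Sum>A\<in>D1. x)" by simp
    also have "\<dots> \<le> (\<Sum>A\<in>D1. real (card A))" by (intro sum_mono) (auto simp: D1_def)
    also have "\<dots> \<le> (\<Sum>A\<in>D. real (card A))" using fin by (intro sum_mono2) (auto simp: D1_def)
    also have "\<dots> = real (card (SIGMA A:D. A))"
    proof -
      have "\<forall>A\<in>D. finite A" by (auto simp: D_def Qs_def)
      then show ?thesis using fin by (simp add: card_SigmaI)
    qed
    also have "\<dots> \<le> s * real (card ?Q)" using inj by (simp add: card_cartesian_product s_def flip: of_nat_mult)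
    finally have "real (card D1) \<le> 48 * s\<^sup>2 * y * real (card ?Q)"
      using s by (simp add: x_def y_def field_simps power2_eq_square)
    moreover have "real (card D2) \<le> real (card ?Q') * y" using elim(1) by (simp add: D2_def x_def y_def)
    moreover have "card ?Q' \<le> card ?Q + (card D1 + card D2)"
    proof -
      have "?Q' \<subseteq> ?Q \<union> (D1 \<union> D2)" by (auto simp: D1_def D2_def D_def Qs_def)
      then have "card ?Q' \<le> card (?Q \<union> (D1 \<union> D2))" using fin by (intro card_mono) auto
      also have "\<dots> \<le> card ?Q + (card D1 + card D2)"
        by (meson add_left_mono card_Un_le order_trans)
      finally show ?thesis .
    qed
    then have "real (card ?Q') \<le> real (card ?Q) + (real (card D1) + real (card D2))"
      by (metis of_nat_add of_nat_mono)
    ultimately have "real (card ?Q') * (1 - y) \<le> real (card ?Q) * (1 + 48 * s\<^sup>2 * y)"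
      by (simp add: algebra_simps)
    also have "\<dots> \<le> real (card ?Q) * exp (48 * s\<^sup>2 * y)" by (intro mult_left_mono exp_ge_add_one_self) auto
    finally have m: "real (card ?Q') * (1 - y) \<le> real (card ?Q) * exp (48 * s\<^sup>2 * y)" .
    \<comment> \<open>For \<open>y \<le> 1/4\<close> the bound
      \<open>exp (- (2 * y)) \<le> 1 - y\<close> turns the division by \<open>1 - y\<close> into a
      factor \<open>exp (2 * y)\<close>; this is the summand 2 in \<open>C\<close>.\<close>
    have "exp (- (2 * y)) \<le> 1 - 2 * y + (2 * y)\<^sup>2" using y by (intro exp_neg_le_quadratic) auto
    also have "\<dots> = 1 - y - y * (1 - 4 * y)" by (simp add: power2_eq_square algebra_simps)
    also have "\<dots> \<le> 1 - y" using y by simp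
    finally have "real (card ?Q') * exp (- (2 * y)) \<le> real (card ?Q') * (1 - y)" by (intro mult_left_mono) auto
    also note m
    finally have "real (card ?Q') * exp (- (2 * y)) * exp (2 * y) \<le> real (card ?Q) * exp (48 * s\<^sup>2 * y) * exp (2 * y)"
      by (intro mult_right_mono) auto
    then show ?case by (simp add: mult.assoc exp_add[symmetric] C_def y_def add_divide_distrib)
  qed
  with \<open>C > 0\<close> show ?thesis by blast
qed

text \<open>Raising the weight bound by order \<open>sqrt N\<close> thus costs a constant factor,
  and by order \<open>sqrt N * ln N\<close> a power of \<open>N\<close>; both ranges occur in the
  theorem.\<close>

lemma card_Qs_growth:
  "\<exists>C>0. \<forall>\<^sub>F N in sequentially. \<forall>h. real (card (Qs (N + h) :: ('n::finite \<times> nat) set set))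
     \<le> real (card (Qs N :: ('n \<times> nat) set set)) * exp (C * real h / sqrt N)"
proof -
  obtain C N0 where C: "C > 0" and step: "\<And>n. n \<ge> N0 \<Longrightarrow> real (card (Qs (Suc n) :: ('n \<times> nat) set set)) \<le> real (card (Qs n :: ('n \<times> nat) set set)) * exp (C / sqrt (Suc n))"
    using card_Qs_Suc_le[where 'n='n] unfolding eventually_sequentially by blast
  have "real (card (Qs (N + h) :: ('n::finite \<times> nat) set set))
     \<le> real (card (Qs N :: ('n \<times> nat) set set)) * exp (C * real h / sqrt N)" if "N \<ge> max N0 1" for N h
  proof (induction h)
    case (Suc h)
    have "real (card (Qs (N + Suc h) :: ('n \<times> nat) set set)) \<le> real (card (Qs (N + h) :: ('n \<times> nat) set set)) * exp (C / sqrt (Suc (N + h)))"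
      using step[of "N + h"] that by simp
    also have "\<dots> \<le> (real (card (Qs N :: ('n \<times> nat) set set)) * exp (C * real h / sqrt N)) * exp (C / sqrt N)"
      using Suc that C by (intro mult_mono) (auto intro!: divide_left_mono)
    also have "\<dots> = real (card (Qs N :: ('n \<times> nat) set set)) * exp (C * real (Suc h) / sqrt N)"
      by (simp add: mult.assoc exp_add[symmetric] add_divide_distrib algebra_simps)
    finally show ?case .
  qed simp
  with C show ?thesis unfolding eventually_sequentially by blast
qed

text \<open>The tilt for \<open>N\<close> still serves up to \<open>N1\<close>, as
  \<open>exp (\<theta> * (N1 - N))\<close> is at most a constant times a power of \<open>N\<close>.
  A deviation of \<open>sqrt N / ln N\<close> gains \<open>exp (- sqrt N / (24 * (ln N)^2))\<close>,
  which beats that power and the factor \<open>exp (C * N powr (1/4))\<close>. One centre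
  \<open>v\<close> serves all \<open>N1\<close> and all coordinates, so that sets of different
  weights become comparable.\<close>

lemma fibre_concentration:
  assumes D: "D > 0"
  shows "\<forall>\<^sub>F N in sequentially. \<exists>v. 0 \<le> v \<and> v \<le> 6 * sqrt N \<and> (\<forall>N1. real N1 \<le> real N + D * sqrt N * ln N + 1 \<longrightarrow>
    real (card {A \<in> (Qs N1 :: ('n::finite \<times> nat) set set). \<exists>j. \<not> \<bar>real (fibre_card j A) - v\<bar> < sqrt N / ln N})
      \<le> real (card (Qs N :: ('n \<times> nat) set set)) / N)"
proof -
  define s where "s = real CARD('n)"
  have s: "s \<ge> 1" by (simp add: s_def Suc_leI)
  obtain C where C: "C > 0" and tilt: "\<forall>\<^sub>F N in sequentially. \<exists>\<theta>. 1 / (6 * sqrt N) \<le> \<theta> \<and> \<theta> \<le> 3 * s / sqrt N \<and>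
     exp (\<theta> * real N) * pfun TYPE('n) (4 * N) \<theta> \<le> real (card (Qs N :: ('n \<times> nat) set set)) * exp (C * real N powr (1/4)) \<and>
     real N - C * real N powr (3/4) \<le> (\<Sum>b\<in>(grid (4 * N) :: ('n \<times> nat) set). real (snd b) * occ \<theta> (snd b))"
    using tilt_exists[where 'n='n] unfolding s_def by blast
  have ev1: "\<forall>\<^sub>F N in sequentially. 2 * (3 * s) \<le> sqrt (real N)" by real_asymp
  have ev2: "\<forall>\<^sub>F N in sequentially. 2 * s * exp (3 * s * D * ln (real N) + 3 * s + C * real N powr (1/4) - sqrt (real N) / (24 * (ln (real N))\<^sup>2)) \<le> 1 / real N"
    by real_asymp
  have ev3: "\<forall>\<^sub>F N in sequentially. D * sqrt N * ln N + 1 \<le> 3 * real N" by real_asymp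
  have ev4: "\<forall>\<^sub>F N in sequentially. ln (real N) \<ge> 1" by real_asymp
  show ?thesis
    using tilt ev1 ev2 ev3 ev4 eventually_ge_at_top[of 10]
  proof eventually_elim
    case (elim N)
    then obtain \<theta> where \<theta>: "1 / (6 * sqrt N) \<le> \<theta>" "\<theta> \<le> 3 * s / sqrt N"
     "exp (\<theta> * real N) * pfun TYPE('n) (4 * N) \<theta> \<le> real (card (Qs N :: ('n \<times> nat) set set)) * exp (C * real N powr (1/4))" by blast
    have sqN: "sqrt N > 0" "sqrt N * sqrt N = N" "sqrt N \<ge> 1" using elim(6) by auto
    have \<theta>0: "\<theta> > 0" using \<theta>(1) sqN by (auto intro: less_le_trans[rotated])
    define v where "v = (\<Sum>l=1..4*N. occ \<theta> l)"
    have v: "v \<le> 6 * sqrt N"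
      unfolding v_def using elim(2,6) \<theta>(1,2) s occ_sum_bounds(1)[of N \<theta> "3 * s"] by auto
    have v0: "0 \<le> v" unfolding v_def by (intro sum_nonneg less_imp_le occ_pos)
    define t where "t = sqrt N / ln N"
    \<comment> \<open>As \<open>v \<le> 6 * sqrt N\<close>, this choice makes the loss
      \<open>\<eta>^2 * v\<close> at most half of the gain \<open>\<eta> * t\<close>.\<close>
    define \<eta> where "\<eta> = 1 / (12 * ln N)"
    have \<eta>: "0 \<le> \<eta>" "\<eta> \<le> 1" using elim(5) by (auto simp: \<eta>_def field_simps)
    have dev: "- \<eta> * t + \<eta>\<^sup>2 * v \<le> - (sqrt N / (24 * (ln N)\<^sup>2))"
    proof -
      have "\<eta>\<^sup>2 * v \<le> \<eta>\<^sup>2 * (6 * sqrt N)" using v by (intro mult_left_mono) auto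
      also have "\<dots> = sqrt N / (24 * (ln N)\<^sup>2)" by (simp add: \<eta>_def power2_eq_square)
      finally show ?thesis by (simp add: \<eta>_def t_def power2_eq_square)
    qed
    have "real (card {A \<in> (Qs N1 :: ('n::finite \<times> nat) set set). \<exists>j. \<not> \<bar>real (fibre_card j A) - v\<bar> < t})
      \<le> real (card (Qs N :: ('n \<times> nat) set set)) / N" if N1: "real N1 \<le> real N + D * sqrt N * ln N + 1" for N1
    proof -
      have N14: "N1 \<le> 4 * N" using N1 elim(4) by linarith
      define B where "B = exp (\<theta> * real N1) * pfun TYPE('n) (4 * N) \<theta> * exp (- \<eta> * t + \<eta>\<^sup>2 * v)"
      let ?L = "\<lambda>j. {A \<in> (Qs N1 :: ('n::finite \<times> nat) set set). real (fibre_card j A) \<le> v - t}"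
      let ?H = "\<lambda>j. {A \<in> (Qs N1 :: ('n::finite \<times> nat) set set). real (fibre_card j A) \<ge> v + t}"
      have "{A \<in> (Qs N1 :: ('n::finite \<times> nat) set set). \<exists>j. \<not> \<bar>real (fibre_card j A) - v\<bar> < t} \<subseteq> (\<Union>j\<in>UNIV. ?L j \<union> ?H j)"
      proof
        fix A assume A: "A \<in> {A \<in> (Qs N1 :: ('n::finite \<times> nat) set set). \<exists>j. \<not> \<bar>real (fibre_card j A) - v\<bar> < t}"
        then obtain j where "\<not> \<bar>real (fibre_card j A) - v\<bar> < t" by auto
        then have "real (fibre_card j A) \<le> v - t \<or> real (fibre_card j A) \<ge> v + t" by linarith
        with A show "A \<in> (\<Union>j\<in>UNIV. ?L j \<union> ?H j)" by blast
      qed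
      then have "card {A \<in> (Qs N1 :: ('n::finite \<times> nat) set set). \<exists>j. \<not> \<bar>real (fibre_card j A) - v\<bar> < t} \<le> card (\<Union>j\<in>UNIV. ?L j \<union> ?H j)"
        by (intro card_mono) auto
      also have "\<dots> \<le> (\<Sum>j\<in>UNIV. card (?L j \<union> ?H j))" by (intro card_UN_le) auto
      finally have "real (card {A \<in> (Qs N1 :: ('n::finite \<times> nat) set set). \<exists>j. \<not> \<bar>real (fibre_card j A) - v\<bar> < t}) \<le> (\<Sum>j\<in>UNIV. real (card (?L j \<union> ?H j)))"
        unfolding of_nat_sum[symmetric] of_nat_le_iff .
      also have "\<dots> \<le> (\<Sum>j\<in>(UNIV :: 'n set). 2 * B)"
      proof (intro sum_mono)
        fix j :: 'n
        have "real (card (?L j \<union> ?H j)) \<le> real (card (?L j)) + real (card (?H j))"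
          using card_Un_le[of "?L j" "?H j"] by linarith
        moreover have "real (card (?L j)) \<le> B" unfolding B_def v_def using \<eta> \<theta>0 N14 by (intro card_fibre_low) auto
        moreover have "real (card (?H j)) \<le> B" unfolding B_def v_def using \<eta> \<theta>0 N14 by (intro card_fibre_high) auto
        ultimately show "real (card (?L j \<union> ?H j)) \<le> 2 * B" by simp
      qed
      also have "\<dots> = 2 * s * B" by (simp add: s_def)
      also have "\<dots> \<le> 2 * s * (real (card (Qs N :: ('n \<times> nat) set set)) *
          exp (3 * s * D * ln (real N) + 3 * s + C * real N powr (1/4) - sqrt (real N) / (24 * (ln (real N))\<^sup>2)))"
      proof (intro mult_left_mono)
        have "\<theta> * (real N1 - real N) \<le> 3 * s / sqrt N * (D * sqrt N * ln N + 1)"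
        proof (cases "real N1 \<ge> real N")
          case True
          then show ?thesis using N1 \<theta> \<theta>0 s sqN by (intro mult_mono) auto
        next
          case False
          then have "\<theta> * (real N1 - real N) \<le> 0" using \<theta>0 by (simp add: mult_nonneg_nonpos)
          also have "0 \<le> 3 * s / sqrt N * (D * sqrt N * ln N + 1)" using s D elim(5) by (intro mult_nonneg_nonneg add_nonneg_nonneg) auto
          finally show ?thesis .
        qed
        also have "\<dots> = 3 * s * D * ln N + 3 * s / sqrt N" using sqN by (simp add: field_simps)
        also have "\<dots> \<le> 3 * s * D * ln N + 3 * s" using sqN s by (simp add: field_simps)
        finally have le: "\<theta> * real N1 \<le> \<theta> * real N + (3 * s * D * ln N + 3 * s)" by (simp add: algebra_simps)
        have "B \<le> exp (\<theta> * real N + (3 * s * D * ln N + 3 * s)) * pfun TYPE('n) (4 * N) \<theta> * exp (- (sqrt N / (24 * (ln N)\<^sup>2)))"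
          unfolding B_def using le dev pfun_pos[of "4*N" \<theta>, where 'n='n] by (intro mult_mono mult_nonneg_nonneg) (auto intro: less_imp_le)
        also have "\<dots> = (exp (\<theta> * real N) * pfun TYPE('n) (4 * N) \<theta>) * (exp (3 * s * D * ln N + 3 * s) * exp (- (sqrt N / (24 * (ln N)\<^sup>2))))"
          by (simp add: exp_add)
        also have "\<dots> \<le> (real (card (Qs N :: ('n \<times> nat) set set)) * exp (C * real N powr (1/4))) * (exp (3 * s * D * ln N + 3 * s) * exp (- (sqrt N / (24 * (ln N)\<^sup>2))))"
          by (intro mult_right_mono \<theta>(3)) auto
        also have "\<dots> = real (card (Qs N :: ('n \<times> nat) set set)) * exp (3 * s * D * ln (real N) + 3 * s + C * real N powr (1/4) - sqrt (real N) / (24 * (ln (real N))\<^sup>2))"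
          by (simp add: exp_add exp_diff exp_minus field_simps)
        finally show "B \<le> real (card (Qs N :: ('n \<times> nat) set set)) * exp (3 * s * D * ln (real N) + 3 * s + C * real N powr (1/4) - sqrt (real N) / (24 * (ln (real N))\<^sup>2))" .
      qed (use s in auto)
      also have "\<dots> = real (card (Qs N :: ('n \<times> nat) set set)) * (2 * s * exp (3 * s * D * ln (real N) + 3 * s + C * real N powr (1/4) - sqrt (real N) / (24 * (ln (real N))\<^sup>2)))"
        by simp
      also have "\<dots> \<le> real (card (Qs N :: ('n \<times> nat) set set)) * (1 / N)"
        using elim(3) by (intro mult_left_mono) auto
      finally show ?thesis by simp
    qed
    with v v0 show ?case unfolding t_def by blast
  qed
qed

section \<open>Characters of the random design\<close>

definition flip :: "'i \<Rightarrow> ('i \<Rightarrow> bool) \<Rightarrow> 'i \<Rightarrow> bool" where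
  "flip b \<omega> = (\<lambda>i. if i = b then \<not> \<omega> i else \<omega> i)"

text \<open>For finite \<open>F\<close>, a character of the group of bit sequences, with values 1
  and -1.\<close>

definition chi :: "'i set \<Rightarrow> ('i \<Rightarrow> bool) \<Rightarrow> real" where
  "chi F \<omega> = (\<Prod>b\<in>F. if \<omega> b then -1 else 1)"

lemma space_design [simp]: "space design = UNIV"
  by (simp add: design_def space_PiM PiE_def)

lemma sets_design_Collect: "Measurable.pred design P \<Longrightarrow> {\<omega>. P \<omega>} \<in> sets design"
  by (simp add: pred_def)

lemma measurable_bit [measurable]: "(\<lambda>\<omega>. \<omega> b) \<in> measurable design (count_space UNIV)"
proof -
  have "(\<lambda>\<omega>. \<omega> b) \<in> measurable design (measure_pmf (bernoulli_pmf (1/2)))"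
    unfolding design_def by (rule measurable_component_singleton) simp
  then show ?thesis by simp
qed

lemma prob_space_design: "prob_space design"
  unfolding design_def by (intro prob_space_PiM measure_pmf.prob_space_axioms)

lemma measurable_flip [measurable]: "flip b \<in> measurable design (design :: 'n rbits measure)"
proof -
  have "flip b \<in> measurable (design :: 'n rbits measure) (PiM UNIV (\<lambda>_. measure_pmf (bernoulli_pmf (1/2))))"
  proof (rule measurable_PiM_single')
    fix i
    have "(\<lambda>\<omega>. flip b \<omega> i) \<in> measurable (design :: 'n rbits measure) (count_space UNIV)"
      unfolding flip_def by (cases "i = b") (simp_all, measurable)
    then show "(\<lambda>\<omega>. flip b \<omega> i) \<in> measurable (design :: 'n rbits measure) (measure_pmf (bernoulli_pmf (1/2)))"
      by (simp add: measurable_cong_sets)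
  qed simp
  then show ?thesis by (simp add: design_def)
qed

text \<open>Flip invariance together with total mass 1 is all that the probability computations
  below take from the product structure.\<close>

lemma distr_flip: "distr design design (flip b) = (design :: 'n rbits measure)"
proof -
  let ?M = "\<lambda>_ :: ('n \<times> nat \<times> nat) + ('n \<times> nat). measure_pmf (bernoulli_pmf (1/2))"
  interpret product_prob_space ?M UNIV
    by (intro product_prob_spaceI measure_pmf.prob_space_axioms)
  have half: "emeasure (measure_pmf (bernoulli_pmf (1/2))) (Not -` X) = emeasure (measure_pmf (bernoulli_pmf (1/2))) X" for X
  proof -
    have "map_pmf Not (bernoulli_pmf (1/2)) = bernoulli_pmf (1/2)"
    proof (rule pmf_eqI)
      fix x :: bool
      have "pmf (map_pmf Not (bernoulli_pmf (1/2))) (\<not> (\<not> x)) = pmf (bernoulli_pmf (1/2)) (\<not> x)"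
        by (rule pmf_map_inj') (simp add: inj_def)
      also have "\<dots> = pmf (bernoulli_pmf (1/2)) x" by (cases x) auto
      finally show "pmf (map_pmf Not (bernoulli_pmf (1/2))) x = pmf (bernoulli_pmf (1/2)) x" by simp
    qed
    moreover have "emeasure (measure_pmf (map_pmf Not (bernoulli_pmf (1/2)))) X = emeasure (measure_pmf (bernoulli_pmf (1/2))) (Not -` X)"
      by (rule emeasure_map_pmf)
    ultimately show ?thesis by simp
  qed
  have "distr design design (flip b) = PiM UNIV ?M"
  proof (rule PiM_eq)
    fix J :: "(('n \<times> nat \<times> nat) + ('n \<times> nat)) set" and F :: "('n \<times> nat \<times> nat) + ('n \<times> nat) \<Rightarrow> bool set"
    assume J: "finite J" "J \<subseteq> UNIV"
    define F' where "F' = (\<lambda>i. if i = b then Not -` F i else F i)"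
    have m: "prod_emb UNIV ?M J (Pi\<^sub>E J F) \<in> sets (PiM UNIV ?M)"
      using J by (intro sets_PiM_I) simp_all
    have "emeasure (distr design design (flip b)) (prod_emb UNIV ?M J (Pi\<^sub>E J F))
        = emeasure design (flip b -` prod_emb UNIV ?M J (Pi\<^sub>E J F))"
      using m by (subst emeasure_distr) (auto simp: design_def[symmetric])
    also have "flip b -` prod_emb UNIV ?M J (Pi\<^sub>E J F) = prod_emb UNIV ?M J (Pi\<^sub>E J F')"
      unfolding prod_emb_def by (force simp: flip_def F'_def PiE_iff)
    also have "emeasure design \<dots> = (\<Prod>j\<in>J. emeasure (measure_pmf (bernoulli_pmf (1/2))) (F' j))"
      unfolding design_def using J by (intro emeasure_PiM_emb) auto
    also have "\<dots> = (\<Prod>j\<in>J. emeasure (measure_pmf (bernoulli_pmf (1/2))) (F j))"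
      by (intro prod.cong refl) (auto simp: F'_def half)
    finally show "emeasure (distr design design (flip b)) (prod_emb UNIV ?M J (Pi\<^sub>E J F))
        = (\<Prod>j\<in>J. emeasure (measure_pmf (bernoulli_pmf (1/2))) (F j))" .
  qed (simp add: design_def)
  then show ?thesis by (simp add: design_def)
qed

lemma chi_measurable [measurable]: "chi F \<in> borel_measurable design"
  unfolding chi_def by measurable

lemma chi_abs: "chi F \<omega> = 1 \<or> chi F \<omega> = -1"
proof (cases "finite F")
  case True
  then show ?thesis unfolding chi_def by (induction F) auto
qed (simp add: chi_def)

lemma abs_chi [simp]: "\<bar>chi F \<omega>\<bar> = 1"
  using chi_abs[of F \<omega>] by auto

lemma chi_flip:
  assumes "finite F"
  shows "chi F (flip b \<omega>) = (if b \<in> F then - chi F \<omega> else chi F \<omega>)"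
proof (cases "b \<in> F")
  case True
  have "(\<Prod>i\<in>F - {b}. if flip b \<omega> i then -1 else 1 :: real) = (\<Prod>i\<in>F - {b}. if \<omega> i then -1 else 1)"
    by (intro prod.cong) (auto simp: flip_def)
  then show ?thesis using True assms unfolding chi_def by (simp add: prod.remove flip_def)
next
  case False
  then show ?thesis unfolding chi_def by (auto simp: flip_def intro!: prod.cong)
qed

lemma integral_odd_flip_eq_0:
  fixes u :: "'n rbits \<Rightarrow> real"
  assumes [measurable]: "u \<in> borel_measurable design" and "\<And>\<omega>. u (flip b \<omega>) = - u \<omega>"
  shows "(\<integral>\<omega>. u \<omega> \<partial>design) = 0"
proof -
  have "(\<integral>\<omega>. u \<omega> \<partial>design) = (\<integral>\<omega>. u \<omega> \<partial>(distr design design (flip b)))" by (simp only: distr_flip)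
  also have "\<dots> = (\<integral>\<omega>. u (flip b \<omega>) \<partial>design)" by (rule integral_distr) measurable
  also have "\<dots> = - (\<integral>\<omega>. u \<omega> \<partial>design)" using assms(2) by simp
  finally show ?thesis by simp
qed

text \<open>If \<open>e i\<close> is 1 or -1, the factor
  \<open>(1 + e i * chi (F i) \<omega>) / 2\<close> is the indicator of
  \<open>chi (F i) \<omega> = e i\<close>. Expanding the product, each nonempty subproduct times
  \<open>h\<close> is odd under the flip of some bit and integrates to 0; only the integral of
  \<open>h / 2 ^ card I\<close> remains. The factor \<open>h\<close> allows conditioning on an event
  untouched by those flips.\<close>

lemma chi_prod_expectation:
  fixes h :: "'n rbits \<Rightarrow> real" and F :: "'a \<Rightarrow> (('n \<times> nat \<times> nat) + ('n \<times> nat)) set"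
  assumes I: "finite I" "\<And>i. i \<in> I \<Longrightarrow> finite (F i)" and h: "integrable design h"
    and e: "\<And>i. i \<in> I \<Longrightarrow> \<bar>e i\<bar> \<le> 1"
    and odd: "\<And>B. B \<subseteq> I \<Longrightarrow> B \<noteq> {} \<Longrightarrow> \<exists>b. odd (card {i \<in> B. b \<in> F i}) \<and> (\<forall>\<omega>. h (flip b \<omega>) = h \<omega>)"
  shows "(\<integral>\<omega>. h \<omega> * (\<Prod>i\<in>I. (1 + e i * chi (F i) \<omega>) / 2) \<partial>design) = (\<integral>\<omega>. h \<omega> \<partial>design) / 2 ^ card I"
proof -
  have hm[measurable]: "h \<in> borel_measurable design" by (rule borel_measurable_integrable[OF h])
  have int: "integrable design (\<lambda>\<omega>. h \<omega> * (\<Prod>i\<in>B. e i * chi (F i) \<omega>))" if "B \<subseteq> I" for B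
  proof (rule Bochner_Integration.integrable_bound[OF h])
    show "AE \<omega> in design. norm (h \<omega> * (\<Prod>i\<in>B. e i * chi (F i) \<omega>)) \<le> norm (h \<omega>)"
    proof (rule AE_I2)
      fix \<omega>
      have "\<bar>\<Prod>i\<in>B. e i * chi (F i) \<omega>\<bar> = (\<Prod>i\<in>B. \<bar>e i * chi (F i) \<omega>\<bar>)" by (rule abs_prod)
      also have "\<dots> \<le> 1"
        using that e by (intro prod_le_1) (auto simp: abs_mult subset_iff)
      finally show "norm (h \<omega> * (\<Prod>i\<in>B. e i * chi (F i) \<omega>)) \<le> norm (h \<omega>)"
        by (simp add: abs_mult mult_left_le)
    qed
  qed measurable
  have zero: "(\<integral>\<omega>. h \<omega> * (\<Prod>i\<in>B. e i * chi (F i) \<omega>) \<partial>design) = 0" if B: "B \<subseteq> I" "B \<noteq> {}" for B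
  proof -
    obtain b where b: "odd (card {i \<in> B. b \<in> F i})" "\<And>\<omega>. h (flip b \<omega>) = h \<omega>" using odd[OF B] by blast
    have fB: "finite B" using B I finite_subset by auto
    show ?thesis
    proof (rule integral_odd_flip_eq_0[of _ b])
      fix \<omega>
      have "(\<Prod>i\<in>B. e i * chi (F i) (flip b \<omega>)) = (\<Prod>i\<in>B. (if b \<in> F i then -1 else 1) * (e i * chi (F i) \<omega>))"
        using B I by (intro prod.cong refl) (auto simp: chi_flip subset_iff)
      also have "\<dots> = (\<Prod>i\<in>B. if b \<in> F i then -1 else 1) * (\<Prod>i\<in>B. e i * chi (F i) \<omega>)"
        by (rule prod.distrib)
      also have "(\<Prod>i\<in>B. if b \<in> F i then -1 else 1 :: real) = (\<Prod>i\<in>{i\<in>B. b \<in> F i}. -1)"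
        using fB by (intro prod.mono_neutral_cong_right) auto
      also have "\<dots> = -1" using b(1) by simp
      finally show "h (flip b \<omega>) * (\<Prod>i\<in>B. e i * chi (F i) (flip b \<omega>)) = - (h \<omega> * (\<Prod>i\<in>B. e i * chi (F i) \<omega>))"
        by (simp add: b(2))
    qed measurable
  qed
  have "h \<omega> * (\<Prod>i\<in>I. (1 + e i * chi (F i) \<omega>) / 2) = (\<Sum>B\<in>Pow I. h \<omega> * (\<Prod>i\<in>B. e i * chi (F i) \<omega>)) / 2 ^ card I" for \<omega>
  proof -
    have "(\<Prod>i\<in>I. (1 + e i * chi (F i) \<omega>) / 2) = (\<Prod>i\<in>I. 1 + e i * chi (F i) \<omega>) / 2 ^ card I"
      by (simp add: prod_dividef)
    also have "\<dots> = (\<Sum>B\<in>Pow I. \<Prod>i\<in>B. e i * chi (F i) \<omega>) / 2 ^ card I"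
      using sum_Pow_prod[OF I(1), of "\<lambda>i. e i * chi (F i) \<omega>"] by simp
    finally show ?thesis by (simp add: sum_distrib_left)
  qed
  then have "(\<integral>\<omega>. h \<omega> * (\<Prod>i\<in>I. (1 + e i * chi (F i) \<omega>) / 2) \<partial>design)
     = (\<integral>\<omega>. (\<Sum>B\<in>Pow I. h \<omega> * (\<Prod>i\<in>B. e i * chi (F i) \<omega>)) \<partial>design) / 2 ^ card I" by simp
  also have "(\<integral>\<omega>. (\<Sum>B\<in>Pow I. h \<omega> * (\<Prod>i\<in>B. e i * chi (F i) \<omega>)) \<partial>design)
     = (\<Sum>B\<in>Pow I. (\<integral>\<omega>. h \<omega> * (\<Prod>i\<in>B. e i * chi (F i) \<omega>) \<partial>design))"
    by (rule Bochner_Integration.integral_sum) (use int in auto)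
  also have "\<dots> = (\<Sum>B\<in>{{}}. (\<integral>\<omega>. h \<omega> * (\<Prod>i\<in>B. e i * chi (F i) \<omega>) \<partial>design))"
    using I zero by (intro sum.mono_neutral_right) auto
  finally show ?thesis by simp
qed

text \<open>The entries in column \<open>r\<close> of the matrices at the rows listed in
  \<open>A\<close>. \<open>chi (crow r A)\<close> is the sign of their sum modulo 2, so
  \<open>in_dual\<close> below says that the selected rows add up to zero in the first
  \<open>m\<close> columns.\<close>

definition crow :: "nat \<Rightarrow> ('n \<times> nat) set \<Rightarrow> (('n \<times> nat \<times> nat) + ('n \<times> nat)) set" where
  "crow r A = (\<lambda>a. Inl (fst a, snd a, r)) ` A"

lemma mem_crow: "Inl (fst x, snd x, r) \<in> crow r' A \<longleftrightarrow> r' = r \<and> x \<in> A"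
proof
  assume "Inl (fst x, snd x, r) \<in> crow r' A"
  then obtain a where a: "a \<in> A" "fst x = fst a" "snd x = snd a" "r = r'" by (auto simp: crow_def)
  then have "x = a" by (simp add: prod_eq_iff)
  with a show "r' = r \<and> x \<in> A" by simp
qed (simp add: crow_def)

definition in_dual :: "nat \<Rightarrow> 'n rbits \<Rightarrow> ('n \<times> nat) set \<Rightarrow> bool" where
  "in_dual m \<omega> A \<longleftrightarrow> (\<forall>r\<in>{1..m}. chi (crow r A) \<omega> = 1)"

definition shift_sign :: "'n rbits \<Rightarrow> ('n \<times> nat) set \<Rightarrow> real" where
  "shift_sign \<omega> A = chi (Inr ` A) \<omega>"

text \<open>Linear independence, over the field with two elements, of the indicator vectors of the
  members.\<close>

definition xor_indep :: "'a set set \<Rightarrow> bool" where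
  "xor_indep I \<longleftrightarrow> (\<forall>B. B \<subseteq> I \<longrightarrow> B \<noteq> {} \<longrightarrow> (\<exists>x. odd (card {A \<in> B. x \<in> A})))"

lemma in_dual_measurable [measurable]: "Measurable.pred design (\<lambda>\<omega>. in_dual m \<omega> A)"
  unfolding in_dual_def by measurable

lemma shift_sign_measurable [measurable]: "(\<lambda>\<omega>. shift_sign \<omega> A) \<in> borel_measurable design"
  unfolding shift_sign_def by measurable

lemma prob_in_dual:
  fixes I :: "('n \<times> nat) set set"
  assumes I: "finite I" "\<And>A. A \<in> I \<Longrightarrow> finite A" and ind: "xor_indep I"
  shows "measure design {\<omega>. \<forall>A\<in>I. in_dual m \<omega> A} = 1 / 2 ^ (m * card I)"
proof -
  interpret D: prob_space "design :: 'n rbits measure" by (rule prob_space_design)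
  let ?J = "I \<times> {1..m}"
  have ev: "{\<omega> :: 'n rbits. \<forall>A\<in>I. in_dual m \<omega> A} \<in> sets design"
    by (intro sets_design_Collect pred_intros_finite I) measurable
  have ind': "indicator {\<omega>. \<forall>A\<in>I. in_dual m \<omega> A} \<omega> = 1 * (\<Prod>i\<in>?J. (1 + 1 * chi (crow (snd i) (fst i)) \<omega>) / 2)"
    for \<omega> :: "'n rbits"
  proof (cases "\<forall>A\<in>I. in_dual m \<omega> A")
    case True
    then have "(\<Prod>i\<in>?J. (1 + 1 * chi (crow (snd i) (fst i)) \<omega>) / 2) = (\<Prod>i\<in>?J. 1)"
      by (intro prod.cong refl) (auto simp: in_dual_def)
    with True show ?thesis by simp
  next
    case False
    then obtain A r where "A \<in> I" "r \<in> {1..m}" "chi (crow r A) \<omega> = -1"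
      using chi_abs by (fastforce simp: in_dual_def)
    then have "\<exists>i\<in>?J. (1 + 1 * chi (crow (snd i) (fst i)) \<omega>) / 2 = 0" by (intro bexI[of _ "(A, r)"]) auto
    with False I show ?thesis by (auto simp: prod_zero_iff)
  qed
  have "measure design {\<omega>. \<forall>A\<in>I. in_dual m \<omega> A} = (\<integral>\<omega>. indicator {\<omega>. \<forall>A\<in>I. in_dual m \<omega> A} \<omega> \<partial>design)"
    using ev by simp
  also have "\<dots> = (\<integral>\<omega>. 1 * (\<Prod>i\<in>?J. (1 + 1 * chi (crow (snd i) (fst i)) \<omega>) / 2) \<partial>design)"
    by (simp only: ind')
  also have "\<dots> = (\<integral>\<omega>. 1 \<partial>(design :: 'n rbits measure)) / 2 ^ card ?J"
  proof (rule chi_prod_expectation)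
    show "finite (crow (snd i) (fst i))" if "i \<in> ?J" for i using that I by (auto simp: crow_def)
    fix B assume B: "B \<subseteq> ?J" "B \<noteq> {}"
    then obtain A0 r where r: "(A0, r) \<in> B" by auto
    \<comment> \<open>Different columns involve disjoint bits. So a single column \<open>r\<close>
      occurring in \<open>B\<close> is enough: independence of its slice \<open>Br\<close> yields a
      bit that is met an odd number of times.\<close>
    define Br where "Br = {A. (A, r) \<in> B}"
    have "Br \<subseteq> I" "Br \<noteq> {}" using B r by (auto simp: Br_def)
    then obtain x where x: "odd (card {A \<in> Br. x \<in> A})" using ind unfolding xor_indep_def by blast
    have "{i \<in> B. Inl (fst x, snd x, r) \<in> crow (snd i) (fst i)} = (\<lambda>A. (A, r)) ` {A \<in> Br. x \<in> A}"
      by (auto simp: mem_crow Br_def image_iff)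
    moreover have "card ((\<lambda>A. (A, r)) ` {A \<in> Br. x \<in> A}) = card {A \<in> Br. x \<in> A}"
      by (intro card_image) (auto simp: inj_on_def)
    ultimately show "\<exists>b. odd (card {i \<in> B. b \<in> crow (snd i) (fst i)}) \<and> (\<forall>\<omega> :: 'n rbits. (1::real) = 1)"
      using x by (intro exI[of _ "Inl (fst x, snd x, r)"]) simp
  qed (use I in auto)
  also have "\<dots> = 1 / 2 ^ (m * card I)" using D.prob_space by (simp add: card_cartesian_product mult.commute)
  finally show ?thesis .
qed

text \<open>\<open>H\<close> will be an event about the matrices alone, hence invariant under flips
  of shift bits; given such an event, the signs of an independent family are uniformly
  distributed.\<close>

lemma prob_shift_pattern:
  fixes I :: "('n \<times> nat) set set"
  assumes I: "finite I" "\<And>A. A \<in> I \<Longrightarrow> finite A" and ind: "xor_indep I"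
    and H: "Measurable.pred design H" "\<And>a \<omega>. H (flip (Inr a) \<omega>) \<longleftrightarrow> H \<omega>" and U: "U \<subseteq> I"
  shows "measure design {\<omega>. H \<omega> \<and> {A \<in> I. shift_sign \<omega> A = -1} = U} = measure design {\<omega>. H \<omega>} / 2 ^ card I"
proof -
  interpret D: prob_space "design :: 'n rbits measure" by (rule prob_space_design)
  note H(1)[measurable]
  define e where "e A = (if A \<in> U then -1 else 1 :: real)" for A
  have ind': "indicator {\<omega>. H \<omega> \<and> {A \<in> I. shift_sign \<omega> A = -1} = U} \<omega>
      = indicator {\<omega>. H \<omega>} \<omega> * (\<Prod>A\<in>I. (1 + e A * chi (Inr ` A) \<omega>) / 2)" for \<omega> :: "'n rbits"
  proof (cases "{A \<in> I. shift_sign \<omega> A = -1} = U")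
    case True
    have "(\<Prod>A\<in>I. (1 + e A * chi (Inr ` A) \<omega>) / 2) = (\<Prod>A\<in>I. 1)"
    proof (intro prod.cong refl)
      fix A assume "A \<in> I"
      then show "(1 + e A * chi (Inr ` A) \<omega>) / 2 = 1"
        using True chi_abs[of "Inr ` A" \<omega>] by (auto simp: e_def shift_sign_def)
    qed
    with True show ?thesis by (simp add: indicator_def)
  next
    case False
    then obtain A where "A \<in> I" "(A \<in> U) \<noteq> (shift_sign \<omega> A = -1)" using U by auto
    then have "\<exists>A\<in>I. (1 + e A * chi (Inr ` A) \<omega>) / 2 = 0"
      using chi_abs[of "Inr ` A" \<omega>] by (intro bexI[of _ A]) (auto simp: e_def shift_sign_def)
    then have "(\<Prod>A\<in>I. (1 + e A * chi (Inr ` A) \<omega>) / 2) = 0" using I by (simp add: prod_zero_iff)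
    with False show ?thesis by (simp add: indicator_def)
  qed
  have s1: "{A \<in> I. shift_sign \<omega> A = -1} = U \<longleftrightarrow> (\<forall>A\<in>I. (shift_sign \<omega> A = -1) = (A \<in> U))" for \<omega> :: "'n rbits"
    using U by blast
  have ev: "{\<omega>. H \<omega> \<and> {A \<in> I. shift_sign \<omega> A = -1} = U} \<in> sets design"
    unfolding s1 by (intro sets_design_Collect pred_intros_logic pred_intros_finite I) measurable
  have evH: "{\<omega>. H \<omega>} \<in> sets design" by (intro sets_design_Collect) measurable
  have "measure design {\<omega>. H \<omega> \<and> {A \<in> I. shift_sign \<omega> A = -1} = U}
     = (\<integral>\<omega>. indicator {\<omega>. H \<omega> \<and> {A \<in> I. shift_sign \<omega> A = -1} = U} \<omega> \<partial>design)"
    using ev by simp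
  also have "\<dots> = (\<integral>\<omega>. indicator {\<omega>. H \<omega>} \<omega> * (\<Prod>A\<in>I. (1 + e A * chi (Inr ` A) \<omega>) / 2) \<partial>design)"
    by (simp only: ind')
  also have "\<dots> = (\<integral>\<omega>. indicator {\<omega>. H \<omega>} \<omega> \<partial>design) / 2 ^ card I"
  proof (rule chi_prod_expectation)
    show "integrable design (indicator {\<omega>. H \<omega>} :: 'n rbits \<Rightarrow> real)"
      using evH by (intro integrable_real_indicator) (auto simp: D.emeasure_finite less_top[symmetric])
    fix B assume "B \<subseteq> I" "B \<noteq> {}"
    then obtain x where x: "odd (card {A \<in> B. x \<in> A})" using ind unfolding xor_indep_def by blast
    show "\<exists>b. odd (card {i \<in> B. b \<in> Inr ` i}) \<and> (\<forall>\<omega>. indicator {\<omega>. H \<omega>} (flip b \<omega>) = (indicator {\<omega>. H \<omega>} \<omega> :: real))"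
      using x H(2) by (intro exI[of _ "Inr x"]) (simp add: inj_image_mem_iff indicator_def)
  qed (use I in \<open>auto simp: e_def\<close>)
  finally show ?thesis using evH by simp
qed

lemma in_dual_flip_Inr: "finite A \<Longrightarrow> in_dual m (flip (Inr a) \<omega>) A \<longleftrightarrow> in_dual m \<omega> A"
  unfolding in_dual_def by (subst chi_flip) (auto simp: crow_def)

section \<open>Decay of the Walsh coefficients\<close>

lemma One_nth [simp]: "(One :: real ^ 'n::finite) $ i = 1"
  by (metis one_index Cart_1)

lemma mem_unit_cube: "x \<in> unit_cube \<longleftrightarrow> (\<forall>i. 0 \<le> x $ i \<and> x $ i \<le> 1)"
  by (simp only: unit_cube_def mem_box_cart One_nth) simp

lemma unit_cube_sets [measurable]: "unit_cube \<in> sets borel"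
  by (simp add: unit_cube_def)

lemma compact_unit_cube: "compact unit_cube"
  by (simp add: unit_cube_def)

lemma emeasure_unit_cube: "emeasure lborel (unit_cube :: (real ^ 'n::finite) set) = 1"
proof -
  have "One \<bullet> b = (1 :: real)" if "b \<in> Basis" for b :: "real ^ 'n"
    using that by simp
  then show ?thesis unfolding unit_cube_def by (subst emeasure_lborel_cbox) auto
qed

section \<open>Binary digits under translation by 2^(-l)\<close>

lemma xdigit_eq: "xdigit x l = (if even \<lfloor>2 ^ l * x\<rfloor> then 0 else 1)"
  by (simp add: xdigit_def even_iff_mod_2_eq_zero odd_iff_mod_2_eq_one)

lemma floor_coarser: "l' \<le> l \<Longrightarrow> \<lfloor>2 ^ l' * x\<rfloor> = \<lfloor>2 ^ l * x\<rfloor> div 2 ^ (l - l')" for x :: real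
proof -
  assume "l' \<le> l"
  then have "(2::real) ^ l = 2 ^ l' * 2 ^ (l - l')" by (simp add: power_add[symmetric])
  then have "2 ^ l' * x = 2 ^ l * x / real_of_int (2 ^ (l - l'))" by simp
  then show ?thesis using floor_divide_real_eq_div[of "2 ^ (l - l')" "2 ^ l * x"] by simp
qed

text \<open>Digit \<open>l\<close> is 0, so adding 2^(-l) produces no carry.\<close>

lemma xdigit_shift:
  fixes x :: real
  assumes l: "l \<ge> 1" and d: "xdigit x l = 0"
  shows "xdigit (x + 1 / 2 ^ l) l' = (if l' = l then 1 else xdigit x l')"
proof -
  define n where "n = \<lfloor>2 ^ l * x\<rfloor>"
  have n: "even n" using d by (simp add: xdigit_eq n_def split: if_splits)
  have n1: "\<lfloor>2 ^ l * (x + 1 / 2 ^ l)\<rfloor> = n + 1" by (simp add: n_def distrib_left)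
  show ?thesis
  proof (cases "l' < l")
    case True
    then obtain d where d: "l - l' = Suc d" using Suc_diff_Suc by metis
    have "(n + 1) div 2 ^ (l - l') = (n + 1) div 2 div 2 ^ d" by (simp add: d zdiv_zmult2_eq)
    also have "(n + 1) div 2 = n div 2" using n by (elim evenE) simp
    also have "n div 2 div 2 ^ d = n div 2 ^ (l - l')" by (simp add: d zdiv_zmult2_eq)
    finally have "\<lfloor>2 ^ l' * (x + 1 / 2 ^ l)\<rfloor> = \<lfloor>2 ^ l' * x\<rfloor>"
      using True floor_coarser[of l' l x] floor_coarser[of l' l "x + 1 / 2 ^ l"] n1 by (simp add: n_def)
    with True show ?thesis unfolding xdigit_eq by simp
  next
    case False
    then obtain d where d: "l' = l + d" using le_Suc_ex not_less by blast
    have "2 ^ l' * (x + 1 / 2 ^ l) = 2 ^ l' * x + real_of_int (2 ^ d)"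
      by (simp add: d distrib_left power_add)
    then have "\<lfloor>2 ^ l' * (x + 1 / 2 ^ l)\<rfloor> = \<lfloor>2 ^ l' * x\<rfloor> + 2 ^ d" by (metis floor_add_int)
    then show ?thesis using n unfolding xdigit_eq by (cases d) (auto simp: d n_def)
  qed
qed

lemma shift_less_1:
  fixes x :: real
  assumes l: "l \<ge> 1" and d: "xdigit x l = 0" and x: "x < 1"
  shows "x + 1 / 2 ^ l < 1"
proof -
  define n where "n = \<lfloor>2 ^ l * x\<rfloor>"
  have n: "even n" using d by (simp add: xdigit_eq n_def split: if_splits)
  have "2 ^ l * x < real_of_int (2 ^ l)" using x by simp
  then have "n < 2 ^ l" unfolding n_def by (simp add: floor_less_iff)
  moreover have "even (2 ^ l :: int)" using l by simp
  moreover have "n + 1 < p" if "n < p" "even p" for p :: int using that n by presburger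
  ultimately have "n + 1 < 2 ^ l" by blast
  then have "2 ^ l * x + 1 < real_of_int (2 ^ l)"
    unfolding n_def using floor_correct[of "2 ^ l * x"] by linarith
  then have "2 ^ l * (x + 1 / 2 ^ l) < 2 ^ l * 1" by (simp add: distrib_left)
  then show ?thesis by (rule mult_left_less_imp_less) simp
qed

lemma xdigit_unshift:
  fixes x :: real
  assumes d: "xdigit x l = 1" and x: "x \<ge> 0"
  shows "x - 1 / 2 ^ l \<ge> 0" "xdigit (x - 1 / 2 ^ l) l = 0"
proof -
  define n where "n = \<lfloor>2 ^ l * x\<rfloor>"
  have n: "odd n" using d by (simp add: xdigit_eq n_def split: if_splits)
  have "n \<ge> 0" using x by (simp add: n_def)
  with n have "n \<ge> 1" by presburger
  then have "2 ^ l * x \<ge> 1" by (simp add: n_def)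
  then show "x - 1 / 2 ^ l \<ge> 0" by (simp add: field_simps)
  have "\<lfloor>2 ^ l * (x - 1 / 2 ^ l)\<rfloor> = n - 1" by (simp add: n_def right_diff_distrib)
  then show "xdigit (x - 1 / 2 ^ l) l = 0" using n by (simp add: xdigit_eq)
qed

definition wal :: "('n \<times> nat) set \<Rightarrow> real ^ 'n \<Rightarrow> real" where
  "wal A x = (\<Prod>a\<in>A. (-1) ^ xdigit (x $ fst a) (snd a))"

text \<open>The domain that remains once the digits in \<open>P\<close> have been folded away;
  half-open, as digits are read from expansions of numbers below 1.\<close>

definition zero_digits :: "('n::finite \<times> nat) set \<Rightarrow> (real ^ 'n) set" where
  "zero_digits P = {x. (\<forall>i. 0 \<le> x $ i \<and> x $ i < 1) \<and> (\<forall>a\<in>P. xdigit (x $ fst a) (snd a) = 0)}"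

definition fhat :: "(real ^ 'n::finite \<Rightarrow> real) \<Rightarrow> ('n \<times> nat) set \<Rightarrow> real" where
  "fhat f A = (LINT x:unit_cube|lborel. f x * wal A x)"

lemma xdigit_measurable [measurable]: "(\<lambda>x. xdigit (x $ i) l) \<in> measurable (borel :: (real ^ 'n::finite) measure) (count_space UNIV)"
  unfolding xdigit_def by measurable

lemma wal_measurable [measurable]: "wal A \<in> borel_measurable (borel :: (real ^ 'n::finite) measure)"
  unfolding wal_def by measurable

lemma abs_wal: "\<bar>wal A x\<bar> = 1"
  unfolding wal_def abs_prod by (simp add: power_abs)

lemma zero_digits_sets [measurable]:
  assumes "finite P" shows "zero_digits (P :: ('n::finite \<times> nat) set) \<in> sets borel"
proof -
  have "Measurable.pred borel (\<lambda>x :: real ^ 'n. (\<forall>i\<in>UNIV. 0 \<le> x $ i \<and> x $ i < 1) \<and> (\<forall>a\<in>P. xdigit (x $ fst a) (snd a) = 0))"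
    by (intro pred_intros_logic pred_intros_finite assms finite) measurable
  then show ?thesis by (simp add: zero_digits_def pred_def)
qed

lemma zero_digits_subset_cube: "zero_digits P \<subseteq> unit_cube"
  unfolding zero_digits_def subset_iff mem_Collect_eq mem_unit_cube
  by (meson less_imp_le)

lemma integral_translate:
  fixes F :: "real ^ 'n::finite \<Rightarrow> real"
  assumes [measurable]: "F \<in> borel_measurable borel"
  shows "(\<integral>x. F (x + v) \<partial>lborel) = (\<integral>x. F x \<partial>lborel)"
proof -
  have "(\<integral>x. F x \<partial>lborel) = (\<integral>x. F x \<partial>(distr lborel borel ((+) v)))" by (simp only: lborel_distr_plus)
  also have "\<dots> = (\<integral>x. F (v + x) \<partial>lborel)" by (rule integral_distr) measurable
  finally show ?thesis by (simp add: add.commute)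
qed

lemma integrable_translate:
  fixes F :: "real ^ 'n::finite \<Rightarrow> real"
  assumes "integrable lborel F"
  shows "integrable lborel (\<lambda>x. F (x + v))"
proof -
  have [measurable]: "F \<in> borel_measurable borel" using borel_measurable_integrable[OF assms] by simp
  have "integrable (distr lborel borel ((+) v)) F" using assms by (simp only: lborel_distr_plus)
  then have "integrable lborel (\<lambda>x. F (v + x))" by (subst (asm) integrable_distr_eq) measurable
  then show ?thesis by (simp add: add.commute)
qed

lemma zero_digits_shift:
  fixes x :: "real ^ 'n::finite"
  assumes l: "l \<ge> 1" and "(j, l) \<notin> P" and x: "x \<in> zero_digits (insert (j, l) P)"
  shows "x + axis j (1 / 2 ^ l) \<in> zero_digits P" "xdigit ((x + axis j (1 / 2 ^ l)) $ j) l = 1"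
proof -
  have c: "(x + axis j (1 / 2 ^ l)) $ i = (if i = j then x $ j + 1 / 2 ^ l else x $ i)" for i
    by (simp add: axis_def)
  have d: "xdigit (x $ j) l = 0" "0 \<le> x $ j" "x $ j < 1" using x by (auto simp: zero_digits_def)
  show "xdigit ((x + axis j (1 / 2 ^ l)) $ j) l = 1" unfolding c using xdigit_shift[OF l d(1), of l] by simp
  have dig: "xdigit ((x + axis j (1 / 2 ^ l)) $ i) l' = xdigit (x $ i) l'" if "(i, l') \<noteq> (j, l)" for i l'
    unfolding c using xdigit_shift[OF l d(1), of l'] that by auto
  have "xdigit ((x + axis j (1 / 2 ^ l)) $ fst a) (snd a) = 0" if "a \<in> P" for a
  proof -
    have "xdigit (x $ fst a) (snd a) = 0" using that x by (auto simp: zero_digits_def)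
    moreover have "(fst a, snd a) \<noteq> (j, l)" using that assms(2) by auto
    ultimately show ?thesis using dig[of "fst a" "snd a"] by simp
  qed
  moreover have "0 \<le> (x + axis j (1 / 2 ^ l)) $ i \<and> (x + axis j (1 / 2 ^ l)) $ i < 1" for i
  proof (cases "i = j")
    case True
    have "0 \<le> x $ j + 1 / 2 ^ l" using d(2) by (intro add_nonneg_nonneg) auto
    then show ?thesis unfolding c using True shift_less_1[OF l d(1,3)] by simp
  next
    case False
    then show ?thesis unfolding c using x by (simp add: zero_digits_def)
  qed
  ultimately show "x + axis j (1 / 2 ^ l) \<in> zero_digits P" unfolding zero_digits_def by blast
qed

text \<open>The points whose digits in \<open>P\<close> vanish split into those with digit
  \<open>(j, l)\<close> equal to 0 and the translate of these by 2^(-l). As an identity of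
  indicators the splitting can be integrated at once.\<close>

lemma zero_digits_insert_iff:
  fixes x :: "real ^ 'n::finite"
  assumes l: "l \<ge> 1" and jl: "(j, l) \<notin> P"
  shows "(indicator (zero_digits P) x :: real) = indicator (zero_digits (insert (j, l) P)) x
     + indicator (zero_digits (insert (j, l) P)) (x - axis j (1 / 2 ^ l))"
proof -
  let ?Q = "zero_digits (insert (j, l) P)" and ?y = "x - axis j (1 / 2 ^ l)"
  have sub: "x \<in> ?Q \<Longrightarrow> x \<in> zero_digits P" for x by (auto simp: zero_digits_def)
  have y: "?y \<in> ?Q \<Longrightarrow> x \<in> zero_digits P \<and> xdigit (x $ j) l = 1"
    using zero_digits_shift[OF l jl, of ?y] by simp
  have unsh: "?y \<in> ?Q" if x: "x \<in> zero_digits P" "xdigit (x $ j) l = 1"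
  proof -
    have c: "?y $ i = (if i = j then x $ j - 1 / 2 ^ l else x $ i)" for i by (simp add: axis_def)
    have u: "x $ j - 1 / 2 ^ l \<ge> 0" "xdigit (x $ j - 1 / 2 ^ l) l = 0"
      using xdigit_unshift[OF x(2)] x(1) by (auto simp: zero_digits_def)
    have same: "xdigit (x $ j) l' = xdigit (x $ j - 1 / 2 ^ l) l'" if "l' \<noteq> l" for l'
      using xdigit_shift[OF l u(2), of l'] that by simp
    have xj: "0 \<le> x $ i" "x $ i < 1" for i using x(1) by (auto simp: zero_digits_def)
    have "(0::real) < 1 / 2 ^ l" by simp
    then have "x $ j - 1 / 2 ^ l < 1" using xj[of j] by linarith
    then have r: "0 \<le> ?y $ i \<and> ?y $ i < 1" for i unfolding c using xj[of i] u by simp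
    have dz: "xdigit (?y $ fst a) (snd a) = 0" if "a \<in> insert (j, l) P" for a
    proof (cases "a = (j, l)")
      case True
      then show ?thesis unfolding c using u by simp
    next
      case False
      then have z: "xdigit (x $ fst a) (snd a) = 0" using that x(1) by (simp add: zero_digits_def)
      show ?thesis
      proof (cases "fst a = j")
        case True
        then have "snd a \<noteq> l" using False by (metis prod.collapse)
        then have "xdigit (x $ j - 1 / 2 ^ l) (snd a) = 0" using same[of "snd a"] z True by simp
        then show ?thesis unfolding c using True by simp
      next
        case False
        then show ?thesis unfolding c using z by simp
      qed
    qed
    show ?thesis unfolding zero_digits_def by (intro CollectI conjI allI ballI r[THEN conjunct1] r[THEN conjunct2] dz)
  qed
  show ?thesis
  proof (cases "x \<in> zero_digits P")
    case True
    show ?thesis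
    proof (cases "xdigit (x $ j) l = 0")
      case t: True
      then have "x \<in> ?Q" using True by (auto simp: zero_digits_def)
      moreover have "?y \<notin> ?Q" using y t by auto
      ultimately show ?thesis using True by (simp add: indicator_def)
    next
      case False
      then have one: "xdigit (x $ j) l = 1" by (simp add: xdigit_eq split: if_splits)
      then have "?y \<in> ?Q" using unsh True by simp
      moreover have "x \<notin> ?Q" using one by (auto simp: zero_digits_def)
      ultimately show ?thesis using True by (simp add: indicator_def)
    qed
  next
    case False
    then show ?thesis using sub[of x] y by (auto simp: indicator_def)
  qed
qed

lemma wal_shift:
  fixes x :: "real ^ 'n::finite"
  assumes l: "l \<ge> 1" and A: "finite A" "(j, l) \<in> A" and d: "xdigit (x $ j) l = 0"
  shows "wal A (x + axis j (1 / 2 ^ l)) = - wal A x"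
proof -
  have c: "(x + axis j (1 / 2 ^ l)) $ i = (if i = j then x $ j + 1 / 2 ^ l else x $ i)" for i
    by (simp add: axis_def)
  have s: "wal A y = (-1) ^ xdigit (y $ j) l * (\<Prod>a\<in>A - {(j, l)}. (-1) ^ xdigit (y $ fst a) (snd a))" for y :: "real ^ 'n"
    unfolding wal_def using A by (simp add: prod.remove[of A "(j, l)"])
  have "(\<Prod>a\<in>A - {(j, l)}. (-1) ^ xdigit ((x + axis j (1 / 2 ^ l)) $ fst a) (snd a))
      = (\<Prod>a\<in>A - {(j, l)}. (-1) ^ xdigit (x $ fst a) (snd a) :: real)"
  proof (intro prod.cong refl)
    fix a assume "a \<in> A - {(j, l)}"
    then show "(-1) ^ xdigit ((x + axis j (1 / 2 ^ l)) $ fst a) (snd a) = ((-1) ^ xdigit (x $ fst a) (snd a) :: real)"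
      unfolding c using xdigit_shift[OF l d, of "snd a"] by (cases a) auto
  qed
  moreover have "xdigit ((x + axis j (1 / 2 ^ l)) $ j) l = 1" unfolding c using xdigit_shift[OF l d, of l] by simp
  ultimately show ?thesis unfolding s[of "x + axis j (1 / 2 ^ l)"] s[of x] using d by simp
qed

lemma integrable_cube_bounded:
  fixes F :: "real ^ 'n::finite \<Rightarrow> real"
  assumes "F \<in> borel_measurable borel" "\<And>x. \<bar>F x\<bar> \<le> M * indicator unit_cube x"
  shows "integrable lborel F"
proof (rule Bochner_Integration.integrable_bound)
  have "integrable lborel (indicator (unit_cube :: (real ^ 'n) set) :: _ \<Rightarrow> real)"
    by (intro integrable_real_indicator) (auto simp: emeasure_unit_cube)
  then show "integrable lborel (\<lambda>x :: real ^ 'n. M * indicator unit_cube x :: real)" by simp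
  show "AE x in lborel. norm (F x) \<le> norm (M * indicator unit_cube x)"
    using assms(2) by (intro AE_I2) (metis abs_ge_self order_trans real_norm_def)
qed (use assms in auto)

lemma cube_bounded:
  fixes g :: "real ^ 'n::finite \<Rightarrow> real"
  assumes "continuous_on unit_cube g"
  obtains M where "M \<ge> 0" "\<And>x. x \<in> unit_cube \<Longrightarrow> \<bar>g x\<bar> \<le> M"
proof -
  have "bounded (g ` unit_cube)" using assms compact_unit_cube compact_continuous_image compact_imp_bounded by blast
  then obtain M where M: "\<forall>y\<in>g ` unit_cube. norm y \<le> M" unfolding bounded_iff by blast
  show thesis by (rule that[of "max M 0"]) (use M in \<open>auto simp: le_max_iff_disj\<close>)
qed

lemma cube_indicator_measurable:
  fixes g :: "real ^ 'n::finite \<Rightarrow> real"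
  assumes "continuous_on unit_cube g"
  shows "(\<lambda>x. indicator unit_cube x * g x) \<in> borel_measurable borel"
  using borel_measurable_continuous_on_indicator[OF unit_cube_sets assms] by simp

text \<open>\<open>\<tau>\<close> accumulates the offsets of the integrations already carried out.
  Admissibility keeps \<open>x + \<tau>\<close> in the closed cube, where alone smoothness is
  assumed.\<close>

definition admissible :: "real ^ 'n::finite \<Rightarrow> ('n \<times> nat) set \<Rightarrow> bool" where
  "admissible \<tau> P \<longleftrightarrow> (\<forall>x\<in>zero_digits P. x + \<tau> \<in> unit_cube)"

definition digit_int :: "(real ^ 'n::finite \<Rightarrow> real) \<Rightarrow> real ^ 'n \<Rightarrow> ('n \<times> nat) set \<Rightarrow> ('n \<times> nat) set \<Rightarrow> real" where
  "digit_int g \<tau> P A = (\<integral>x. indicator (zero_digits P) x * (g (x + \<tau>) * wal A x) \<partial>lborel)"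

lemma digit_int_integrable:
  assumes g: "continuous_on unit_cube g" and P: "finite P" "admissible \<tau> P"
  shows "integrable lborel (\<lambda>x. indicator (zero_digits P) x * (g (x + \<tau>) * wal A x) :: real)"
proof -
  obtain M where M: "M \<ge> 0" "\<And>x. x \<in> unit_cube \<Longrightarrow> \<bar>g x\<bar> \<le> M" using cube_bounded[OF g] by blast
  note [measurable] = zero_digits_sets[OF P(1)] cube_indicator_measurable[OF g]
  \<comment> \<open>Continuity on the cube gives measurability only of \<open>g\<close> times the
    indicator of the cube; by admissibility the extra indicator changes nothing.\<close>
  have eq: "indicator (zero_digits P) x * (g (x + \<tau>) * wal A x)
      = indicator (zero_digits P) x * ((indicator unit_cube (x + \<tau>) * g (x + \<tau>)) * wal A x)" for x
    using P(2) by (auto simp: admissible_def indicator_def)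
  show ?thesis unfolding eq
  proof (rule integrable_cube_bounded)
    show "(\<lambda>x. indicator (zero_digits P) x * ((indicator unit_cube (x + \<tau>) * g (x + \<tau>)) * wal A x)) \<in> borel_measurable borel"
      by measurable
    show "\<bar>indicator (zero_digits P) x * ((indicator unit_cube (x + \<tau>) * g (x + \<tau>)) * wal A x)\<bar> \<le> M * indicator unit_cube x" for x
      using P(2) M zero_digits_subset_cube[of P] by (auto simp: admissible_def indicator_def abs_mult abs_wal)
  qed
qed

lemma smooth_continuous: "smooth_on_cube g \<Longrightarrow> continuous_on unit_cube g"
  unfolding smooth_on_cube_def by (metis iter_partial.simps(1))

lemma iter_partial_append: "iter_partial (xs @ ys) g = iter_partial xs (iter_partial ys g)"
  by (induction xs) auto

lemma smooth_partial: "smooth_on_cube g \<Longrightarrow> smooth_on_cube (partial j g)"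
  unfolding smooth_on_cube_def
proof
  fix js
  assume "\<forall>js. continuous_on unit_cube (iter_partial js g) \<and>
     (\<forall>j. \<forall>x\<in>unit_cube.
        ((\<lambda>t. iter_partial js g (upd x j t)) has_vector_derivative partial j (iter_partial js g) x)
          (at (x $ j) within {0..1}))"
  from this[rule_format, of "js @ [j]"] show "continuous_on unit_cube (iter_partial js (partial j g)) \<and>
     (\<forall>ja. \<forall>x\<in>unit_cube.
        ((\<lambda>t. iter_partial js (partial j g) (upd x ja t)) has_vector_derivative partial ja (iter_partial js (partial j g)) x)
          (at (x $ ja) within {0..1}))"
    by (simp add: iter_partial_append)
qed

lemma axis_segment_cube:
  fixes y :: "real ^ 'n::finite"
  assumes "y \<in> unit_cube" "y + axis j h \<in> unit_cube" "0 \<le> t" "t \<le> h"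
  shows "y + axis j t \<in> unit_cube"
proof -
  have c: "(y + axis j t) $ i = (if i = j then y $ j + t else y $ i)" for i and t :: real
    by (simp add: axis_def)
  show ?thesis using assms unfolding mem_unit_cube c by (smt (verit))
qed

lemma partial_FTC:
  fixes y :: "real ^ 'n::finite"
  assumes g: "smooth_on_cube g" and y: "y \<in> unit_cube" "y + axis j h \<in> unit_cube" and h: "h \<ge> 0"
  shows "(\<integral>t. indicator {0..h} t * partial j g (y + axis j t) \<partial>lborel) = g (y + axis j h) - g y"
proof -
  have c: "(y + axis j t) $ j = y $ j + t" for t by simp
  have u: "upd y j (y $ j + t) = y + axis j t" for t by (simp add: upd_def axis_def vec_eq_iff)
  have uu: "upd (y + axis j t) j s = upd y j s" for t s by (simp add: upd_def axis_def vec_eq_iff)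
  have "(y + axis j h) $ j \<le> 1" "0 \<le> y $ j" using y unfolding mem_unit_cube by blast+
  then have yj: "0 \<le> y $ j" "y $ j + h \<le> 1" unfolding c by auto
  have seg: "y + axis j t \<in> unit_cube" if "0 \<le> t" "t \<le> h" for t
    using axis_segment_cube[OF y] that by auto
  have gd: "((\<lambda>s. g (upd x j s)) has_vector_derivative partial j g x) (at (x $ j) within {0..1})" if "x \<in> unit_cube" for x
    using g that unfolding smooth_on_cube_def by (metis iter_partial.simps(1))
  have "(\<integral>t. indicator {0..h} t *\<^sub>R partial j g (y + axis j t) \<partial>lborel) = g (y + axis j h) - g (y + axis j 0)"
  proof (rule integral_FTC_Icc[OF h])
    fix t assume t: "0 \<le> t" "t \<le> h"
    have "((\<lambda>s. g (upd y j s)) has_vector_derivative partial j g (y + axis j t)) (at (y $ j + t) within {0..1})"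
      using gd[OF seg[OF t]] unfolding uu c .
    then have d: "((\<lambda>s. g (upd y j s)) has_vector_derivative partial j g (y + axis j t)) (at (y $ j + t) within (+) (y $ j) ` {0..h})"
      by (rule has_vector_derivative_within_subset) (use yj in auto)
    have "((+) (y $ j) has_vector_derivative 1) (at t within {0..h})"
      by (auto intro!: derivative_eq_intros)
    from vector_diff_chain_within[OF this d]
    show "((\<lambda>t. g (y + axis j t)) has_vector_derivative partial j g (y + axis j t)) (at t within {0..h})"
      by (simp add: o_def u)
  next
    have "continuous_on unit_cube (partial j g)" using smooth_continuous[OF smooth_partial[OF g]] .
    moreover have "continuous_on {0..h} (\<lambda>t. y + axis j t)"
    proof -
      have eq: "(\<lambda>t. y + axis j t) = (\<lambda>t. y + t *\<^sub>R axis j (1::real))"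
        by (rule ext) (simp add: axis_def vec_eq_iff)
      show ?thesis unfolding eq by (intro continuous_intros)
    qed
    ultimately show "continuous_on {0..h} (\<lambda>t. partial j g (y + axis j t))"
      by (rule continuous_on_compose2) (use seg in auto)
  qed
  moreover have "y + axis j (0::real) = y" by (simp add: axis_def vec_eq_iff)
  ultimately show ?thesis by simp
qed

lemma admissible_step:
  assumes l: "l \<ge> 1" and jl: "(j, l) \<notin> P" and ad: "admissible \<tau> P" and t: "0 \<le> t" "t \<le> 1 / 2 ^ l"
  shows "admissible (\<tau> + axis j t) (insert (j, l) P)"
  unfolding admissible_def
proof
  fix x assume x: "x \<in> zero_digits (insert (j, l) P)"
  then have "x \<in> zero_digits P" by (auto simp: zero_digits_def)
  then have 1: "x + \<tau> \<in> unit_cube" using ad by (simp add: admissible_def)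
  have "x + axis j (1 / 2 ^ l) + \<tau> \<in> unit_cube"
    using ad zero_digits_shift(1)[OF l jl x] by (simp add: admissible_def)
  then have "x + \<tau> + axis j (1 / 2 ^ l) \<in> unit_cube" by (simp add: algebra_simps)
  from axis_segment_cube[OF 1 this t] show "x + (\<tau> + axis j t) \<in> unit_cube" by (simp add: add.assoc)
qed

text \<open>The points with digit \<open>(j, l)\<close> equal to 1 are the shifts by \<open>2 ^ (- l)\<close> of those with digit 0, and the
  Walsh function changes sign under this shift. Hence each digit in \<open>A\<close> replaces \<open>g\<close> by a difference, that
  is, by the integral of a partial derivative over an interval of length \<open>2 ^ (- l)\<close>. This works for
  any order of the derivatives, so their symmetry is not needed.\<close>

lemma digit_int_step:
  fixes g :: "real ^ 'n::finite \<Rightarrow> real"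
  assumes g: "smooth_on_cube g" and l: "l \<ge> 1" and jl: "(j, l) \<notin> P" "(j, l) \<in> A"
    and fin: "finite A" "finite P" and ad: "admissible \<tau> P"
  shows "digit_int g \<tau> P A = - (\<integral>t. indicator {0..1 / 2 ^ l} t * digit_int (partial j g) (\<tau> + axis j t) (insert (j, l) P) A \<partial>lborel)"
proof -
  define h where "h = 1 / (2::real) ^ l"
  have h: "h \<ge> 0" by (simp add: h_def)
  define P' where "P' = insert (j, l) P"
  have finP': "finite P'" using fin by (simp add: P'_def)
  define v where "v = (axis j h :: real ^ 'n)"
  have gc: "continuous_on unit_cube g" by (rule smooth_continuous[OF g])
  have pc: "continuous_on unit_cube (partial j g)" using smooth_continuous[OF smooth_partial[OF g]] .
  note [measurable] = zero_digits_sets[OF finP'] zero_digits_sets[OF fin(2)] cube_indicator_measurable[OF gc] cube_indicator_measurable[OF pc]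
  define F where "F x = (indicator unit_cube (x + \<tau>) * g (x + \<tau>)) * wal A x" for x
  have [measurable]: "F \<in> borel_measurable borel" unfolding F_def by measurable
  have a0: "\<tau> + axis j 0 = \<tau>" by (simp add: axis_def vec_eq_iff)
  have ad0: "admissible \<tau> P'" using admissible_step[OF l jl(1) ad, of 0] unfolding a0 P'_def by simp
  have adh: "admissible (\<tau> + v) P'" using admissible_step[OF l jl(1) ad, of h] by (simp add: P'_def v_def h_def)
  have F1: "indicator (zero_digits P') x * F x = indicator (zero_digits P') x * (g (x + \<tau>) * wal A x)" for x
    using ad0 by (auto simp: F_def admissible_def indicator_def)
  have F2: "indicator (zero_digits P') x * F (x + v) = - (indicator (zero_digits P') x * (g (x + (\<tau> + v)) * wal A x))" for x
  proof (cases "x \<in> zero_digits P'")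
    case True
    then have "wal A (x + v) = - wal A x" unfolding v_def h_def
      by (intro wal_shift l fin jl) (auto simp: zero_digits_def P'_def)
    moreover have "x + v + \<tau> = x + (\<tau> + v)" by (simp add: algebra_simps)
    moreover have "x + (\<tau> + v) \<in> unit_cube" using True adh by (simp add: admissible_def)
    ultimately show ?thesis unfolding F_def by (simp only:) simp
  qed simp
  have i1: "integrable lborel (\<lambda>x. indicator (zero_digits P') x * F x)"
    unfolding F1 by (rule digit_int_integrable[OF gc finP' ad0])
  have i2: "integrable lborel (\<lambda>x. indicator (zero_digits P') x * F (x + v))"
    unfolding F2 by (intro Bochner_Integration.integrable_minus digit_int_integrable[OF gc finP' adh])
  have i3: "integrable lborel (\<lambda>x. indicator (zero_digits P') (x - v) * F x)"
    using integrable_translate[OF i2, of "- v"] by simp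
  have "digit_int g \<tau> P A = (\<integral>x. indicator (zero_digits P) x * F x \<partial>lborel)"
    unfolding digit_int_def
  proof (rule Bochner_Integration.integral_cong[OF refl])
    show "indicator (zero_digits P) x * (g (x + \<tau>) * wal A x) = indicator (zero_digits P) x * F x" for x
      using ad by (auto simp: F_def admissible_def indicator_def)
  qed
  also have "\<dots> = (\<integral>x. indicator (zero_digits P') x * F x + indicator (zero_digits P') (x - v) * F x \<partial>lborel)"
    by (simp only: zero_digits_insert_iff[OF l jl(1)] P'_def[symmetric] v_def h_def distrib_right)
  also have "\<dots> = (\<integral>x. indicator (zero_digits P') x * F x \<partial>lborel) + (\<integral>x. indicator (zero_digits P') (x - v) * F x \<partial>lborel)"
    by (rule Bochner_Integration.integral_add[OF i1 i3])
  also have "(\<integral>x. indicator (zero_digits P') (x - v) * F x \<partial>lborel) = (\<integral>x. indicator (zero_digits P') x * F (x + v) \<partial>lborel)"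
    using integral_translate[of "\<lambda>x. indicator (zero_digits P') (x - v) * F x" v] by simp
  also have "(\<integral>x. indicator (zero_digits P') x * F x \<partial>lborel) + (\<integral>x. indicator (zero_digits P') x * F (x + v) \<partial>lborel)
     = (\<integral>x. indicator (zero_digits P') x * F x + indicator (zero_digits P') x * F (x + v) \<partial>lborel)"
    by (rule Bochner_Integration.integral_add[OF i1 i2, symmetric])
  also have "\<dots> = (\<integral>x. - (\<integral>t. indicator (zero_digits P') x * indicator {0..h} t * (indicator unit_cube (x + \<tau> + axis j t) * partial j g (x + \<tau> + axis j t)) * wal A x \<partial>lborel) \<partial>lborel)"
  proof (rule Bochner_Integration.integral_cong[OF refl])
    fix x
    show "indicator (zero_digits P') x * F x + indicator (zero_digits P') x * F (x + v)
      = - (\<integral>t. indicator (zero_digits P') x * indicator {0..h} t * (indicator unit_cube (x + \<tau> + axis j t) * partial j g (x + \<tau> + axis j t)) * wal A x \<partial>lborel)"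
    proof (cases "x \<in> zero_digits P'")
      case True
      have y: "x + \<tau> \<in> unit_cube" "x + \<tau> + axis j h \<in> unit_cube"
        using True ad0 adh by (auto simp: admissible_def v_def add.assoc)
      have eq: "indicator (zero_digits P') x * indicator {0..h} t * (indicator unit_cube (x + \<tau> + axis j t) * partial j g (x + \<tau> + axis j t)) * wal A x
         = (indicator {0..h} t * partial j g (x + \<tau> + axis j t)) * wal A x" for t
        using True axis_segment_cube[OF y, of t] by (auto simp: indicator_def)
      have "(\<integral>t. indicator (zero_digits P') x * indicator {0..h} t * (indicator unit_cube (x + \<tau> + axis j t) * partial j g (x + \<tau> + axis j t)) * wal A x \<partial>lborel)
         = (g (x + \<tau> + axis j h) - g (x + \<tau>)) * wal A x"
        unfolding eq using partial_FTC[OF g y h] by simp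
      then show ?thesis unfolding F1 F2 using True by (simp add: v_def algebra_simps)
    qed simp
  qed
  also have "\<dots> = - (\<integral>x. (\<integral>t. indicator (zero_digits P') x * indicator {0..h} t * (indicator unit_cube (x + \<tau> + axis j t) * partial j g (x + \<tau> + axis j t)) * wal A x \<partial>lborel) \<partial>lborel)"
    by simp
  also have "(\<integral>x. (\<integral>t. indicator (zero_digits P') x * indicator {0..h} t * (indicator unit_cube (x + \<tau> + axis j t) * partial j g (x + \<tau> + axis j t)) * wal A x \<partial>lborel) \<partial>lborel)
     = (\<integral>t. (\<integral>x. indicator (zero_digits P') x * indicator {0..h} t * (indicator unit_cube (x + \<tau> + axis j t) * partial j g (x + \<tau> + axis j t)) * wal A x \<partial>lborel) \<partial>lborel)"
  proof (rule lborel_pair.Fubini_integral[symmetric])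
    obtain M where M: "M \<ge> 0" "\<And>x. x \<in> unit_cube \<Longrightarrow> \<bar>partial j g x\<bar> \<le> M" using cube_bounded[OF pc] by blast
    define W where "W = (unit_cube :: (real ^ 'n) set) \<times> {0..h}"
    define w where "w = (axis j 1 :: real ^ 'n)"
    have ax: "axis j t = t *\<^sub>R w" for t :: real by (simp add: w_def axis_def vec_eq_iff)
    show "integrable (lborel \<Otimes>\<^sub>M lborel) (\<lambda>(x, t). indicator (zero_digits P') x * indicator {0..h} t * (indicator unit_cube (x + \<tau> + axis j t) * partial j g (x + \<tau> + axis j t)) * wal A x)"
    proof (rule Bochner_Integration.integrable_bound)
      have "emeasure (lborel \<Otimes>\<^sub>M lborel) W = emeasure lborel (unit_cube :: (real ^ 'n) set) * emeasure lborel {0..h}"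
        unfolding W_def by (intro lborel.emeasure_pair_measure_Times) auto
      also have "\<dots> < \<infinity>" by (simp add: emeasure_unit_cube h)
      finally have "integrable (lborel \<Otimes>\<^sub>M lborel) (indicator W :: _ \<Rightarrow> real)"
        by (intro integrable_real_indicator) (auto simp: W_def)
      then show "integrable (lborel \<Otimes>\<^sub>M lborel) (\<lambda>p. M * indicator W p :: real)" by simp
      show "(\<lambda>(x, t). indicator (zero_digits P') x * indicator {0..h} t * (indicator unit_cube (x + \<tau> + axis j t) * partial j g (x + \<tau> + axis j t)) * wal A x) \<in> borel_measurable (lborel \<Otimes>\<^sub>M lborel)"
        unfolding ax by measurable
      show "AE p in lborel \<Otimes>\<^sub>M lborel. norm (case p of (x, t) \<Rightarrow> indicator (zero_digits P') x * indicator {0..h} t * (indicator unit_cube (x + \<tau> + axis j t) * partial j g (x + \<tau> + axis j t)) * wal A x) \<le> norm (M * indicator W p)"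
        using M zero_digits_subset_cube[of P'] by (intro AE_I2) (auto simp: indicator_def W_def abs_mult abs_wal)
    qed
  qed
  also have "\<dots> = (\<integral>t. indicator {0..h} t * digit_int (partial j g) (\<tau> + axis j t) P' A \<partial>lborel)"
  proof (rule Bochner_Integration.integral_cong[OF refl])
    fix t :: real
    show "(\<integral>x. indicator (zero_digits P') x * indicator {0..h} t * (indicator unit_cube (x + \<tau> + axis j t) * partial j g (x + \<tau> + axis j t)) * wal A x \<partial>lborel)
       = indicator {0..h} t * digit_int (partial j g) (\<tau> + axis j t) P' A"
    proof (cases "t \<in> {0..h}")
      case True
      then have "admissible (\<tau> + axis j t) P'" using admissible_step[OF l jl(1) ad, of t] by (simp add: P'_def h_def)
      then have "indicator (zero_digits P') x * indicator {0..h} t * (indicator unit_cube (x + \<tau> + axis j t) * partial j g (x + \<tau> + axis j t)) * wal A x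
         = indicator (zero_digits P') x * (partial j g (x + (\<tau> + axis j t)) * wal A x)" for x
        using True by (auto simp: indicator_def admissible_def add.assoc)
      then have "(\<integral>x. indicator (zero_digits P') x * indicator {0..h} t * (indicator unit_cube (x + \<tau> + axis j t) * partial j g (x + \<tau> + axis j t)) * wal A x \<partial>lborel)
         = digit_int (partial j g) (\<tau> + axis j t) P' A" by (simp only: digit_int_def)
      then show ?thesis using True by simp
    qed simp
  qed
  finally show ?thesis by (simp add: h_def P'_def)
qed

text \<open>The list \<open>ps\<close> fixes the order in which digits are folded. The induction
  removes its last element, since \<open>iter_partial\<close> applies the last derivative first.
  Each integration over \<open>t\<close> contributes the length 2^(-l) of its interval; only at the
  end is the integrand bounded in the L1 norm, its translated domain lying in the cube.\<close>

lemma digit_int_bound: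
  fixes g :: "real ^ 'n::finite \<Rightarrow> real"
  assumes "smooth_on_cube g" "distinct ps" "set ps \<inter> P = {}" "set ps \<union> P = A" "finite A"
    "\<And>a. a \<in> set ps \<Longrightarrow> snd a \<ge> 1" "admissible \<tau> P"
  shows "\<bar>digit_int g \<tau> P A\<bar> \<le> (\<Prod>a\<in>set ps. 1 / 2 ^ snd a) * L1_norm_cube (iter_partial (map fst ps) g)"
  using assms
proof (induction ps arbitrary: g \<tau> P rule: rev_induct)
  case Nil
  then have PA: "P = A" "finite P" by auto
  have gc: "continuous_on unit_cube g" using Nil.prems(1) by (rule smooth_continuous)
  note [measurable] = cube_indicator_measurable[OF gc]
  have int: "integrable lborel (\<lambda>x. indicator unit_cube x * \<bar>g x\<bar>)"
  proof -
    obtain M where M: "M \<ge> 0" "\<And>x. x \<in> unit_cube \<Longrightarrow> \<bar>g x\<bar> \<le> M" using cube_bounded[OF gc] by blast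
    have e: "indicator unit_cube x * \<bar>g x\<bar> = \<bar>indicator unit_cube x * g x\<bar>" for x by (simp add: abs_mult)
    show ?thesis unfolding e
    proof (rule integrable_cube_bounded)
      show "(\<lambda>x. \<bar>indicator unit_cube x * g x\<bar>) \<in> borel_measurable borel" by measurable
      show "\<bar>\<bar>indicator unit_cube x * g x\<bar>\<bar> \<le> M * indicator unit_cube x" for x
        using M by (auto simp: indicator_def)
    qed
  qed
  have "\<bar>digit_int g \<tau> P A\<bar> \<le> (\<integral>x. \<bar>indicator (zero_digits P) x * (g (x + \<tau>) * wal A x)\<bar> \<partial>lborel)"
    unfolding digit_int_def by (rule integral_abs_bound)
  also have "\<dots> \<le> (\<integral>x. indicator unit_cube (x + \<tau>) * \<bar>g (x + \<tau>)\<bar> \<partial>lborel)"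
  proof (rule integral_mono)
    show "integrable lborel (\<lambda>x. \<bar>indicator (zero_digits P) x * (g (x + \<tau>) * wal A x)\<bar>)"
      by (intro integrable_abs digit_int_integrable gc PA Nil.prems)
    show "integrable lborel (\<lambda>x. indicator unit_cube (x + \<tau>) * \<bar>g (x + \<tau>)\<bar>)"
      by (rule integrable_translate[OF int])
    show "\<bar>indicator (zero_digits P) x * (g (x + \<tau>) * wal A x)\<bar> \<le> indicator unit_cube (x + \<tau>) * \<bar>g (x + \<tau>)\<bar>" for x
      using Nil.prems(7) by (auto simp: admissible_def indicator_def abs_mult abs_wal)
  qed
  also have "\<dots> = (\<integral>x. indicator unit_cube x * \<bar>g x\<bar> \<partial>lborel)"
    using borel_measurable_integrable[OF int] by (intro integral_translate) simp
  finally show ?case by (simp add: L1_norm_cube_def set_lebesgue_integral_def)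
next
  case (snoc p ps)
  obtain j l where p: "p = (j, l)" by (cases p)
  define B where "B = (\<Prod>a\<in>set ps. 1 / 2 ^ snd a) * L1_norm_cube (iter_partial (map fst ps) (partial j g))"
  have B: "B \<ge> 0" unfolding B_def L1_norm_cube_def set_lebesgue_integral_def
    by (intro mult_nonneg_nonneg prod_nonneg integral_nonneg_AE AE_I2) auto
  have l: "l \<ge> 1" using snoc.prems(6)[of p] by (simp add: p)
  have jl: "(j, l) \<notin> P" "(j, l) \<in> A" using snoc.prems by (auto simp: p)
  have finP: "finite P" using snoc.prems(4,5) by (metis finite_Un)
  have bd: "\<bar>digit_int (partial j g) (\<tau> + axis j t) (insert (j, l) P) A\<bar> \<le> B" if t: "0 \<le> t" "t \<le> 1 / 2 ^ l" for t
    unfolding B_def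
  proof (rule snoc.IH)
    show "smooth_on_cube (partial j g)" by (rule smooth_partial) fact
    show "admissible (\<tau> + axis j t) (insert (j, l) P)" by (rule admissible_step[OF l jl(1) snoc.prems(7) t])
  qed (use snoc.prems in \<open>auto simp: p\<close>)
  define \<phi> where "\<phi> t = indicator {0..1 / 2 ^ l} t * digit_int (partial j g) (\<tau> + axis j t) (insert (j, l) P) A" for t :: real
  have iB: "integrable lborel (\<lambda>t :: real. B * indicator {0..1 / 2 ^ l} t :: real)" by simp
  have "\<bar>\<integral>t. \<phi> t \<partial>lborel\<bar> \<le> (\<integral>t. B * indicator {0..1 / (2::real) ^ l} t \<partial>lborel)"
  \<comment> \<open>If \<open>\<phi>\<close> is not integrable, its Bochner integral is 0 by
    convention and the bound holds because \<open>B \<ge> 0\<close>; this avoids a proof of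
    measurability in \<open>t\<close>.\<close>
  proof (cases "integrable lborel \<phi>")
    case True
    have "\<bar>\<integral>t. \<phi> t \<partial>lborel\<bar> \<le> (\<integral>t. \<bar>\<phi> t\<bar> \<partial>lborel)" by (rule integral_abs_bound)
    also have "\<dots> \<le> (\<integral>t. B * indicator {0..1 / (2::real) ^ l} t \<partial>lborel)"
      by (rule integral_mono[OF integrable_abs[OF True] iB]) (use bd in \<open>auto simp: \<phi>_def indicator_def\<close>)
    finally show ?thesis .
  next
    case False
    then show ?thesis using B by (simp add: not_integrable_integral_eq)
  qed
  also have "\<dots> = 1 / 2 ^ l * B" by simp
  finally have "\<bar>digit_int g \<tau> P A\<bar> \<le> 1 / 2 ^ l * B"
    using digit_int_step[OF snoc.prems(1) l jl snoc.prems(5) finP snoc.prems(7)] by (simp add: \<phi>_def)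
  also have "\<dots> = (\<Prod>a\<in>set (ps @ [p]). 1 / 2 ^ snd a) * L1_norm_cube (iter_partial (map fst (ps @ [p])) g)"
    using snoc.prems(2) by (simp add: B_def p iter_partial_append)
  finally show ?case .
qed

lemma AE_cube_eq: "AE x in lborel. (indicator unit_cube x :: real) = indicator (zero_digits {} :: (real ^ 'n::finite) set) x"
proof (rule AE_I)
  show "{x \<in> space lborel. (indicator unit_cube x :: real) \<noteq> indicator (zero_digits {} :: (real ^ 'n) set) x} \<subseteq> unit_cube - box 0 One"
  proof
    fix x :: "real ^ 'n" assume "x \<in> {x \<in> space lborel. (indicator unit_cube x :: real) \<noteq> indicator (zero_digits {} :: (real ^ 'n) set) x}"
    then have ne: "(x \<in> unit_cube) \<noteq> (x \<in> zero_digits {})" by (auto simp: indicator_def split: if_splits)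
    with zero_digits_subset_cube have x: "x \<in> unit_cube" "x \<notin> zero_digits {}" by auto
    have "x \<notin> box 0 One"
    proof
      assume "x \<in> box 0 One"
      then have "\<forall>i. 0 < x $ i \<and> x $ i < 1" by (simp only: mem_box_cart One_nth) simp
      then show False using x(2) by (auto simp: zero_digits_def less_imp_le)
    qed
    with x show "x \<in> unit_cube - box 0 One" by simp
  qed
  have sub: "box 0 One \<subseteq> (unit_cube :: (real ^ 'n) set)" by (simp add: unit_cube_def box_subset_cbox)
  have "One \<bullet> b = (1 :: real)" if "b \<in> Basis" for b :: "real ^ 'n" using that by simp
  then have "emeasure lborel (box 0 (One :: real ^ 'n)) = 1" by (subst emeasure_lborel_box) auto
  then show "emeasure lborel (unit_cube - box 0 (One :: real ^ 'n)) = 0"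
    using sub by (subst emeasure_Diff) (auto simp: emeasure_unit_cube)
qed simp

lemma fhat_eq_digit_int:
  assumes "continuous_on unit_cube f"
  shows "fhat f A = digit_int f 0 {} A"
proof -
  have "integrable lborel (\<lambda>x. indicator (zero_digits {}) x * (f x * wal A x) :: real)"
    using digit_int_integrable[OF assms, of "{}" 0 A] zero_digits_subset_cube by (auto simp: admissible_def)
  then have [measurable]: "(\<lambda>x. indicator (zero_digits {}) x * (f x * wal A x) :: real) \<in> borel_measurable lborel"
    by (rule borel_measurable_integrable)
  have eq: "indicator unit_cube x * (f x * wal A x) = (indicator unit_cube x * f x) * wal A x" for x by simp
  note [measurable] = cube_indicator_measurable[OF assms]
  have "(\<integral>x. indicator unit_cube x * (f x * wal A x) \<partial>lborel) = (\<integral>x. indicator (zero_digits {}) x * (f x * wal A x) \<partial>lborel)"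
  proof (rule integral_cong_AE)
    show "(\<lambda>x. indicator unit_cube x * (f x * wal A x)) \<in> borel_measurable lborel" unfolding eq by measurable
    show "AE x in lborel. indicator unit_cube x * (f x * wal A x) = indicator (zero_digits {}) x * (f x * wal A x)"
      using AE_cube_eq by eventually_elim simp
  qed measurable
  then show ?thesis by (simp add: fhat_def digit_int_def set_lebesgue_integral_def)
qed

section \<open>Walsh expansion of the net average\<close>

definition cells :: "('n \<Rightarrow> nat) \<Rightarrow> ('n \<times> nat) set" where
  "cells k = (SIGMA j:UNIV. kappa (k j))"

lemma kappa_eq: "kappa k = Suc ` set_decode k"
proof (rule set_eqI)
  fix l show "l \<in> kappa k \<longleftrightarrow> l \<in> Suc ` set_decode k"
    by (cases l) (auto simp: kappa_def set_decode_def bit_iff_odd)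
qed

lemma finite_kappa [simp]: "finite (kappa k)"
  by (simp add: kappa_eq)

lemma finite_cells: "finite (cells (k :: 'n::finite \<Rightarrow> nat))"
  by (simp add: cells_def)

lemma inj_cells: "inj cells"
proof (rule injI)
  fix k k' :: "'n \<Rightarrow> nat" assume "cells k = cells k'"
  then have "kappa (k j) = kappa (k' j)" for j unfolding cells_def by blast
  then have "set_decode (k j) = set_decode (k' j)" for j by (simp add: kappa_eq inj_image_eq_iff)
  then show "k = k'" by (metis ext set_decode_inverse)
qed

lemma cells_surj:
  assumes "finite (A :: ('n::finite \<times> nat) set)" "A \<subseteq> UNIV \<times> {1..}"
  obtains k where "cells k = A"
proof -
  define k where "k j = set_encode {n. (j, Suc n) \<in> A}" for j
  have fin: "finite {n. (j, Suc n) \<in> A}" for j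
    by (rule finite_vimageI[OF assms(1), of "\<lambda>n. (j, Suc n)", unfolded vimage_def]) (auto simp: inj_def)
  have "cells k = A"
  proof (rule set_eqI)
    fix a :: "'n \<times> nat"
    obtain j l where a: "a = (j, l)" by (cases a)
    show "a \<in> cells k \<longleftrightarrow> a \<in> A"
      using assms(2) fin[of j] by (cases l) (auto simp: a cells_def kappa_eq k_def)
  qed
  then show thesis by (rule that)
qed

lemma cells_range: "cells k \<subseteq> UNIV \<times> {1..}"
  by (auto simp: cells_def kappa_def)

lemma wt_cells: "kappa_norm1 (k :: 'n::finite \<Rightarrow> nat) = wt (cells k)"
  unfolding kappa_norm1_def wt_def cells_def by (simp add: sum.Sigma case_prod_unfold)

lemma card_cells: "kappa_norm0 (k :: 'n::finite \<Rightarrow> nat) = card (cells k)"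
  unfolding kappa_norm0_def cells_def by (simp add: card_SigmaI)

lemma fibre_card_cells: "fibre_card j (cells k) = card (kappa (k j))"
  unfolding fibre_card_def cells_def by simp

lemma walsh_coeff_eq:
  fixes f :: "real ^ 'n::finite \<Rightarrow> real"
  shows "walsh_coeff f k = fhat f (cells k)"
proof -
  have "(\<Prod>j\<in>UNIV. walsh (k j) (x $ j)) = wal (cells k) x" for x :: "real ^ 'n"
    unfolding walsh_def wal_def cells_def
    by (simp add: power_sum prod.Sigma case_prod_unfold)
  then show ?thesis by (simp add: walsh_coeff_def fhat_def)
qed

definition mfac :: "'n::finite set set \<Rightarrow> ('n \<times> nat) set \<Rightarrow> real" where
  "mfac JJ A = Max ((\<lambda>J. \<Prod>j\<in>J. fact (fibre_card j A)) ` JJ)"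

lemma max_fact_eq: "max_fact JJ k = mfac JJ (cells k)"
  by (simp add: max_fact_def mfac_def fibre_card_cells)

lemma cells_Q_set: "cells ` (Q_set N :: ('n::finite \<Rightarrow> nat) set) = Qs N - {{}}"
proof -
  have e: "cells k = {} \<longleftrightarrow> k = (\<lambda>_. 0)" for k :: "'n \<Rightarrow> nat"
  proof -
    have "cells (\<lambda>_::'n. 0) = {}" by (simp add: cells_def kappa_def)
    then show ?thesis by (metis injD[OF inj_cells])
  qed
  show ?thesis
  proof (intro equalityI subsetI)
    fix A assume "A \<in> cells ` (Q_set N :: ('n \<Rightarrow> nat) set)"
    then obtain k where k: "A = cells k" "k \<in> Q_set N" by blast
    then show "A \<in> Qs N - {{}}" using cells_range[of k] finite_cells[of k] by (simp add: Q_set_def Qs_def e wt_cells)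
  next
    fix A :: "('n \<times> nat) set" assume A: "A \<in> Qs N - {{}}"
    then obtain k where "cells k = A" using cells_surj[of A] by (auto simp: Qs_def)
    with A show "A \<in> cells ` (Q_set N :: ('n \<Rightarrow> nat) set)" using e[of k] by (auto simp: Q_set_def Qs_def wt_cells)
  qed
qed

lemma card_Q_set: "card (Q_set N :: ('n::finite \<Rightarrow> nat) set) = card (Qs N - {{} :: ('n \<times> nat) set})"
  unfolding cells_Q_set[symmetric] by (rule card_image[symmetric]) (rule inj_on_subset[OF inj_cells], simp)

lemma card_Q_large:
  "card (Q_large f N c \<beta> JJ) = card {A \<in> Qs N - {{}}. \<bar>fhat f A\<bar> \<ge> c * 2 powr (- real (wt A)) * \<beta> ^ card A * mfac JJ A}"
proof -
  have "cells ` Q_large f N c \<beta> JJ = {A \<in> Qs N - {{}}. \<bar>fhat f A\<bar> \<ge> c * 2 powr (- real (wt A)) * \<beta> ^ card A * mfac JJ A}"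
    unfolding Q_large_def cells_Q_set[symmetric] walsh_coeff_eq wt_cells card_cells max_fact_eq by auto
  moreover have "card (cells ` Q_large f N c \<beta> JJ) = card (Q_large f N c \<beta> JJ)"
    by (rule card_image) (rule inj_on_subset[OF inj_cells], simp)
  ultimately show ?thesis by simp
qed

section \<open>Ordering the digits along a prescribed list of derivatives\<close>

lemma fibre_card_remove:
  assumes "finite A" "(j, l) \<in> A"
  shows "fibre_card i A = (if i = j then 1 else 0) + fibre_card i (A - {(j, l)})"
proof (cases "i = j")
  case True
  have "finite {l. (j, l) \<in> A}"
    by (rule finite_vimageI[OF assms(1), of "\<lambda>l. (j, l)", unfolded vimage_def]) (auto simp: inj_def)
  moreover have "{l'. (j, l') \<in> A - {(j, l)}} = {l. (j, l) \<in> A} - {l}" by auto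
  ultimately show ?thesis using assms True card_Suc_Diff1[of "{l. (j, l) \<in> A}" l] by (simp add: fibre_card_def)
next
  case False
  then have "{l'. (i, l') \<in> A - {(j, l)}} = {l. (i, l) \<in> A}" by auto
  then show ?thesis using False by (simp add: fibre_card_def)
qed

text \<open>\<open>mixed_deriv\<close> takes an unspecified list of coordinates with the right
  multiplicities. Listing the cells of \<open>A\<close> along that very list makes
  \<open>digit_int_bound\<close> produce exactly this derivative.\<close>

lemma enumerate_fibres:
  assumes "finite A" "\<And>j. count_list js j = fibre_card j A"
  obtains ps where "distinct ps" "set ps = A" "map fst ps = js"
  using assms
proof (induction js arbitrary: A thesis)
  case Nil
  have "A = {}"
  proof (rule ccontr)
    assume "A \<noteq> {}"
    then obtain j l where "(j, l) \<in> A" by auto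
    then show False using Nil.prems(3)[of j] fibre_card_remove[OF Nil.prems(2), of j l j] by simp
  qed
  then show ?case using Nil.prems(1)[of "[]"] by simp
next
  case (Cons j js)
  have "fibre_card j A \<noteq> 0" using Cons.prems(3)[of j] by simp
  then have "{l. (j, l) \<in> A} \<noteq> {}" by (metis card.empty fibre_card_def)
  then obtain l where l: "(j, l) \<in> A" by auto
  obtain ps where ps: "distinct ps" "set ps = A - {(j, l)}" "map fst ps = js"
  proof (rule Cons.IH)
    show "finite (A - {(j, l)})" using Cons.prems by simp
    show "count_list js i = fibre_card i (A - {(j, l)})" for i
      using Cons.prems(3)[of i] fibre_card_remove[OF Cons.prems(2) l, of i] by (auto split: if_splits)
  qed
  show ?case by (rule Cons.prems(1)[of "(j, l) # ps"]) (use ps l in auto)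
qed

lemma count_list_enum:
  assumes "distinct ps"
  shows "count_list (map fst ps) j = fibre_card j (set ps)"
  using assms
proof (induction ps)
  case Nil
  then show ?case by (simp add: fibre_card_def)
next
  case (Cons p ps)
  obtain i l where p: "p = (i, l)" by (cases p)
  have "insert p (set ps) - {(i, l)} = set ps" using Cons.prems by (auto simp: p)
  then show ?case using Cons fibre_card_remove[of "insert p (set ps)" i l j] by (simp add: p)
qed

lemma fhat_bound:
  fixes f :: "real ^ 'n::finite \<Rightarrow> real"
  assumes f: "smooth_on_cube f" and A: "finite A" "A \<subseteq> UNIV \<times> {1..}"
  shows "\<bar>fhat f A\<bar> \<le> (1 / 2 ^ wt A) * L1_norm_cube (mixed_deriv f (\<lambda>j. fibre_card j A))"
proof -
  define js where "js = (SOME js. \<forall>j. count_list js j = fibre_card j A)"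
  obtain qs where qs: "set qs = A" "distinct qs" using finite_distinct_list[OF A(1)] by blast
  \<comment> \<open>A list with these multiplicities exists, so the choice operator does return
    one.\<close>
  have "\<forall>j. count_list (map fst qs) j = fibre_card j A" using count_list_enum[OF qs(2)] qs(1) by simp
  then have "\<forall>j. count_list js j = fibre_card j A" unfolding js_def by (rule someI)
  then have cl: "count_list js j = fibre_card j A" for j ..
  obtain ps where ps: "distinct ps" "set ps = A" "map fst ps = js"
    by (rule enumerate_fibres[OF A(1) cl])
  have "admissible 0 ({} :: ('n \<times> nat) set)" using zero_digits_subset_cube by (auto simp: admissible_def)
  then have "\<bar>digit_int f 0 {} A\<bar> \<le> (\<Prod>a\<in>set ps. 1 / 2 ^ snd a) * L1_norm_cube (iter_partial (map fst ps) f)"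
    using ps A by (intro digit_int_bound f) auto
  also have "(\<Prod>a\<in>set ps. 1 / 2 ^ snd a :: real) = 1 / 2 ^ wt A"
    unfolding ps(2) wt_def power_sum prod_dividef by simp
  also have "iter_partial (map fst ps) f = mixed_deriv f (\<lambda>j. fibre_card j A)"
    by (simp add: mixed_deriv_def js_def ps(3))
  finally show ?thesis using fhat_eq_digit_int[OF smooth_continuous[OF f]] by simp
qed

lemma fhat_bound':
  fixes f :: "real ^ 'n::finite \<Rightarrow> real"
  assumes f: "smooth_on_cube f" and A: "finite A" "A \<subseteq> UNIV \<times> {1..}"
    and deriv_bound: "\<And>k::'n \<Rightarrow> nat.
       L1_norm_cube (mixed_deriv f (\<lambda>j. card (kappa (k j)))) \<le> K * \<alpha> ^ kappa_norm0 k * max_fact JJ k"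
  shows "\<bar>fhat f A\<bar> \<le> (1 / 2 ^ wt A) * (K * \<alpha> ^ card A * mfac JJ A)"
proof -
  obtain k where k: "cells k = A" using cells_surj[OF A] .
  have "L1_norm_cube (mixed_deriv f (\<lambda>j. fibre_card j A)) \<le> K * \<alpha> ^ card A * mfac JJ A"
    using deriv_bound[of k] by (simp add: k[symmetric] fibre_card_cells card_cells max_fact_eq)
  then have "(1 / 2 ^ wt A) * L1_norm_cube (mixed_deriv f (\<lambda>j. fibre_card j A)) \<le> (1 / 2 ^ wt A) * (K * \<alpha> ^ card A * mfac JJ A)"
    by (intro mult_left_mono) auto
  with fhat_bound[OF f A] show ?thesis by linarith
qed

text \<open>Orthogonality to constants: the two halves of the cube cut out by one digit of
  \<open>A\<close> contribute opposite values.\<close>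

lemma digit_mean_zero:
  fixes A :: "('n::finite \<times> nat) set"
  assumes A: "finite A" "A \<subseteq> UNIV \<times> {1..}" "A \<noteq> {}"
  shows "(\<integral>x. indicator (zero_digits {}) x * wal A x \<partial>lborel) = 0"
proof -
  obtain j l where jl: "(j, l) \<in> A" using A(3) by auto
  have l: "l \<ge> 1" using A(2) jl by auto
  define P where "P = {(j, l)}"
  define v where "v = (axis j (1 / 2 ^ l) :: real ^ 'n)"
  have [measurable]: "zero_digits P \<in> sets borel" "zero_digits ({} :: ('n \<times> nat) set) \<in> sets borel"
    by (auto intro!: zero_digits_sets simp: P_def)
  have i1: "integrable lborel (\<lambda>x. indicator (zero_digits P) x * wal A x)"
    by (rule integrable_cube_bounded[of _ 1], measurable)
      (use zero_digits_subset_cube[of P] in \<open>auto simp: indicator_def abs_wal\<close>)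
  have sh: "indicator (zero_digits P) x * wal A (x + v) = - (indicator (zero_digits P) x * wal A x)" for x
  proof (cases "x \<in> zero_digits P")
    case True
    then have "wal A (x + v) = - wal A x" unfolding v_def
      by (intro wal_shift l A jl) (auto simp: zero_digits_def P_def)
    then show ?thesis by simp
  qed simp
  have i2: "integrable lborel (\<lambda>x. indicator (zero_digits P) x * wal A (x + v))"
    unfolding sh using i1 by simp
  have i3: "integrable lborel (\<lambda>x. indicator (zero_digits P) (x - v) * wal A x)"
    using integrable_translate[OF i2, of "- v"] by simp
  have "(\<integral>x. indicator (zero_digits {}) x * wal A x \<partial>lborel)
     = (\<integral>x. indicator (zero_digits P) x * wal A x + indicator (zero_digits P) (x - v) * wal A x \<partial>lborel)"
  proof (rule Bochner_Integration.integral_cong[OF refl])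
    show "indicator (zero_digits {}) x * wal A x = indicator (zero_digits P) x * wal A x + indicator (zero_digits P) (x - v) * wal A x" for x
      unfolding P_def v_def using zero_digits_insert_iff[OF l, of j "{}" x] by (simp add: distrib_right)
  qed
  also have "\<dots> = (\<integral>x. indicator (zero_digits P) x * wal A x \<partial>lborel) + (\<integral>x. indicator (zero_digits P) (x - v) * wal A x \<partial>lborel)"
    by (rule Bochner_Integration.integral_add[OF i1 i3])
  also have "(\<integral>x. indicator (zero_digits P) (x - v) * wal A x \<partial>lborel) = (\<integral>x. indicator (zero_digits P) x * wal A (x + v) \<partial>lborel)"
    using integral_translate[of "\<lambda>x. indicator (zero_digits P) (x - v) * wal A x" v] by simp
  also have "\<dots> = - (\<integral>x. indicator (zero_digits P) x * wal A x \<partial>lborel)"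
    unfolding sh by simp
  finally show ?thesis by simp
qed

lemma measure_zero_digits_empty: "(\<integral>x. indicator (zero_digits ({} :: ('n::finite \<times> nat) set)) x \<partial>lborel) = (1::real)"
proof -
  have [measurable]: "zero_digits ({} :: ('n \<times> nat) set) \<in> sets borel" by (intro zero_digits_sets) simp
  have "(\<integral>x. indicator (zero_digits ({} :: ('n \<times> nat) set)) x \<partial>lborel) = (\<integral>x. indicator (unit_cube :: (real ^ 'n) set) x \<partial>lborel :: real)"
  proof (rule integral_cong_AE)
    show "AE x in lborel. indicator (zero_digits ({} :: ('n \<times> nat) set)) x = (indicator unit_cube x :: real)"
      using AE_cube_eq by eventually_elim simp
  qed measurable
  also have "\<dots> = 1" by (simp add: measure_def emeasure_unit_cube)
  finally show ?thesis .
qed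

section \<open>Digit sequences and pointwise convergence of the Walsh series\<close>

lemma floor_digits:
  fixes y :: real
  assumes "0 \<le> y" "y < 1"
  shows "real_of_int \<lfloor>2 ^ n * y\<rfloor> / 2 ^ n = (\<Sum>l=1..n. real (xdigit y l) / 2 ^ l)"
proof (induction n)
  case 0
  have "\<lfloor>y\<rfloor> = 0" using assms by (simp add: floor_eq_iff)
  then show ?case by simp
next
  case (Suc n)
  have "\<lfloor>2 ^ n * y\<rfloor> = \<lfloor>2 ^ Suc n * y\<rfloor> div 2" using floor_coarser[of n "Suc n" y] by simp
  then have "\<lfloor>2 ^ Suc n * y\<rfloor> = 2 * \<lfloor>2 ^ n * y\<rfloor> + \<lfloor>2 ^ Suc n * y\<rfloor> mod 2" by simp
  also have "\<lfloor>2 ^ Suc n * y\<rfloor> mod 2 = int (xdigit y (Suc n))" by (simp add: xdigit_def)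
  finally have "real_of_int \<lfloor>2 ^ Suc n * y\<rfloor> = 2 * real_of_int \<lfloor>2 ^ n * y\<rfloor> + real (xdigit y (Suc n))"
    by (metis of_int_add of_int_mult of_int_numeral of_int_of_nat_eq)
  then have "real_of_int \<lfloor>2 ^ Suc n * y\<rfloor> / 2 ^ Suc n = real_of_int \<lfloor>2 ^ n * y\<rfloor> / 2 ^ n + real (xdigit y (Suc n)) / 2 ^ Suc n"
    by (simp add: add_divide_distrib)
  then show ?case using Suc by simp
qed

definition digit_point :: "('n::finite \<times> nat \<Rightarrow> nat) \<Rightarrow> real ^ 'n" where
  "digit_point \<delta> = (\<chi> j. \<Sum>l. real (\<delta> (j, Suc l)) / 2 ^ Suc l)"

lemma digit_series:
  fixes d :: "nat \<Rightarrow> nat"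
  assumes "\<And>l. d l \<le> 1"
  shows "summable (\<lambda>l. real (d (Suc l)) / 2 ^ Suc l)"
    "(\<Sum>l=1..n. real (d l) / 2 ^ l) \<le> (\<Sum>l. real (d (Suc l)) / 2 ^ Suc l)"
    "(\<Sum>l. real (d (Suc l)) / 2 ^ Suc l) \<le> (\<Sum>l=1..n. real (d l) / 2 ^ l) + 1 / 2 ^ n"
proof -
  have half: "summable (\<lambda>l. 1 / (2::real) ^ Suc l)" "(\<Sum>l. 1 / (2::real) ^ Suc l) = 1"
    using power_half_series by (auto simp: sums_iff power_one_over)
  have le: "real (d l) \<le> 1" for l using assms[of l] by simp
  show s: "summable (\<lambda>l. real (d (Suc l)) / 2 ^ Suc l)"
    by (rule summable_comparison_test[OF _ half(1)]) (use le in \<open>auto simp: divide_right_mono\<close>)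
  have split: "(\<Sum>l. real (d (Suc l)) / 2 ^ Suc l) = (\<Sum>l. real (d (Suc (l + n))) / 2 ^ Suc (l + n)) + (\<Sum>l<n. real (d (Suc l)) / 2 ^ Suc l)"
    by (rule suminf_split_initial_segment[OF s])
  have fs: "(\<Sum>l<n. real (d (Suc l)) / 2 ^ Suc l) = (\<Sum>l=1..n. real (d l) / 2 ^ l)"
    by (rule sum.reindex_bij_witness[of _ "\<lambda>l. l - 1" Suc]) auto
  have s': "summable (\<lambda>l. real (d (Suc (l + n))) / 2 ^ Suc (l + n))"
    using s by (rule summable_ignore_initial_segment)
  have "0 \<le> (\<Sum>l. real (d (Suc (l + n))) / 2 ^ Suc (l + n))" by (rule suminf_nonneg[OF s']) auto
  then show "(\<Sum>l=1..n. real (d l) / 2 ^ l) \<le> (\<Sum>l. real (d (Suc l)) / 2 ^ Suc l)" using split fs by simp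
  have h2: "summable (\<lambda>l. 1 / 2 ^ n * (1 / (2::real) ^ Suc l))" using half(1) by (rule summable_mult)
  have "(\<Sum>l. real (d (Suc (l + n))) / 2 ^ Suc (l + n)) \<le> (\<Sum>l. 1 / 2 ^ n * (1 / (2::real) ^ Suc l))"
    by (rule suminf_le[OF _ s' h2]) (use le in \<open>auto simp: power_add field_simps\<close>)
  also have "\<dots> = 1 / 2 ^ n" using suminf_mult[OF half(1), of "1 / 2 ^ n"] half(2) by simp
  finally show "(\<Sum>l. real (d (Suc l)) / 2 ^ Suc l) \<le> (\<Sum>l=1..n. real (d l) / 2 ^ l) + 1 / 2 ^ n" using split fs by simp
qed

lemma digit_point_in_cube:
  assumes "\<And>a. \<delta> a \<le> 1"
  shows "digit_point \<delta> \<in> unit_cube"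
  unfolding mem_unit_cube
proof (intro allI)
  fix i
  show "0 \<le> digit_point \<delta> $ i \<and> digit_point \<delta> $ i \<le> 1"
    using digit_series(2,3)[of "\<lambda>l. \<delta> (i, l)" 0] assms by (simp add: digit_point_def)
qed

lemma digit_point_close:
  fixes y :: "real ^ 'n::finite"
  assumes d: "\<And>a. \<delta> a \<le> 1" and y: "y \<in> zero_digits {}"
    and m: "\<And>a. a \<in> grid n \<Longrightarrow> xdigit (y $ fst a) (snd a) = \<delta> a"
  shows "dist y (digit_point \<delta>) \<le> real CARD('n) / 2 ^ n"
proof -
  have "\<bar>(y - digit_point \<delta>) $ i\<bar> \<le> 1 / 2 ^ n" for i
  proof -
    have yi: "0 \<le> y $ i" "y $ i < 1" using y by (auto simp: zero_digits_def)
    have "(\<Sum>l=1..n. real (xdigit (y $ i) l) / 2 ^ l) = (\<Sum>l=1..n. real (\<delta> (i, l)) / 2 ^ l)"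
    proof (intro sum.cong refl)
      fix l assume "l \<in> {1..n}"
      then show "real (xdigit (y $ i) l) / 2 ^ l = real (\<delta> (i, l)) / 2 ^ l" using m[of "(i, l)"] by (simp add: grid_def)
    qed
    then have f: "real_of_int \<lfloor>2 ^ n * y $ i\<rfloor> / 2 ^ n = (\<Sum>l=1..n. real (\<delta> (i, l)) / 2 ^ l)" using floor_digits[OF yi] by simp
    have "real_of_int \<lfloor>2 ^ n * y $ i\<rfloor> \<le> 2 ^ n * y $ i" "2 ^ n * y $ i \<le> real_of_int \<lfloor>2 ^ n * y $ i\<rfloor> + 1" by linarith+
    then have "real_of_int \<lfloor>2 ^ n * y $ i\<rfloor> / 2 ^ n \<le> y $ i" "y $ i \<le> real_of_int \<lfloor>2 ^ n * y $ i\<rfloor> / 2 ^ n + 1 / 2 ^ n"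
      by (simp_all add: field_simps)
    moreover have "(\<Sum>l=1..n. real (\<delta> (i, l)) / 2 ^ l) \<le> digit_point \<delta> $ i" "digit_point \<delta> $ i \<le> (\<Sum>l=1..n. real (\<delta> (i, l)) / 2 ^ l) + 1 / 2 ^ n"
      using digit_series(2,3)[of "\<lambda>l. \<delta> (i, l)" n] d by (simp_all add: digit_point_def)
    ultimately have "\<bar>y $ i - digit_point \<delta> $ i\<bar> \<le> 1 / 2 ^ n" using f by linarith
    then show ?thesis by simp
  qed
  then have "(\<Sum>i\<in>UNIV. \<bar>(y - digit_point \<delta>) $ i\<bar>) \<le> (\<Sum>i\<in>(UNIV :: 'n set). 1 / 2 ^ n)" by (intro sum_mono)
  also have "\<dots> = real CARD('n) / 2 ^ n" by simp
  finally show ?thesis using norm_le_l1_cart[of "y - digit_point \<delta>"] by (simp add: dist_norm)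
qed

text \<open>\<open>\<rho>\<close> is the Dirichlet kernel of the Walsh system: it equals
  \<open>2 ^ card (grid n)\<close> on the dyadic cell with digits \<open>\<delta>\<close> and 0
  elsewhere on the cube, and has integral 1. So the error of the partial sum inherits the bound on
  the oscillation of \<open>f\<close> on that cell.\<close>

lemma walsh_partial_sum:
  fixes f :: "real ^ 'n::finite \<Rightarrow> real"
  assumes f: "continuous_on unit_cube f" and d: "\<And>a. \<delta> a \<le> 1"
    and e: "\<And>y. y \<in> zero_digits {} \<Longrightarrow> (\<And>a. a \<in> grid n \<Longrightarrow> xdigit (y $ fst a) (snd a) = \<delta> a) \<Longrightarrow> \<bar>f y - f (digit_point \<delta>)\<bar> \<le> \<epsilon>"
  shows "\<bar>(\<Sum>A\<in>Pow (grid n). fhat f A * (\<Prod>a\<in>A. (-1) ^ \<delta> a)) - f (digit_point \<delta>)\<bar> \<le> \<epsilon>"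
proof -
  define H where "H = (zero_digits {} :: (real ^ 'n) set)"
  define G where "G = (grid n :: ('n \<times> nat) set)"
  have fG: "finite G" by (simp add: G_def)
  define \<rho> where "\<rho> y = (\<Prod>a\<in>G. 1 + (-1) ^ \<delta> a * (-1) ^ xdigit (y $ fst a) (snd a) :: real)" for y
  define z where "z = f (digit_point \<delta>)"
  have ad: "admissible 0 ({} :: ('n \<times> nat) set)" using zero_digits_subset_cube by (auto simp: admissible_def)
  have exp: "\<rho> y = (\<Sum>A\<in>Pow G. (\<Prod>a\<in>A. (-1) ^ \<delta> a) * wal A y)" for y
    unfolding \<rho>_def wal_def prod.distrib[symmetric] by (rule sum_Pow_prod[OF fG, symmetric])
  have fi: "integrable lborel (\<lambda>x. indicator H x * (g x * wal A x))" if "continuous_on unit_cube g" for g :: "real ^ 'n \<Rightarrow> real" and A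
    using digit_int_integrable[OF that _ ad] by (simp add: H_def)
  have sum_int: "(\<Sum>A\<in>Pow G. (\<Prod>a\<in>A. (-1) ^ \<delta> a) * (\<integral>x. indicator H x * (g x * wal A x) \<partial>lborel)) = (\<integral>x. indicator H x * (g x * \<rho> x) \<partial>lborel)"
    and int: "integrable lborel (\<lambda>x. indicator H x * (g x * \<rho> x))"
    if g: "continuous_on unit_cube g" for g :: "real ^ 'n \<Rightarrow> real"
  proof -
    have eq: "indicator H x * (g x * \<rho> x) = (\<Sum>A\<in>Pow G. (\<Prod>a\<in>A. (-1) ^ \<delta> a) * (indicator H x * (g x * wal A x)))" for x
      unfolding exp by (simp add: sum_distrib_left mult_ac)
    show "integrable lborel (\<lambda>x. indicator H x * (g x * \<rho> x))" unfolding eq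
      by (intro Bochner_Integration.integrable_sum integrable_mult_right fi[OF g])
    show "(\<Sum>A\<in>Pow G. (\<Prod>a\<in>A. (-1) ^ \<delta> a) * (\<integral>x. indicator H x * (g x * wal A x) \<partial>lborel)) = (\<integral>x. indicator H x * (g x * \<rho> x) \<partial>lborel)"
      unfolding eq by (subst Bochner_Integration.integral_sum) (use fi[OF g] in auto)
  qed
  have one: "(\<integral>x. indicator H x * (1 * \<rho> x) \<partial>lborel) = 1"
  proof -
    have "(\<integral>x. indicator H x * (1 * \<rho> x) \<partial>lborel) = (\<Sum>A\<in>Pow G. (\<Prod>a\<in>A. (-1) ^ \<delta> a) * (\<integral>x. indicator H x * (1 * wal A x) \<partial>lborel))"
      by (rule sum_int[symmetric]) simp
    also have "\<dots> = (\<Sum>A\<in>{{}}. (\<Prod>a\<in>A. (-1) ^ \<delta> a) * (\<integral>x. indicator H x * (1 * wal A x) \<partial>lborel))"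
    proof (rule sum.mono_neutral_right)
      show "\<forall>A\<in>Pow G - {{}}. (\<Prod>a\<in>A. (-1) ^ \<delta> a) * (\<integral>x. indicator H x * (1 * wal A x) \<partial>lborel) = 0"
      proof
        fix A assume A: "A \<in> Pow G - {{}}"
        then have "finite A" "A \<subseteq> UNIV \<times> {1..}" using finite_subset[OF _ fG, of A] by (auto simp: G_def grid_def)
        then show "(\<Prod>a\<in>A. (-1) ^ \<delta> a) * (\<integral>x. indicator H x * (1 * wal A x) \<partial>lborel) = 0"
          using digit_mean_zero[of A] A by (simp add: H_def)
      qed
    qed (use fG in auto)
    also have "\<dots> = 1" using measure_zero_digits_empty[where 'n='n] by (simp add: H_def wal_def)
    finally show ?thesis .
  qed
  have \<rho>0: "0 \<le> \<rho> y" for y unfolding \<rho>_def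
  proof (rule prod_nonneg)
    fix a
    have "(-1) ^ \<delta> a * (-1) ^ xdigit (y $ fst a) (snd a) = (1::real) \<or> (-1) ^ \<delta> a * (-1) ^ xdigit (y $ fst a) (snd a) = (-1::real)"
      using neg_one_even_power neg_one_odd_power by (metis power_add)
    then show "0 \<le> 1 + (-1) ^ \<delta> a * (-1 :: real) ^ xdigit (y $ fst a) (snd a)" by auto
  qed
  have match: "\<bar>f y - z\<bar> \<le> \<epsilon>" if y: "y \<in> H" "\<rho> y \<noteq> 0" for y
    unfolding z_def
  proof (rule e)
    show "y \<in> zero_digits {}" using y by (simp add: H_def)
    fix a :: "'n \<times> nat" assume "a \<in> grid n"
    then have ne: "1 + (-1) ^ \<delta> a * (-1) ^ xdigit (y $ fst a) (snd a) \<noteq> (0::real)"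
      using y(2) fG unfolding \<rho>_def G_def by (simp add: prod_zero_iff)
    have "\<delta> a = 0 \<or> \<delta> a = 1" using d[of a] by linarith
    moreover have "xdigit (y $ fst a) (snd a) = 0 \<or> xdigit (y $ fst a) (snd a) = 1" by (simp add: xdigit_eq)
    ultimately show "xdigit (y $ fst a) (snd a) = \<delta> a" using ne by auto
  qed
  have "(\<Sum>A\<in>Pow G. fhat f A * (\<Prod>a\<in>A. (-1) ^ \<delta> a)) = (\<integral>x. indicator H x * (f x * \<rho> x) \<partial>lborel)"
    unfolding sum_int[OF f, symmetric] by (simp add: fhat_eq_digit_int[OF f] digit_int_def H_def mult.commute)
  moreover have "z = (\<integral>x. indicator H x * (z * \<rho> x) \<partial>lborel)"
  proof -
    have "(\<integral>x. indicator H x * (z * \<rho> x) \<partial>lborel) = (\<integral>x. z * (indicator H x * (1 * \<rho> x)) \<partial>lborel)"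
      by (rule Bochner_Integration.integral_cong) auto
    also have "\<dots> = z * 1" using one by simp
    finally show ?thesis by simp
  qed
  ultimately have "(\<Sum>A\<in>Pow G. fhat f A * (\<Prod>a\<in>A. (-1) ^ \<delta> a)) - z = (\<integral>x. indicator H x * (f x * \<rho> x) \<partial>lborel) - (\<integral>x. indicator H x * (z * \<rho> x) \<partial>lborel)"
    by simp
  also have "\<dots> = (\<integral>x. indicator H x * (f x * \<rho> x) - indicator H x * (z * \<rho> x) \<partial>lborel)"
    by (rule Bochner_Integration.integral_diff[symmetric]) (intro int f continuous_on_const)+
  finally have "\<bar>(\<Sum>A\<in>Pow G. fhat f A * (\<Prod>a\<in>A. (-1) ^ \<delta> a)) - z\<bar> \<le> (\<integral>x. \<bar>indicator H x * (f x * \<rho> x) - indicator H x * (z * \<rho> x)\<bar> \<partial>lborel)"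
    by simp
  also have "\<dots> \<le> (\<integral>x. \<epsilon> * (indicator H x * (1 * \<rho> x)) \<partial>lborel)"
  proof (rule integral_mono)
    show "integrable lborel (\<lambda>x. \<bar>indicator H x * (f x * \<rho> x) - indicator H x * (z * \<rho> x)\<bar>)"
      by (intro integrable_abs Bochner_Integration.integrable_diff int f continuous_on_const)
    show "integrable lborel (\<lambda>x. \<epsilon> * (indicator H x * (1 * \<rho> x)))"
      by (intro integrable_mult_right int continuous_on_const)
    fix x
    show "\<bar>indicator H x * (f x * \<rho> x) - indicator H x * (z * \<rho> x)\<bar> \<le> \<epsilon> * (indicator H x * (1 * \<rho> x))"
    proof (cases "x \<in> H \<and> \<rho> x \<noteq> 0")
      case True
      have "\<bar>f x * \<rho> x - z * \<rho> x\<bar> = \<bar>f x - z\<bar> * \<rho> x" using \<rho>0[of x] by (simp add: abs_mult left_diff_distrib[symmetric])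
      also have "\<dots> \<le> \<epsilon> * \<rho> x" using match[of x] True \<rho>0[of x] by (intro mult_right_mono) auto
      finally show ?thesis using True by simp
    qed auto
  qed
  also have "\<dots> = \<epsilon>" using one by simp
  finally show ?thesis by (simp add: G_def z_def)
qed

text \<open>The partial sum over \<open>grid n\<close> is the mean of \<open>f\<close> over a dyadic cell whose closure contains the point,
  so digit sequences ending in infinitely many ones need no special treatment.\<close>

lemma walsh_series:
  fixes f :: "real ^ 'n::finite \<Rightarrow> real"
  assumes f: "continuous_on unit_cube f" and d: "\<And>a. \<delta> a \<le> 1"
  shows "(\<lambda>n. \<Sum>A\<in>Pow (grid n). fhat f A * (\<Prod>a\<in>A. (-1) ^ \<delta> a)) \<longlonglongrightarrow> f (digit_point \<delta>)"
proof (rule LIMSEQ_I)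
  fix r :: real assume r: "r > 0"
  define x where "x = digit_point \<delta>"
  have x: "x \<in> unit_cube" unfolding x_def by (rule digit_point_in_cube[OF d])
  obtain \<eta> where \<eta>: "\<eta> > 0" "\<And>y. y \<in> unit_cube \<Longrightarrow> dist y x < \<eta> \<Longrightarrow> dist (f y) (f x) < r / 2"
    using f x r unfolding continuous_on_iff by (meson half_gt_zero)
  have "(\<lambda>n. real CARD('n) / 2 ^ n) \<longlonglongrightarrow> 0" by real_asymp
  then have "\<forall>\<^sub>F n in sequentially. real CARD('n) / 2 ^ n < \<eta>" using \<eta>(1) by (rule order_tendstoD(2))
  then obtain n0 where n0: "\<And>n. n \<ge> n0 \<Longrightarrow> real CARD('n) / 2 ^ n < \<eta>" unfolding eventually_sequentially by blast
  show "\<exists>no. \<forall>n\<ge>no. norm ((\<Sum>A\<in>Pow (grid n). fhat f A * (\<Prod>a\<in>A. (-1) ^ \<delta> a)) - f (digit_point \<delta>)) < r"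
  proof (intro exI allI impI)
    fix n assume n: "n \<ge> n0"
    have "\<bar>(\<Sum>A\<in>Pow (grid n). fhat f A * (\<Prod>a\<in>A. (-1) ^ \<delta> a)) - f (digit_point \<delta>)\<bar> \<le> r / 2"
    proof (rule walsh_partial_sum[OF f d])
      fix y :: "real ^ 'n" assume y: "y \<in> zero_digits {}" "\<And>a. a \<in> grid n \<Longrightarrow> xdigit (y $ fst a) (snd a) = \<delta> a"
      have "dist y x < \<eta>" using digit_point_close[where n=n, OF d y] n0[OF n] by (simp add: x_def)
      then show "\<bar>f y - f (digit_point \<delta>)\<bar> \<le> r / 2"
        using \<eta>(2)[of y] y(1) zero_digits_subset_cube[of "{} :: ('n \<times> nat) set"] by (auto simp: dist_real_def x_def less_imp_le)
    qed
    then show "norm ((\<Sum>A\<in>Pow (grid n). fhat f A * (\<Prod>a\<in>A. (-1) ^ \<delta> a)) - f (digit_point \<delta>)) < r" using r by simp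
  qed
qed

text \<open>The numbers below \<open>2 ^ m\<close> enumerate all subsets of \<open>{1..m}\<close> by
  their bits, so this is the expansion of a product; the induction splits off the top bit.\<close>

lemma sum_bits_prod:
  fixes c :: "nat \<Rightarrow> real"
  shows "(\<Sum>i<(2::nat) ^ m. \<Prod>r=1..m. if bit i (r - 1) then c r else 1) = (\<Prod>r=1..m. 1 + c r)"
proof (induction m)
  case (Suc m)
  define g where "g k i = (\<Prod>r=1..k. if bit i (r - 1) then c r else (1::real))" for k and i :: nat
  have lo: "g (Suc m) i = g m i" if "i < 2 ^ m" for i
    using that by (simp add: g_def bit_iff_odd)
  have hi: "g (Suc m) (i + 2 ^ m) = c (Suc m) * g m i" if "i < 2 ^ m" for i
  proof -
    have b: "bit (i + 2 ^ m) r = bit i r" if "r < m" for r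
    proof -
      obtain d where "m = r + Suc d" using \<open>r < m\<close> by (metis add_Suc_right less_imp_Suc_add)
      then have "(2::nat) ^ m = 2 ^ r * (2 * 2 ^ d)" by (simp add: power_add)
      then have "(i + 2 ^ m) div 2 ^ r = 2 * 2 ^ d + i div 2 ^ r" by (simp add: div_plus_div_distrib_dvd_right)
      then show ?thesis by (simp add: bit_iff_odd)
    qed
    have "bit (i + 2 ^ m) m" using that by (simp add: bit_iff_odd)
    moreover have "(\<Prod>r=1..m. if bit (i + 2 ^ m) (r - 1) then c r else 1) = g m i"
      unfolding g_def using b by (intro prod.cong refl) auto
    ultimately show ?thesis by (simp add: g_def mult.commute)
  qed
  have "(\<Sum>i<2 ^ Suc m. g (Suc m) i) = (\<Sum>i<2 ^ m. g (Suc m) i) + (\<Sum>i<2 ^ m. g (Suc m) (i + 2 ^ m))"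
  proof -
    have "(\<Sum>i<2 ^ Suc m. g (Suc m) i) = (\<Sum>i\<in>{0..<2 ^ m} \<union> {2 ^ m..<2 ^ m + 2 ^ m}. g (Suc m) i)"
      by (intro sum.cong) auto
    also have "\<dots> = (\<Sum>i\<in>{0..<2 ^ m}. g (Suc m) i) + (\<Sum>i\<in>{2 ^ m..<2 ^ m + 2 ^ m}. g (Suc m) i)"
      by (rule sum.union_disjoint) auto
    also have "(\<Sum>i\<in>{2 ^ m..<2 ^ m + 2 ^ m}. g (Suc m) i) = (\<Sum>i<2 ^ m. g (Suc m) (i + 2 ^ m))"
      using sum.shift_bounds_nat_ivl[of "g (Suc m)" 0 "2 ^ m" "2 ^ m"] by (simp add: atLeast0LessThan)
    finally show ?thesis by (simp add: atLeast0LessThan)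
  qed
  also have "\<dots> = (\<Sum>i<2 ^ m. (1 + c (Suc m)) * g m i)"
    unfolding sum.distrib[symmetric] by (intro sum.cong refl) (simp add: lo hi algebra_simps)
  also have "\<dots> = (1 + c (Suc m)) * (\<Prod>r=1..m. 1 + c r)"
    using Suc by (simp add: sum_distrib_left[symmetric] g_def)
  finally show ?case by (simp add: g_def mult.commute)
qed simp

text \<open>In the point index \<open>i\<close> the Walsh function is, up to the sign of the shift,
  a character of the group of \<open>m\<close>-digit vectors; its mean is 1 if the character is
  trivial and 0 otherwise.\<close>

lemma net_walsh_average:
  assumes A: "finite A"
  shows "(\<Sum>i<2 ^ m. \<Prod>a\<in>A. (-1) ^ net_digit \<omega> m i (fst a) (snd a)) / 2 ^ m
     = (if in_dual m \<omega> A then shift_sign \<omega> A else 0 :: real)"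
proof -
  have m2: "(-1) ^ (x mod 2) = ((-1) ^ x :: real)" for x :: nat
    by (cases "even x") (auto simp: even_iff_mod_2_eq_zero odd_iff_mod_2_eq_one)
  have ch: "chi (crow r A) \<omega> = (\<Prod>a\<in>A. if \<omega> (Inl (fst a, snd a, r)) then -1 else 1)" for r
    unfolding chi_def crow_def by (subst prod.reindex) (auto simp: inj_on_def prod_eq_iff)
  have sg: "shift_sign \<omega> A = (\<Prod>a\<in>A. if \<omega> (Inr a) then -1 else 1)"
    unfolding shift_sign_def chi_def by (subst prod.reindex) auto
  have "(\<Prod>a\<in>A. (-1) ^ net_digit \<omega> m i (fst a) (snd a)) = shift_sign \<omega> A * (\<Prod>r=1..m. if bit i (r - 1) then chi (crow r A) \<omega> else 1)" for i
  proof -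
    have "(-1) ^ net_digit \<omega> m i (fst a) (snd a) = (if \<omega> (Inr a) then -1 else 1) *
       (\<Prod>r=1..m. if bit i (r - 1) then (if \<omega> (Inl (fst a, snd a, r)) then -1 else 1) else (1::real))" for a
    proof -
      have "(\<Prod>r=1..m. if bit i (r - 1) then (if \<omega> (Inl (fst a, snd a, r)) then -1 else 1) else (1::real))
         = (\<Prod>r\<in>{r \<in> {1..m}. \<omega> (Inl (fst a, snd a, r)) \<and> bit i (r - 1)}. -1)"
        by (rule prod.mono_neutral_cong_right) auto
      then show ?thesis unfolding net_digit_def m2 by (simp add: power_add)
    qed
    then have "(\<Prod>a\<in>A. (-1) ^ net_digit \<omega> m i (fst a) (snd a)) = shift_sign \<omega> A *
       (\<Prod>a\<in>A. \<Prod>r=1..m. if bit i (r - 1) then (if \<omega> (Inl (fst a, snd a, r)) then -1 else 1) else (1::real))"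
      by (simp add: prod.distrib sg)
    also have "(\<Prod>a\<in>A. \<Prod>r=1..m. if bit i (r - 1) then (if \<omega> (Inl (fst a, snd a, r)) then -1 else 1) else (1::real))
       = (\<Prod>r=1..m. \<Prod>a\<in>A. if bit i (r - 1) then (if \<omega> (Inl (fst a, snd a, r)) then -1 else 1) else (1::real))"
      by (rule prod.swap)
    also have "\<dots> = (\<Prod>r=1..m. if bit i (r - 1) then chi (crow r A) \<omega> else 1)"
      by (intro prod.cong refl) (simp add: ch)
    finally show ?thesis .
  qed
  then have "(\<Sum>i<2 ^ m. \<Prod>a\<in>A. (-1) ^ net_digit \<omega> m i (fst a) (snd a)) = shift_sign \<omega> A * (\<Prod>r=1..m. 1 + chi (crow r A) \<omega>)"
    by (simp only: sum_distrib_left[symmetric] sum_bits_prod)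
  also have "(\<Prod>r=1..m. 1 + chi (crow r A) \<omega>) = (if in_dual m \<omega> A then 2 ^ m else 0)"
  proof (cases "in_dual m \<omega> A")
    case True
    then have "(\<Prod>r=1..m. 1 + chi (crow r A) \<omega>) = (\<Prod>r=1..m. 2)" by (intro prod.cong refl) (auto simp: in_dual_def)
    with True show ?thesis by simp
  next
    case False
    then obtain r where "r \<in> {1..m}" "chi (crow r A) \<omega> = -1" using chi_abs unfolding in_dual_def by blast
    then have "\<exists>r\<in>{1..m}. 1 + chi (crow r A) \<omega> = 0" by force
    with False show ?thesis by (simp add: prod_zero_iff)
  qed
  finally show ?thesis by simp
qed

text \<open>Only convergence along the grids is claimed; the estimates of the remainder are
  therefore uniform in \<open>n\<close>.\<close>

lemma mu_hat_series:
  fixes f :: "real ^ 'n::finite \<Rightarrow> real"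
  assumes f: "continuous_on unit_cube f"
  shows "(\<lambda>n. \<Sum>A\<in>Pow (grid n). if in_dual m \<omega> A then fhat f A * shift_sign \<omega> A else 0) \<longlonglongrightarrow> mu_hat f m \<omega>"
proof -
  define \<delta> where "\<delta> i a = net_digit \<omega> m i (fst a) (snd a)" for i :: nat and a :: "'n \<times> nat"
  have d: "\<delta> i a \<le> 1" for i a unfolding \<delta>_def net_digit_def by simp
  have p: "net_point \<omega> m i = digit_point (\<delta> i)" for i
    by (simp add: net_point_def digit_point_def \<delta>_def)
  have "(\<lambda>n. (\<Sum>i<2 ^ m. \<Sum>A\<in>Pow (grid n). fhat f A * (\<Prod>a\<in>A. (-1) ^ \<delta> i a)) / 2 ^ m) \<longlonglongrightarrow> mu_hat f m \<omega>"
    unfolding mu_hat_def p by (intro tendsto_divide tendsto_sum walsh_series f d tendsto_const) simp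
  moreover have "(\<Sum>i<2 ^ m. \<Sum>A\<in>Pow (grid n). fhat f A * (\<Prod>a\<in>A. (-1) ^ \<delta> i a)) / 2 ^ m
     = (\<Sum>A\<in>Pow (grid n). if in_dual m \<omega> A then fhat f A * shift_sign \<omega> A else 0)" for n
  proof -
    have "(\<Sum>i<2 ^ m. \<Sum>A\<in>Pow (grid n). fhat f A * (\<Prod>a\<in>A. (-1) ^ \<delta> i a)) / 2 ^ m
       = (\<Sum>A\<in>Pow (grid n). \<Sum>i<2 ^ m. fhat f A * (\<Prod>a\<in>A. (-1) ^ \<delta> i a)) / 2 ^ m" by (subst sum.swap) simp
    also have "\<dots> = (\<Sum>A\<in>Pow (grid n). fhat f A * ((\<Sum>i<2 ^ m. \<Prod>a\<in>A. (-1) ^ \<delta> i a) / 2 ^ m))"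
      by (simp add: sum_divide_distrib sum_distrib_left)
    also have "\<dots> = (\<Sum>A\<in>Pow (grid n). if in_dual m \<omega> A then fhat f A * shift_sign \<omega> A else 0)"
    proof (intro sum.cong refl)
      fix A assume "A \<in> Pow (grid n :: ('n \<times> nat) set)"
      then have "finite A" using finite_subset[OF _ finite_grid] by auto
      then show "fhat f A * ((\<Sum>i<2 ^ m. \<Prod>a\<in>A. (-1) ^ \<delta> i a) / 2 ^ m) = (if in_dual m \<omega> A then fhat f A * shift_sign \<omega> A else 0)"
        using net_walsh_average[OF \<open>finite A\<close>, where \<omega>=\<omega> and m=m] by (simp add: \<delta>_def)
    qed
    finally show ?thesis .
  qed
  ultimately show ?thesis by simp
qed

lemma mu_hat_measurable [measurable]:
  assumes "continuous_on unit_cube f"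
  shows "mu_hat f m \<in> borel_measurable design"
  by (rule borel_measurable_LIMSEQ_real[OF mu_hat_series[OF assms]]) measurable

section \<open>Linear independence in the dual net\<close>

text \<open>For a finite family, the symmetric difference of all its members.\<close>

definition oddset :: "'a set set \<Rightarrow> 'a set" where
  "oddset I = {x. odd (card {A \<in> I. x \<in> A})}"

definition xor_families :: "'a set set \<Rightarrow> nat \<Rightarrow> 'a set \<Rightarrow> 'a set set set" where
  "xor_families Q r u = {I. I \<subseteq> Q \<and> card I = r \<and> oddset I = u}"

lemma xor_indep_iff: "xor_indep I \<longleftrightarrow> (\<forall>B. B \<subseteq> I \<longrightarrow> B \<noteq> {} \<longrightarrow> oddset B \<noteq> {})"
  by (simp add: xor_indep_def oddset_def)

lemma finite_xor_families: "finite Q \<Longrightarrow> finite (xor_families Q r u)"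
  unfolding xor_families_def by (rule finite_subset[of _ "Pow Q"]) auto

lemma oddset_remove:
  assumes "finite I" "A \<in> I"
  shows "oddset (I - {A}) = {x. (x \<in> oddset I) \<noteq> (x \<in> A)}"
proof (rule set_eqI)
  fix x
  have "{B \<in> I - {A}. x \<in> B} = {B \<in> I. x \<in> B} - {A}" by auto
  moreover have "card ({B \<in> I. x \<in> B} - {A}) = (if x \<in> A then card {B \<in> I. x \<in> B} - 1 else card {B \<in> I. x \<in> B})"
    using assms by (auto simp: card_Diff_singleton)
  moreover have "x \<in> A \<Longrightarrow> card {B \<in> I. x \<in> B} > 0" using assms by (auto simp: card_gt_0_iff)
  ultimately show "x \<in> oddset (I - {A}) \<longleftrightarrow> x \<in> {x. (x \<in> oddset I) \<noteq> (x \<in> A)}"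
    unfolding oddset_def by (auto split: if_splits)
qed

lemma oddset_insert:
  assumes "finite I" "A \<notin> I"
  shows "oddset (insert A I) = {x. (x \<in> A) \<noteq> (x \<in> oddset I)}"
proof -
  have "oddset I = {x. (x \<in> oddset (insert A I)) \<noteq> (x \<in> A)}"
    using oddset_remove[of "insert A I" A] assms by simp
  then show ?thesis by blast
qed

lemma oddset_empty [simp]: "oddset {} = {}"
  by (simp add: oddset_def)

text \<open>Iterating this bound yields the factor \<open>1 / r!\<close> in the number of dependent families.\<close>

lemma card_xor_families_step:
  assumes Q: "finite Q" and b: "\<And>u. card (xor_families Q r u) \<le> b"
  shows "Suc r * card (xor_families Q (Suc r) u) \<le> card Q * b"
proof -
  let ?S = "xor_families Q (Suc r) u"
  let ?v = "\<lambda>A. {x. (x \<in> u) \<noteq> (x \<in> A)}"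
  have fin: "finite I" if "I \<in> ?S" for I using that Q finite_subset by (auto simp: xor_families_def)
  have "Suc r * card ?S = (\<Sum>I\<in>?S. card I)" by (simp add: xor_families_def)
  also have "\<dots> = card (SIGMA I:?S. I)" using fin finite_xor_families[OF Q] by (simp add: card_SigmaI)
  also have "\<dots> \<le> card (SIGMA A:Q. xor_families Q r (?v A))"
  proof (rule card_inj_on_le)
    show "inj_on (\<lambda>(I, A). (A, I - {A})) (SIGMA I:?S. I)"
      by (auto simp: inj_on_def)
    show "(\<lambda>(I, A). (A, I - {A})) ` (SIGMA I:?S. I) \<subseteq> (SIGMA A:Q. xor_families Q r (?v A))"
    proof clarify
      fix I A assume I: "I \<in> ?S" and A: "A \<in> I"
      have "oddset (I - {A}) = ?v A" using oddset_remove[OF fin[OF I] A] I by (simp add: xor_families_def)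
      moreover have "card (I - {A}) = r" using I A fin[OF I] by (simp add: xor_families_def)
      ultimately show "A \<in> Q \<and> I - {A} \<in> xor_families Q r (?v A)" using I A by (auto simp: xor_families_def)
    qed
    show "finite (SIGMA A:Q. xor_families Q r (?v A))" using Q finite_xor_families by blast
  qed
  also have "\<dots> = (\<Sum>A\<in>Q. card (xor_families Q r (?v A)))" using Q finite_xor_families[OF Q] by (simp add: card_SigmaI)
  also have "\<dots> \<le> card Q * b" using sum_bounded_above[of Q "\<lambda>A. card (xor_families Q r (?v A))" b] b by simp
  finally show ?thesis .
qed

text \<open>The induction starts at triples, the smallest dependent families of nonempty sets; the 6
  is the factorial of 3.\<close>

lemma card_xor_families_le:
  assumes Q: "finite Q" and b: "\<And>u. real (card (xor_families Q 3 u)) \<le> \<beta>"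
  shows "real (card (xor_families Q (3 + k) u)) \<le> 6 * \<beta> * real (card Q) ^ k / fact (3 + k)"
proof (induction k arbitrary: u)
  case 0
  then show ?case using b[of u] by (simp add: fact_numeral)
next
  case (Suc k)
  define B where "B = nat \<lfloor>6 * \<beta> * real (card Q) ^ k / fact (3 + k)\<rfloor>"
  have \<beta>: "\<beta> \<ge> 0" using b[of "{}"] by linarith
  have "card (xor_families Q (3 + k) u) \<le> B" for u
    using Suc[of u] by (simp add: B_def le_nat_floor)
  then have "Suc (3 + k) * card (xor_families Q (Suc (3 + k)) u) \<le> card Q * B"
    by (rule card_xor_families_step[OF Q])
  then have "real (Suc (3 + k)) * real (card (xor_families Q (3 + Suc k) u)) \<le> real (card Q) * real B"
    unfolding of_nat_mult[symmetric] of_nat_le_iff by simp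
  also have "real B \<le> 6 * \<beta> * real (card Q) ^ k / fact (3 + k)"
    unfolding B_def using \<beta> by (intro of_nat_floor) auto
  finally have "real (Suc (3 + k)) * real (card (xor_families Q (3 + Suc k) u)) \<le> real (card Q) * (6 * \<beta> * real (card Q) ^ k / fact (3 + k))"
    by (simp add: mult_left_mono)
  moreover have "0 < real (Suc (3 + k))" by simp
  ultimately have "real (card (xor_families Q (3 + Suc k) u)) \<le> real (card Q) * (6 * \<beta> * real (card Q) ^ k / fact (3 + k)) / real (Suc (3 + k))"
    by (simp only: pos_le_divide_eq mult.commute)
  also have "\<dots> = 6 * \<beta> * real (card Q) ^ Suc k / fact (3 + Suc k)"
  proof -
    have F: "(fact (3 + Suc k) :: real) = real (Suc (3 + k)) * fact (3 + k)"
      by (simp only: add_Suc_right fact_Suc)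
    show ?thesis unfolding F by (simp del: of_nat_Suc add: mult_ac)
  qed
  finally show ?case .
qed

text \<open>The third member of a triple is determined by the other two and \<open>u\<close>. The
  superset \<open>Q'\<close> appears because the counting bound concerns all of \<open>Qs N\<close>,
  whereas dual families leave out the empty set.\<close>

lemma card_xor_families_3:
  assumes "finite Q'" "Q \<subseteq> Q'"
  shows "card (xor_families Q 3 u) \<le> card {(A, B). A \<in> Q' \<and> B \<in> Q' \<and> xor3 A B u \<in> Q'}"
proof -
  let ?P = "{(A, B). A \<in> Q' \<and> B \<in> Q' \<and> xor3 A B u \<in> Q'}"
  have "xor_families Q 3 u \<subseteq> (\<lambda>(A, B). {A, B, xor3 A B u}) ` ?P"
  proof
    fix I assume I: "I \<in> xor_families Q 3 u"
    then obtain A B C where ABC: "I = {A, B, C}" "A \<noteq> B" "A \<noteq> C" "B \<noteq> C"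
      unfolding xor_families_def by (auto simp: card_3_iff)
    have "u = oddset {A, B, C}" using I ABC by (simp add: xor_families_def)
    then have u: "u = {x. (x \<in> A) \<noteq> ((x \<in> B) \<noteq> (x \<in> C))}" using ABC by (simp add: oddset_insert)
    have C: "xor3 A B u = C" unfolding u xor3_def by blast
    have "A \<in> Q'" "B \<in> Q'" "C \<in> Q'" using I ABC(1) assms(2) by (auto simp: xor_families_def)
    then have "(A, B) \<in> ?P" using C by simp
    moreover have "I = (\<lambda>(A, B). {A, B, xor3 A B u}) (A, B)" using ABC(1) C by simp
    ultimately show "I \<in> (\<lambda>(A, B). {A, B, xor3 A B u}) ` ?P" by (rule rev_image_eqI)
  qed
  moreover have fin: "finite ?P" by (rule finite_subset[of _ "Q' \<times> Q'"]) (use assms in auto)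
  ultimately have "card (xor_families Q 3 u) \<le> card ((\<lambda>(A, B). {A, B, xor3 A B u}) ` ?P)" by (intro card_mono) auto
  also have "\<dots> \<le> card ?P" using fin by (rule card_image_le)
  finally show ?thesis .
qed

section \<open>Dependent families inside the random dual\<close>

definition dual :: "nat \<Rightarrow> ('n \<times> nat) set set \<Rightarrow> 'n rbits \<Rightarrow> ('n \<times> nat) set set" where
  "dual m Q \<omega> = {A \<in> Q. in_dual m \<omega> A}"

lemma dual_pred:
  fixes Q :: "('n \<times> nat) set set"
  assumes "finite Q"
  shows "Measurable.pred design (\<lambda>\<omega>. P (dual m Q \<omega>))"
proof -
  have eq: "P (dual m Q \<omega>) \<longleftrightarrow> (\<exists>I\<in>{I \<in> Pow Q. P I}. \<forall>A\<in>Q. in_dual m \<omega> A \<longleftrightarrow> A \<in> I)" for \<omega> :: "'n rbits"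
  proof
    assume "P (dual m Q \<omega>)"
    then show "\<exists>I\<in>{I \<in> Pow Q. P I}. \<forall>A\<in>Q. in_dual m \<omega> A \<longleftrightarrow> A \<in> I"
      by (intro bexI[of _ "dual m Q \<omega>"]) (simp_all add: dual_def)
  next
    assume "\<exists>I\<in>{I \<in> Pow Q. P I}. \<forall>A\<in>Q. in_dual m \<omega> A \<longleftrightarrow> A \<in> I"
    then obtain I where I: "I \<subseteq> Q" "P I" "\<forall>A\<in>Q. in_dual m \<omega> A \<longleftrightarrow> A \<in> I" by auto
    then have "dual m Q \<omega> = I" by (auto simp: dual_def)
    with I show "P (dual m Q \<omega>)" by simp
  qed
  have fin: "finite {I \<in> Pow Q. P I}" using assms by simp
  have "Measurable.pred design (\<lambda>\<omega> :: 'n rbits. \<exists>I\<in>{I \<in> Pow Q. P I}. \<forall>A\<in>Q. in_dual m \<omega> A \<longleftrightarrow> A \<in> I)"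
    by (intro pred_intros_finite(3,4) fin assms) measurable
  then show ?thesis by (simp only: eq)
qed

lemma xor_indep_pair:
  assumes "A \<noteq> {}" "B \<noteq> {}" "A \<noteq> B"
  shows "xor_indep {A, B}"
  unfolding xor_indep_iff
proof (intro allI impI)
  fix C assume C: "C \<subseteq> {A, B}" "C \<noteq> {}"
  then have "C = {A} \<or> C = {B} \<or> C = {A, B}" by auto
  moreover have "oddset {A} = A" "oddset {B} = B" "oddset {A, B} = {x. (x \<in> A) \<noteq> (x \<in> B)}"
    using assms(3) by (simp_all add: oddset_insert)
  moreover have "{x. (x \<in> A) \<noteq> (x \<in> B)} \<noteq> {}" using assms(3) by blast
  ultimately show "oddset C \<noteq> {}" using assms(1,2) by metis
qed

lemma xor_indep_single: "A \<noteq> {} \<Longrightarrow> xor_indep {A}"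
  unfolding xor_indep_iff by (auto simp: oddset_insert subset_singleton_iff)

lemma prob_in_dual_single:
  assumes "finite A" "A \<noteq> {}"
  shows "measure design {\<omega>. in_dual m \<omega> A} = 1 / 2 ^ m"
  using prob_in_dual[of "{A}" m] assms xor_indep_single[of A] by simp

text \<open>Union bound over minimal dependent families. Such a family becomes independent when one
  member is dropped, so its probability is at most that of \<open>r - 1\<close> independent
  memberships. Sizes 1 and 2 are impossible for distinct nonempty sets, whence the start at
  3.\<close>

lemma prob_dependent:
  fixes Q :: "('n \<times> nat) set set"
  assumes Q: "finite Q" "\<And>A. A \<in> Q \<Longrightarrow> finite A \<and> A \<noteq> {}"
  shows "measure design {\<omega>. \<not> xor_indep (dual m Q \<omega>)} \<le> (\<Sum>r=3..card Q. real (card (xor_families Q r {})) / 2 ^ (m * (r - 1)))"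
proof -
  interpret D: prob_space "design :: 'n rbits measure" by (rule prob_space_design)
  define MS where "MS r = {B \<in> xor_families Q r {}. \<forall>C. C \<subset> B \<longrightarrow> C \<noteq> {} \<longrightarrow> oddset C \<noteq> {}}" for r
  define E where "E B = {\<omega> :: 'n rbits. \<forall>A\<in>B. in_dual m \<omega> A}" for B
  have finMS: "finite (MS r)" for r unfolding MS_def using finite_xor_families[OF Q(1)] by simp
  have finB: "finite B" if "B \<in> MS r" for B r using that Q finite_subset by (auto simp: MS_def xor_families_def)
  have Em: "E B \<in> sets design" if "finite B" for B
    unfolding E_def by (intro sets_design_Collect pred_intros_finite that) measurable
  have sub: "{\<omega>. \<not> xor_indep (dual m Q \<omega>)} \<subseteq> (\<Union>r\<in>{3..card Q}. \<Union>B\<in>MS r. E B)"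
  proof
    fix \<omega> :: "'n rbits" assume "\<omega> \<in> {\<omega>. \<not> xor_indep (dual m Q \<omega>)}"
    then obtain B0 where B0: "B0 \<subseteq> dual m Q \<omega>" "B0 \<noteq> {}" "oddset B0 = {}" by (auto simp: xor_indep_iff)
    define B where "B = arg_min card (\<lambda>B. B \<subseteq> dual m Q \<omega> \<and> B \<noteq> {} \<and> oddset B = {})"
    have B: "B \<subseteq> dual m Q \<omega>" "B \<noteq> {}" "oddset B = {}"
      using arg_min_natI[of "\<lambda>B. B \<subseteq> dual m Q \<omega> \<and> B \<noteq> {} \<and> oddset B = {}" B0 card] B0 unfolding B_def by auto
    have least: "card B \<le> card C" if "C \<subseteq> dual m Q \<omega>" "C \<noteq> {}" "oddset C = {}" for C
      unfolding B_def using arg_min_nat_le[of "\<lambda>B. B \<subseteq> dual m Q \<omega> \<and> B \<noteq> {} \<and> oddset B = {}" C card] that by auto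
    have BQ: "B \<subseteq> Q" using B by (auto simp: dual_def)
    then have fB: "finite B" using Q finite_subset by auto
    have min: "oddset C \<noteq> {}" if "C \<subset> B" "C \<noteq> {}" for C
    proof
      assume "oddset C = {}"
      then have "card B \<le> card C" using least[of C] that B by auto
      then show False using psubset_card_mono[OF fB that(1)] by simp
    qed
    have "card B \<noteq> 0" using fB B by simp
    moreover have "card B \<noteq> 1"
    proof
      assume "card B = 1"
      then obtain A where A: "B = {A}" by (auto simp: card_1_singleton_iff)
      then have "A = {}" using B(3) by (simp add: oddset_insert)
      then show False using BQ A Q by auto
    qed
    moreover have "card B \<noteq> 2"
    proof
      assume "card B = 2"
      then obtain A A' where A: "B = {A, A'}" "A \<noteq> A'" by (auto simp: card_2_iff)
      then have "\<forall>x. \<not> ((x \<in> A) \<noteq> (x \<in> A'))" using B(3) by (auto simp: oddset_insert)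
      then show False using A by blast
    qed
    ultimately have "3 \<le> card B" by linarith
    moreover have "card B \<le> card Q" using BQ Q by (simp add: card_mono)
    moreover have "B \<in> MS (card B)" using B BQ min by (auto simp: MS_def xor_families_def)
    moreover have "\<omega> \<in> E B" using B by (auto simp: E_def dual_def)
    ultimately show "\<omega> \<in> (\<Union>r\<in>{3..card Q}. \<Union>B\<in>MS r. E B)" by auto
  qed
  have pE: "measure design (E B) \<le> 1 / 2 ^ (m * (r - 1))" if B: "B \<in> MS r" and r: "r \<ge> 3" for B r
  proof -
    have "card B = r" using B by (simp add: MS_def xor_families_def)
    then have "B \<noteq> {}" using r by auto
    then obtain A where A: "A \<in> B" by auto
    have "xor_indep (B - {A})" unfolding xor_indep_iff
    proof (intro allI impI)
      fix C assume "C \<subseteq> B - {A}" "C \<noteq> {}"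
      then show "oddset C \<noteq> {}" using B A by (auto simp: MS_def psubset_eq)
    qed
    then have "measure design (E (B - {A})) = 1 / 2 ^ (m * card (B - {A}))"
      unfolding E_def using B Q finB[OF B] by (intro prob_in_dual) (auto simp: MS_def xor_families_def)
    moreover have "measure design (E B) \<le> measure design (E (B - {A}))"
      using finB[OF B] by (intro D.finite_measure_mono Em) (auto simp: E_def)
    ultimately show ?thesis using A finB[OF B] \<open>card B = r\<close> by simp
  qed
  have "measure design {\<omega>. \<not> xor_indep (dual m Q \<omega>)} \<le> measure design (\<Union>r\<in>{3..card Q}. \<Union>B\<in>MS r. E B)"
    using finMS finB Em by (intro D.finite_measure_mono sub sets.finite_UN) auto
  also have "\<dots> \<le> (\<Sum>r\<in>{3..card Q}. measure design (\<Union>B\<in>MS r. E B))"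
    using finMS finB Em by (intro D.finite_measure_subadditive_finite image_subsetI sets.finite_UN) auto
  also have "\<dots> \<le> (\<Sum>r\<in>{3..card Q}. \<Sum>B\<in>MS r. measure design (E B))"
    using finMS finB Em by (intro sum_mono D.finite_measure_subadditive_finite image_subsetI) auto
  also have "\<dots> \<le> (\<Sum>r\<in>{3..card Q}. \<Sum>B\<in>MS r. 1 / 2 ^ (m * (r - 1)))"
    using pE by (intro sum_mono) auto
  also have "\<dots> \<le> (\<Sum>r=3..card Q. real (card (xor_families Q r {})) / 2 ^ (m * (r - 1)))"
  proof (intro sum_mono)
    fix r
    have "card (MS r) \<le> card (xor_families Q r {})" using finite_xor_families[OF Q(1)] by (intro card_mono) (auto simp: MS_def)
    then show "(\<Sum>B\<in>MS r. 1 / 2 ^ (m * (r - 1))) \<le> real (card (xor_families Q r {})) / 2 ^ (m * (r - 1))"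
      by (simp add: divide_right_mono)
  qed
  finally show ?thesis .
qed

text \<open>The factor \<open>1 / r!\<close> turns the sum over \<open>r\<close> into the
  exponential series of \<open>M\<close>, which bounds \<open>card Q' / 2 ^ m\<close> and thus the
  mean number of nonempty dual members. The proportion \<open>p\<close> of bad pairs will be
  exponentially small in \<open>sqrt N\<close>, so \<open>M\<close> may be a small multiple of
  \<open>m\<close>.\<close>

lemma prob_dependent_le:
  fixes Q :: "('n \<times> nat) set set"
  assumes Q: "finite Q'" "Q \<subseteq> Q'" "\<And>A. A \<in> Q \<Longrightarrow> finite A \<and> A \<noteq> {}"
    and x3: "\<And>u. real (card {(A, B). A \<in> Q' \<and> B \<in> Q' \<and> xor3 A B u \<in> Q'}) \<le> (real (card Q'))\<^sup>2 * p" and p: "p \<ge> 0"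
    and M: "real (card Q') \<le> M * 2 ^ m"
  shows "measure design {\<omega>. \<not> xor_indep (dual m Q \<omega>)} \<le> 6 * p * exp M"
proof -
  have fQ: "finite Q" using Q finite_subset by auto
  define q where "q = real (card Q')"
  have M0: "M \<ge> 0"
  proof -
    have "0 \<le> M * 2 ^ m" using M by linarith
    then show ?thesis using divide_nonneg_pos[of "M * 2 ^ m" "2 ^ m"] by simp
  qed
  have b3: "real (card (xor_families Q 3 u)) \<le> q\<^sup>2 * p" for u
    using card_xor_families_3[OF Q(1,2), of u] x3[of u] by (simp add: q_def)
  have each: "real (card (xor_families Q r {})) / 2 ^ (m * (r - 1)) \<le> 6 * p * (M ^ (r - 1) / fact (r - 1))" if r: "r \<in> {3..card Q}" for r
  proof -
    obtain k where k: "r = 3 + k" using r by (metis atLeastAtMost_iff le_Suc_ex)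
    have "real (card (xor_families Q r {})) \<le> 6 * (q\<^sup>2 * p) * real (card Q) ^ k / fact r"
      unfolding k by (rule card_xor_families_le[OF fQ b3])
    also have "\<dots> \<le> 6 * (q\<^sup>2 * p) * q ^ k / fact (r - 1)"
    proof (intro frac_le mult_left_mono power_mono)
      show "real (card Q) \<le> q" unfolding q_def using card_mono[OF Q(1,2)] by simp
      show "fact (r - 1) \<le> (fact r :: real)" by (rule fact_mono) simp
    qed (use p in \<open>auto simp: q_def\<close>)
    also have "\<dots> = 6 * p * (q ^ (r - 1) / fact (r - 1))"
    proof -
      have "q\<^sup>2 * q ^ k = q ^ (r - 1)" by (simp add: k power_add[symmetric])
      then show ?thesis by (simp add: mult_ac)
    qed
    also have "\<dots> \<le> 6 * p * ((M * 2 ^ m) ^ (r - 1) / fact (r - 1))"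
      using M p by (intro mult_left_mono divide_right_mono power_mono) (auto simp: q_def)
    also have "\<dots> = 6 * p * (M ^ (r - 1) / fact (r - 1)) * 2 ^ (m * (r - 1))"
      by (simp add: power_mult_distrib power_mult)
    finally show ?thesis by (simp add: divide_le_eq)
  qed
  have "measure design {\<omega>. \<not> xor_indep (dual m Q \<omega>)} \<le> (\<Sum>r=3..card Q. real (card (xor_families Q r {})) / 2 ^ (m * (r - 1)))"
    by (rule prob_dependent[OF fQ Q(3)])
  also have "\<dots> \<le> (\<Sum>r=3..card Q. 6 * p * (M ^ (r - 1) / fact (r - 1)))" by (intro sum_mono each)
  also have "\<dots> = 6 * p * (\<Sum>r=3..card Q. M ^ (r - 1) / fact (r - 1))" by (simp add: sum_distrib_left)
  also have "(\<Sum>r=3..card Q. M ^ (r - 1) / fact (r - 1)) = (\<Sum>n\<in>(\<lambda>r. r - 1) ` {3..card Q}. M ^ n / fact n)"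
    by (subst sum.reindex) (auto simp: inj_on_def)
  also have "\<dots> \<le> exp M"
  proof -
    have s: "(\<lambda>n. M ^ n / fact n) sums exp M" using exp_converges[of M] by (simp add: field_simps)
    show ?thesis using sum_le_suminf[OF sums_summable[OF s], of "(\<lambda>r. r - 1) ` {3..card Q}"] sums_unique[OF s] M0 by auto
  qed
  finally show ?thesis using p by (simp add: mult_left_mono)
qed

section \<open>The truncated error\<close>

definition main_sum :: "(('n \<times> nat) set \<Rightarrow> real) \<Rightarrow> nat \<Rightarrow> ('n \<times> nat) set set \<Rightarrow> 'n rbits \<Rightarrow> real" where
  "main_sum a m Q \<omega> = (\<Sum>A\<in>dual m Q \<omega>. a A * shift_sign \<omega> A)"

definition minus_set :: "nat \<Rightarrow> ('n \<times> nat) set set \<Rightarrow> 'n rbits \<Rightarrow> ('n \<times> nat) set set" where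
  "minus_set m Q \<omega> = {A \<in> dual m Q \<omega>. shift_sign \<omega> A = -1}"

lemma main_sum_eq: "main_sum a m Q \<omega> = signed_sum a (dual m Q \<omega>) (minus_set m Q \<omega>)"
  unfolding main_sum_def signed_sum_def
proof (intro sum.cong refl)
  fix A assume "A \<in> dual m Q \<omega>"
  then show "a A * shift_sign \<omega> A = (if A \<in> minus_set m Q \<omega> then - a A else a A)"
    using chi_abs[of "Inr ` A" \<omega>] by (auto simp: minus_set_def shift_sign_def)
qed

text \<open>The dual depends on the matrices only. Hence, given \<open>dual m Q \<omega> = I\<close>
  with \<open>I\<close> independent, the set of negative signs is a uniformly random subset of
  \<open>I\<close>. \<open>\<phi>\<close> is left arbitrary so that symmetry and anticoncentration
  follow from one formula.\<close>

lemma prob_pattern: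
  fixes Q :: "('n \<times> nat) set set"
  assumes Q: "finite Q" "\<And>A. A \<in> Q \<Longrightarrow> finite A" and good: "\<And>I. Good I \<Longrightarrow> xor_indep I"
  shows "{\<omega>. Good (dual m Q \<omega>) \<and> \<phi> (dual m Q \<omega>) (minus_set m Q \<omega>)} \<in> sets design"
    and "measure design {\<omega>. Good (dual m Q \<omega>) \<and> \<phi> (dual m Q \<omega>) (minus_set m Q \<omega>)}
      = (\<Sum>I\<in>{I \<in> Pow Q. Good I}. measure design {\<omega>. dual m Q \<omega> = I} * (real (card {U \<in> Pow I. \<phi> I U}) / 2 ^ card I))"
proof -
  interpret D: prob_space "design :: 'n rbits measure" by (rule prob_space_design)
  define S where "S = (SIGMA I:{I \<in> Pow Q. Good I}. {U \<in> Pow I. \<phi> I U})"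
  define E where "E p = {\<omega> :: 'n rbits. dual m Q \<omega> = fst p \<and> {A \<in> fst p. shift_sign \<omega> A = -1} = snd p}" for p
  have finI: "finite I" if "I \<subseteq> Q" for I using that Q finite_subset by auto
  have finS: "finite S" unfolding S_def using Q finI by (intro finite_SigmaI) auto
  have dp: "Measurable.pred design (\<lambda>\<omega> :: 'n rbits. dual m Q \<omega> = I)" for I
    by (rule dual_pred[OF Q(1), of "\<lambda>X. X = I"])
  have Em: "E p \<in> sets design" if "p \<in> S" for p
  proof -
    have sub: "snd p \<subseteq> fst p" and fin: "finite (fst p)" using that finI by (auto simp: S_def)
    have eq: "{A \<in> fst p. shift_sign \<omega> A = -1} = snd p \<longleftrightarrow> (\<forall>A\<in>fst p. (shift_sign \<omega> A = -1) = (A \<in> snd p))" for \<omega> :: "'n rbits"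
      using sub by blast
    have "Measurable.pred design (\<lambda>\<omega> :: 'n rbits. \<forall>A\<in>fst p. (shift_sign \<omega> A = -1) = (A \<in> snd p))"
      by (intro pred_intros_finite(3) fin) measurable
    then show ?thesis unfolding E_def eq by (intro sets_design_Collect pred_intros_logic dp)
  qed
  have union: "{\<omega>. Good (dual m Q \<omega>) \<and> \<phi> (dual m Q \<omega>) (minus_set m Q \<omega>)} = (\<Union>p\<in>S. E p)"
  proof (intro equalityI subsetI)
    fix \<omega> assume w: "\<omega> \<in> {\<omega>. Good (dual m Q \<omega>) \<and> \<phi> (dual m Q \<omega>) (minus_set m Q \<omega>)}"
    have "(dual m Q \<omega>, minus_set m Q \<omega>) \<in> S" using w by (auto simp: S_def dual_def minus_set_def)
    moreover have "\<omega> \<in> E (dual m Q \<omega>, minus_set m Q \<omega>)" by (simp add: E_def minus_set_def)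
    ultimately show "\<omega> \<in> (\<Union>p\<in>S. E p)" by blast
  next
    fix \<omega> assume "\<omega> \<in> (\<Union>p\<in>S. E p)"
    then obtain I U where p: "(I, U) \<in> S" "\<omega> \<in> E (I, U)" by auto
    then have "dual m Q \<omega> = I" "minus_set m Q \<omega> = U" by (auto simp: E_def minus_set_def)
    with p(1) show "\<omega> \<in> {\<omega>. Good (dual m Q \<omega>) \<and> \<phi> (dual m Q \<omega>) (minus_set m Q \<omega>)}" by (simp add: S_def)
  qed
  show "{\<omega>. Good (dual m Q \<omega>) \<and> \<phi> (dual m Q \<omega>) (minus_set m Q \<omega>)} \<in> sets design"
    unfolding union using finS Em by (intro sets.finite_UN) auto
  have PE: "measure design (E (I, U)) = measure design {\<omega>. dual m Q \<omega> = I} / 2 ^ card I" if "(I, U) \<in> S" for I U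
  proof -
    have IU: "I \<subseteq> Q" "Good I" "U \<subseteq> I" using that by (auto simp: S_def)
    have "measure design {\<omega>. dual m Q \<omega> = I \<and> {A \<in> I. shift_sign \<omega> A = -1} = U} = measure design {\<omega>. dual m Q \<omega> = I} / 2 ^ card I"
    proof (rule prob_shift_pattern)
      fix a and \<omega> :: "'n rbits"
      have "dual m Q (flip (Inr a) \<omega>) = dual m Q \<omega>"
        unfolding dual_def using Q(2) by (auto simp: in_dual_flip_Inr)
      then show "(dual m Q (flip (Inr a) \<omega>) = I) = (dual m Q \<omega> = I)" by (simp only:)
    qed (use IU Q good finI dp in auto)
    then show ?thesis by (simp add: E_def)
  qed
  have "measure design (\<Union>p\<in>S. E p) = (\<Sum>p\<in>S. measure design (E p))"
  proof (rule D.finite_measure_finite_Union[OF finS])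
    show "E ` S \<subseteq> sets design" using Em by auto
    show "disjoint_family_on E S" unfolding disjoint_family_on_def E_def by (auto simp: prod_eq_iff)
  qed
  also have "\<dots> = (\<Sum>(I, U)\<in>S. measure design {\<omega>. dual m Q \<omega> = I} / 2 ^ card I)"
    by (intro sum.cong refl) (auto simp: PE)
  also have "\<dots> = (\<Sum>I\<in>{I \<in> Pow Q. Good I}. \<Sum>U\<in>{U \<in> Pow I. \<phi> I U}. measure design {\<omega>. dual m Q \<omega> = I} / 2 ^ card I)"
    unfolding S_def using Q finI by (subst sum.Sigma) auto
  also have "\<dots> = (\<Sum>I\<in>{I \<in> Pow Q. Good I}. measure design {\<omega>. dual m Q \<omega> = I} * (real (card {U \<in> Pow I. \<phi> I U}) / 2 ^ card I))"
    by (intro sum.cong refl) (simp add: mult.commute)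
  finally show "measure design {\<omega>. Good (dual m Q \<omega>) \<and> \<phi> (dual m Q \<omega>) (minus_set m Q \<omega>)}
      = (\<Sum>I\<in>{I \<in> Pow Q. Good I}. measure design {\<omega>. dual m Q \<omega> = I} * (real (card {U \<in> Pow I. \<phi> I U}) / 2 ^ card I))"
    unfolding union .
qed

lemma prob_dual_sum_le:
  fixes Q :: "('n \<times> nat) set set"
  assumes "finite Q" "F \<subseteq> Pow Q"
  shows "(\<Sum>I\<in>F. measure design {\<omega> :: 'n rbits. dual m Q \<omega> = I}) \<le> 1"
proof -
  interpret D: prob_space "design :: 'n rbits measure" by (rule prob_space_design)
  have fin: "finite F" using assms finite_subset by blast
  have "(\<Sum>I\<in>F. measure design {\<omega> :: 'n rbits. dual m Q \<omega> = I}) = measure design (\<Union>I\<in>F. {\<omega> :: 'n rbits. dual m Q \<omega> = I})"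
  proof (rule D.finite_measure_finite_Union[OF fin, symmetric])
    show "(\<lambda>I. {\<omega> :: 'n rbits. dual m Q \<omega> = I}) ` F \<subseteq> sets design"
      by (intro image_subsetI sets_design_Collect dual_pred[OF assms(1), of "\<lambda>X. X = _"])
    show "disjoint_family_on (\<lambda>I. {\<omega> :: 'n rbits. dual m Q \<omega> = I}) F" by (auto simp: disjoint_family_on_def)
  qed
  also have "\<dots> \<le> 1" by (rule D.prob_le_1)
  finally show ?thesis .
qed

text \<open>Complementing the set of negative signs negates the sum.\<close>

lemma main_sum_symmetric:
  fixes Q :: "('n \<times> nat) set set"
  assumes Q: "finite Q" "\<And>A. A \<in> Q \<Longrightarrow> finite A" and good: "\<And>I. Good I \<Longrightarrow> xor_indep I"
  shows "measure design {\<omega>. Good (dual m Q \<omega>) \<and> main_sum a m Q \<omega> < 0} = measure design {\<omega>. Good (dual m Q \<omega>) \<and> main_sum a m Q \<omega> > 0}"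
proof -
  have "card {U \<in> Pow I. signed_sum a I U < 0} = card {U \<in> Pow I. signed_sum a I U > 0}" for I
    by (rule bij_betw_same_card[of "\<lambda>U. I - U"], rule bij_betw_byWitness[of _ "\<lambda>U. I - U"])
      (auto simp: signed_sum_complement double_diff)
  then show ?thesis unfolding main_sum_eq
    using prob_pattern(2)[OF Q good, where \<phi>="\<lambda>I U. signed_sum a I U < 0" and m=m and Good=Good]
      prob_pattern(2)[OF Q good, where \<phi>="\<lambda>I U. signed_sum a I U > 0" and m=m and Good=Good] by simp
qed

lemma main_sum_anticoncentrated:
  fixes Q :: "('n \<times> nat) set set"
  assumes Q: "finite Q" "\<And>A. A \<in> Q \<Longrightarrow> finite A"
    and good: "\<And>I. Good I \<Longrightarrow> xor_indep I" "\<And>I. Good I \<Longrightarrow> real (card (I \<inter> T)) \<ge> R"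
    and R: "R > 0" and \<tau>: "\<tau> > 0" and big: "\<And>A. A \<in> T \<Longrightarrow> \<bar>a A\<bar> \<ge> \<tau>"
  shows "measure design {\<omega>. Good (dual m Q \<omega>) \<and> \<bar>main_sum a m Q \<omega>\<bar> < \<tau>} \<le> 1 / sqrt R"
proof -
  have "measure design {\<omega>. Good (dual m Q \<omega>) \<and> \<bar>main_sum a m Q \<omega>\<bar> < \<tau>}
     = (\<Sum>I\<in>{I \<in> Pow Q. Good I}. measure design {\<omega>. dual m Q \<omega> = I} * (real (card {U \<in> Pow I. \<bar>signed_sum a I U\<bar> < \<tau>}) / 2 ^ card I))"
    unfolding main_sum_eq by (rule prob_pattern(2)[OF Q good(1)])
  also have "\<dots> \<le> (\<Sum>I\<in>{I \<in> Pow Q. Good I}. measure design {\<omega>. dual m Q \<omega> = I} * (1 / sqrt R))"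
  proof (intro sum_mono mult_left_mono)
    fix I assume I: "I \<in> {I \<in> Pow Q. Good I}"
    have fin: "finite I" using I Q finite_subset by auto
    have cR: "real (card (I \<inter> T)) \<ge> R" using I good by auto
    then have ne: "I \<inter> T \<noteq> {}" using R by auto
    have "real (card {U \<in> Pow I. \<bar>signed_sum a I U\<bar> < \<tau>}) \<le> 2 ^ card I / sqrt (card (I \<inter> T))"
      by (rule Littlewood_Offord[OF fin _ ne \<tau>]) (use big in auto)
    then have "real (card {U \<in> Pow I. \<bar>signed_sum a I U\<bar> < \<tau>}) / 2 ^ card I \<le> 1 / sqrt (card (I \<inter> T))"
      by (simp add: divide_le_eq mult.commute)
    also have "\<dots> \<le> 1 / sqrt R" using cR R by (intro divide_left_mono) auto
    finally show "real (card {U \<in> Pow I. \<bar>signed_sum a I U\<bar> < \<tau>}) / 2 ^ card I \<le> 1 / sqrt R" .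
  qed simp
  also have "\<dots> = (\<Sum>I\<in>{I \<in> Pow Q. Good I}. measure design {\<omega> :: 'n rbits. dual m Q \<omega> = I}) * (1 / sqrt R)"
    by (rule sum_distrib_right[symmetric])
  also have "\<dots> \<le> 1 * (1 / sqrt R)"
    using R by (intro mult_right_mono prob_dual_sum_le Q) auto
  finally show ?thesis by simp
qed

text \<open>Second moment method: two distinct nonempty sets are linearly independent, so
  memberships in the dual are pairwise independent, the variance is at most the mean, and
  Chebyshev's inequality applies.\<close>

lemma prob_few_dual:
  fixes T :: "('n \<times> nat) set set" and m :: nat
  assumes T: "finite T" "\<And>A. A \<in> T \<Longrightarrow> finite A \<and> A \<noteq> {}" "T \<noteq> {}"
  defines "mn \<equiv> real (card T) / 2 ^ m"
  shows "measure design {\<omega>. real (card (dual m T \<omega>)) < mn / 2} \<le> 4 / mn"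
proof -
  interpret D: prob_space "design :: 'n rbits measure" by (rule prob_space_design)
  have l0: "mn > 0" using T by (simp add: mn_def card_gt_0_iff)
  define Z where "Z A = (indicator {\<omega> :: 'n rbits. in_dual m \<omega> A} :: _ \<Rightarrow> real)" for A
  have Zs: "{\<omega> :: 'n rbits. in_dual m \<omega> A} \<in> sets design" for A by (intro sets_design_Collect) measurable
  have Y: "real (card (dual m T \<omega>)) = (\<Sum>A\<in>T. Z A \<omega>)" for \<omega> :: "'n rbits"
  proof -
    have "(\<Sum>A\<in>T. Z A \<omega>) = (\<Sum>A\<in>dual m T \<omega>. 1)"
      using T(1) by (intro sum.mono_neutral_cong_right) (auto simp: dual_def Z_def indicator_def)
    then show ?thesis by simp
  qed
  have Zi: "integrable design (Z A)" for A unfolding Z_def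
    using Zs by (intro integrable_real_indicator) (auto simp: D.emeasure_finite less_top[symmetric])
  have ZZ: "Z A \<omega> * Z B \<omega> = indicator ({\<omega>. in_dual m \<omega> A} \<inter> {\<omega>. in_dual m \<omega> B}) \<omega>" for A B \<omega>
    by (simp add: Z_def indicator_inter_arith)
  have ZZi: "integrable design (\<lambda>\<omega>. Z A \<omega> * Z B \<omega>)" for A B unfolding ZZ
    using Zs by (intro integrable_real_indicator) (auto simp: D.emeasure_finite less_top[symmetric])
  have EZ: "(\<integral>\<omega>. Z A \<omega> \<partial>design) = 1 / 2 ^ m" if "A \<in> T" for A
    using prob_in_dual_single[of A m] T(2)[OF that] Zs by (simp add: Z_def)
  have EZZ: "(\<integral>\<omega>. Z A \<omega> * Z B \<omega> \<partial>design) \<le> (if A = B then 1 / 2 ^ m else 0) + 1 / 2 ^ m * (1 / 2 ^ m)" if "A \<in> T" "B \<in> T" for A B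
  proof (cases "A = B")
    case True
    have "(\<integral>\<omega>. Z A \<omega> * Z A \<omega> \<partial>design) = (\<integral>\<omega>. Z A \<omega> \<partial>design)"
      by (rule Bochner_Integration.integral_cong) (auto simp: Z_def indicator_def)
    then show ?thesis using True EZ[OF that(1)] by simp
  next
    case False
    have "(\<integral>\<omega>. Z A \<omega> * Z B \<omega> \<partial>design) = measure design {\<omega>. \<forall>C\<in>{A, B}. in_dual m \<omega> C}"
    proof -
      have "{\<omega>. in_dual m \<omega> A} \<inter> {\<omega>. in_dual m \<omega> B} = {\<omega>. \<forall>C\<in>{A, B}. in_dual m \<omega> C}" by auto
      then show ?thesis unfolding ZZ using Zs by simp
    qed
    also have "\<dots> = 1 / 2 ^ (m * card {A, B})"
      using T(2) that False by (intro prob_in_dual xor_indep_pair) auto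
    also have "\<dots> = 1 / 2 ^ m * (1 / 2 ^ m)" using False by (simp add: power_add mult_2_right)
    finally show ?thesis using False by simp
  qed
  define V where "V \<omega> = ((\<Sum>A\<in>T. Z A \<omega>) - mn)\<^sup>2" for \<omega>
  have Vexp: "V \<omega> = (\<Sum>A\<in>T. \<Sum>B\<in>T. Z A \<omega> * Z B \<omega>) - 2 * mn * (\<Sum>A\<in>T. Z A \<omega>) + mn\<^sup>2" for \<omega>
    unfolding V_def power2_diff by (simp add: power2_eq_square sum_product)
  have Vi: "integrable design V" unfolding Vexp[abs_def]
    by (intro Bochner_Integration.integrable_add Bochner_Integration.integrable_diff Bochner_Integration.integrable_sum integrable_mult_right ZZi Zi) simp
  have sumZ: "(\<integral>\<omega>. (\<Sum>A\<in>T. Z A \<omega>) \<partial>design) = mn"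
    by (subst Bochner_Integration.integral_sum) (use Zi EZ in \<open>auto simp: mn_def\<close>)
  have "(\<integral>\<omega>. V \<omega> \<partial>design) = (\<integral>\<omega>. (\<Sum>A\<in>T. \<Sum>B\<in>T. Z A \<omega> * Z B \<omega>) \<partial>design) - 2 * mn * (\<integral>\<omega>. (\<Sum>A\<in>T. Z A \<omega>) \<partial>design) + mn\<^sup>2"
  proof -
    have i1: "integrable design (\<lambda>\<omega>. \<Sum>A\<in>T. \<Sum>B\<in>T. Z A \<omega> * Z B \<omega>)" by (intro Bochner_Integration.integrable_sum ZZi)
    have i2: "integrable design (\<lambda>\<omega>. 2 * mn * (\<Sum>A\<in>T. Z A \<omega>))" by (intro Bochner_Integration.integrable_sum integrable_mult_right Zi)
    have u: "measure design (UNIV :: 'n rbits set) = 1" using D.prob_space by simp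
    show ?thesis unfolding Vexp
      by (subst Bochner_Integration.integral_add, (intro Bochner_Integration.integrable_diff i1 i2 | simp)+,
          subst Bochner_Integration.integral_diff[OF i1 i2]) (simp add: u)
  qed
  also have "(\<integral>\<omega>. (\<Sum>A\<in>T. \<Sum>B\<in>T. Z A \<omega> * Z B \<omega>) \<partial>design) = (\<Sum>A\<in>T. \<Sum>B\<in>T. (\<integral>\<omega>. Z A \<omega> * Z B \<omega> \<partial>design))"
    by (subst Bochner_Integration.integral_sum, intro Bochner_Integration.integrable_sum ZZi, intro sum.cong refl Bochner_Integration.integral_sum ZZi)
  also have "\<dots> \<le> (\<Sum>A\<in>T. \<Sum>B\<in>T. (if A = B then 1 / 2 ^ m else 0) + 1 / 2 ^ m * (1 / 2 ^ m))"
    by (intro sum_mono EZZ)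
  also have "\<dots> = mn + mn\<^sup>2"
    using T(1) by (simp add: sum.distrib mn_def power2_eq_square distrib_left)
  finally have EV: "(\<integral>\<omega>. V \<omega> \<partial>design) \<le> mn"
    unfolding sumZ by (simp add: power2_eq_square algebra_simps)
  have sub: "{\<omega>. real (card (dual m T \<omega>)) < mn / 2} \<subseteq> {\<omega> \<in> space design. mn\<^sup>2 / 4 \<le> V \<omega>}"
  proof
    fix \<omega> assume "\<omega> \<in> {\<omega>. real (card (dual m T \<omega>)) < mn / 2}"
    then have "mn / 2 \<le> mn - (\<Sum>A\<in>T. Z A \<omega>)" by (simp add: Y)
    then have "(mn / 2)\<^sup>2 \<le> (mn - (\<Sum>A\<in>T. Z A \<omega>))\<^sup>2" using l0 by (intro power_mono) auto
    then show "\<omega> \<in> {\<omega> \<in> space design. mn\<^sup>2 / 4 \<le> V \<omega>}"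
      unfolding V_def by (simp add: power2_commute power_divide)
  qed
  have Vm: "V \<in> borel_measurable design" using Vi by (rule borel_measurable_integrable)
  have "measure design {\<omega>. real (card (dual m T \<omega>)) < mn / 2} \<le> measure design {\<omega> \<in> space design. mn\<^sup>2 / 4 \<le> V \<omega>}"
    using Vm by (intro D.finite_measure_mono sub) measurable
  also have "\<dots> \<le> (\<integral>\<omega>. V \<omega> \<partial>design) / (mn\<^sup>2 / 4)"
    by (rule integral_Markov_inequality_measure[OF Vi]) (use l0 in \<open>auto simp: V_def\<close>)
  also have "\<dots> \<le> mn / (mn\<^sup>2 / 4)" using EV l0 by (intro divide_right_mono) auto
  also have "\<dots> = 4 / mn" using l0 by (simp add: power2_eq_square)
  finally show ?thesis .
qed

text \<open>Markov's inequality for each \<open>n\<close>, then continuity along the increasing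
  events. The event quantifies over all \<open>n\<close> in order to control the limit of the
  partial sums pointwise.\<close>

lemma prob_tail:
  fixes a :: "('n::finite \<times> nat) set \<Rightarrow> real"
  assumes W: "\<And>n. (\<Sum>A\<in>Pow (grid n) \<inter> Tl. \<bar>a A\<bar>) \<le> W" and Tl: "{} \<notin> Tl" and t: "t > 0"
  shows "{\<omega>. \<exists>n. (\<Sum>A\<in>Pow (grid n) \<inter> Tl. if in_dual m \<omega> A then \<bar>a A\<bar> else 0) \<ge> t} \<in> sets design"
    and "measure design {\<omega>. \<exists>n. (\<Sum>A\<in>Pow (grid n) \<inter> Tl. if in_dual m \<omega> A then \<bar>a A\<bar> else 0) \<ge> t} \<le> W / 2 ^ m / t"
proof -
  interpret D: prob_space "design :: 'n rbits measure" by (rule prob_space_design)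
  define y where "y n \<omega> = (\<Sum>A\<in>Pow (grid n) \<inter> Tl. if in_dual m \<omega> A then \<bar>a A\<bar> else 0)" for n and \<omega> :: "'n rbits"
  define E where "E n = {\<omega>. y n \<omega> \<ge> t}" for n
  have ym[measurable]: "y n \<in> borel_measurable design" for n unfolding y_def by measurable
  have Em: "E n \<in> sets design" for n unfolding E_def by (intro sets_design_Collect) measurable
  have eq: "{\<omega>. \<exists>n. y n \<omega> \<ge> t} = (\<Union>n. E n)" by (auto simp: E_def)
  show "{\<omega>. \<exists>n. (\<Sum>A\<in>Pow (grid n) \<inter> Tl. if in_dual m \<omega> A then \<bar>a A\<bar> else 0) \<ge> t} \<in> sets design"
    using Em unfolding y_def[symmetric] eq by (intro sets.countable_UN) auto
  have fin: "finite (Pow (grid n :: ('n \<times> nat) set) \<inter> Tl)" for n by simp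
  have y_int: "integrable design (\<lambda>\<omega> :: 'n rbits. if in_dual m \<omega> A then \<bar>a A\<bar> else 0)" for A
    by (rule D.integrable_const_bound[of _ "\<bar>a A\<bar>"]) (auto, measurable)
  have Ey: "(\<integral>\<omega>. y n \<omega> \<partial>design) \<le> W / 2 ^ m" for n
  proof -
    have "(\<integral>\<omega>. y n \<omega> \<partial>design) = (\<Sum>A\<in>Pow (grid n) \<inter> Tl. \<integral>\<omega>. (if in_dual m \<omega> A then \<bar>a A\<bar> else 0) \<partial>design)"
      unfolding y_def by (rule Bochner_Integration.integral_sum) (rule y_int)
    also have "\<dots> = (\<Sum>A\<in>Pow (grid n) \<inter> Tl. \<bar>a A\<bar> * (1 / 2 ^ m))"
    proof (intro sum.cong refl)
      fix A assume A: "A \<in> Pow (grid n) \<inter> Tl"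
      then have "finite A" "A \<noteq> {}" using finite_subset[OF _ finite_grid, of A n] Tl by auto
      moreover have "(\<integral>\<omega>. (if in_dual m \<omega> A then \<bar>a A\<bar> else 0) \<partial>design) = (\<integral>\<omega>. \<bar>a A\<bar> * indicator {\<omega>. in_dual m \<omega> A} \<omega> \<partial>design)"
        by (rule Bochner_Integration.integral_cong) (auto simp: indicator_def)
      moreover have "{\<omega> :: 'n rbits. in_dual m \<omega> A} \<in> sets design" by (intro sets_design_Collect) measurable
      ultimately show "(\<integral>\<omega>. (if in_dual m \<omega> A then \<bar>a A\<bar> else 0) \<partial>design) = \<bar>a A\<bar> * (1 / 2 ^ m)"
        using prob_in_dual_single[of A m] by simp
    qed
    also have "\<dots> = (\<Sum>A\<in>Pow (grid n) \<inter> Tl. \<bar>a A\<bar>) / 2 ^ m" by (simp add: sum_divide_distrib)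
    also have "\<dots> \<le> W / 2 ^ m" using W by (intro divide_right_mono) auto
    finally show ?thesis .
  qed
  have PE: "measure design (E n) \<le> W / 2 ^ m / t" for n
  proof -
    have yi: "integrable design (y n)" unfolding y_def by (intro Bochner_Integration.integrable_sum y_int)
    have "measure design {\<omega> \<in> space design. t \<le> y n \<omega>} \<le> (\<integral>\<omega>. y n \<omega> \<partial>design) / t"
      by (rule integral_Markov_inequality_measure[OF yi]) (use t in \<open>auto simp: y_def intro!: sum_nonneg\<close>)
    also have "\<dots> \<le> W / 2 ^ m / t" using Ey t by (intro divide_right_mono) auto
    finally show ?thesis by (simp add: E_def)
  qed
  have "incseq E"
  proof (rule incseq_SucI, rule subsetI)
    fix n \<omega> assume "\<omega> \<in> E n"
    moreover have "y n \<omega> \<le> y (Suc n) \<omega>" unfolding y_def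
      by (intro sum_mono2) (auto simp: grid_def)
    ultimately show "\<omega> \<in> E (Suc n)" by (simp add: E_def)
  qed
  then have "(\<lambda>n. measure design (E n)) \<longlonglongrightarrow> measure design (\<Union>n. E n)"
    using Em by (intro D.finite_Lim_measure_incseq) auto
  then have "measure design (\<Union>n. E n) \<le> W / 2 ^ m / t"
    by (rule LIMSEQ_le_const2) (use PE in auto)
  then show "measure design {\<omega>. \<exists>n. (\<Sum>A\<in>Pow (grid n) \<inter> Tl. if in_dual m \<omega> A then \<bar>a A\<bar> else 0) \<ge> t} \<le> W / 2 ^ m / t"
    unfolding y_def[symmetric] eq .
qed

text \<open>Outside the bad event \<open>Bd\<close> the main sum is at least \<open>\<tau>\<close>
  in absolute value and the remainder at most \<open>\<tau> / 2\<close>, so the error has the sign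
  of the main sum, whose two signs are equally likely on the good event. \<open>At\<close> collects
  sets that are simply required to miss the dual.\<close>

lemma sign_balance:
  fixes f :: "real ^ 'n::finite \<Rightarrow> real"
  assumes f: "continuous_on unit_cube f" and \<mu>: "\<mu> = fhat f {}"
    and Q: "finite Q" "\<And>A. A \<in> Q \<Longrightarrow> finite A \<and> A \<noteq> {} \<and> A \<subseteq> UNIV \<times> {1..}"
    and T: "T \<subseteq> Q" and At: "finite At" "\<And>A. A \<in> At \<Longrightarrow> finite A \<and> A \<noteq> {}"
    and \<tau>: "\<tau> > 0" and big: "\<And>A. A \<in> T \<Longrightarrow> \<bar>fhat f A\<bar> \<ge> \<tau>" and R: "R > 0"
    and W: "\<And>n. (\<Sum>A\<in>Pow (grid n) \<inter> (- (Q \<union> At \<union> {{}})). \<bar>fhat f A\<bar>) \<le> W"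
  shows "\<bar>measure design {\<omega>. mu_hat f m \<omega> < \<mu>} + 1/2 * measure design {\<omega>. mu_hat f m \<omega> = \<mu>} - 1/2\<bar>
    \<le> measure design {\<omega> :: 'n rbits. \<not> xor_indep (dual m Q \<omega>)} + measure design {\<omega> :: 'n rbits. real (card (dual m T \<omega>)) < R}
      + real (card At) / 2 ^ m + W / 2 ^ m / (\<tau> / 2) + 1 / sqrt R"
proof -
  interpret D: prob_space "design :: 'n rbits measure" by (rule prob_space_design)
  note mm[measurable] = mu_hat_measurable[OF f, of m]
  define Good where "Good I \<longleftrightarrow> xor_indep I \<and> real (card (I \<inter> T)) \<ge> R" for I :: "('n \<times> nat) set set"
  define X where "X = main_sum (fhat f) m Q"
  define Tl where "Tl = - (Q \<union> At \<union> {{}})"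
  have Q': "\<And>A. A \<in> Q \<Longrightarrow> finite A" using Q by blast
  have good: "\<And>I. Good I \<Longrightarrow> xor_indep I" "\<And>I. Good I \<Longrightarrow> real (card (I \<inter> T)) \<ge> R" by (auto simp: Good_def)
  define B1 where "B1 = {\<omega> :: 'n rbits. \<not> xor_indep (dual m Q \<omega>)}"
  define B2 where "B2 = {\<omega> :: 'n rbits. real (card (dual m T \<omega>)) < R}"
  define B3 where "B3 = (\<Union>A\<in>At. {\<omega> :: 'n rbits. in_dual m \<omega> A})"
  define B4 where "B4 = {\<omega> :: 'n rbits. \<exists>n. (\<Sum>A\<in>Pow (grid n) \<inter> Tl. if in_dual m \<omega> A then \<bar>fhat f A\<bar> else 0) \<ge> \<tau> / 2}"
  define Sm where "Sm = {\<omega>. Good (dual m Q \<omega>) \<and> \<bar>X \<omega>\<bar> < \<tau>}"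
  define XL where "XL = {\<omega>. Good (dual m Q \<omega>) \<and> X \<omega> < 0}"
  define XG where "XG = {\<omega>. Good (dual m Q \<omega>) \<and> X \<omega> > 0}"
  define Lo where "Lo = {\<omega>. mu_hat f m \<omega> < \<mu>}"
  define Gr where "Gr = {\<omega>. mu_hat f m \<omega> > \<mu>}"
  define Eq where "Eq = {\<omega>. mu_hat f m \<omega> = \<mu>}"
  define Bd where "Bd = Sm \<union> B1 \<union> B2 \<union> B3 \<union> B4"
  have finT: "finite T" using T Q finite_subset by auto
  have Tl0: "{} \<notin> Tl" by (simp add: Tl_def)
  have t2: "\<tau> / 2 > 0" using \<tau> by simp
  have sets: "B1 \<in> sets design" "B2 \<in> sets design" "B3 \<in> sets design" "B4 \<in> sets design" "Sm \<in> sets design"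
    "XL \<in> sets design" "XG \<in> sets design" "Lo \<in> sets design" "Gr \<in> sets design" "Eq \<in> sets design"
  proof -
    show "B1 \<in> sets design" unfolding B1_def by (intro sets_design_Collect dual_pred Q)
    show "B2 \<in> sets design" unfolding B2_def by (intro sets_design_Collect dual_pred finT)
    show "B3 \<in> sets design" unfolding B3_def
      by (intro sets.finite_UN At(1) sets_design_Collect in_dual_measurable)
    show "B4 \<in> sets design" unfolding B4_def by (rule prob_tail(1)[OF W[folded Tl_def] Tl0 t2])
    show "Sm \<in> sets design" unfolding Sm_def X_def main_sum_eq by (rule prob_pattern(1)[OF Q(1) Q' good(1)])
    show "XL \<in> sets design" unfolding XL_def X_def main_sum_eq by (rule prob_pattern(1)[OF Q(1) Q' good(1)])
    show "XG \<in> sets design" unfolding XG_def X_def main_sum_eq by (rule prob_pattern(1)[OF Q(1) Q' good(1)])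
    show "Lo \<in> sets design" unfolding Lo_def by (intro sets_design_Collect) measurable
    show "Gr \<in> sets design" unfolding Gr_def by (intro sets_design_Collect) measurable
    show "Eq \<in> sets design" unfolding Eq_def by (intro sets_design_Collect) measurable
  qed
  have Bds: "Bd \<in> sets design" unfolding Bd_def by (intro sets.Un sets)
  have close: "\<bar>mu_hat f m \<omega> - \<mu> - X \<omega>\<bar> \<le> \<tau> / 2" if w: "\<omega> \<notin> B3" "\<omega> \<notin> B4" for \<omega>
  proof -
    define g where "g A = (if in_dual m \<omega> A then fhat f A * shift_sign \<omega> A else 0)" for A
    \<comment> \<open>A crude height: the weight, hence every level, of a set in \<open>Q\<close> is
      at most this sum.\<close>
    define n0 where "n0 = (\<Sum>A\<in>Q. wt A)"
    have Qn: "Q \<subseteq> Pow (grid n)" if "n \<ge> n0" for n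
    proof
      fix A assume A: "A \<in> Q"
      have "wt A \<le> n0" unfolding n0_def using A Q(1) by (intro member_le_sum) auto
      then have "A \<in> Qs n0" using Q(2)[OF A] by (simp add: Qs_def)
      then show "A \<in> Pow (grid n)" using Qs_eq[OF that] by auto
    qed
    have "\<bar>(\<Sum>A\<in>Pow (grid n). g A) - \<mu> - X \<omega>\<bar> \<le> \<tau> / 2" if n: "n \<ge> n0" for n
    proof -
      let ?P = "Pow (grid n) :: ('n \<times> nat) set set"
      have "(\<Sum>A\<in>?P. g A) = (\<Sum>A\<in>?P - ?P \<inter> Tl. g A) + (\<Sum>A\<in>?P \<inter> Tl. g A)"
        by (intro sum.subset_diff) auto
      also have "(\<Sum>A\<in>?P - ?P \<inter> Tl. g A) = (\<Sum>A\<in>insert {} Q. g A)"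
      proof (rule sum.mono_neutral_right)
        show "insert {} Q \<subseteq> ?P - ?P \<inter> Tl" using Qn[OF n] by (auto simp: Tl_def)
        show "\<forall>A\<in>?P - ?P \<inter> Tl - insert {} Q. g A = 0"
        proof
          fix A assume "A \<in> ?P - ?P \<inter> Tl - insert {} Q"
          then have "A \<in> At" by (auto simp: Tl_def)
          then have "\<not> in_dual m \<omega> A" using w(1) by (auto simp: B3_def)
          then show "g A = 0" by (simp add: g_def)
        qed
      qed simp
      also have "\<dots> = g {} + (\<Sum>A\<in>Q. g A)" using Q by (intro sum.insert) auto
      also have "g {} = \<mu>" by (simp add: g_def \<mu> in_dual_def crow_def chi_def shift_sign_def)
      also have "(\<Sum>A\<in>Q. g A) = X \<omega>" unfolding X_def main_sum_def
        using Q(1) by (intro sum.mono_neutral_cong_right) (auto simp: dual_def g_def)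
      finally have "(\<Sum>A\<in>?P. g A) - \<mu> - X \<omega> = (\<Sum>A\<in>?P \<inter> Tl. g A)" by simp
      also have "\<bar>\<dots>\<bar> \<le> (\<Sum>A\<in>?P \<inter> Tl. \<bar>g A\<bar>)" by (rule sum_abs)
      also have "\<dots> = (\<Sum>A\<in>?P \<inter> Tl. if in_dual m \<omega> A then \<bar>fhat f A\<bar> else 0)"
        by (intro sum.cong refl) (simp add: g_def abs_mult shift_sign_def)
      also have "\<dots> \<le> \<tau> / 2" using w(2) unfolding B4_def by (auto simp: not_le intro: less_imp_le)
      finally show ?thesis .
    qed
    moreover have "(\<lambda>n. \<bar>(\<Sum>A\<in>Pow (grid n). g A) - \<mu> - X \<omega>\<bar>) \<longlonglongrightarrow> \<bar>mu_hat f m \<omega> - \<mu> - X \<omega>\<bar>"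
      unfolding g_def by (intro tendsto_intros mu_hat_series f)
    ultimately show ?thesis by (intro LIMSEQ_le_const2) auto
  qed
  have cases: "\<omega> \<in> Bd \<or> (Good (dual m Q \<omega>) \<and> \<tau> \<le> \<bar>X \<omega>\<bar> \<and> \<bar>mu_hat f m \<omega> - \<mu> - X \<omega>\<bar> \<le> \<tau> / 2)" for \<omega>
  proof (cases "\<omega> \<in> Bd")
    case False
    have "dual m Q \<omega> \<inter> T = dual m T \<omega>" using T by (auto simp: dual_def)
    then have "Good (dual m Q \<omega>)" using False by (simp add: Bd_def B1_def B2_def Good_def)
    moreover have "\<tau> \<le> \<bar>X \<omega>\<bar>" using False calculation by (simp add: Bd_def Sm_def)
    ultimately show ?thesis using close[of \<omega>] False by (simp add: Bd_def)
  qed simp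
  have subs: "Lo \<subseteq> XL \<union> Bd" "XL \<subseteq> Lo \<union> Bd" "Gr \<subseteq> XG \<union> Bd" "XG \<subseteq> Gr \<union> Bd"
  proof -
    have "(\<omega> \<in> Lo \<longleftrightarrow> \<omega> \<in> XL) \<and> (\<omega> \<in> Gr \<longleftrightarrow> \<omega> \<in> XG)" if "\<omega> \<notin> Bd" for \<omega>
    proof -
      have c: "Good (dual m Q \<omega>)" "\<tau> \<le> \<bar>X \<omega>\<bar>" "\<bar>mu_hat f m \<omega> - \<mu> - X \<omega>\<bar> \<le> \<tau> / 2" using cases[of \<omega>] that by auto
      have "mu_hat f m \<omega> < \<mu> \<longleftrightarrow> X \<omega> < 0" "mu_hat f m \<omega> > \<mu> \<longleftrightarrow> X \<omega> > 0" using c(2,3) \<tau> by linarith+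
      then show ?thesis using c(1) by (simp add: Lo_def XL_def Gr_def XG_def)
    qed
    then show "Lo \<subseteq> XL \<union> Bd" "XL \<subseteq> Lo \<union> Bd" "Gr \<subseteq> XG \<union> Bd" "XG \<subseteq> Gr \<union> Bd" by blast+
  qed
  have le: "measure design S \<le> measure design S' + measure design Bd" if "S \<subseteq> S' \<union> Bd" "S' \<in> sets design" for S S'
  proof -
    have "measure design S \<le> measure design (S' \<union> Bd)" using that Bds by (intro D.finite_measure_mono) auto
    also have "\<dots> \<le> measure design S' + measure design Bd" using that Bds by (intro measure_Un_le)
    finally show ?thesis .
  qed
  have sym: "measure design XL = measure design XG"
    unfolding XL_def XG_def X_def by (rule main_sum_symmetric[OF Q(1) Q' good(1)])
  have tot: "measure design Lo + measure design Eq + measure design Gr = 1"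
  proof -
    have "measure design (Lo \<union> Eq \<union> Gr) = measure design (Lo \<union> Eq) + measure design Gr"
      by (intro D.finite_measure_Union sets.Un sets) (auto simp: Lo_def Eq_def Gr_def)
    moreover have "measure design (Lo \<union> Eq) = measure design Lo + measure design Eq"
      by (intro D.finite_measure_Union sets) (auto simp: Lo_def Eq_def Gr_def)
    moreover have "Lo \<union> Eq \<union> Gr = UNIV" by (auto simp: Lo_def Eq_def Gr_def)
    moreover have "measure design (UNIV :: 'n rbits set) = 1" using D.prob_space by simp
    ultimately show ?thesis by simp
  qed
  have "measure design Bd \<le> measure design Sm + measure design B1 + measure design B2 + measure design B3 + measure design B4"
  proof -
    have "measure design Bd \<le> measure design (Sm \<union> B1 \<union> B2 \<union> B3) + measure design B4"
      unfolding Bd_def by (intro measure_Un_le sets.Un sets)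
    moreover have "measure design (Sm \<union> B1 \<union> B2 \<union> B3) \<le> measure design (Sm \<union> B1 \<union> B2) + measure design B3"
      by (intro measure_Un_le sets.Un sets)
    moreover have "measure design (Sm \<union> B1 \<union> B2) \<le> measure design (Sm \<union> B1) + measure design B2"
      by (intro measure_Un_le sets.Un sets)
    moreover have "measure design (Sm \<union> B1) \<le> measure design Sm + measure design B1"
      by (intro measure_Un_le sets.Un sets)
    ultimately show ?thesis by linarith
  qed
  moreover have "measure design Sm \<le> 1 / sqrt R"
    unfolding Sm_def X_def by (rule main_sum_anticoncentrated[OF Q(1) Q' good R \<tau> big])
  moreover have "measure design B3 \<le> real (card At) / 2 ^ m"
  proof -
    have "measure design B3 \<le> (\<Sum>A\<in>At. measure design {\<omega> :: 'n rbits. in_dual m \<omega> A})"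
      unfolding B3_def by (intro D.finite_measure_subadditive_finite At(1) image_subsetI sets_design_Collect in_dual_measurable)
    also have "\<dots> = (\<Sum>A\<in>At. 1 / 2 ^ m)" using At(2) by (intro sum.cong refl prob_in_dual_single) auto
    finally show ?thesis by simp
  qed
  moreover have "measure design B4 \<le> W / 2 ^ m / (\<tau> / 2)"
    unfolding B4_def by (rule prob_tail(2)[OF W[folded Tl_def] Tl0 t2])
  \<comment> \<open>As the three probabilities add up to 1, the left side is half the absolute
    difference of those of \<open>Lo\<close> and \<open>Gr\<close>; each of these differs by at most
    the probability of \<open>Bd\<close> from the common value for \<open>XL\<close> and
    \<open>XG\<close>.\<close>
  moreover have "\<bar>measure design Lo + 1/2 * measure design Eq - 1/2\<bar> \<le> measure design Bd"
    using le[OF subs(1) sets(6)] le[OF subs(2) sets(8)] le[OF subs(3) sets(7)] le[OF subs(4) sets(9)] sym tot by linarith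
  ultimately show ?thesis unfolding Lo_def Eq_def B1_def B2_def by linarith
qed

section \<open>Tail estimates and conclusion\<close>

lemma card_le_sum_nat:
  "finite L \<Longrightarrow> L \<subseteq> {1..} \<Longrightarrow> card L * (card L + 1) \<le> 2 * \<Sum>(L :: nat set)"
proof (induction L rule: finite_linorder_max_induct)
  case (insert b L)
  have "L \<subseteq> {1..<b}" using insert by auto
  then have "card L \<le> card {1..<b}" by (intro card_mono) auto
  moreover have "b \<ge> 1" using insert by auto
  ultimately have "card L + 1 \<le> b" by simp
  moreover have "b \<notin> L" using insert by auto
  ultimately show ?case using insert by (simp add: algebra_simps)
qed simp

lemma finite_fibre: "finite A \<Longrightarrow> finite {l. (j, l) \<in> A}"
  by (rule finite_vimageI[of A "\<lambda>l. (j, l)", unfolded vimage_def]) (auto simp: inj_def)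

lemma card_eq_sum_fibres:
  assumes "finite (A :: ('n::finite \<times> nat) set)"
  shows "card A = (\<Sum>j\<in>UNIV. fibre_card j A)"
proof -
  have "A = (SIGMA j:UNIV. {l. (j, l) \<in> A})" by auto
  then have "card A = card (SIGMA j:UNIV. {l. (j, l) \<in> A})" by simp
  also have "\<dots> = (\<Sum>j\<in>UNIV. card {l. (j, l) \<in> A})" using finite_fibre[OF assms] by (intro card_SigmaI) auto
  finally show ?thesis by (simp add: fibre_card_def)
qed

text \<open>The deterministic counterpart of fibre concentration, for weights beyond its range:
  \<open>k\<close> distinct levels weigh at least \<open>k * (k + 1) / 2\<close>.\<close>

lemma card_le_sqrt_wt:
  assumes A: "finite (A :: ('n::finite \<times> nat) set)" "A \<subseteq> UNIV \<times> {1..}"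
  shows "real (card A) \<le> real CARD('n) * sqrt (2 * real (wt A))"
proof -
  have fib: "real (fibre_card j A) \<le> sqrt (2 * real (wt A))" for j
  proof (rule real_le_rsqrt)
    define L where "L = {l. (j, l) \<in> A}"
    have L: "finite L" "L \<subseteq> {1..}" using finite_fibre[OF A(1)] A(2) by (auto simp: L_def)
    have "\<Sum>L = (\<Sum>a\<in>Pair j ` L. snd a)" by (subst sum.reindex) (auto simp: inj_on_def)
    also have "\<dots> \<le> wt A" unfolding wt_def using A(1) by (intro sum_mono2) (auto simp: L_def)
    finally have "card L * card L \<le> 2 * wt A" using card_le_sum_nat[OF L] by simp
    then have "real (card L * card L) \<le> real (2 * wt A)" by (rule of_nat_mono)
    then show "(real (fibre_card j A))\<^sup>2 \<le> 2 * real (wt A)" by (simp add: fibre_card_def L_def power2_eq_square)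
  qed
  have "real (card A) = (\<Sum>j\<in>UNIV. real (fibre_card j A))" using card_eq_sum_fibres[OF A(1)] by simp
  also have "\<dots> \<le> (\<Sum>j\<in>(UNIV :: 'n set). sqrt (2 * real (wt A)))" by (intro sum_mono fib)
  finally show ?thesis by simp
qed

lemma mfac_attained:
  assumes "finite JJ" "JJ \<noteq> {}"
  obtains J where "J \<in> JJ" "mfac JJ A = (\<Prod>j\<in>J. fact (fibre_card j A))"
proof -
  have "mfac JJ A \<in> (\<lambda>J. \<Prod>j\<in>J. fact (fibre_card j A)) ` JJ" unfolding mfac_def using assms by (intro Max_in) auto
  then show thesis using that by auto
qed

lemma mfac_ge: "finite JJ \<Longrightarrow> J \<in> JJ \<Longrightarrow> (\<Prod>j\<in>J. fact (fibre_card j A)) \<le> mfac JJ A"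
  unfolding mfac_def by (intro Max_ge) auto

lemma mfac_ge_1:
  assumes "finite JJ" "JJ \<noteq> {}"
  shows "mfac JJ A \<ge> 1"
proof -
  obtain J where "J \<in> JJ" using assms by auto
  moreover have "(1::real) \<le> (\<Prod>j\<in>J. fact (fibre_card j A))" by (intro prod_ge_1) (auto simp: fact_ge_1)
  ultimately show ?thesis using mfac_ge[OF assms(1), of J A] by linarith
qed

text \<open>A set \<open>J\<close> attaining the maximum for \<open>A\<close> competes in the
  maximum for \<open>A'\<close>; \<open>\<rho> \<ge> 1\<close> allows the exponent
  \<open>CARD('n)\<close> for every \<open>J\<close>.\<close>

lemma mfac_compare:
  fixes A A' :: "('n::finite \<times> nat) set"
  assumes JJ: "finite JJ" "JJ \<noteq> {}" and \<rho>: "\<rho> \<ge> 1" and le: "\<And>j. (fact (fibre_card j A) :: real) \<le> \<rho> * fact (fibre_card j A')"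
  shows "mfac JJ A \<le> \<rho> ^ CARD('n) * mfac JJ A'"
proof -
  obtain J where J: "J \<in> JJ" "mfac JJ A = (\<Prod>j\<in>J. fact (fibre_card j A))" using mfac_attained[OF JJ] .
  have "mfac JJ A \<le> (\<Prod>j\<in>J. \<rho> * fact (fibre_card j A'))" unfolding J(2) using le by (intro prod_mono) auto
  also have "\<dots> = \<rho> ^ card J * (\<Prod>j\<in>J. fact (fibre_card j A'))" by (simp add: prod.distrib)
  also have "\<dots> \<le> \<rho> ^ CARD('n) * mfac JJ A'"
    using \<rho> mfac_ge[OF JJ(1) J(1), of A'] by (intro mult_mono power_increasing card_mono prod_nonneg) auto
  finally show ?thesis .
qed

lemma mfac_le_power:
  fixes A :: "('n::finite \<times> nat) set"
  assumes JJ: "finite JJ" "JJ \<noteq> {}" and A: "finite A" and y: "real (card A) \<le> y" "y \<ge> 1"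
  shows "mfac JJ A \<le> y ^ card A"
proof -
  obtain J where J: "J \<in> JJ" "mfac JJ A = (\<Prod>j\<in>J. fact (fibre_card j A))" using mfac_attained[OF JJ] .
  have "mfac JJ A \<le> (\<Prod>j\<in>J. y ^ fibre_card j A)" unfolding J(2)
  proof (intro prod_mono conjI)
    fix j
    have "fact (fibre_card j A) \<le> real (fibre_card j A) ^ fibre_card j A" by (metis fact_le_power of_nat_fact of_nat_le_iff of_nat_power)
    also have "\<dots> \<le> y ^ fibre_card j A" using fibre_card_le[OF A, of j] y by (intro power_mono) auto
    finally show "fact (fibre_card j A) \<le> y ^ fibre_card j A" .
  qed auto
  also have "\<dots> = y ^ (\<Sum>j\<in>J. fibre_card j A)" by (simp add: power_sum)
  also have "\<dots> \<le> y ^ card A"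
    unfolding card_eq_sum_fibres[OF A] using y by (intro power_increasing sum_mono2) auto
  finally show ?thesis .
qed

lemma fact_le_shift: "fact (b + k) \<le> real (b + k) ^ k * fact b"
proof (induction k)
  case (Suc k)
  have "fact (b + Suc k) = real (b + Suc k) * fact (b + k)" by simp
  also have "\<dots> \<le> real (b + Suc k) * (real (b + k) ^ k * fact b)" using Suc by (intro mult_left_mono) auto
  also have "\<dots> \<le> real (b + Suc k) * (real (b + Suc k) ^ k * fact b)"
    by (intro mult_left_mono mult_right_mono power_mono) auto
  finally show ?case by (simp add: mult_ac)
qed simp

text \<open>The real exponent \<open>d\<close> fits fibres whose sizes differ by less than
  \<open>2 * sqrt N / ln N\<close>: with \<open>y\<close> of order \<open>sqrt N\<close> the
  logarithm of the ratio is then of order \<open>sqrt N\<close>, without a factor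
  \<open>ln N\<close>.\<close>

lemma fact_ratio:
  assumes "real a - real b \<le> d" "real a \<le> y" "y \<ge> 1" "d \<ge> 0"
  shows "fact a \<le> y powr d * fact b"
proof (cases "a \<le> b")
  case True
  then have "(fact a :: real) \<le> 1 * fact b" by (simp add: fact_mono)
  also have "\<dots> \<le> y powr d * fact b" using assms by (intro mult_right_mono ge_one_powr_ge_zero) auto
  finally show ?thesis .
next
  case False
  define k where "k = a - b"
  have a: "a = b + k" using False by (simp add: k_def)
  have "fact a \<le> real a ^ k * fact b" unfolding a by (rule fact_le_shift)
  also have "\<dots> \<le> y ^ k * fact b" using assms by (intro mult_right_mono power_mono) auto
  also have "y ^ k = y powr real k" using assms by (simp add: powr_realpow)
  also have "y powr real k * fact b \<le> y powr d * fact b" using assms a by (intro mult_right_mono powr_mono) auto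
  finally show ?thesis .
qed

text \<open>With \<open>h\<close> the weight in excess of \<open>N\<close>, the left side is the
  logarithm of the worst-case bound on the powers of \<open>\<alpha>\<close> and the factorials; it
  has to stay below a quarter of \<open>h * ln 2\<close>. For \<open>h \<le> N\<close> it is at most
  \<open>4 * s * sqrt N * ln N\<close>, which fixes the constant 32 with a factor 2 to spare; for
  larger \<open>h\<close> it grows only like \<open>sqrt h * ln h\<close>.\<close>

lemma far_tail_exponent:
  assumes s: "s \<ge> (1::real)" and \<alpha>: "\<alpha> \<ge> 1"
  shows "\<forall>\<^sub>F N in sequentially. \<forall>h. 32 * s / ln 2 * sqrt (real N) * ln (real N) \<le> h \<longrightarrow>
     s * sqrt (2 * (real N + h)) * ln (\<alpha> * (s * sqrt (2 * (real N + h)))) \<le> h * ln 2 / 4"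
proof -
  have "\<forall>\<^sub>F h in at_top. s * sqrt (2 * (2 * h)) * ln (2 * h) \<le> h * ln 2 / 4" by real_asymp
  then obtain H where H: "\<And>h. h \<ge> H \<Longrightarrow> s * sqrt (2 * (2 * h)) * ln (2 * h) \<le> h * ln 2 / 4"
    unfolding eventually_at_top_linorder by blast
  have ev1: "\<forall>\<^sub>F N in sequentially. H \<le> real N" by real_asymp
  have ev2: "\<forall>\<^sub>F N in sequentially. (\<alpha> * s)\<^sup>2 * 2 \<le> real N" by real_asymp
  show ?thesis using ev1 ev2 eventually_ge_at_top[of 3]
  proof eventually_elim
    case (elim N)
    show ?case
    proof (intro allI impI)
      fix h assume h: "32 * s / ln 2 * sqrt (real N) * ln (real N) \<le> h"
      have lnN: "ln (real N) \<ge> 0" using elim by simp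
      have "0 \<le> 32 * s / ln 2 * sqrt (real N) * ln (real N)" using s lnN by (intro mult_nonneg_nonneg) auto
      then have h0: "h \<ge> 0" using h by linarith
      define w where "w = real N + h"
      have w: "w \<ge> 3" "w \<ge> real N" using h0 elim by (auto simp: w_def)
      have "\<alpha> * (s * sqrt (2 * w)) \<le> w"
      proof (rule power2_le_imp_le)
        have "(\<alpha> * (s * sqrt (2 * w)))\<^sup>2 = ((\<alpha> * s)\<^sup>2 * 2) * w" using w by (simp add: power_mult_distrib)
        also have "\<dots> \<le> w * w" using elim(2) w by (intro mult_right_mono) auto
        finally show "(\<alpha> * (s * sqrt (2 * w)))\<^sup>2 \<le> w\<^sup>2" by (simp add: power2_eq_square)
      qed (use w in simp)
      moreover have "\<alpha> * (s * sqrt (2 * w)) > 0" using \<alpha> s w by simp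
      ultimately have "ln (\<alpha> * (s * sqrt (2 * w))) \<le> ln w" using w by simp
      then have 1: "s * sqrt (2 * w) * ln (\<alpha> * (s * sqrt (2 * w))) \<le> s * sqrt (2 * w) * ln w"
        using s w by (intro mult_left_mono) auto
      show "s * sqrt (2 * (real N + h)) * ln (\<alpha> * (s * sqrt (2 * (real N + h)))) \<le> h * ln 2 / 4"
      proof (cases "h \<le> real N")
        case True
        have "sqrt (2 * w) \<le> sqrt (4 * real N)" using True by (intro real_sqrt_le_mono) (simp add: w_def)
        also have "\<dots> = 2 * sqrt (real N)" by (simp add: real_sqrt_mult)
        finally have a: "sqrt (2 * w) \<le> 2 * sqrt (real N)" .
        have "w \<le> real N * real N"
        proof -
          have "w \<le> 2 * real N" using True by (simp add: w_def)
          also have "\<dots> \<le> real N * real N" using elim by (intro mult_right_mono) auto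
          finally show ?thesis .
        qed
        then have "ln w \<le> ln (real N * real N)" using w by simp
        also have "\<dots> = 2 * ln (real N)" using elim by (simp add: ln_mult)
        finally have b: "ln w \<le> 2 * ln (real N)" .
        have "s * sqrt (2 * w) * ln w \<le> s * (2 * sqrt (real N)) * (2 * ln (real N))"
          using a b s w by (intro mult_mono) auto
        also have "\<dots> = (32 * s / ln 2 * sqrt (real N) * ln (real N)) * (ln 2 / 8)" by simp
        also have "\<dots> \<le> h * (ln 2 / 8)" using h by (intro mult_right_mono) auto
        also have "\<dots> \<le> h * ln 2 / 4" using h0 by simp
        finally show ?thesis using 1 by (simp add: w_def)
      next
        case False
        then have w2: "w \<le> 2 * h" by (simp add: w_def)
        have "s * sqrt (2 * w) * ln w \<le> s * sqrt (2 * (2 * h)) * ln (2 * h)"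
          using w w2 s by (intro mult_mono real_sqrt_le_mono) auto
        also have "\<dots> \<le> h * ln 2 / 4" using H[of h] False elim(1) by simp
        finally show ?thesis using 1 by (simp add: w_def)
      qed
    qed
  qed
qed

text \<open>The decay 2^(-h) at weight \<open>N + h\<close> is spent in three shares: a quarter on
  the powers and factorials, a quarter on the factor \<open>exp (- (H * ln 2 / 4))\<close>, and the
  remaining half on summability, where it is at most \<open>exp (- \<theta> * h)\<close>, whose sum
  is controlled by \<open>pfun\<close>.\<close>

lemma far_tail_sum:
  fixes a :: "('n::finite \<times> nat) set \<Rightarrow> real"
  assumes K: "K \<ge> 0" and \<alpha>: "\<alpha> \<ge> 1" and JJ: "finite JJ" "JJ \<noteq> {}"
    and a: "\<And>A. finite A \<Longrightarrow> A \<subseteq> UNIV \<times> {1..} \<Longrightarrow> \<bar>a A\<bar> \<le> (1 / 2 ^ wt A) * (K * \<alpha> ^ card A * mfac JJ A)"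
    and ex: "\<forall>h. H \<le> h \<longrightarrow> real CARD('n) * sqrt (2 * (real N + h)) * ln (\<alpha> * (real CARD('n) * sqrt (2 * (real N + h)))) \<le> h * ln 2 / 4"
    and N: "N > 0" "1 / sqrt (real N) \<le> ln 2 / 2"
  shows "(\<Sum>A\<in>{A \<in> Pow (grid n). real (wt A) \<ge> real N + H \<and> A \<noteq> {}}. \<bar>a A\<bar>) \<le> K / 2 ^ N * exp (- (H * ln 2 / 4)) * exp ((1 + real CARD('n)) * sqrt N)"
proof -
  define s where "s = real CARD('n)"
  have s: "s \<ge> 1" by (simp add: s_def Suc_leI)
  define \<theta> where "\<theta> = 1 / sqrt (real N)"
  have \<theta>: "\<theta> > 0" "\<theta> \<le> ln 2 / 2" using N by (auto simp: \<theta>_def)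
  have each: "\<bar>a A\<bar> \<le> K / 2 ^ N * exp (- (H * ln 2 / 4)) * (exp (\<theta> * real N) * exp (- \<theta> * real (wt A)))"
    if A: "A \<in> {A \<in> Pow (grid n). real (wt A) \<ge> real N + H \<and> A \<noteq> {}}" for A
  proof -
    have fA: "finite A" "A \<subseteq> UNIV \<times> {1..}" "A \<noteq> {}" using A finite_subset[OF _ finite_grid, of A n] by (auto simp: grid_def)
    define h where "h = real (wt A) - real N"
    have h: "H \<le> h" using A by (simp add: h_def)
    have w: "real (wt A) = real N + h" by (simp add: h_def)
    define y where "y = s * sqrt (2 * real (wt A))"
    have cy: "real (card A) \<le> y" unfolding y_def s_def by (rule card_le_sqrt_wt[OF fA(1,2)])
    have "card A \<ge> 1" using fA by (simp add: card_gt_0_iff Suc_leI)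
    then have y1: "y \<ge> 1" using cy by linarith
    have ay: "\<alpha> * y \<ge> 1" using \<alpha> y1 by (metis mult_mono' mult_1 zero_le_one)
    have "\<alpha> ^ card A * mfac JJ A \<le> \<alpha> ^ card A * y ^ card A"
      using \<alpha> mfac_le_power[OF JJ fA(1) cy y1] by (intro mult_left_mono) auto
    also have "\<dots> = (\<alpha> * y) powr real (card A)" using ay by (simp add: power_mult_distrib powr_realpow)
    also have "\<dots> \<le> (\<alpha> * y) powr y" using ay cy by (intro powr_mono) auto
    also have "\<dots> = exp (y * ln (\<alpha> * y))" using \<alpha> y1 by (simp add: powr_def)
    also have "\<dots> \<le> exp (h * ln 2 / 4)" using ex[rule_format, OF h] by (simp add: y_def w s_def)
    finally have m: "\<alpha> ^ card A * mfac JJ A \<le> exp (h * ln 2 / 4)" .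
    have "\<bar>a A\<bar> \<le> (1 / 2 ^ wt A) * (K * (\<alpha> ^ card A * mfac JJ A))" using a[OF fA(1,2)] by (simp add: mult_ac)
    also have "\<dots> \<le> (1 / 2 ^ wt A) * (K * exp (h * ln 2 / 4))" using m K by (intro mult_left_mono) auto
    also have "(1::real) / 2 ^ wt A = 1 / 2 ^ N * exp (- (h * ln 2))"
    proof -
      have "(2::real) ^ wt A = exp (real (wt A) * ln 2)" by (simp add: exp_of_nat_mult)
      also have "\<dots> = exp (real N * ln 2) * exp (h * ln 2)" by (simp add: w distrib_right exp_add)
      also have "exp (real N * ln 2) = (2::real) ^ N" by (simp add: exp_of_nat_mult)
      finally show ?thesis by (simp add: exp_minus field_simps)
    qed
    also have "1 / 2 ^ N * exp (- (h * ln 2)) * (K * exp (h * ln 2 / 4)) = K / 2 ^ N * exp (- (h * ln 2 / 4) - h * (ln 2 / 2))"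
      by (simp add: exp_add[symmetric] mult_ac field_simps)
    also have "\<dots> \<le> K / 2 ^ N * exp (- (H * ln 2 / 4) - \<theta> * h)"
    proof (intro mult_left_mono iffD2[OF exp_le_cancel_iff])
      have "H * ln 2 / 4 \<le> h * ln 2 / 4" using h by (simp add: divide_right_mono mult_right_mono)
      \<comment> \<open>A negative \<open>h\<close> would contradict \<open>ex\<close>, whose left
        side is nonnegative when \<open>N + h\<close> is the weight of an actual nonempty
        set.\<close>
      moreover have "h \<ge> 0"
      proof (rule ccontr)
        assume "\<not> h \<ge> 0"
        then have "h * ln 2 / 4 < 0" by (simp add: mult_neg_pos)
        moreover have "0 \<le> y * ln (\<alpha> * y)" using ay y1 by simp
        ultimately show False using ex[rule_format, OF h] by (simp add: y_def w s_def)
      qed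
      then have "h * \<theta> \<le> h * (ln 2 / 2)" using \<theta> by (intro mult_left_mono) auto
      then have "\<theta> * h \<le> h * (ln 2 / 2)" by (simp only: mult.commute)
      ultimately show "- (h * ln 2 / 4) - h * (ln 2 / 2) \<le> - (H * ln 2 / 4) - \<theta> * h" by linarith
    qed (use K in auto)
    also have "\<dots> = K / 2 ^ N * exp (- (H * ln 2 / 4)) * (exp (\<theta> * real N) * exp (- \<theta> * real (wt A)))"
    proof -
      have "- (H * ln 2 / 4) - \<theta> * h = - (H * ln 2 / 4) + (\<theta> * real N + - \<theta> * real (wt A))"
        by (simp add: w algebra_simps)
      then show ?thesis by (simp only: exp_add mult.assoc)
    qed
    finally show ?thesis .
  qed
  have "(\<Sum>A\<in>{A \<in> Pow (grid n). real (wt A) \<ge> real N + H \<and> A \<noteq> {}}. \<bar>a A\<bar>)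
     \<le> (\<Sum>A\<in>{A \<in> Pow (grid n :: ('n \<times> nat) set). real (wt A) \<ge> real N + H \<and> A \<noteq> {}}. K / 2 ^ N * exp (- (H * ln 2 / 4)) * (exp (\<theta> * real N) * exp (- \<theta> * real (wt A))))"
  proof (rule sum_mono)
    fix A :: "('n \<times> nat) set" assume "A \<in> {A \<in> Pow (grid n). real (wt A) \<ge> real N + H \<and> A \<noteq> {}}"
    then show "\<bar>a A\<bar> \<le> K / 2 ^ N * exp (- (H * ln 2 / 4)) * (exp (\<theta> * real N) * exp (- \<theta> * real (wt A)))"
      by (rule each)
  qed
  also have "\<dots> \<le> (\<Sum>A\<in>Pow (grid n :: ('n \<times> nat) set). K / 2 ^ N * exp (- (H * ln 2 / 4)) * (exp (\<theta> * real N) * exp (- \<theta> * real (wt A))))"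
    using K by (intro sum_mono2) auto
  also have "\<dots> = K / 2 ^ N * exp (- (H * ln 2 / 4)) * (exp (\<theta> * real N) * pfun TYPE('n) n \<theta>)"
    by (simp only: sum_distrib_left[symmetric] pfun_eq)
  also have "\<dots> \<le> K / 2 ^ N * exp (- (H * ln 2 / 4)) * (exp (\<theta> * real N) * exp (s / \<theta>))"
    unfolding s_def using K \<theta> by (intro mult_left_mono pfun_le) auto
  also have "exp (\<theta> * real N) * exp (s / \<theta>) = exp ((1 + s) * sqrt N)"
    using N by (simp add: exp_add[symmetric] \<theta>_def real_div_sqrt algebra_simps)
  finally show ?thesis by (simp add: s_def)
qed

text \<open>Singletons of one fibre give a crude bound; it makes the count unbounded, so that the
  least number defining \<open>N0\<close> exists.\<close>

lemma card_Qs_ge: "card (Qs N :: ('n::finite \<times> nat) set set) \<ge> Suc N"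
proof -
  have "inj_on (\<lambda>l. if l = 0 then {} else {(undefined :: 'n, l)}) {0..N}" by (auto simp: inj_on_def split: if_splits)
  moreover have "(\<lambda>l. if l = 0 then {} else {(undefined :: 'n, l)}) ` {0..N} \<subseteq> Qs N"
    by (auto simp: Qs_def wt_def)
  ultimately have "card {0..N} \<le> card (Qs N :: ('n \<times> nat) set set)" by (rule card_inj_on_le) simp
  then show ?thesis by simp
qed

theorem theorem7:
  fixes f :: "real ^ 'n::finite \<Rightarrow> real"
    and K \<alpha> c \<beta> \<mu> :: real
    and JJ :: "'n set set"
  assumes smooth: "smooth_on_cube f"
    and mu: "\<mu> = (LINT x:unit_cube|lborel. f x)"
    and K: "K > 0" and alpha: "\<alpha> > 0"
    and JJ: "finite JJ" "JJ \<noteq> {}"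
    and deriv_bound: "\<And>k::'n \<Rightarrow> nat.
       L1_norm_cube (mixed_deriv f (\<lambda>j. card (kappa (k j))))
         \<le> K * \<alpha> ^ kappa_norm0 k * max_fact JJ k"
    and c: "c > 0" and beta: "\<beta> > 0"
    and dense: "liminf (\<lambda>N. ereal (real (card (Q_large f N c \<beta> JJ)) / real (card (Q_set N :: ('n \<Rightarrow> nat) set)))) > 0"
  shows "limsup (\<lambda>m. ereal (sqrt (real m) *
           \<bar>measure design {\<omega> \<in> space design. mu_hat f m \<omega> < \<mu>}
            + 1/2 * measure design {\<omega> \<in> space design. mu_hat f m \<omega> = \<mu>} - 1/2\<bar>)) < \<infinity>"
proof -
  have fc: "continuous_on unit_cube f" by (rule smooth_continuous[OF smooth])
  have \<mu>: "\<mu> = fhat f {}" by (simp add: mu fhat_def wal_def)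
  define s where "s = real CARD('n)"
  have s: "s \<ge> 1" by (simp add: s_def Suc_leI)
  \<comment> \<open>With \<open>\<alpha>' \<ge> 1\<close> and \<open>\<beta>' \<le> 1\<close>, upper
    bounds on cardinalities suffice to estimate the powers on both sides.\<close>
  define \<alpha>' where "\<alpha>' = max \<alpha> 1"
  define \<beta>' where "\<beta>' = min \<beta> 1"
  have \<alpha>': "\<alpha>' \<ge> 1" "\<alpha> \<le> \<alpha>'" and \<beta>': "0 < \<beta>'" "\<beta>' \<le> 1" "\<beta>' \<le> \<beta>" using beta by (auto simp: \<alpha>'_def \<beta>'_def)
  define la where "la = ln \<alpha>'"
  define b where "b = - ln \<beta>'"
  have la: "la \<ge> 0" and b: "b \<ge> 0" using \<alpha>' \<beta>' by (auto simp: la_def b_def)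
  have mf: "mfac JJ A \<ge> 1" for A by (rule mfac_ge_1[OF JJ])
  have fb: "\<bar>fhat f A\<bar> \<le> (1 / 2 ^ wt A) * (K * \<alpha>' ^ card A * mfac JJ A)" if A: "finite A" "A \<subseteq> UNIV \<times> {1..}" for A
  proof -
    have "\<bar>fhat f A\<bar> \<le> (1 / 2 ^ wt A) * (K * \<alpha> ^ card A * mfac JJ A)" by (rule fhat_bound'[OF smooth A deriv_bound])
    also have "\<dots> \<le> (1 / 2 ^ wt A) * (K * \<alpha>' ^ card A * mfac JJ A)"
      using K alpha \<alpha>' mf[of A] by (intro mult_left_mono mult_right_mono power_mono) auto
    finally show ?thesis .
  qed
  define q where "q N = real (card (Qs N :: ('n \<times> nat) set set))" for N
  have q0: "q N > 0" for N by (simp add: q_def)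
  \<comment> \<open>\<open>C3 * sqrt N\<close> collects the logarithmic losses in comparing two
    typical sets of at most \<open>7 * s * sqrt N\<close> cells: powers of \<open>\<alpha>'\<close>,
    powers of \<open>\<beta>'\<close>, and the ratio \<open>exp (2 * s * sqrt N)\<close> of the
    factorials. \<open>B\<close> is such that an excess weight of \<open>B * sqrt N\<close> pays for
    them and leaves \<open>exp (- sqrt N)\<close>; \<open>D\<close> is the constant of
    \<open>far_tail_exponent\<close>.\<close>
  define C3 where "C3 = 7 * s * la + 7 * s * b + 2 * s"
  define B where "B = (C3 + 1) / ln 2"
  define D where "D = 32 * s / ln 2"
  have C3: "C3 \<ge> 0" using s la b by (simp add: C3_def)
  have B: "B > 0" "B * ln 2 = C3 + 1" using C3 by (auto simp: B_def)
  have D: "D > 0" using s by (simp add: D_def)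
  obtain Cg where Cg: "Cg > 0" and growth: "\<forall>\<^sub>F N in sequentially. \<forall>h. q (N + h) \<le> q N * exp (Cg * real h / sqrt N)"
    using card_Qs_growth[where 'n='n] unfolding q_def by blast
  obtain cx Nx where cx: "cx > 0" and xor: "\<And>N u. N \<ge> Nx \<Longrightarrow>
      real (card {(A, B). A \<in> Qs N \<and> B \<in> Qs N \<and> xor3 A B u \<in> (Qs N :: ('n \<times> nat) set set)}) \<le> (q N)\<^sup>2 * exp (- cx * sqrt N)"
    using xor3_rare[where 'n='n] unfolding q_def eventually_sequentially by blast
  obtain \<epsilon>0 where \<epsilon>0: "\<epsilon>0 > 0" and dens: "\<forall>\<^sub>F N in sequentially. \<epsilon>0 < real (card (Q_large f N c \<beta> JJ)) / real (card (Q_set N :: ('n \<Rightarrow> nat) set))"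
  proof -
    obtain z where z: "0 < ereal z" "ereal z < liminf (\<lambda>N. ereal (real (card (Q_large f N c \<beta> JJ)) / real (card (Q_set N :: ('n \<Rightarrow> nat) set))))"
      using ereal_dense2[OF dense] by blast
    show thesis by (rule that[of z]) (use z less_LiminfD[OF z(2)] in auto)
  qed
  \<comment> \<open>By \<open>card_Qs_le\<close>, a count of at least \<open>2 ^ m\<close> at
    \<open>N0 m + 1\<close> forces the root of that number above \<open>m * ln 2 / (1 + s)\<close>;
    halving this absorbs the step back to \<open>N0 m\<close>.\<close>
  define \<kappa> where "\<kappa> = ln 2 / (2 * (1 + s))"
  have \<kappa>: "\<kappa> > 0" using s by (simp add: \<kappa>_def)
  \<comment> \<open>Dependence in the dual will cost
    \<open>6 * exp (\<epsilon> * m - cx * sqrt N)\<close>, and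
    \<open>cx * sqrt N \<ge> 2 * \<epsilon> * m\<close>. The divisor in \<open>\<epsilon>'\<close>
    offsets the growth of the count from \<open>N\<close> to the cut-off near
    \<open>N + B * sqrt N\<close>.\<close>
  define \<epsilon> where "\<epsilon> = cx * \<kappa> / 2"
  define \<epsilon>' where "\<epsilon>' = \<epsilon> / exp (Cg * (B + 1))"
  have \<epsilon>: "\<epsilon> > 0" "\<epsilon>' > 0" using cx \<kappa> by (auto simp: \<epsilon>_def \<epsilon>'_def)
  \<comment> \<open>A fraction \<open>\<epsilon>0 / 4\<close> of at least
    \<open>\<epsilon>' * m * 2 ^ m * exp (- Cg)\<close> sets will be large and typical, so their
    mean number in the dual is at least \<open>2 * \<delta> * m\<close>, and half of the mean at
    least \<open>\<delta> * m\<close>.\<close>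
  define \<delta> where "\<delta> = \<epsilon>0 * \<epsilon>' * exp (- Cg) / 8"
  have \<delta>: "\<delta> > 0" using \<epsilon> \<epsilon>0 by (simp add: \<delta>_def)
  define large where "large A \<longleftrightarrow> c * 2 powr (- real (wt A)) * \<beta> ^ card A * mfac JJ A \<le> \<bar>fhat f A\<bar>" for A

  \<comment> \<open>The count crosses the threshold between \<open>N0 m\<close> and
    \<open>N0 m + 1\<close>: this bounds it above at the first and below at the second.\<close>
  define N0 where "N0 m = (LEAST N. q (Suc N) > \<epsilon>' * real m * 2 ^ m)" for m :: nat
  have up: "q (Suc (N0 m)) > \<epsilon>' * real m * 2 ^ m" for m
  proof -
    define N where "N = nat \<lceil>\<epsilon>' * real m * 2 ^ m\<rceil>"
    have "\<epsilon>' * real m * 2 ^ m \<le> real N" unfolding N_def by (rule of_nat_ceiling)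
    also have "\<dots> < q (Suc N)" using card_Qs_ge[of "Suc N", where 'n='n] by (simp add: q_def)
    finally show ?thesis unfolding N0_def by (rule LeastI)
  qed
  have lo: "q (N0 m) \<le> \<epsilon>' * real m * 2 ^ m" if m: "\<epsilon>' * real m \<ge> 1" for m
  proof (cases "N0 m")
    case 0
    \<comment> \<open>Minimality gives no information here; the count 1 is compared with the
      threshold directly, which is where \<open>\<epsilon>' * m \<ge> 1\<close> enters.\<close>
    have "(Qs 0 :: ('n \<times> nat) set set) = {{}}" by (auto simp: Qs_eq[of 0 0] grid_def wt_def)
    then have "q 0 = 1" by (simp add: q_def)
    moreover have "1 * 1 \<le> \<epsilon>' * real m * 2 ^ m" using m by (intro mult_mono) auto
    ultimately show ?thesis using 0 by simp
  next
    case (Suc k)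
    then have "\<not> q (Suc k) > \<epsilon>' * real m * 2 ^ m" unfolding N0_def by (intro not_less_Least) simp
    then show ?thesis using Suc by simp
  qed
  have em: "\<forall>\<^sub>F m in sequentially. \<epsilon>' * real m \<ge> 1" using \<epsilon> by real_asymp
  have km: "\<forall>\<^sub>F m in sequentially. \<kappa> * real m \<ge> 1" using \<kappa> by real_asymp
  have sqrtN: "\<forall>\<^sub>F m in sequentially. \<kappa> * real m \<le> sqrt (N0 m)"
    using em km
  proof eventually_elim
    case (elim m)
    have "(2::real) ^ m \<le> \<epsilon>' * real m * 2 ^ m" using elim(1) by simp
    also have "\<dots> < q (Suc (N0 m))" by (rule up)
    also have "\<dots> \<le> exp ((1 + s) * sqrt (Suc (N0 m)))" unfolding q_def s_def by (rule card_Qs_le) simp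
    also have "(2::real) ^ m = exp (real m * ln 2)" by (simp add: exp_of_nat_mult)
    finally have "real m * ln 2 < (1 + s) * sqrt (Suc (N0 m))" by (simp only: exp_less_cancel_iff)
    then have "2 * \<kappa> * real m < sqrt (Suc (N0 m))" using s by (simp add: \<kappa>_def field_simps)
    also have "sqrt (Suc (N0 m)) \<le> sqrt (N0 m) + sqrt 1"
      using sqrt_add_le_add_sqrt[of "real (N0 m)" 1] by (simp add: add.commute)
    finally show ?case using elim(2) by simp
  qed
  have N0lim: "filterlim N0 at_top sequentially"
    unfolding filterlim_at_top
  proof
    fix Z :: nat
    have "\<forall>\<^sub>F m in sequentially. sqrt (real Z) \<le> \<kappa> * real m" using \<kappa> by real_asymp
    then show "\<forall>\<^sub>F m in sequentially. Z \<le> N0 m" using sqrtN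
    proof eventually_elim
      case (elim m)
      then have "sqrt (real Z) \<le> sqrt (real (N0 m))" by linarith
      then show ?case by simp
    qed
  qed

  \<comment> \<open>The two long inequalities bound the tail probabilities below and above weight
    \<open>N + D * sqrt N * ln N\<close>: in the former \<open>exp (- sqrt N)\<close> beats a power
    of \<open>N\<close>, in the latter \<open>sqrt N * ln N\<close> beats \<open>sqrt N\<close> in
    the exponent.\<close>
  have numN: "\<forall>\<^sub>F N in sequentially. B * sqrt (real N) \<le> D * sqrt (real N) * ln (real N) \<and> 1 / real N \<le> \<epsilon>0 / 4 \<and>
      (2 * \<epsilon>' * K / (c * \<kappa>)) * sqrt (real N) * exp (Cg * (D * ln (real N) + 1) - sqrt (real N)) \<le> 1 / sqrt (real N) \<and>
      2 * (K / c) * exp ((1 + s) * sqrt (real N) + 7 * s * b * sqrt (real N) - D * sqrt (real N) * ln (real N) * ln 2 / 4) \<le> 1 / sqrt (real N) \<and>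
      1 / sqrt (real N) \<le> ln 2 / 2 \<and> ln (7 * sqrt (real N)) \<le> ln (real N) \<and> ln (real N) \<ge> 1 \<and> N \<ge> 100"
    using B(1) D \<epsilon>0
    by (intro eventually_conj; (real_asymp | rule eventually_ge_at_top))
  have ev: "\<forall>\<^sub>F N in sequentially. (\<forall>h. q (N + h) \<le> q N * exp (Cg * real h / sqrt N)) \<and> N \<ge> Nx \<and>
     \<epsilon>0 < real (card (Q_large f N c \<beta> JJ)) / real (card (Q_set N :: ('n \<Rightarrow> nat) set)) \<and>
     (\<exists>v. 0 \<le> v \<and> v \<le> 6 * sqrt N \<and> (\<forall>N1. real N1 \<le> real N + D * sqrt N * ln N + 1 \<longrightarrow>
        real (card {A \<in> (Qs N1 :: ('n \<times> nat) set set). \<exists>j. \<not> \<bar>real (fibre_card j A) - v\<bar> < sqrt N / ln N}) \<le> q N / N)) \<and>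
     (\<forall>h. D * sqrt (real N) * ln (real N) \<le> h \<longrightarrow>
       s * sqrt (2 * (real N + h)) * ln (\<alpha>' * (s * sqrt (2 * (real N + h)))) \<le> h * ln 2 / 4)"
    unfolding q_def D_def using fibre_concentration[OF D, where 'n='n] far_tail_exponent[OF s \<alpha>'(1)] growth
    by (intro eventually_conj eventually_ge_at_top dens) (simp_all add: D_def q_def)
  have numm: "\<forall>\<^sub>F m in sequentially. sqrt (real m) * (6 * exp (- \<epsilon> * real m)) \<le> 6 \<and> m \<ge> 1"
    using \<epsilon> by (intro eventually_conj; (real_asymp | rule eventually_ge_at_top))
  define Cfin where "Cfin = 6 + 2 / \<delta> + \<epsilon>' / \<kappa>\<^sup>2 + 2 / \<kappa> + 1 / sqrt \<delta>"

  have "\<forall>\<^sub>F m in sequentially. sqrt (real m) * \<bar>measure design {\<omega>. mu_hat f m \<omega> < \<mu>} + 1/2 * measure design {\<omega>. mu_hat f m \<omega> = \<mu>} - 1/2\<bar> \<le> Cfin"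
    using eventually_compose_filterlim[OF eventually_conj[OF numN ev] N0lim] sqrtN em numm
  proof eventually_elim
    case (elim m)
    define N where "N = N0 m"
    note el = elim(1)[folded N_def]
    have num: "B * sqrt (real N) \<le> D * sqrt (real N) * ln (real N)" "1 / real N \<le> \<epsilon>0 / 4"
      "(2 * \<epsilon>' * K / (c * \<kappa>)) * sqrt (real N) * exp (Cg * (D * ln (real N) + 1) - sqrt (real N)) \<le> 1 / sqrt (real N)"
      "2 * (K / c) * exp ((1 + s) * sqrt (real N) + 7 * s * b * sqrt (real N) - D * sqrt (real N) * ln (real N) * ln 2 / 4) \<le> 1 / sqrt (real N)"
      "1 / sqrt (real N) \<le> ln 2 / 2" "ln (7 * sqrt (real N)) \<le> ln (real N)" "ln (real N) \<ge> 1" "N \<ge> 100"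
      using el by auto
    have gr: "q (N + h) \<le> q N * exp (Cg * real h / sqrt N)" for h using el by blast
    have NNx: "N \<ge> Nx" using el by blast
    have dn: "\<epsilon>0 < real (card (Q_large f N c \<beta> JJ)) / real (card (Q_set N :: ('n \<Rightarrow> nat) set))" using el by blast
    obtain v where v: "0 \<le> v" "v \<le> 6 * sqrt N" and conc: "\<And>N1. real N1 \<le> real N + D * sqrt N * ln N + 1 \<Longrightarrow>
        real (card {A \<in> (Qs N1 :: ('n \<times> nat) set set). \<exists>j. \<not> \<bar>real (fibre_card j A) - v\<bar> < sqrt N / ln N}) \<le> q N / N"
      using el by blast
    have fex: "\<forall>h. D * sqrt (real N) * ln (real N) \<le> h \<longrightarrow>
       s * sqrt (2 * (real N + h)) * ln (\<alpha>' * (s * sqrt (2 * (real N + h)))) \<le> h * ln 2 / 4" using el by blast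
    have kmN: "\<kappa> * real m \<le> sqrt N" using elim(2) by (simp add: N_def)
    have m1: "real m \<ge> 1" "m > 0" using elim(4) by auto
    have em1: "\<epsilon>' * real m \<ge> 1" using elim(3) by simp
    have qN: "q N \<le> \<epsilon>' * real m * 2 ^ m" unfolding N_def by (rule lo[OF em1])
    have sqN: "sqrt N \<ge> 10" "sqrt N * sqrt N = real N"
      using num(8) real_le_rsqrt[of 10 "real N"] by auto
    have sp: "sqrt N > 0" using num(8) by simp
    have inv: "1 / sqrt N \<le> 1 / (\<kappa> * real m)" using kmN \<kappa> m1 num(8) by (intro divide_left_mono mult_pos_pos) auto
    \<comment> \<open>Three ranges of weight: up to \<open>N2\<close> the sets enter the main sum;
      from there up to \<open>N1\<close> typical sets have individually small coefficients; beyond,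
      the far tail applies. Atypical sets up to \<open>N1\<close> are gathered in \<open>At\<close>
      and must miss the dual.\<close>
    define H where "H = D * sqrt (real N) * ln (real N)"
    have H0: "H \<ge> 0" unfolding H_def using D num(7) by (intro mult_nonneg_nonneg) auto
    define h1 where "h1 = nat \<lceil>H\<rceil>"
    define h2 where "h2 = nat \<lceil>B * sqrt (real N)\<rceil>"
    define N1 where "N1 = N + h1"
    define N2 where "N2 = N + h2"
    have B0: "B * sqrt N \<ge> 0" using B by simp
    have h1: "H \<le> real h1" "real h1 \<le> H + 1" unfolding h1_def using H0 by linarith+
    have h2: "B * sqrt N \<le> real h2" "real h2 \<le> B * sqrt N + 1" unfolding h2_def using B0 by linarith+
    have h12: "h2 \<le> h1" unfolding h1_def h2_def H_def using num(1) by (intro nat_mono ceiling_mono)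
    define typical where "typical A \<longleftrightarrow> (\<forall>j. \<bar>real (fibre_card j A) - v\<bar> < sqrt N / ln N)" for A :: "('n \<times> nat) set"
    define Q where "Q = Qs N2 - {{} :: ('n \<times> nat) set}"
    define At where "At = {A \<in> (Qs N1 :: ('n \<times> nat) set set). \<not> typical A \<and> A \<noteq> {}}"
    define T where "T = {A \<in> Qs N - {{} :: ('n \<times> nat) set}. large A \<and> typical A}"
    have finT: "finite T" by (simp add: T_def)
    have TQ: "T \<subseteq> Q" using Qs_mono[of N N2, where 'a='n] by (auto simp: T_def Q_def N2_def)

    have finQ: "finite Q" "finite At" by (simp_all add: Q_def At_def)
    have Qp: "finite A \<and> A \<noteq> {} \<and> A \<subseteq> UNIV \<times> {1..}" if "A \<in> Q" for A
      using that by (auto simp: Q_def Qs_def)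
    have Atp: "finite A \<and> A \<noteq> {}" if "A \<in> At" for A using that by (auto simp: At_def Qs_def)

    \<comment> \<open>Passing from \<open>q N - 1\<close> to \<open>q N / 2\<close> leaves density
      \<open>\<epsilon>0 / 2\<close>; removing the atypical sets, at most a fraction
      \<open>1 / N \<le> \<epsilon>0 / 4\<close>, leaves \<open>\<epsilon>0 / 4\<close>.\<close>
    have cT: "\<epsilon>0 / 4 * q N \<le> real (card T)"
    proof -
      define Ql where "Ql = {A \<in> Qs N - {{} :: ('n \<times> nat) set}. large A}"
      define Ua where "Ua = {A \<in> (Qs N :: ('n \<times> nat) set set). \<exists>j. \<not> \<bar>real (fibre_card j A) - v\<bar> < sqrt N / ln N}"
      have Ua: "real (card Ua) \<le> q N / N" unfolding Ua_def using H0 by (intro conc) (simp add: H_def)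
      have cQ: "real (card (Q_set N :: ('n \<Rightarrow> nat) set)) = q N - 1"
        unfolding card_Q_set q_def by (simp add: card_Diff_singleton of_nat_diff Suc_leI)
      have "Suc N \<le> card (Qs N :: ('n \<times> nat) set set)" by (rule card_Qs_ge)
      then have q2: "q N \<ge> 2" using num(8) by (simp add: q_def)
      have "\<epsilon>0 * (q N - 1) < real (card (Q_large f N c \<beta> JJ))"
        using dn q2 unfolding cQ by (simp add: less_divide_eq)
      also have "card (Q_large f N c \<beta> JJ) = card Ql" unfolding card_Q_large Ql_def large_def ..
      also have "card Ql \<le> card (T \<union> Ua)"
        by (intro card_mono) (auto simp: Ql_def T_def Ua_def typical_def)
      also have "real (card (T \<union> Ua)) \<le> real (card T) + real (card Ua)" using card_Un_le[of T Ua] by linarith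
      finally have "\<epsilon>0 * (q N - 1) \<le> real (card T) + q N / N" using Ua by simp
      moreover have "\<epsilon>0 * (q N / 2) \<le> \<epsilon>0 * (q N - 1)" using q2 \<epsilon>0 by (intro mult_left_mono) auto
      moreover have "q N * (1 / N) \<le> q N * (\<epsilon>0 / 4)" using num(2) q0[of N] by (intro mult_left_mono) auto
      then have "q N / N \<le> \<epsilon>0 / 4 * q N" by (simp add: mult.commute)
      moreover have "\<epsilon>0 * (q N / 2) = 2 * (\<epsilon>0 / 4 * q N)" by simp
      ultimately show ?thesis by linarith
    qed
    have qNlow: "\<epsilon>' * real m * 2 ^ m * exp (- Cg) \<le> q N"
    proof -
      have "\<epsilon>' * real m * 2 ^ m \<le> q (N + 1)" using up[of m] by (simp add: N_def)
      also have "\<dots> \<le> q N * exp (Cg * real 1 / sqrt N)" by (rule gr)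
      also have "\<dots> \<le> q N * exp Cg" using Cg sqN q0[of N] by (intro mult_left_mono) (auto simp: divide_le_eq)
      finally show ?thesis by (simp add: exp_minus field_simps)
    qed
    define mn where "mn = real (card T) / 2 ^ m"
    have mn: "mn \<ge> 2 * \<delta> * real m"
    proof -
      have "\<epsilon>0 / 4 * (\<epsilon>' * real m * 2 ^ m * exp (- Cg)) \<le> \<epsilon>0 / 4 * q N" using qNlow \<epsilon>0 by (intro mult_left_mono) auto
      also note cT
      finally show ?thesis by (simp add: mn_def \<delta>_def le_divide_eq mult_ac)
    qed
    have R: "\<delta> * real m > 0" using \<delta> m1 by simp
    have mn0: "mn > 0" using mn R by linarith
    then have Tne: "T \<noteq> {}" by (auto simp: mn_def)

    have typ_card: "real (fibre_card j A) \<le> 7 * sqrt N" if "typical A" for A j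
    proof -
      have "sqrt N / ln N \<le> sqrt N / 1" using num(7) sqN by (intro divide_left_mono) auto
      moreover have "\<bar>real (fibre_card j A) - v\<bar> < sqrt N / ln N" using that by (simp add: typical_def)
      ultimately show ?thesis using v by linarith
    qed
    have typ_card': "real (card A) \<le> 7 * s * sqrt N" if "typical A" "finite A" for A
    proof -
      have "real (card A) = (\<Sum>j\<in>UNIV. real (fibre_card j A))" using card_eq_sum_fibres[OF that(2)] by simp
      also have "\<dots> \<le> (\<Sum>j\<in>(UNIV :: 'n set). 7 * sqrt N)" by (intro sum_mono typ_card that)
      finally show ?thesis by (simp add: s_def mult_ac)
    qed
    have typ_mfac: "mfac JJ A \<le> exp (2 * s * sqrt N) * mfac JJ A'" if t: "typical A" "typical A'" for A A'
    proof -
      have "(fact (fibre_card j A) :: real) \<le> exp (2 * sqrt N) * fact (fibre_card j A')" for j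
      proof -
        \<comment> \<open>Since \<open>ln y \<le> ln N\<close>, the logarithm cancels the one in the
          width \<open>sqrt N / ln N\<close> of the typical window.\<close>
        define y where "y = 7 * sqrt (real N)"
        define d where "d = 2 * (sqrt N / ln N)"
        have y: "y \<ge> 1" using sqN by (simp add: y_def)
        have d: "d \<ge> 0" using num(7) by (simp add: d_def)
        have "\<bar>real (fibre_card j A) - v\<bar> < sqrt N / ln N" "\<bar>real (fibre_card j A') - v\<bar> < sqrt N / ln N"
          using t by (auto simp: typical_def)
        then have "real (fibre_card j A) - real (fibre_card j A') \<le> d" by (simp add: d_def)
        then have "fact (fibre_card j A) \<le> y powr d * fact (fibre_card j A')"
          using typ_card[OF t(1), of j] y d by (intro fact_ratio) (auto simp: y_def)
        also have "y powr d = exp (d * ln y)" using y by (simp add: powr_def)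
        also have "d * ln y \<le> d * ln (real N)" using num(6) d by (intro mult_left_mono) (auto simp: y_def)
        then have "exp (d * ln y) * fact (fibre_card j A') \<le> exp (d * ln (real N)) * (fact (fibre_card j A') :: real)" by simp
        also have "d * ln (real N) = 2 * sqrt N" using num(7) by (simp add: d_def)
        finally show ?thesis .
      qed
      then have "mfac JJ A \<le> exp (2 * sqrt N) ^ CARD('n) * mfac JJ A'" by (intro mfac_compare JJ) auto
      also have "exp (2 * sqrt N) ^ CARD('n) = exp (2 * s * sqrt N)" by (simp add: exp_of_nat_mult[symmetric] s_def mult_ac)
      finally show ?thesis .
    qed

    \<comment> \<open>The smallest large coefficient is the scale for the Littlewood-Offord bound
      and for the remainder. It is attained at a typical set \<open>A0\<close>, with which the
      coefficients just above the cut-off are compared.\<close>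
    define \<tau> where "\<tau> = Min ((\<lambda>A. \<bar>fhat f A\<bar>) ` T)"
    have "\<tau> \<in> (\<lambda>A. \<bar>fhat f A\<bar>) ` T" unfolding \<tau>_def using finT Tne by (intro Min_in) auto
    then obtain A0 where A0: "A0 \<in> T" "\<tau> = \<bar>fhat f A0\<bar>" by auto
    have big: "\<bar>fhat f A\<bar> \<ge> \<tau>" if "A \<in> T" for A unfolding \<tau>_def using finT that by (intro Min_le) auto
    have \<tau>low: "c / 2 ^ N * exp (- (7 * s * b * sqrt N)) * mfac JJ A0 \<le> \<tau>"
    proof -
      have A0': "finite A0" "wt A0 \<le> N" "large A0" "typical A0" using A0(1) by (auto simp: T_def Qs_def)
      have "1 / 2 ^ N \<le> 1 / (2::real) ^ wt A0" using A0' by (intro divide_left_mono power_increasing) auto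
      also have "\<dots> = 2 powr (- real (wt A0))" by (simp add: powr_minus powr_realpow divide_inverse)
      finally have p: "1 / 2 ^ N \<le> 2 powr (- real (wt A0))" .
      have "exp (- (7 * s * b * sqrt N)) \<le> exp (- (b * real (card A0)))"
        using mult_left_mono[OF typ_card'[OF A0'(4,1)] b] by (simp add: mult_ac)
      also have "\<dots> = \<beta>' ^ card A0" using \<beta>' by (simp add: b_def exp_of_nat2_mult)
      also have "\<dots> \<le> \<beta> ^ card A0" using \<beta>' by (intro power_mono) auto
      finally have e: "exp (- (7 * s * b * sqrt N)) \<le> \<beta> ^ card A0" .
      have "c / 2 ^ N * exp (- (7 * s * b * sqrt N)) * mfac JJ A0 = c * (1 / 2 ^ N) * exp (- (7 * s * b * sqrt N)) * mfac JJ A0" by simp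
      also have "\<dots> \<le> c * 2 powr (- real (wt A0)) * \<beta> ^ card A0 * mfac JJ A0"
        using p e c mf[of A0] beta by (intro mult_right_mono mult_mono mult_left_mono) auto
      also have "\<dots> \<le> \<tau>" using A0'(3) A0(2) by (simp add: large_def)
      finally show ?thesis .
    qed
    have \<tau>0: "\<tau> > 0"
    proof -
      have "0 < c / 2 ^ N * exp (- (7 * s * b * sqrt N)) * mfac JJ A0" using c mf[of A0] by (intro mult_pos_pos) auto
      then show ?thesis using \<tau>low by linarith
    qed
    \<comment> \<open>The excess weight of at least \<open>B * sqrt N\<close> outweighs the loss
      \<open>C3 * sqrt N\<close> incurred in comparing \<open>A\<close> with the minimiser
      \<open>A0\<close>.\<close>
    have near: "\<bar>fhat f A\<bar> \<le> K / c * exp (- sqrt N) * \<tau>"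
      if A: "finite A" "A \<subseteq> UNIV \<times> {1..}" "typical A" "N2 \<le> wt A" for A
    proof -
      have tA0: "typical A0" using A0 by (simp add: T_def)
      have "\<alpha>' ^ card A = exp (la * real (card A))" using \<alpha>' by (simp add: la_def exp_of_nat2_mult)
      also have "\<dots> \<le> exp (7 * s * la * sqrt N)" using mult_left_mono[OF typ_card'[OF A(3,1)] la] by (simp add: mult_ac)
      finally have a1: "\<alpha>' ^ card A \<le> exp (7 * s * la * sqrt N)" .
      have "1 / (2::real) ^ wt A \<le> 1 / 2 ^ N2" using A by (intro divide_left_mono power_increasing) auto
      also have "\<dots> = 1 / 2 ^ N * (1 / 2 ^ h2)" by (simp add: N2_def power_add)
      also have "(1::real) / 2 ^ h2 = exp (- (real h2 * ln 2))" by (simp add: exp_minus exp_of_nat_mult inverse_eq_divide)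
      also have "1 / 2 ^ N * exp (- (real h2 * ln 2)) \<le> 1 / 2 ^ N * exp (- (B * ln 2 * sqrt N))"
      proof (intro mult_left_mono)
        have "B * sqrt N * ln 2 \<le> real h2 * ln 2" using h2 by (intro mult_right_mono) auto
        then show "exp (- (real h2 * ln 2)) \<le> exp (- (B * ln 2 * sqrt N))" by (simp add: mult_ac)
      qed simp
      finally have a2: "1 / (2::real) ^ wt A \<le> 1 / 2 ^ N * exp (- (B * ln 2 * sqrt N))" .
      have "\<bar>fhat f A\<bar> \<le> (1 / 2 ^ wt A) * (K * \<alpha>' ^ card A * mfac JJ A)" by (rule fb[OF A(1,2)])
      also have "\<dots> \<le> (1 / 2 ^ N * exp (- (B * ln 2 * sqrt N))) * (K * exp (7 * s * la * sqrt N) * (exp (2 * s * sqrt N) * mfac JJ A0))"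
        using a1 a2 K \<alpha>' mf[of A] mf[of A0] typ_mfac[OF A(3) tA0]
        by (intro mult_mono mult_nonneg_nonneg) (auto intro: order_trans[OF zero_le_one])
      also have "\<dots> = K / 2 ^ N * (exp (- (B * ln 2 * sqrt N)) * exp (7 * s * la * sqrt N) * exp (2 * s * sqrt N)) * mfac JJ A0" by simp
      also have "exp (- (B * ln 2 * sqrt N)) * exp (7 * s * la * sqrt N) * exp (2 * s * sqrt N) = exp (- (7 * s * b * sqrt N)) * exp (- sqrt N)"
      proof -
        have "- (B * ln 2 * sqrt N) + 7 * s * la * sqrt N + 2 * s * sqrt N = - (7 * s * b * sqrt N) + - sqrt N"
          unfolding B(2) C3_def by (simp add: algebra_simps)
        then show ?thesis by (simp only: exp_add[symmetric])
      qed
      also have "K / 2 ^ N * (exp (- (7 * s * b * sqrt N)) * exp (- sqrt N)) * mfac JJ A0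
         = K / c * exp (- sqrt N) * (c / 2 ^ N * exp (- (7 * s * b * sqrt N)) * mfac JJ A0)" using c by simp
      also have "\<dots> \<le> K / c * exp (- sqrt N) * \<tau>" using \<tau>low K c by (intro mult_left_mono) auto
      finally show ?thesis .
    qed

    define W1 where "W1 = q N1 * (K / c * exp (- sqrt N) * \<tau>)"
    define W2 where "W2 = K / 2 ^ N * exp (- (H * ln 2 / 4)) * exp ((1 + s) * sqrt N)"
    have Wb: "(\<Sum>A\<in>Pow (grid n) \<inter> (- (Q \<union> At \<union> {{}})). \<bar>fhat f A\<bar>) \<le> W1 + W2" for n
    proof -
      define Nr where "Nr = {A \<in> (Qs N1 :: ('n \<times> nat) set set). typical A \<and> N2 \<le> wt A}"
      define Fr where "Fr = {A \<in> Pow (grid n :: ('n \<times> nat) set). real (wt A) \<ge> real N + H \<and> A \<noteq> {}}"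
      have fin: "finite Nr" "finite Fr" by (auto simp: Nr_def Fr_def)
      have "Pow (grid n) \<inter> (- (Q \<union> At \<union> {{}})) \<subseteq> Nr \<union> Fr"
      proof
        fix A assume A: "A \<in> Pow (grid n) \<inter> (- (Q \<union> At \<union> {{}}))"
        then have fA: "finite A" "A \<subseteq> UNIV \<times> {1..}" "A \<noteq> {}" using finite_subset[OF _ finite_grid, of A n] by (auto simp: grid_def)
        show "A \<in> Nr \<union> Fr"
        proof (cases "wt A \<le> N1")
          case True
          then have "A \<in> Qs N1" using fA by (simp add: Qs_def)
          moreover have "typical A" using A calculation fA by (auto simp: At_def)
          moreover have "\<not> wt A \<le> N2" using A fA by (auto simp: Q_def Qs_def)
          ultimately show ?thesis by (simp add: Nr_def)
        next
          case False
          then have "real (wt A) \<ge> real N + real h1" by (simp add: N1_def)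
          then show ?thesis using A fA h1 by (simp add: Fr_def)
        qed
      qed
      then have "(\<Sum>A\<in>Pow (grid n) \<inter> (- (Q \<union> At \<union> {{}})). \<bar>fhat f A\<bar>) \<le> (\<Sum>A\<in>Nr \<union> Fr. \<bar>fhat f A\<bar>)"
        using fin by (intro sum_mono2) auto
      also have "\<dots> \<le> (\<Sum>A\<in>Nr. \<bar>fhat f A\<bar>) + (\<Sum>A\<in>Fr. \<bar>fhat f A\<bar>)"
      proof -
        have "0 \<le> (\<Sum>A\<in>Nr \<inter> Fr. \<bar>fhat f A\<bar>)" by (rule sum_nonneg) simp
        then show ?thesis using sum.union_inter[OF fin, of "\<lambda>A. \<bar>fhat f A\<bar>"] by linarith
      qed
      also have "(\<Sum>A\<in>Nr. \<bar>fhat f A\<bar>) \<le> (\<Sum>A\<in>Nr. K / c * exp (- sqrt N) * \<tau>)"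
        by (intro sum_mono near) (auto simp: Nr_def Qs_def)
      also have "\<dots> = real (card Nr) * (K / c * exp (- sqrt N) * \<tau>)" by simp
      also have "\<dots> \<le> W1" unfolding W1_def q_def using K c \<tau>0
        by (intro mult_right_mono of_nat_mono card_mono) (auto simp: Nr_def)
      also have "(\<Sum>A\<in>Fr. \<bar>fhat f A\<bar>) \<le> W2" unfolding Fr_def W2_def s_def
        using K \<alpha>' num(5,8) fex by (intro far_tail_sum[where \<alpha>=\<alpha>' and JJ=JJ] fb JJ) (auto simp: H_def s_def)
      finally show ?thesis by simp
    qed

    have Pw1: "W1 / 2 ^ m / (\<tau> / 2) \<le> 1 / sqrt N"
    proof -
      have "W1 / 2 ^ m / (\<tau> / 2) = (q N1 / 2 ^ m) * (2 * K / c * exp (- sqrt N))"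
        unfolding W1_def using \<tau>0 by (simp add: field_simps)
      also have "\<dots> \<le> ((\<epsilon>' * (sqrt N / \<kappa>)) * exp (Cg * (D * ln N + 1))) * (2 * K / c * exp (- sqrt N))"
      proof (intro mult_right_mono)
        have "Cg * real h1 / sqrt N \<le> Cg * (H + 1) / sqrt N" using h1 Cg sqN by (intro divide_right_mono mult_left_mono) auto
        also have "\<dots> = Cg * (D * ln N + 1 / sqrt N)" using sp unfolding H_def by (simp add: field_simps)
        also have "\<dots> \<le> Cg * (D * ln N + 1)" using Cg sqN by (intro mult_left_mono) (auto simp: divide_le_eq)
        finally have ex1: "Cg * real h1 / sqrt N \<le> Cg * (D * ln N + 1)" .
        have "q N1 \<le> q N * exp (Cg * real h1 / sqrt N)" unfolding N1_def by (rule gr)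
        also have "\<dots> \<le> (\<epsilon>' * real m * 2 ^ m) * exp (Cg * (D * ln N + 1))" using qN ex1 q0[of N] \<epsilon> by (intro mult_mono) auto
        finally have "q N1 / 2 ^ m \<le> (\<epsilon>' * real m) * exp (Cg * (D * ln N + 1))" by (simp add: divide_le_eq mult_ac)
        also have "\<dots> \<le> (\<epsilon>' * (sqrt N / \<kappa>)) * exp (Cg * (D * ln N + 1))"
          using kmN \<kappa> \<epsilon> by (intro mult_right_mono mult_left_mono) (auto simp: le_divide_eq mult.commute)
        finally show "q N1 / 2 ^ m \<le> (\<epsilon>' * (sqrt N / \<kappa>)) * exp (Cg * (D * ln N + 1))" .
      qed (use K c in auto)
      also have "\<dots> = (2 * \<epsilon>' * K / (c * \<kappa>)) * sqrt (real N) * exp (Cg * (D * ln (real N) + 1) - sqrt (real N))"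
      proof -
        have "exp (Cg * (D * ln (real N) + 1) - sqrt (real N)) = exp (Cg * (D * ln (real N) + 1)) * exp (- sqrt N)"
          unfolding exp_add[symmetric] by simp
        then show ?thesis by (simp add: mult_ac)
      qed
      also note num(3)
      finally show ?thesis .
    qed
    have Pw2: "W2 / 2 ^ m / (\<tau> / 2) \<le> 1 / sqrt N"
    proof -
      have W20: "W2 \<ge> 0" using K by (simp add: W2_def)
      have "W2 / 2 ^ m / (\<tau> / 2) \<le> W2 / 1 / (\<tau> / 2)" using W20 \<tau>0 by (intro divide_right_mono divide_left_mono) auto
      also have "\<dots> \<le> W2 / 1 / (c / 2 ^ N * exp (- (7 * s * b * sqrt N)) / 2)"
      proof (intro divide_left_mono)
        have "c / 2 ^ N * exp (- (7 * s * b * sqrt N)) * 1 \<le> c / 2 ^ N * exp (- (7 * s * b * sqrt N)) * mfac JJ A0"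
          using mf[of A0] c by (intro mult_left_mono) auto
        then show "c / 2 ^ N * exp (- (7 * s * b * sqrt N)) / 2 \<le> \<tau> / 2" using \<tau>low by simp
      qed (use W20 \<tau>0 c in auto)
      also have "\<dots> = 2 * (K / c) * (exp (- (H * ln 2 / 4)) * exp ((1 + s) * sqrt N) * exp (7 * s * b * sqrt N))"
        unfolding W2_def using c by (simp add: exp_minus field_simps)
      also have "exp (- (H * ln 2 / 4)) * exp ((1 + s) * sqrt N) * exp (7 * s * b * sqrt N)
         = exp ((1 + s) * sqrt (real N) + 7 * s * b * sqrt (real N) - D * sqrt (real N) * ln (real N) * ln 2 / 4)"
        unfolding exp_add[symmetric] H_def by (simp add: algebra_simps)
      also note num(4)
      finally show ?thesis .
    qed
    have P1: "measure design {\<omega> :: 'n rbits. \<not> xor_indep (dual m Q \<omega>)} \<le> 6 * exp (- \<epsilon> * real m)"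
    proof -
      have ex2: "Cg * real h2 / sqrt N \<le> Cg * (B + 1)"
      proof -
        have "Cg * real h2 / sqrt N \<le> Cg * (B * sqrt N + 1) / sqrt N" using h2 Cg by (intro divide_right_mono mult_left_mono) auto
        also have "\<dots> = Cg * (B + 1 / sqrt N)" using sp by (simp add: field_simps)
        also have "\<dots> \<le> Cg * (B + 1)" using Cg sqN by (intro mult_left_mono) (auto simp: divide_le_eq)
        finally show ?thesis .
      qed
      have "q N2 \<le> q N * exp (Cg * real h2 / sqrt N)" unfolding N2_def by (rule gr)
      also have "\<dots> \<le> (\<epsilon>' * real m * 2 ^ m) * exp (Cg * (B + 1))" using qN ex2 q0[of N] \<epsilon> by (intro mult_mono) auto
      also have "\<dots> = \<epsilon> * real m * 2 ^ m" by (simp add: \<epsilon>'_def)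
      finally have q2: "q N2 \<le> \<epsilon> * real m * 2 ^ m" .
      have "measure design {\<omega> :: 'n rbits. \<not> xor_indep (dual m Q \<omega>)} \<le> 6 * exp (- cx * sqrt N2) * exp (\<epsilon> * real m)"
      proof (rule prob_dependent_le[where Q'="Qs N2"])
        show "real (card {(A, B). A \<in> Qs N2 \<and> B \<in> Qs N2 \<and> xor3 A B u \<in> (Qs N2 :: ('n \<times> nat) set set)}) \<le> (real (card (Qs N2 :: ('n \<times> nat) set set)))\<^sup>2 * exp (- cx * sqrt N2)" for u
          using xor[of N2 u] NNx by (simp add: N2_def q_def)
        show "real (card (Qs N2 :: ('n \<times> nat) set set)) \<le> \<epsilon> * real m * 2 ^ m" using q2 by (simp add: q_def)
        show "finite A \<and> A \<noteq> {}" if "A \<in> Q" for A using Qp[OF that] by blast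
      qed (auto simp: Q_def)
      also have "\<dots> = 6 * exp (\<epsilon> * real m - cx * sqrt N2)" by (simp add: exp_diff exp_minus field_simps)
      also have "\<dots> \<le> 6 * exp (- \<epsilon> * real m)"
      proof -
        have "sqrt N \<le> sqrt N2" by (simp add: N2_def)
        then have "\<kappa> * real m \<le> sqrt N2" using kmN by linarith
        then have "cx * (\<kappa> * real m) \<le> cx * sqrt N2" using cx by (intro mult_left_mono) auto
        then show ?thesis by (simp add: \<epsilon>_def algebra_simps)
      qed
      finally show ?thesis .
    qed
    have P2: "measure design {\<omega> :: 'n rbits. real (card (dual m T \<omega>)) < \<delta> * real m} \<le> 2 / \<delta> / real m"
    proof -
      interpret PD: prob_space "design :: 'n rbits measure" by (rule prob_space_design)
      have "measure design {\<omega> :: 'n rbits. real (card (dual m T \<omega>)) < \<delta> * real m} \<le> measure design {\<omega> :: 'n rbits. real (card (dual m T \<omega>)) < mn / 2}"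
        using mn by (intro PD.finite_measure_mono sets_design_Collect dual_pred finT) auto
      also have "\<dots> \<le> 4 / mn" unfolding mn_def
        by (rule prob_few_dual[OF finT _ Tne]) (auto simp: T_def Qs_def)
      also have "\<dots> \<le> 4 / (2 * \<delta> * real m)" using mn mn0 R by (intro divide_left_mono) auto
      finally show ?thesis by simp
    qed
    \<comment> \<open>At most order \<open>m * 2 ^ m / N\<close> sets with \<open>N\<close> at least
      of order \<open>m^2\<close>, so the expected number of them in the dual is of order
      \<open>1 / m\<close>.\<close>
    have P3: "real (card At) / 2 ^ m \<le> \<epsilon>' / \<kappa>\<^sup>2 / real m"
    proof -
      have "real (card At) \<le> real (card {A \<in> (Qs N1 :: ('n \<times> nat) set set). \<exists>j. \<not> \<bar>real (fibre_card j A) - v\<bar> < sqrt N / ln N})"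
        by (intro of_nat_mono card_mono) (auto simp: At_def typical_def)
      also have "\<dots> \<le> q N / N" using h1 by (intro conc) (simp add: N1_def H_def)
      also have "\<dots> \<le> (\<epsilon>' * real m * 2 ^ m) / N" using qN by (intro divide_right_mono) auto
      finally have "real (card At) / 2 ^ m \<le> \<epsilon>' * real m / N" by (simp add: divide_le_eq field_simps)
      also have "\<dots> \<le> \<epsilon>' * real m / (\<kappa> * real m)\<^sup>2"
      proof (intro divide_left_mono)
        have "(\<kappa> * real m)\<^sup>2 \<le> (sqrt N)\<^sup>2" using kmN \<kappa> by (intro power_mono) auto
        then show "(\<kappa> * real m)\<^sup>2 \<le> real N" by simp
      qed (use \<epsilon> \<kappa> m1 num(8) in auto)
      also have "\<dots> = \<epsilon>' / \<kappa>\<^sup>2 / real m" using m1 by (simp add: power2_eq_square)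
      finally show ?thesis .
    qed
    have "\<bar>measure design {\<omega>. mu_hat f m \<omega> < \<mu>} + 1/2 * measure design {\<omega>. mu_hat f m \<omega> = \<mu>} - 1/2\<bar>
      \<le> measure design {\<omega> :: 'n rbits. \<not> xor_indep (dual m Q \<omega>)} + measure design {\<omega> :: 'n rbits. real (card (dual m T \<omega>)) < \<delta> * real m}
      + real (card At) / 2 ^ m + (W1 + W2) / 2 ^ m / (\<tau> / 2) + 1 / sqrt (\<delta> * real m)"
      by (rule sign_balance[OF fc \<mu> finQ(1) Qp TQ finQ(2) Atp \<tau>0 big R Wb])
    also have "(W1 + W2) / 2 ^ m / (\<tau> / 2) = W1 / 2 ^ m / (\<tau> / 2) + W2 / 2 ^ m / (\<tau> / 2)" by (simp add: add_divide_distrib)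
    \<comment> \<open>Only the Littlewood-Offord term is of order \<open>1 / sqrt m\<close>; the
      others are of order \<open>1 / m\<close> or smaller.\<close>
    finally have "\<bar>measure design {\<omega>. mu_hat f m \<omega> < \<mu>} + 1/2 * measure design {\<omega>. mu_hat f m \<omega> = \<mu>} - 1/2\<bar>
      \<le> 6 * exp (- \<epsilon> * real m) + (2 / \<delta> + \<epsilon>' / \<kappa>\<^sup>2 + 2 / \<kappa>) / real m + 1 / sqrt (\<delta> * real m)"
      using P1 P2 P3 Pw1 Pw2 inv by (simp add: add_divide_distrib)
    then have "sqrt m * \<bar>measure design {\<omega>. mu_hat f m \<omega> < \<mu>} + 1/2 * measure design {\<omega>. mu_hat f m \<omega> = \<mu>} - 1/2\<bar>
      \<le> sqrt m * (6 * exp (- \<epsilon> * real m) + (2 / \<delta> + \<epsilon>' / \<kappa>\<^sup>2 + 2 / \<kappa>) / real m + 1 / sqrt (\<delta> * real m))"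
      by (intro mult_left_mono) auto
    also have "\<dots> = sqrt m * (6 * exp (- \<epsilon> * real m)) + sqrt m * ((2 / \<delta> + \<epsilon>' / \<kappa>\<^sup>2 + 2 / \<kappa>) / real m) + sqrt m * (1 / sqrt (\<delta> * real m))"
      by (simp only: distrib_left)
    also have "sqrt m * (1 / sqrt (\<delta> * real m)) = 1 / sqrt \<delta>" using m1 by (simp add: real_sqrt_mult)
    also have "sqrt m * ((2 / \<delta> + \<epsilon>' / \<kappa>\<^sup>2 + 2 / \<kappa>) / real m) \<le> 2 / \<delta> + \<epsilon>' / \<kappa>\<^sup>2 + 2 / \<kappa>"
    proof -
      have nn: "0 \<le> 2 / \<delta> + \<epsilon>' / \<kappa>\<^sup>2 + 2 / \<kappa>" using \<delta> \<epsilon> \<kappa> by simp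
      have "sqrt (real m) * 1 \<le> sqrt (real m) * sqrt (real m)" using m1 by (intro mult_left_mono) auto
      then have "sqrt (real m) \<le> real m" by simp
      then have "sqrt (real m) / real m \<le> 1" using m1 by (simp add: divide_le_eq)
      then have "(2 / \<delta> + \<epsilon>' / \<kappa>\<^sup>2 + 2 / \<kappa>) * (sqrt (real m) / real m) \<le> (2 / \<delta> + \<epsilon>' / \<kappa>\<^sup>2 + 2 / \<kappa>) * 1" using nn by (rule mult_left_mono)
      then show ?thesis by (simp add: mult.commute)
    qed
    also have "sqrt m * (6 * exp (- \<epsilon> * real m)) \<le> 6" using elim(4) by simp
    finally show ?case by (simp add: Cfin_def)
  qed
  then have "limsup (\<lambda>m. ereal (sqrt (real m) *
           \<bar>measure design {\<omega> \<in> space design. mu_hat f m \<omega> < \<mu>}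
            + 1/2 * measure design {\<omega> \<in> space design. mu_hat f m \<omega> = \<mu>} - 1/2\<bar>)) \<le> ereal Cfin"
    by (intro Limsup_bounded) (simp add: space_design)
  then show ?thesis by (rule le_less_trans) simp
qed

end
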